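(* Let $0 \leq m < k < n$ be integers. For every $\alpha \in \mathscr S$ there exists a family $(\alpha_P)_{P \in G}$, where for each $P \in G$, $\alpha_P$ is a smooth $m$-form on $P$, such that for every $x \in \mathbf R^n$, $$\alpha(x) = \int_{G} P^*(\alpha_P)(x) \, dP,$$ and for every compactly supported $m$-current $T$ on $\mathbf R^n$, $$\int_T \alpha = \int_{G} \int_{P_* T} \alpha_P \, dP.$$
   Context: Let $G$ be the Grassmannian of $k$-dimensional linear subspaces of $\mathbf R^n$, and let $dP$ denote the unique Borel probability measure on $G$ invariant under the natural action of $O(n)$. $\mathscr S$ is the Schwartz space of $m$-forms on $\mathbf R^n$: smooth $m$-forms $\alpha$ such that $\alpha$ and all of its partial derivatives are $O(\langle x\rangle^{-N})$ for every $N \in \{0,1,2,\dots\}$, where $\langle x \rangle = \sqrt{1+|x|^2}$. For a finite-dimensional real vector space $V$ ($V = \mathbf R^n$ or $V = P \in G$), a compactly supported $m$-current $T$ on $V$ is a continuous linear functional on the space of all smooth $m$-forms on $V$ (with its usual $C^\infty$ Fréchet topology of uniform convergence of all derivatives on compact sets). One writes $\int_T \alpha$ for $T(\alpha)$. For $P \in G$ and an $m$-form $\alpha$ on $P$, $P^*\alpha$ denotes the $m$-form on $\mathbf R^n$ which is the pullback of $\alpha$ by the orthogonal projection $\mathbf R^n \to P$. For a compactly supported $m$-current $T$ on $\mathbf R^n$, $P_*T$ denotes the compactly supported $m$-current on $P$ defined by $\int_{P_*T} \alpha = \int_T P^*\alpha$ for every smooth $m$-form $\alpha$ on $P$. *)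

theory Defs
  imports "HOL-Probability.Probability"
begin

(* A subspace V of a Euclidean space is a set, not a type, so forms on V are functions on the
   ambient space.  To have one representative per form, they take the value 0 at base points
   outside V and on argument lists that are not m-tuples of vectors of V. *)

definition alternating_forms :: "'a::euclidean_space set \<Rightarrow> nat \<Rightarrow> ('a list \<Rightarrow> real) set" where
  "alternating_forms V m =
    {A. (\<forall>vs. \<not> (length vs = m \<and> set vs \<subseteq> V) \<longrightarrow> A vs = 0) \<and>
        (\<forall>vs i u w a b. length vs = m \<and> set vs \<subseteq> V \<and> i < m \<and> u \<in> V \<and> w \<in> V \<longrightarrow>
           A (vs[i := a *\<^sub>R u + b *\<^sub>R w]) = a * A (vs[i := u]) + b * A (vs[i := w])) \<and>
        (\<forall>vs i j. length vs = m \<and> set vs \<subseteq> V \<and> i < j \<and> j < m \<and> vs ! i = vs ! j \<longrightarrow> A vs = 0)}"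

type_synonym 'a form = "'a \<Rightarrow> 'a list \<Rightarrow> real"

definition dir_deriv :: "'a::euclidean_space \<Rightarrow> ('a \<Rightarrow> real) \<Rightarrow> 'a \<Rightarrow> real" where
  "dir_deriv u f x = deriv (\<lambda>t. f (x + t *\<^sub>R u)) 0"

definition iter_deriv :: "'a::euclidean_space list \<Rightarrow> ('a \<Rightarrow> real) \<Rightarrow> 'a \<Rightarrow> real" where
  "iter_deriv us f = foldr dir_deriv us f"

(* For a subspace V: existence of all iterated directional derivatives along V, each of them
   Frechet differentiable (hence continuous) on V. *)
definition smooth_on_subspace :: "'a::euclidean_space set \<Rightarrow> ('a \<Rightarrow> real) \<Rightarrow> bool" where
  "smooth_on_subspace V f \<longleftrightarrow> (\<forall>us. set us \<subseteq> V \<longrightarrow> iter_deriv us f differentiable_on V)"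

definition smooth_forms :: "'a::euclidean_space set \<Rightarrow> nat \<Rightarrow> 'a form set" where
  "smooth_forms V m =
    {\<alpha>. (\<forall>x\<in>V. \<alpha> x \<in> alternating_forms V m) \<and>
        (\<forall>x. x \<notin> V \<longrightarrow> \<alpha> x = (\<lambda>vs. 0)) \<and>
        (\<forall>vs. smooth_on_subspace V (\<lambda>x. \<alpha> x vs))}"

definition schwartz_forms :: "nat \<Rightarrow> 'a::euclidean_space form set" where
  "schwartz_forms m =
    {\<alpha> \<in> smooth_forms UNIV m.
       \<forall>us vs (N::nat). set us \<subseteq> Basis \<longrightarrow>
         (\<exists>C. \<forall>x. \<bar>iter_deriv us (\<lambda>y. \<alpha> y vs) x\<bar> \<le> C / sqrt (1 + (norm x)\<^sup>2) ^ N)}"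

(* The topology of uniform convergence of all derivatives on compact sets, given by the subbasis
   of balls of the seminorms sup over K of a derivative of a coefficient. *)
definition smooth_forms_topology :: "'a::euclidean_space set \<Rightarrow> nat \<Rightarrow> 'a form topology" where
  "smooth_forms_topology V m = topology_generated_by
    {{\<beta> \<in> smooth_forms V m.
        \<forall>x\<in>K. \<bar>iter_deriv us (\<lambda>y. \<beta> y vs - \<alpha> y vs) x\<bar> < e} | \<alpha> K us vs e.
      \<alpha> \<in> smooth_forms V m \<and> compact K \<and> K \<subseteq> V \<and> set us \<subseteq> V \<and> 0 < e}"

lemma topspace_smooth_forms_topology [simp]:
  "topspace (smooth_forms_topology V m) = smooth_forms V m"
proof -
  have "\<alpha> \<in> topspace (smooth_forms_topology V m)" if "\<alpha> \<in> smooth_forms V m" for \<alpha>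
    unfolding smooth_forms_topology_def topology_generated_by_topspace
  proof (rule UnionI)
    show "\<alpha> \<in> {\<beta> \<in> smooth_forms V m. \<forall>x\<in>{}. \<bar>iter_deriv [] (\<lambda>y. \<beta> y [] - \<alpha> y []) x\<bar> < 1}"
      using that by simp
    show "{\<beta> \<in> smooth_forms V m. \<forall>x\<in>{}. \<bar>iter_deriv [] (\<lambda>y. \<beta> y [] - \<alpha> y []) x\<bar> < 1} \<in>
      {{\<beta> \<in> smooth_forms V m.
        \<forall>x\<in>K. \<bar>iter_deriv us (\<lambda>y. \<beta> y vs - \<alpha> y vs) x\<bar> < e} | \<alpha> K us vs e.
      \<alpha> \<in> smooth_forms V m \<and> compact K \<and> K \<subseteq> V \<and> set us \<subseteq> V \<and> 0 < e}"
      using that by (intro CollectI exI[of _ \<alpha>] exI[of _ "{}"] exI[of _ "[]"] exI[of _ 1]) auto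
  qed
  then show ?thesis
    unfolding smooth_forms_topology_def topology_generated_by_topspace by blast
qed

(* Only the values of a current on smooth forms are meaningful. *)
definition compact_currents :: "'a::euclidean_space set \<Rightarrow> nat \<Rightarrow> ('a form \<Rightarrow> real) set" where
  "compact_currents V m =
    {T. (\<forall>\<alpha>\<in>smooth_forms V m. \<forall>\<beta>\<in>smooth_forms V m.
           T (\<lambda>x vs. \<alpha> x vs + \<beta> x vs) = T \<alpha> + T \<beta>) \<and>
        (\<forall>c. \<forall>\<alpha>\<in>smooth_forms V m. T (\<lambda>x vs. c * \<alpha> x vs) = c * T \<alpha>) \<and>
        continuous_map (smooth_forms_topology V m) euclideanreal T}"

definition orth_proj :: "'a::euclidean_space set \<Rightarrow> 'a \<Rightarrow> 'a" where
  "orth_proj P x = (THE y. y \<in> P \<and> (\<forall>z\<in>P. orthogonal (x - y) z))"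

lemma orth_proj:
  assumes "subspace P"
  shows orth_proj_in: "orth_proj P x \<in> P"
    and orth_proj_orthogonal: "z \<in> P \<Longrightarrow> orthogonal (x - orth_proj P x) z"
proof -
  have ex: "\<exists>y. y \<in> P \<and> (\<forall>z\<in>P. orthogonal (x - y) z)"
    using orthogonal_subspace_decomp_exists[of P x] span_eq_iff[of P] assms
    by (metis add_diff_cancel_left')
  have uniq: "y = y'"
    if "y \<in> P \<and> (\<forall>z\<in>P. orthogonal (x - y) z)" "y' \<in> P \<and> (\<forall>z\<in>P. orthogonal (x - y') z)" for y y'
  proof -
    have "y - y' \<in> P"
      using that subspace_diff[OF assms] by blast
    then have "(x - y') \<bullet> (y - y') = 0" "(x - y) \<bullet> (y - y') = 0"
      using that by (auto simp: orthogonal_def)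
    then have "(y - y') \<bullet> (y - y') = 0"
      by (simp add: inner_diff_left)
    then show ?thesis by simp
  qed
  have "\<exists>!y. y \<in> P \<and> (\<forall>z\<in>P. orthogonal (x - y) z)"
    using ex uniq by blast
  from theI'[OF this] show "orth_proj P x \<in> P" "z \<in> P \<Longrightarrow> orthogonal (x - orth_proj P x) z"
    unfolding orth_proj_def by blast+
qed

definition pullback_form :: "'a::euclidean_space set \<Rightarrow> 'a form \<Rightarrow> 'a form" where
  "pullback_form P \<alpha> = (\<lambda>x vs. \<alpha> (orth_proj P x) (map (orth_proj P) vs))"

definition pushforward_current ::
  "'a::euclidean_space set \<Rightarrow> ('a form \<Rightarrow> real) \<Rightarrow> ('a form \<Rightarrow> real)" where
  "pushforward_current P T = (\<lambda>\<alpha>. T (pullback_form P \<alpha>))"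

definition grassmannian :: "nat \<Rightarrow> (real^'n) set set" where
  "grassmannian k = {P. subspace P \<and> dim P = k}"

(* The usual topology, obtained by identifying a subspace with the matrix of the orthogonal
   projection onto it. *)
definition grassmannian_topology :: "nat \<Rightarrow> (real^'n) set topology" where
  "grassmannian_topology k =
    pullback_topology (grassmannian k) (\<lambda>P. matrix (orth_proj P)) euclidean"

definition invariant_grassmannian_measure :: "nat \<Rightarrow> (real^'n) set measure \<Rightarrow> bool" where
  "invariant_grassmannian_measure k M \<longleftrightarrow>
    prob_space M \<and>
    space M = grassmannian k \<and>
    sets M = sigma_sets (grassmannian k) {U. openin (grassmannian_topology k) U} \<and>
    (\<forall>g. orthogonal_transformation g \<longrightarrow>
       (\<forall>A\<in>sets M. emeasure M ((\<lambda>P. g ` P) ` A) = emeasure M A))"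

end

theory Submission
  imports Defs "HOL-Real_Asymp.Real_Asymp"
begin

text \<open>The form \<open>\<alpha>P P\<close> is a convolution of derivatives of \<open>\<alpha>\<close> with a radial kernel into which the
orthogonal projection \<open>X\<close> onto \<open>P\<close> has been inserted.  Two independent facts make the average over
\<open>P\<close> equal to \<open>\<alpha>\<close>.

The first is analytic.  The vector field \<open>y / |y|^n\<close> has divergence a multiple of the point mass at the origin
(\<open>newton_int_div\<close>), so a Schwartz function is recovered from its gradient by convolution with it.  This
kernel is too singular here: as \<open>0 < k < n\<close>, the field \<open>X y / |X y|^n\<close> is not locally integrable when \<open>X\<close>
has rank \<open>k\<close>.  Green's formula (\<open>green_radial\<close>) trades two powers of \<open>|y|\<close> for one Laplacian, so that
\<open>|y|^(-n)\<close> can be replaced by a continuous kernel of polynomial growth, \<open>\<kappa>(r) = |r|\<close> for odd \<open>n\<close>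
and \<open>\<kappa>(r) = r^2 ln |r|\<close> for even \<open>n\<close>: for a suitable \<open>N\<close> and some \<open>C \<noteq> 0\<close>,
\<open>\<Sum>i. \<integral> \<kappa>(|y|) y_i (\<Delta>^N \<partial>_i f)(x + y) dy = C f(x)\<close> (\<open>radial_kernel_exists\<close>).

The second is algebraic.  If \<open>X\<close> is a random projection whose law is invariant under the orthogonal group,
then for a unit vector \<open>e\<close> and a weight \<open>w\<close> the mean of \<open>w(|X e|) X^*(e \<and> \<eta>)\<close> is \<open>c e \<and> \<eta>\<close>, with a
constant \<open>c\<close> that depends only on \<open>w\<close> and the degree (\<open>avg_eigenvalue\<close>).  For a positive weight \<open>c\<close> is
positive if the degree of \<open>e \<and> \<eta>\<close> is at most the rank \<open>k\<close> of \<open>X\<close> (\<open>avg_eigenvalue_pos\<close>); since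
forms of degree up to \<open>m + 1\<close> occur, this is where \<open>m < k\<close> enters.

To combine them put \<open>\<gamma>_i = \<Delta>^N \<partial>_i \<alpha>\<close>, write \<open>\<iota>\<close> for contraction, and let \<open>F X\<close> be
\<open>\<integral> \<kappa>(|X y|) \<Sum>i. X^*(p1 \<iota>_(X y) (e_i \<and> \<gamma>_i) + p2 X y \<and> \<iota>_(e_i) \<gamma>_i)(x + y) dy\<close>.
Translating \<open>y\<close> along the null space of \<open>X\<close> shows that \<open>F X\<close> is a pullback from the range of \<open>X\<close>
(\<open>F_projection\<close>).  Its mean is computed by Fubini's theorem.  In polar form the kernel satisfies
\<open>\<kappa>(r t) = \<kappa>(r) w(t) + r^2 d(t)\<close>, so the algebraic fact, applied with \<open>e = y / |y|\<close>, removes \<open>X\<close> at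
the price of constants, which \<open>p1\<close> and \<open>p2\<close> normalise; the terms with \<open>r^2\<close> vanish because a power of the
Laplacian annihilates \<open>|y|^2 y_j\<close>.  What remains is
\<open>\<integral> \<kappa>(|y|) \<Sum>i. \<iota>_y (e_i \<and> \<gamma>_i) + y \<and> \<iota>_(e_i) \<gamma>_i\<close>, up to the factor \<open>1 / C\<close>.  Since the kernel is a
gradient, the roles of \<open>y\<close> and \<open>e_i\<close> may be exchanged in the second term, and Cartan's identity
\<open>\<iota>_y (e \<and> \<gamma>) + e \<and> \<iota>_y \<gamma> = (e \<bullet> y) \<gamma>\<close> (\<open>contract_wedge\<close>) leaves the scalar formula for each
coefficient of \<open>\<alpha>\<close> (\<open>representation\<close>).

For currents it is not enough that the integral holds pointwise.  But \<open>F X\<close> depends continuously on the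
matrix \<open>X\<close> in the topology of smooth forms, and \<open>X\<close> ranges over a compact set; the integral is therefore
approximated in every seminorm by finite sums, with which a current commutes (\<open>current_representation\<close>).
The passage between subspaces and projection matrices is \<open>random_projection_grassmannian\<close>.\<close>

section \<open>Alternating forms and the identity of Cartan\<close>

definition contract :: "'a \<Rightarrow> ('a list \<Rightarrow> real) \<Rightarrow> 'a list \<Rightarrow> real" where
  "contract w \<gamma> vs = \<gamma> (w # vs)"

text \<open>The vector \<open>w\<close> stands for the covector \<open>(\<bullet>) w\<close>.  The formula expands
\<open>w \<and> \<gamma>\<close> along its first factor; the signs are absorbed by writing the head \<open>v\<close> of the argument list into
the slot \<open>l\<close> vacated by \<open>us ! l\<close>, which is a transposition of the remaining arguments.\<close>

definition wedge :: "'a::real_inner \<Rightarrow> ('a list \<Rightarrow> real) \<Rightarrow> 'a list \<Rightarrow> real" where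
  "wedge w \<gamma> vs = (case vs of [] \<Rightarrow> 0
     | v # us \<Rightarrow> (w \<bullet> v) * \<gamma> us - (\<Sum>l<length us. (w \<bullet> us ! l) * \<gamma> (us[l := v])))"

abbreviation alt :: "nat \<Rightarrow> ('a::euclidean_space list \<Rightarrow> real) set" where
  "alt m \<equiv> alternating_forms UNIV m"

lemma altI:
  assumes "\<And>vs. length vs \<noteq> m \<Longrightarrow> \<Omega> vs = 0"
    and "\<And>vs i u w a b. length vs = m \<Longrightarrow> i < m \<Longrightarrow>
      \<Omega> (vs[i := a *\<^sub>R u + b *\<^sub>R w]) = a * \<Omega> (vs[i := u]) + b * \<Omega> (vs[i := w])"
    and "\<And>vs i j. length vs = m \<Longrightarrow> i < j \<Longrightarrow> j < m \<Longrightarrow> vs ! i = vs ! j \<Longrightarrow> \<Omega> vs = 0"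
  shows "\<Omega> \<in> alt m"
  unfolding alternating_forms_def using assms by auto

lemma alt_length: "\<Omega> \<in> alt m \<Longrightarrow> length vs \<noteq> m \<Longrightarrow> \<Omega> vs = 0"
  unfolding alternating_forms_def by auto

lemma alt_linear: "\<Omega> \<in> alt m \<Longrightarrow> length vs = m \<Longrightarrow> i < m \<Longrightarrow>
    \<Omega> (vs[i := a *\<^sub>R u + b *\<^sub>R w]) = a * \<Omega> (vs[i := u]) + b * \<Omega> (vs[i := w])"
  unfolding alternating_forms_def by auto

lemma alt_repeat:
  assumes "\<Omega> \<in> alt m" "length vs = m" "i < m" "j < m" "i \<noteq> j" "vs ! i = vs ! j"
  shows "\<Omega> vs = 0"
proof -
  have *: "\<Omega> vs = 0" if "i < j" "j < m" "vs ! i = vs ! j" for i j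
    using assms(1,2) that unfolding alternating_forms_def by blast
  show ?thesis using assms *[of i j] *[of j i] by (cases "i < j") auto
qed

lemma alt_not_distinct: "\<Omega> \<in> alt m \<Longrightarrow> \<not> distinct vs \<Longrightarrow> \<Omega> vs = 0"
  using alt_repeat[of \<Omega> m vs] alt_length[of \<Omega> m vs] unfolding distinct_conv_nth by blast

lemma alt_add: "\<Omega> \<in> alt m \<Longrightarrow> length vs = m \<Longrightarrow> i < m \<Longrightarrow>
    \<Omega> (vs[i := u + w]) = \<Omega> (vs[i := u]) + \<Omega> (vs[i := w])"
  using alt_linear[of \<Omega> m vs i 1 u 1 w] by simp

lemma alt_scale: "\<Omega> \<in> alt m \<Longrightarrow> length vs = m \<Longrightarrow> i < m \<Longrightarrow>
    \<Omega> (vs[i := a *\<^sub>R u]) = a * \<Omega> (vs[i := u])"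
  using alt_linear[of \<Omega> m vs i a u 0 u] by simp

lemma alt_slot_linear: "\<Omega> \<in> alt m \<Longrightarrow> length vs = m \<Longrightarrow> i < m \<Longrightarrow> linear (\<lambda>u. \<Omega> (vs[i := u]))"
  by (rule linearI) (auto simp: alt_add alt_scale)

lemma alt_Cons_linear: "\<Omega> \<in> alt (Suc m) \<Longrightarrow> linear (\<lambda>u. \<Omega> (u # vs))"
proof (cases "length vs = m")
  case True
  then show "\<Omega> \<in> alt (Suc m) \<Longrightarrow> linear (\<lambda>u. \<Omega> (u # vs))"
    using alt_slot_linear[of \<Omega> "Suc m" "0 # vs" 0] by simp
next
  case False
  show "\<Omega> \<in> alt (Suc m) \<Longrightarrow> linear (\<lambda>u. \<Omega> (u # vs))"
    by (rule linearI) (use False in \<open>auto simp: alt_length\<close>)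
qed

lemma alt_swap:
  assumes "\<Omega> \<in> alt m" "length vs = m" "i < m" "j < m" "i \<noteq> j"
  shows "\<Omega> (vs[i := u, j := w]) = - \<Omega> (vs[i := w, j := u])"
proof -
  have z: "\<Omega> (vs[i := x, j := x]) = 0" for x
    by (rule alt_repeat[OF assms(1), of _ i j]) (use assms in auto)
  have "0 = \<Omega> (vs[i := u + w, j := u + w])" using z by simp
  also have "\<dots> = \<Omega> (vs[i := u + w, j := u]) + \<Omega> (vs[i := u + w, j := w])"
    by (rule alt_add) (use assms in auto)
  also have "\<Omega> (vs[i := u + w, j := u]) = \<Omega> (vs[j := u, i := u + w])"
    using assms by (simp add: list_update_swap)
  also have "\<dots> = \<Omega> (vs[j := u, i := u]) + \<Omega> (vs[j := u, i := w])"
    by (rule alt_add) (use assms in auto)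
  also have "\<Omega> (vs[i := u + w, j := w]) = \<Omega> (vs[j := w, i := u + w])"
    using assms by (simp add: list_update_swap)
  also have "\<dots> = \<Omega> (vs[j := w, i := u]) + \<Omega> (vs[j := w, i := w])"
    by (rule alt_add) (use assms in auto)
  finally show ?thesis using z assms by (simp add: list_update_swap[of i j])
qed

lemma alt_lincomb:
  assumes "\<Omega> \<in> alt m" "\<Psi> \<in> alt m"
  shows "(\<lambda>vs. a * \<Omega> vs + b * \<Psi> vs) \<in> alt m"
proof (rule altI)
  fix vs :: "'a list" and i j
  assume "length vs = m" "i < j" "j < m" "vs ! i = vs ! j"
  then show "a * \<Omega> vs + b * \<Psi> vs = 0"
    using alt_repeat[OF assms(1), of vs i j] alt_repeat[OF assms(2), of vs i j] by simp
next
  fix vs :: "'a list" and i u w c d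
  assume "length vs = m" "i < m"
  then show "a * \<Omega> (vs[i := c *\<^sub>R u + d *\<^sub>R w]) + b * \<Psi> (vs[i := c *\<^sub>R u + d *\<^sub>R w]) =
    c * (a * \<Omega> (vs[i := u]) + b * \<Psi> (vs[i := u])) + d * (a * \<Omega> (vs[i := w]) + b * \<Psi> (vs[i := w]))"
    by (simp only: alt_linear[OF assms(1)] alt_linear[OF assms(2)]) (simp add: algebra_simps)
qed (use assms in \<open>simp add: alt_length\<close>)

lemma alt_zero: "(\<lambda>vs. 0) \<in> alt m"
  by (rule altI) auto

lemma alt_cmult: "\<Omega> \<in> alt m \<Longrightarrow> (\<lambda>vs. a * \<Omega> vs) \<in> alt m"
  using alt_lincomb[of \<Omega> m \<Omega> a 0] by simp

lemma alt_sum: "(\<And>i. i \<in> I \<Longrightarrow> \<Omega> i \<in> alt m) \<Longrightarrow> (\<lambda>vs. \<Sum>i\<in>I. \<Omega> i vs) \<in> alt m"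
proof (induction I rule: infinite_finite_induct)
  case (insert x F)
  then show ?case using alt_lincomb[of "\<Omega> x" m "\<lambda>vs. \<Sum>i\<in>F. \<Omega> i vs" 1 1] by simp
qed (auto simp: alt_zero)

lemma alt_map:
  assumes "\<Omega> \<in> alt m" "linear f"
  shows "(\<lambda>vs. \<Omega> (map f vs)) \<in> alt m"
proof (rule altI)
  interpret linear f by fact
  fix vs :: "'b list" and i u w a b
  assume "length vs = m" "i < m"
  then show "\<Omega> (map f (vs[i := a *\<^sub>R u + b *\<^sub>R w])) = a * \<Omega> (map f (vs[i := u])) + b * \<Omega> (map f (vs[i := w]))"
    using assms(1) by (simp add: map_update add scaleR alt_linear)
next
  fix vs :: "'b list" and i j
  assume "length vs = m" "i < j" "j < m" "vs ! i = vs ! j"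
  then show "\<Omega> (map f vs) = 0"
    by (intro alt_repeat[OF assms(1), of _ i j]) auto
qed (use assms(1) in \<open>auto simp: alt_length\<close>)

lemma contract_alt:
  assumes "\<Omega> \<in> alt (Suc m)"
  shows "contract w \<Omega> \<in> alt m"
proof (rule altI)
  fix vs :: "'a list" and i u x a b
  assume "length vs = m" "i < m"
  then show "contract w \<Omega> (vs[i := a *\<^sub>R u + b *\<^sub>R x]) = a * contract w \<Omega> (vs[i := u]) + b * contract w \<Omega> (vs[i := x])"
    using alt_linear[OF assms, of "w # vs" "Suc i" a u b x] by (simp add: contract_def)
next
  fix vs :: "'a list" and i j
  assume "length vs = m" "i < j" "j < m" "vs ! i = vs ! j"
  then show "contract w \<Omega> vs = 0" unfolding contract_def
    by (intro alt_repeat[OF assms, of _ "Suc i" "Suc j"]) auto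
qed (use assms in \<open>auto simp: alt_length contract_def\<close>)

lemma contract_not_alt_0: "\<Omega> \<in> alt 0 \<Longrightarrow> contract w \<Omega> = (\<lambda>vs. 0)"
  by (auto simp: contract_def alt_length)

lemma wedge_alt:
  assumes \<gamma>: "\<gamma> \<in> alt m"
  shows "wedge w \<gamma> \<in> alt (Suc m)"
proof (rule altI)
  fix vs :: "'a list"
  assume "length vs \<noteq> Suc m"
  then show "wedge w \<gamma> vs = 0"
    by (cases vs) (auto simp: wedge_def alt_length[OF \<gamma>])
next
  fix vs :: "'a list" and i u x a b
  assume len: "length vs = Suc m" and i: "i < Suc m"
  then obtain v us where vs: "vs = v # us" "length us = m" by (cases vs) auto
  show "wedge w \<gamma> (vs[i := a *\<^sub>R u + b *\<^sub>R x]) = a * wedge w \<gamma> (vs[i := u]) + b * wedge w \<gamma> (vs[i := x])"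
  proof (cases i)
    case 0
    have "(w \<bullet> us ! l) * \<gamma> (us[l := a *\<^sub>R u + b *\<^sub>R x]) =
      a * ((w \<bullet> us ! l) * \<gamma> (us[l := u])) + b * ((w \<bullet> us ! l) * \<gamma> (us[l := x]))" if "l < m" for l
      using that vs by (simp add: alt_linear[OF \<gamma>] algebra_simps)
    then have "(\<Sum>l<m. (w \<bullet> us ! l) * \<gamma> (us[l := a *\<^sub>R u + b *\<^sub>R x])) =
      a * (\<Sum>l<m. (w \<bullet> us ! l) * \<gamma> (us[l := u])) + b * (\<Sum>l<m. (w \<bullet> us ! l) * \<gamma> (us[l := x]))"
      by (simp add: sum_distrib_left sum.distrib)
    then show ?thesis using 0 vs by (simp add: wedge_def inner_add_right algebra_simps)
  next
    case (Suc i')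
    then have i': "i' < m" using i by simp
    let ?g = "\<lambda>z l. (w \<bullet> us[i' := z] ! l) * \<gamma> (us[i' := z, l := v])"
    have "?g (a *\<^sub>R u + b *\<^sub>R x) l = a * ?g u l + b * ?g x l" if "l < m" for l
    proof (cases "l = i'")
      case True
      then show ?thesis using vs i' by (simp add: inner_add_right algebra_simps)
    next
      case False
      have sw: "us[i' := z, l := v] = us[l := v, i' := z]" for z
        using False by (simp add: list_update_swap)
      show ?thesis unfolding sw using False vs i' that by (simp add: alt_linear[OF \<gamma>] algebra_simps)
    qed
    then have "(\<Sum>l<m. ?g (a *\<^sub>R u + b *\<^sub>R x) l) = a * (\<Sum>l<m. ?g u l) + b * (\<Sum>l<m. ?g x l)"
      by (simp add: sum_distrib_left sum.distrib)
    then show ?thesis using Suc vs i' by (simp add: wedge_def alt_linear[OF \<gamma>] algebra_simps)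
  qed
next
  fix vs :: "'a list" and i j
  assume len: "length vs = Suc m" and ij: "i < j" "j < Suc m" and eq: "vs ! i = vs ! j"
  then obtain v us where vs: "vs = v # us" "length us = m" by (cases vs) auto
  from ij obtain j' where j: "j = Suc j'" "j' < m" by (cases j) auto
  show "wedge w \<gamma> vs = 0"
  proof (cases i)
    case 0
    then have v: "us ! j' = v" using eq vs j by simp
    have "(w \<bullet> us ! l) * \<gamma> (us[l := v]) = (if l = j' then (w \<bullet> v) * \<gamma> us else 0)" if "l < m" for l
    proof (cases "l = j'")
      case True
      then show ?thesis using v by (metis list_update_id)
    next
      case False
      have "\<gamma> (us[l := v]) = 0"
        by (rule alt_repeat[OF \<gamma>, of _ l j']) (use vs that j v False in auto)
      then show ?thesis using False by simp
    qed
    then have "(\<Sum>l<m. (w \<bullet> us ! l) * \<gamma> (us[l := v])) = (\<Sum>l<m. if l = j' then (w \<bullet> v) * \<gamma> us else 0)"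
      by (intro sum.cong) auto
    then show ?thesis using vs j by (simp add: wedge_def)
  next
    case (Suc i')
    then have i': "i' < m" "i' \<noteq> j'" "us ! i' = us ! j'" using ij eq vs j by auto
    define g where "g l = (w \<bullet> us ! l) * \<gamma> (us[l := v])" for l
    have g0: "g l = 0" if "l < m" "l \<noteq> i'" "l \<noteq> j'" for l
    proof -
      have "\<gamma> (us[l := v]) = 0"
        by (rule alt_repeat[OF \<gamma>, of _ i' j']) (use vs that j i' in auto)
      then show ?thesis by (simp add: g_def)
    qed
    have "us[i' := v] = us[i' := v, j' := us ! j']"
      using i' by (metis list_update_id nth_list_update_neq)
    moreover have "us[j' := v] = us[i' := us ! i', j' := v]"
      by (simp only: list_update_id)
    ultimately have "\<gamma> (us[i' := v]) = - \<gamma> (us[j' := v])"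
      using alt_swap[OF \<gamma>, of us i' j' v "us ! j'"] i' j vs by simp
    then have gg: "g i' + g j' = 0" using i' by (simp add: g_def)
    have "(\<Sum>l<m. g l) = (\<Sum>l\<in>{i', j'}. g l)"
      by (rule sum.mono_neutral_right) (use i' j g0 in auto)
    also have "\<dots> = 0" using gg i' by simp
    finally have s: "(\<Sum>l<m. g l) = 0" .
    have "\<gamma> us = 0"
      by (rule alt_repeat[OF \<gamma>, of _ i' j']) (use vs j i' in auto)
    then show ?thesis using s vs by (simp add: wedge_def g_def)
  qed
qed

text \<open>Contraction is an antiderivation.  In the expansion of \<open>w \<and> \<gamma>\<close> at \<open>y # vs\<close> every
term with \<open>y\<close> inside \<open>\<gamma>\<close> is also a term of \<open>w \<and> \<iota>_y \<gamma>\<close>, with the opposite sign because two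
arguments of \<open>\<gamma>\<close> have been exchanged; only the term \<open>(w \<bullet> y) \<gamma>\<close> survives.\<close>

lemma contract_wedge:
  assumes \<gamma>: "\<gamma> \<in> alt m"
  shows "contract y (wedge w \<gamma>) vs + wedge w (contract y \<gamma>) vs = (w \<bullet> y) * \<gamma> vs"
proof (cases vs)
  case Nil
  then show ?thesis by (simp add: contract_def wedge_def)
next
  case (Cons v us)
  show ?thesis
  proof (cases "length vs = m")
    case False
    have "\<gamma> (vs[l := y]) = 0" "\<gamma> (y # us[l := v]) = 0" "\<gamma> (y # us) = 0" for l
      using False Cons by (auto intro!: alt_length[OF \<gamma>] simp del: list_update.simps)
    then show ?thesis using False Cons by (simp add: contract_def wedge_def alt_length[OF \<gamma>])
  next
    case True
    have "\<gamma> (v # us[l := y]) = - \<gamma> (y # us[l := v])" if "l < length us" for l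
    proof -
      have "\<gamma> ((v # us)[0 := v, Suc l := y]) = - \<gamma> ((v # us)[0 := y, Suc l := v])"
        by (rule alt_swap[OF \<gamma>]) (use that True Cons in auto)
      then show ?thesis by (simp only: list_update.simps nat.case)
    qed
    then have "(\<Sum>l<length us. (w \<bullet> us ! l) * \<gamma> (v # us[l := y])) =
        - (\<Sum>l<length us. (w \<bullet> us ! l) * \<gamma> (y # us[l := v]))"
      by (simp add: sum_negf[symmetric])
    moreover have "(\<Sum>l<Suc (length us). (w \<bullet> (v # us) ! l) * \<gamma> ((v # us)[l := y])) =
       (w \<bullet> v) * \<gamma> (y # us) + (\<Sum>l<length us. (w \<bullet> us ! l) * \<gamma> (v # us[l := y]))"
      by (subst sum.lessThan_Suc_shift) simp
    ultimately show ?thesis using Cons by (simp add: contract_def wedge_def)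
  qed
qed

lemma contract_sum_Basis:
  assumes "\<Omega> \<in> alt (Suc m)"
  shows "contract y \<Omega> vs = (\<Sum>b\<in>Basis. (y \<bullet> b) * contract b \<Omega> vs)"
proof -
  interpret linear "\<lambda>u. \<Omega> (u # vs)" by (rule alt_Cons_linear) fact
  have "\<Omega> (y # vs) = \<Omega> ((\<Sum>b\<in>Basis. (y \<bullet> b) *\<^sub>R b) # vs)" by (simp add: euclidean_representation)
  also have "\<dots> = (\<Sum>b\<in>Basis. (y \<bullet> b) * \<Omega> (b # vs))" by (simp only: sum scaleR real_scaleR_def)
  finally show ?thesis by (simp add: contract_def)
qed

lemma wedge_linear: "linear (\<lambda>w. wedge w \<gamma> vs)"
proof (cases vs)
  case Nil
  then show ?thesis by (simp add: wedge_def linear_zero)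
next
  case (Cons v us)
  show ?thesis
    unfolding Cons wedge_def list.case
    by (intro linear_compose_sub linear_compose_sum ballI
        linear_compose[OF bounded_linear.linear[OF bounded_linear_inner_left]
          bounded_linear.linear[OF bounded_linear_mult_left], unfolded o_def])
qed

lemma wedge_sum_Basis: "wedge y \<gamma> vs = (\<Sum>b\<in>Basis. (y \<bullet> b) * wedge b \<gamma> vs)"
proof -
  interpret linear "\<lambda>w. wedge w \<gamma> vs" by (rule wedge_linear)
  have "wedge y \<gamma> vs = wedge (\<Sum>b\<in>Basis. (y \<bullet> b) *\<^sub>R b) \<gamma> vs" by (simp add: euclidean_representation)
  also have "\<dots> = (\<Sum>b\<in>Basis. (y \<bullet> b) * wedge b \<gamma> vs)" by (simp only: sum scaleR real_scaleR_def)
  finally show ?thesis .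
qed

definition basis_lists :: "'a set \<Rightarrow> nat \<Rightarrow> 'a list set" where
  "basis_lists B m = {bs. set bs \<subseteq> B \<and> length bs = m}"

lemma basis_lists_0: "basis_lists B 0 = {[]}" by (auto simp: basis_lists_def)
lemma basis_lists_Suc: "basis_lists B (Suc m) = (\<lambda>(b, bs). b # bs) ` (B \<times> basis_lists B m)"
proof (intro set_eqI iffI)
  fix xs assume "xs \<in> basis_lists B (Suc m)"
  then obtain b bs where "xs = b # bs" "b \<in> B" "bs \<in> basis_lists B m" by (cases xs) (auto simp: basis_lists_def)
  then show "xs \<in> (\<lambda>(b, bs). b # bs) ` (B \<times> basis_lists B m)" by blast
qed (auto simp: basis_lists_def)

lemma finite_basis_lists: "finite B \<Longrightarrow> finite (basis_lists B m)"
  unfolding basis_lists_def by (rule finite_lists_length_eq)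

lemma sum_basis_lists_Suc: "sum f (basis_lists B (Suc m)) = (\<Sum>b\<in>B. \<Sum>bs\<in>basis_lists B m. f (b # bs))"
proof -
  have "inj_on (\<lambda>(b, bs). b # bs) (B \<times> basis_lists B m)" by (auto simp: inj_on_def)
  then show ?thesis
    unfolding basis_lists_Suc by (simp add: sum.reindex sum.cartesian_product case_prod_unfold)
qed

text \<open>The coefficient of the list \<open>bs\<close> when a multilinear form is expanded in all its arguments.\<close>

fun coord :: "'a::real_inner list \<Rightarrow> 'a list \<Rightarrow> real" where
  "coord (v # vs) (b # bs) = (v \<bullet> b) * coord vs bs"
| "coord _ _ = 1"

lemma alt_expand:
  assumes "\<Omega> \<in> alt m" "length vs = m" and B: "\<And>v. v = (\<Sum>b\<in>B. (v \<bullet> b) *\<^sub>R b)"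
  shows "\<Omega> vs = (\<Sum>bs\<in>basis_lists B m. coord vs bs * \<Omega> bs)"
  using assms(1,2)
proof (induction m arbitrary: \<Omega> vs)
  case 0
  then show ?case by (simp add: basis_lists_0)
next
  case (Suc m)
  then obtain v us where vs: "vs = v # us" "length us = m" by (cases vs) auto
  interpret linear "\<lambda>u. \<Omega> (u # us)" by (rule alt_Cons_linear) fact
  have "\<Omega> vs = \<Omega> ((\<Sum>b\<in>B. (v \<bullet> b) *\<^sub>R b) # us)" using B vs by metis
  also have "\<dots> = (\<Sum>b\<in>B. (v \<bullet> b) * contract b \<Omega> us)" by (simp only: sum scaleR real_scaleR_def contract_def)
  also have "\<dots> = (\<Sum>b\<in>B. (v \<bullet> b) * (\<Sum>bs\<in>basis_lists B m. coord us bs * contract b \<Omega> bs))"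
    using Suc.IH[OF contract_alt[OF Suc.prems(1)] vs(2)] by simp
  also have "\<dots> = (\<Sum>bs\<in>basis_lists B (Suc m). coord vs bs * \<Omega> bs)"
    by (simp add: sum_basis_lists_Suc vs contract_def sum_distrib_left mult.assoc)
  finally show ?case .
qed

lemma alt_eqI:
  assumes "\<Omega> \<in> alt m" "\<Psi> \<in> alt m" and B: "\<And>v. v = (\<Sum>b\<in>B. (v \<bullet> b) *\<^sub>R b)"
    and eq: "\<And>bs. bs \<in> basis_lists B m \<Longrightarrow> distinct bs \<Longrightarrow> \<Omega> bs = \<Psi> bs"
  shows "\<Omega> vs = \<Psi> vs"
proof (cases "length vs = m")
  case True
  have "\<Omega> bs = \<Psi> bs" if "bs \<in> basis_lists B m" for bs
    using eq[OF that] alt_not_distinct[OF assms(1)] alt_not_distinct[OF assms(2)] by (cases "distinct bs") auto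
  then show ?thesis
    using alt_expand[OF assms(1) True B] alt_expand[OF assms(2) True B] by simp
qed (use assms in \<open>auto simp: alt_length\<close>)

text \<open>An alternating form changes only by a sign under a permutation, so vanishing at one
enumeration of a set of vectors is vanishing at all of them.  Proved by moving the head of \<open>J'\<close> to the
front of \<open>J\<close> with one transposition, which avoids signs of permutations.\<close>

lemma alt_perm_zero:
  assumes "\<Omega> \<in> alt m" "distinct J" "distinct J'" "set J = set J'" "length J = m" "\<Omega> J = 0"
  shows "\<Omega> J' = 0"
  using assms
proof (induction m arbitrary: \<Omega> J J')
  case 0
  then show ?case by simp
next
  case (Suc m)
  from Suc.prems obtain a as where J: "J = a # as" "length as = m" by (cases J) auto
  have "length J' = Suc m" using Suc.prems by (metis distinct_card)
  then obtain b bs where J': "J' = b # bs" "length bs = m" by (cases J') auto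
  show ?case
  proof (cases "a = b")
    case True
    have "contract b \<Omega> bs = 0"
      by (rule Suc.IH[OF contract_alt[OF Suc.prems(1)], of as])
         (use Suc.prems J J' True in \<open>auto simp: contract_def\<close>)
    then show ?thesis by (simp add: J' contract_def)
  next
    case False
    then have "b \<in> set as" using Suc.prems J J' by auto
    then obtain i where i: "i < m" "as ! i = b" using J by (metis in_set_conv_nth)
    have "\<Omega> ((a # as)[0 := a, Suc i := b]) = - \<Omega> ((a # as)[0 := b, Suc i := a])"
      by (rule alt_swap[OF Suc.prems(1)]) (use J i in auto)
    moreover have "(a # as)[0 := a, Suc i := b] = J" using J i by auto
    ultimately have z: "\<Omega> (b # as[i := a]) = 0" using Suc.prems by simp
    have set: "set (as[i := a]) = insert a (set as - {b})"
      using i J Suc.prems by (simp add: set_update_distinct)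
    have "contract b \<Omega> bs = 0"
    proof (rule Suc.IH[OF contract_alt[OF Suc.prems(1)], of "as[i := a]"])
      show "distinct (as[i := a])" using Suc.prems J by (intro distinct_list_update) auto
      show "set (as[i := a]) = set bs" using set Suc.prems J J' False by auto
    qed (use Suc.prems J J' z in \<open>auto simp: contract_def\<close>)
    then show ?thesis by (simp add: J' contract_def)
  qed
qed

section \<open>Monomial forms and orthogonal maps\<close>

text \<open>The product \<open>u_1 \<and> \<dots> \<and> u_m\<close>.\<close>

fun monomial_form :: "'a::euclidean_space list \<Rightarrow> 'a list \<Rightarrow> real" where
  "monomial_form [] = (\<lambda>vs. if vs = [] then 1 else 0)"
| "monomial_form (u # us) = wedge u (monomial_form us)"

lemma monomial_form_alt: "monomial_form us \<in> alt (length us)"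
proof (induction us)
  case Nil
  show ?case by (rule altI) auto
qed (auto intro: wedge_alt)

definition orthonormal :: "'a::euclidean_space list \<Rightarrow> bool" where
  "orthonormal us \<longleftrightarrow> (\<forall>i<length us. \<forall>j<length us. us ! i \<bullet> us ! j = (if i = j then 1 else 0))"

lemma orthonormal_Cons:
  "orthonormal (u # us) \<longleftrightarrow> u \<bullet> u = 1 \<and> (\<forall>v\<in>set us. u \<bullet> v = 0) \<and> orthonormal us"
proof -
  have all_Suc: "(\<forall>i<Suc n. P i) \<longleftrightarrow> P 0 \<and> (\<forall>i<n. P (Suc i))" for P n
    using less_Suc_eq_0_disj by auto
  show ?thesis
    unfolding all_set_conv_all_nth by (auto simp: orthonormal_def all_Suc inner_commute)
qed

lemma monomial_form_orthonormal: "orthonormal us \<Longrightarrow> monomial_form us us = 1"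
proof (induction us)
  case (Cons u us)
  then show ?case by (auto simp: orthonormal_Cons wedge_def)
qed simp

lemma orthonormal_distinct: "orthonormal us \<Longrightarrow> distinct us"
  unfolding orthonormal_def distinct_conv_nth by (metis zero_neq_one)

lemma wedge_sum: "wedge w (\<lambda>vs. \<Sum>i\<in>I. a i * \<gamma> i vs) vs = (\<Sum>i\<in>I. a i * wedge w (\<gamma> i) vs)"
proof (cases vs)
  case (Cons v us)
  have "(\<Sum>l<length us. (w \<bullet> us ! l) * (\<Sum>i\<in>I. a i * \<gamma> i (us[l := v]))) =
    (\<Sum>i\<in>I. a i * (\<Sum>l<length us. (w \<bullet> us ! l) * \<gamma> i (us[l := v])))"
    unfolding sum_distrib_left by (subst sum.swap) (simp add: algebra_simps)
  then show ?thesis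
    by (simp add: Cons wedge_def sum_distrib_left right_diff_distrib sum_subtractf mult.left_commute)
qed (simp add: wedge_def)

text \<open>Multilinearity in the factors \<open>us\<close> instead of the arguments.\<close>

lemma monomial_form_expand:
  "monomial_form us vs = (\<Sum>J\<in>basis_lists Basis (length us). coord us J * monomial_form J vs)"
proof (induction us arbitrary: vs)
  case (Cons u us)
  have "monomial_form (u # us) vs = (\<Sum>b\<in>Basis. (u \<bullet> b) * wedge b (monomial_form us) vs)"
    by (simp add: wedge_sum_Basis[of u])
  also have "\<dots> = (\<Sum>b\<in>Basis. (u \<bullet> b) * wedge b (\<lambda>vs. \<Sum>J\<in>basis_lists Basis (length us). coord us J * monomial_form J vs) vs)"
    using Cons.IH by presburger
  also have "\<dots> = (\<Sum>J\<in>basis_lists Basis (length (u # us)). coord (u # us) J * monomial_form J vs)"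
    by (simp add: wedge_sum sum_basis_lists_Suc sum_distrib_left mult.assoc)
  finally show ?case .
qed (simp add: basis_lists_0)

lemma coord_bound:
  "set bs \<subseteq> Basis \<Longrightarrow> length bs = length us \<Longrightarrow> \<bar>coord us bs\<bar> \<le> prod_list (map norm us)"
proof (induction us bs rule: coord.induct)
  case (1 v vs b bs)
  then have "\<bar>v \<bullet> b\<bar> \<le> norm v" by (simp add: Basis_le_norm)
  then show ?case using 1 by (auto simp: abs_mult intro!: mult_mono)
qed auto

text \<open>Any norm on the finite-dimensional space of alternating forms would do.\<close>

definition alt_norm :: "nat \<Rightarrow> ('a::euclidean_space list \<Rightarrow> real) \<Rightarrow> real" where
  "alt_norm m \<Omega> = (\<Sum>bs\<in>basis_lists Basis m. \<bar>\<Omega> bs\<bar>)"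

lemma alt_bound:
  assumes "\<Omega> \<in> alt m"
  shows "\<bar>\<Omega> us\<bar> \<le> alt_norm m \<Omega> * prod_list (map norm us)"
proof (cases "length us = m")
  case True
  have "\<bar>\<Omega> us\<bar> = \<bar>\<Sum>bs\<in>basis_lists Basis m. coord us bs * \<Omega> bs\<bar>"
    by (subst alt_expand[OF assms True, of Basis]) (simp_all add: euclidean_representation)
  also have "\<dots> \<le> (\<Sum>bs\<in>basis_lists Basis m. \<bar>coord us bs * \<Omega> bs\<bar>)" by (rule sum_abs)
  also have "\<dots> \<le> (\<Sum>bs\<in>basis_lists Basis m. prod_list (map norm us) * \<bar>\<Omega> bs\<bar>)"
    by (rule sum_mono) (auto simp: abs_mult basis_lists_def True intro!: mult_right_mono coord_bound)
  also have "\<dots> = alt_norm m \<Omega> * prod_list (map norm us)"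
    by (simp add: alt_norm_def sum_distrib_left mult.commute)
  finally show ?thesis .
next
  case False
  have "prod_list (map norm us) \<ge> 0" by (induction us) auto
  then show ?thesis using False assms by (auto simp: alt_length alt_norm_def intro!: mult_nonneg_nonneg sum_nonneg)
qed

lemma prod_list_norm_mono:
  "(\<And>v. norm (f v) \<le> norm v) \<Longrightarrow> prod_list (map norm (map f us)) \<le> prod_list (map norm us)"
proof (induction us)
  case (Cons u us)
  have "prod_list (map norm (map f us)) \<ge> 0" by (induction us) auto
  then show ?case using Cons by (auto intro!: mult_mono)
qed simp

definition reflect :: "'a::euclidean_space \<Rightarrow> 'a \<Rightarrow> 'a" where
  "reflect d x = x - (2 * (x \<bullet> d) / (d \<bullet> d)) *\<^sub>R d"

lemma linear_reflect: "linear (reflect d)"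
  by (rule linearI) (auto simp: reflect_def inner_add_left algebra_simps add_divide_distrib)

lemma orthogonal_transformation_reflect: "orthogonal_transformation (reflect d)"
proof -
  have "reflect d v \<bullet> reflect d w = v \<bullet> w" for v w
    by (cases "d = 0") (auto simp: reflect_def inner_diff_left inner_diff_right inner_commute field_simps)
  then show ?thesis by (simp add: orthogonal_transformation_def linear_reflect)
qed

lemma reflect_orthogonal: "x \<bullet> d = 0 \<Longrightarrow> reflect d x = x"
  by (simp add: reflect_def)

lemma reflect_self: "reflect d d = - d"
  by (cases "d = 0") (auto simp: reflect_def algebra_simps scaleR_2)

text \<open>The reflection in the hyperplane that bisects two unit vectors exchanges them.\<close>

lemma reflect_diff:
  assumes "v \<bullet> v = 1" "u \<bullet> u = 1"
  shows "reflect (v - u) v = u"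
proof (cases "v = u")
  case False
  have "(v - u) \<bullet> (v - u) = 2 * (v \<bullet> (v - u))"
    using assms by (simp add: algebra_simps inner_commute)
  moreover have "(v - u) \<bullet> (v - u) \<noteq> 0" using False by simp
  ultimately show ?thesis by (simp add: reflect_def)
qed (simp add: reflect_def)

text \<open>The orthogonal group is transitive on orthonormal lists of a given length: once the
tail has been matched by \<open>g\<close>, the reflection that exchanges \<open>g u\<close> and \<open>v\<close> fixes the vectors already
placed, since these are orthogonal to both.\<close>

lemma orthogonal_transformation_between:
  fixes us vs :: "'a::euclidean_space list"
  assumes "orthonormal us" "orthonormal vs" "length us = length vs"
  shows "\<exists>g. orthogonal_transformation g \<and> map g us = vs"
  using assms(3,1,2)
proof (induction us vs rule: list_induct2)
  case Nil
  show ?case by (intro exI[of _ "\<lambda>x. x"]) (simp add: orthogonal_transformation_id)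
next
  case (Cons u us v vs)
  then obtain g where g: "orthogonal_transformation g" "map g us = vs"
    by (auto simp: orthonormal_Cons)
  let ?h = "reflect (g u - v) \<circ> g"
  have gi: "g x \<bullet> g y = x \<bullet> y" for x y
    using g(1) by (simp add: orthogonal_transformation_def)
  have "?h u = v" using Cons.prems gi by (simp add: reflect_diff orthonormal_Cons)
  moreover have "reflect (g u - v) (g x) = g x" if "x \<in> set us" for x
  proof (rule reflect_orthogonal)
    have "g x \<in> set vs" using that g(2) by force
    show "g x \<bullet> (g u - v) = 0"
    proof -
      have "g x \<bullet> g u = 0" using Cons.prems that gi[of x u] inner_commute[of x u] by (simp add: orthonormal_Cons)
      moreover have "g x \<bullet> v = 0"
        using Cons.prems \<open>g x \<in> set vs\<close> inner_commute[of v "g x"] by (simp add: orthonormal_Cons)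
      ultimately show ?thesis by (simp add: inner_diff_right)
    qed
  qed
  then have "map ?h us = vs" using g(2) by (auto simp: map_idI intro: map_cong)
  moreover have "orthogonal_transformation ?h"
    by (intro orthogonal_transformation_compose g orthogonal_transformation_reflect)
  ultimately show ?case by (intro exI[of _ ?h]) (simp add: comp_def)
qed

lemma Basis_orthonormal: "set us \<subseteq> Basis \<Longrightarrow> distinct us \<Longrightarrow> orthonormal us"
  unfolding orthonormal_def by (auto simp: inner_Basis nth_eq_iff_index_eq subset_eq)

text \<open>The sign reveals whether \<open>b\<close> occurs in \<open>J\<close>; this is how coefficients at different
index sets are told apart below.\<close>

lemma reflect_Basis_list:
  assumes "\<Psi> \<in> alt m" "b \<in> Basis" "set J \<subseteq> Basis" "distinct J"
  shows "\<Psi> (map (reflect b) J) = (if b \<in> set J then -1 else 1) * \<Psi> J"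
proof (cases "length J = m")
  case len: True
  have fx: "reflect b x = x" if "x \<in> set J" "x \<noteq> b" for x
    using that assms by (intro reflect_orthogonal) (auto simp: inner_Basis)
  show ?thesis
  proof (cases "b \<in> set J")
    case True
    then obtain i where i: "i < length J" "J ! i = b" by (auto simp: in_set_conv_nth)
    have "map (reflect b) J = J[i := (-1) *\<^sub>R b]"
    proof (rule nth_equalityI)
      fix j assume "j < length (map (reflect b) J)"
      then show "map (reflect b) J ! j = J[i := (-1) *\<^sub>R b] ! j"
        using i fx[of "J ! j"] reflect_self[of b] assms(4) by (cases "j = i") (auto simp: nth_eq_iff_index_eq)
    qed simp
    then have "\<Psi> (map (reflect b) J) = (-1) * \<Psi> (J[i := b])"
      using alt_scale[OF assms(1) len, of i "-1" b] i len by simp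
    then show ?thesis using True i by auto
  next
    case False
    then have "map (reflect b) J = J" by (intro map_idI fx) auto
    then show ?thesis using False by simp
  qed
qed (use assms in \<open>auto simp: alt_length\<close>)

section \<open>Averaging an alternating form over a random projection\<close>

lemma bounded_linear_mult_vec: "bounded_linear (\<lambda>X::real^'n^'m. X *v v)"
  unfolding linear_conv_bounded_linear[symmetric]
  by (rule linearI) (simp_all add: matrix_vector_mult_add_rdistrib scaleR_matrix_vector_assoc)

lemma coord_map_continuous: "continuous_on S (\<lambda>X::real^'n^'n. coord (map ((*v) X) vs) bs)"
  by (induction vs bs rule: coord.induct)
     (auto intro!: continuous_intros bounded_linear.continuous_on[OF bounded_linear_mult_vec])

text \<open>The law of the matrix of the orthogonal projection onto a random subspace.  Matrices
rather than subspaces carry the measure, so that continuity in \<open>X\<close> is available on a whole vector space.\<close>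

locale random_projection = prob_space \<mu> for \<mu> :: "(real^'n^'n) measure" +
  fixes k :: nat
  assumes sets_eq [measurable_cong, simp]: "sets \<mu> = sets borel"
    and proj: "AE X in \<mu>. transpose X = X \<and> X ** X = X \<and> dim (range ((*v) X)) = k"
    and invariant: "\<And>g. orthogonal_transformation g \<Longrightarrow>
      distr \<mu> borel (\<lambda>X. matrix g ** X ** transpose (matrix g)) = \<mu>"
begin

lemma space_eq [simp]: "space \<mu> = UNIV"
  using sets_eq_imp_space_eq[OF sets_eq] by simp

end

lemma symmetric_inner: "transpose X = X \<Longrightarrow> (X *v u) \<bullet> v = u \<bullet> (X *v v)" for X :: "real^'n^'n"
  by (metis dot_lmul_matrix matrix_vector_mul_assoc transpose_matrix_vector vector_transpose_matrix)

lemma projection_norm_le: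
  fixes X :: "real^'n^'n"
  assumes "transpose X = X" "X ** X = X"
  shows "norm (X *v v) \<le> norm v"
proof -
  have "(X *v v) \<bullet> (X *v v) = v \<bullet> (X *v v)"
    using symmetric_inner[OF assms(1), of v "X *v v"] assms(2) by (simp add: matrix_vector_mul_assoc)
  also have "\<dots> \<le> norm v * norm (X *v v)" by (rule norm_cauchy_schwarz)
  finally have "norm (X *v v) * norm (X *v v) \<le> norm v * norm (X *v v)"
    by (simp add: power2_norm_eq_inner[symmetric] power2_eq_square)
  then show ?thesis by (cases "X *v v = 0") auto
qed

text \<open>Only the values on \<open>[0, 1]\<close> matter, since a projection does not increase norms.\<close>

definition weight :: "(real \<Rightarrow> real) \<Rightarrow> bool" where
  "weight w \<longleftrightarrow> w \<in> borel_measurable borel \<and> (\<exists>W. \<forall>t\<in>{0..1}. \<bar>w t\<bar> \<le> W)"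

text \<open>The mean of \<open>w(|X e|) X^* \<Omega>\<close>.\<close>

definition avg :: "(real^'n^'n) measure \<Rightarrow> (real \<Rightarrow> real) \<Rightarrow> real^'n \<Rightarrow> ((real^'n) list \<Rightarrow> real) \<Rightarrow> (real^'n) list \<Rightarrow> real" where
  "avg \<mu> w e \<Omega> vs = (\<integral>X. w (norm (X *v e)) * \<Omega> (map ((*v) X) vs) \<partial>\<mu>)"

lemma alt_map_continuous:
  assumes "\<Omega> \<in> alt m"
  shows "continuous_on S (\<lambda>X::real^'n^'n. \<Omega> (map ((*v) X) vs))"
proof (cases "length vs = m")
  case True
  have "(\<lambda>X::real^'n^'n. \<Omega> (map ((*v) X) vs)) = (\<lambda>X. \<Sum>bs\<in>basis_lists Basis m. coord (map ((*v) X) vs) bs * \<Omega> bs)"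
    by (rule ext, rule alt_expand[OF assms]) (simp_all add: True euclidean_representation)
  then show ?thesis by (simp only:) (intro continuous_intros coord_map_continuous)
qed (use assms in \<open>simp add: alt_length\<close>)

lemma mult_vec_continuous [continuous_intros]: "continuous_on S (\<lambda>X::real^'n^'m. X *v v)"
  by (rule bounded_linear.continuous_on[OF bounded_linear_mult_vec continuous_on_id])

context random_projection
begin

lemma avg_measurable:
  assumes "\<Omega> \<in> alt m" "w \<in> borel_measurable borel"
  shows "(\<lambda>X::real^'n^'n. w (norm (X *v e)) * \<Omega> (map ((*v) X) vs)) \<in> borel_measurable borel"
proof -
  have "(\<lambda>X::real^'n^'n. norm (X *v e)) \<in> borel_measurable borel"
    by (intro borel_measurable_continuous_onI continuous_intros)
  moreover have "(\<lambda>X::real^'n^'n. \<Omega> (map ((*v) X) vs)) \<in> borel_measurable borel"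
    by (intro borel_measurable_continuous_onI alt_map_continuous[OF assms(1)])
  ultimately show ?thesis using assms(2) by measurable
qed

lemma avg_integrable:
  assumes "\<Omega> \<in> alt m" "weight w" "norm e = 1"
  shows "integrable \<mu> (\<lambda>X. w (norm (X *v e)) * \<Omega> (map ((*v) X) vs))"
proof -
  from assms(2) obtain W where w: "w \<in> borel_measurable borel" and W: "\<And>t. t \<in> {0..1} \<Longrightarrow> \<bar>w t\<bar> \<le> W"
    unfolding weight_def by blast
  let ?B = "alt_norm m \<Omega> * prod_list (map norm vs)"
  have "AE X in \<mu>. norm (w (norm (X *v e)) * \<Omega> (map ((*v) X) vs)) \<le> W * ?B"
    using proj
  proof eventually_elim
    case (elim X)
    have le: "norm (X *v v) \<le> norm v" for v using elim by (intro projection_norm_le) auto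
    have "\<bar>\<Omega> (map ((*v) X) vs)\<bar> \<le> alt_norm m \<Omega> * prod_list (map norm (map ((*v) X) vs))"
      by (rule alt_bound[OF assms(1)])
    also have "\<dots> \<le> ?B"
      by (intro mult_left_mono prod_list_norm_mono le) (auto simp: alt_norm_def sum_nonneg)
    finally show ?case
      using W[of "norm (X *v e)"] le[of e] assms(3) by (simp add: abs_mult mult_mono)
  qed
  then show ?thesis
    using avg_measurable[OF assms(1) w] by (intro integrable_const_bound) auto
qed

text \<open>Substitute \<open>g X g^T\<close> for \<open>X\<close>.\<close>

lemma avg_invariant:
  assumes g: "orthogonal_transformation g" and \<Omega>: "\<Omega> \<in> alt m" and w: "w \<in> borel_measurable borel"
  shows "avg \<mu> w (g e) \<Omega> (map g vs) = avg \<mu> w e (\<lambda>vs. \<Omega> (map g vs)) vs"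
proof -
  interpret linear g by (rule orthogonal_transformation_linear[OF g])
  have gm: "matrix g *v x = g x" for x
    using matrix_vector_mul(2)[OF orthogonal_transformation_linear[OF g]] by metis
  have "orthogonal_matrix (matrix g)" using g by (simp add: orthogonal_transformation_matrix)
  then have tg: "transpose (matrix g) *v g x = x" for x
    by (metis gm matrix_vector_mul_assoc matrix_vector_mul_lid orthogonal_matrix_def)
  have conj: "(matrix g ** X ** transpose (matrix g)) *v g x = g (X *v x)" for X x
    by (metis gm matrix_vector_mul_assoc tg)
  have norm: "norm (g x) = norm x" for x by (rule orthogonal_transformation_norm[OF g])
  have meas: "(\<lambda>X. matrix g ** X ** transpose (matrix g)) \<in> measurable \<mu> borel"
    unfolding measurable_cong_sets[OF sets_eq refl]
    by (intro borel_measurable_continuous_onI linear_continuous_on linear_conv_bounded_linear[THEN iffD1] linearI)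
       (simp_all add: matrix_eq matrix_vector_mul_assoc[symmetric] matrix_vector_mult_add_rdistrib
          matrix_vector_right_distrib scaleR_matrix_vector_assoc[symmetric] matrix_vector_mult_scaleR)
  have "avg \<mu> w (g e) \<Omega> (map g vs) =
    (\<integral>X. w (norm (X *v g e)) * \<Omega> (map ((*v) X) (map g vs)) \<partial>distr \<mu> borel (\<lambda>X. matrix g ** X ** transpose (matrix g)))"
    by (simp add: avg_def invariant[OF g])
  also have "\<dots> = (\<integral>X. w (norm (g (X *v e))) * \<Omega> (map (\<lambda>x. g (X *v x)) vs) \<partial>\<mu>)"
    by (subst integral_distr[OF meas avg_measurable[OF \<Omega> w]]) (simp add: conj comp_def)
  finally show ?thesis by (simp add: avg_def norm comp_def)
qed

lemma avg_lincomb: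
  assumes "\<Omega> \<in> alt m" "\<Psi> \<in> alt m" "weight w" "norm e = 1"
  shows "avg \<mu> w e (\<lambda>vs. a * \<Omega> vs + b * \<Psi> vs) vs = a * avg \<mu> w e \<Omega> vs + b * avg \<mu> w e \<Psi> vs"
proof -
  have "avg \<mu> w e (\<lambda>vs. a * \<Omega> vs + b * \<Psi> vs) vs =
    (\<integral>X. a * (w (norm (X *v e)) * \<Omega> (map ((*v) X) vs)) + b * (w (norm (X *v e)) * \<Psi> (map ((*v) X) vs)) \<partial>\<mu>)"
    by (simp add: avg_def algebra_simps)
  also have "\<dots> = a * avg \<mu> w e \<Omega> vs + b * avg \<mu> w e \<Psi> vs"
    unfolding avg_def
    by (subst Bochner_Integration.integral_add)
       (use assms in \<open>auto intro!: avg_integrable integrable_mult_right\<close>)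
  finally show ?thesis .
qed

lemma avg_alt:
  assumes "\<Omega> \<in> alt m" "weight w" "norm e = 1"
  shows "avg \<mu> w e \<Omega> \<in> alt m"
proof (rule altI)
  fix vs :: "(real^'n) list" and i u x a b
  assume vs: "length vs = m" "i < m"
  have "avg \<mu> w e \<Omega> (vs[i := a *\<^sub>R u + b *\<^sub>R x]) =
    (\<integral>X. a * (w (norm (X *v e)) * \<Omega> (map ((*v) X) (vs[i := u]))) +
         b * (w (norm (X *v e)) * \<Omega> (map ((*v) X) (vs[i := x]))) \<partial>\<mu>)"
    using vs by (simp add: avg_def map_update matrix_vector_right_distrib matrix_vector_mult_scaleR
        alt_linear[OF assms(1)] algebra_simps)
  also have "\<dots> = a * avg \<mu> w e \<Omega> (vs[i := u]) + b * avg \<mu> w e \<Omega> (vs[i := x])"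
    unfolding avg_def
    by (subst Bochner_Integration.integral_add)
       (use assms in \<open>auto intro!: avg_integrable integrable_mult_right\<close>)
  finally show "avg \<mu> w e \<Omega> (vs[i := a *\<^sub>R u + b *\<^sub>R x]) =
    a * avg \<mu> w e \<Omega> (vs[i := u]) + b * avg \<mu> w e \<Omega> (vs[i := x])" .
next
  fix vs :: "(real^'n) list" and i j
  assume vs: "length vs = m" "i < j" "j < m" "vs ! i = vs ! j"
  have "\<Omega> (map ((*v) X) vs) = 0" for X
    by (rule alt_repeat[OF assms(1), of _ i j]) (use vs in auto)
  then show "avg \<mu> w e \<Omega> vs = 0" by (simp add: avg_def)
qed (use assms(1) in \<open>auto simp: avg_def alt_length\<close>)

text \<open>Let \<open>\<Psi>\<close> be the part of \<open>\<Omega>\<close> supported on the lists that enumerate the set of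
\<open>J\<close>.  It is reached from \<open>\<Omega>\<close> by symmetrising with the reflections in the coordinate directions one
after the other: each kills the coefficients whose index set differs from that of \<open>J\<close> at that
direction, and none changes the mean at \<open>J\<close>, because \<open>reflect b e = \<plusminus> e\<close> and \<open>w\<close> sees only a norm.  If
\<open>\<Omega> J = 0\<close> then \<open>\<Psi> = 0\<close>.\<close>

lemma avg_basis_list_zero:
  assumes w: "weight w" and e: "e \<in> Basis" and \<Omega>: "\<Omega> \<in> alt m"
    and J: "J \<in> basis_lists Basis m" "distinct J" "\<Omega> J = 0"
  shows "avg \<mu> w e \<Omega> J = 0"
proof -
  have wm: "w \<in> borel_measurable borel" using w by (simp add: weight_def)
  have ne: "norm e = 1" using e by simp
  let ?s = "\<lambda>b J. if b \<in> set J then -1 else 1 :: real"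
  have flip: "avg \<mu> w e (\<lambda>vs. \<Omega> (map (reflect b) vs)) J = ?s b J * avg \<mu> w e \<Omega> J"
    if b: "b \<in> Basis" and \<Omega>: "\<Omega> \<in> alt m" for b \<Omega>
  proof -
    have "reflect b e = e \<or> reflect b e = - e"
    proof (cases "e = b")
      case False
      then show ?thesis using b e by (intro disjI1 reflect_orthogonal) (auto simp: inner_Basis)
    qed (simp add: reflect_self)
    then have "avg \<mu> w (reflect b e) \<Omega> vs = avg \<mu> w e \<Omega> vs" for vs
      by (auto simp: avg_def linear_neg[OF matrix_vector_mul_linear])
    then have "avg \<mu> w e (\<lambda>vs. \<Omega> (map (reflect b) vs)) J = avg \<mu> w e \<Omega> (map (reflect b) J)"
      using avg_invariant[OF orthogonal_transformation_reflect \<Omega> wm, of b e J] by simp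
    also have "\<dots> = ?s b J * avg \<mu> w e \<Omega> J"
      using J b by (intro reflect_Basis_list[OF avg_alt[OF \<Omega> w ne]]) (auto simp: basis_lists_def)
    finally show ?thesis .
  qed
  have "\<exists>\<Psi>\<in>alt m. avg \<mu> w e \<Psi> J = avg \<mu> w e \<Omega> J \<and>
    (\<forall>J'\<in>basis_lists Basis m. distinct J' \<longrightarrow> \<Psi> J' = (if set J' \<inter> B = set J \<inter> B then \<Omega> J' else 0))"
    if "finite B" "B \<subseteq> Basis" for B
    using that
  proof (induction B rule: finite_induct)
    case empty
    then show ?case using \<Omega> by auto
  next
    case (insert b B)
    then obtain \<Psi> where \<Psi>: "\<Psi> \<in> alt m" "avg \<mu> w e \<Psi> J = avg \<mu> w e \<Omega> J"
      "\<And>J'. J' \<in> basis_lists Basis m \<Longrightarrow> distinct J' \<Longrightarrow> \<Psi> J' = (if set J' \<inter> B = set J \<inter> B then \<Omega> J' else 0)"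
      by auto
    have b: "b \<in> Basis" using insert by auto
    let ?\<Phi> = "\<lambda>vs. (1/2) * \<Psi> vs + (?s b J / 2) * \<Psi> (map (reflect b) vs)"
    have r: "(\<lambda>vs. \<Psi> (map (reflect b) vs)) \<in> alt m" by (rule alt_map[OF \<Psi>(1) linear_reflect])
    have 1: "?\<Phi> \<in> alt m" by (rule alt_lincomb[OF \<Psi>(1) r])
    have 2: "avg \<mu> w e ?\<Phi> J = avg \<mu> w e \<Omega> J"
      unfolding avg_lincomb[OF \<Psi>(1) r w ne] flip[OF b \<Psi>(1)] \<Psi>(2) by simp
    have 3: "?\<Phi> J' = (if set J' \<inter> insert b B = set J \<inter> insert b B then \<Omega> J' else 0)"
      if "J' \<in> basis_lists Basis m" "distinct J'" for J'
    proof -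
      have "\<Psi> (map (reflect b) J') = ?s b J' * \<Psi> J'"
        using that b by (intro reflect_Basis_list[OF \<Psi>(1)]) (auto simp: basis_lists_def)
      moreover have "set J' \<inter> insert b B = set J \<inter> insert b B \<longleftrightarrow>
          (b \<in> set J' \<longleftrightarrow> b \<in> set J) \<and> set J' \<inter> B = set J \<inter> B"
        using insert.hyps by blast
      ultimately show ?thesis using \<Psi>(3)[OF that] by auto
    qed
    from 1 2 3 show ?case by blast
  qed
  from this[of Basis] obtain \<Psi> where \<Psi>: "\<Psi> \<in> alt m" "avg \<mu> w e \<Psi> J = avg \<mu> w e \<Omega> J"
      "\<And>J'. J' \<in> basis_lists Basis m \<Longrightarrow> distinct J' \<Longrightarrow> \<Psi> J' = (if set J' \<inter> Basis = set J \<inter> Basis then \<Omega> J' else 0)"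
    by auto
  have "\<Psi> vs = 0" for vs
  proof (rule alt_eqI[OF \<Psi>(1) alt_zero, of Basis])
    fix J' :: "(real^'n) list" assume J': "J' \<in> basis_lists Basis m" "distinct J'"
    show "\<Psi> J' = 0"
    proof (cases "set J' = set J")
      case True
      then have "\<Omega> J' = 0" using J J' True by (subst alt_perm_zero[OF \<Omega>, of J]) (auto simp: basis_lists_def)
      then show ?thesis using \<Psi>(3)[OF J'] by simp
    next
      case False
      then have "set J' \<inter> Basis \<noteq> set J \<inter> Basis" using J J' by (auto simp: basis_lists_def)
      then show ?thesis using \<Psi>(3)[OF J'] by simp
    qed
  qed (simp add: euclidean_representation)
  then have "avg \<mu> w e \<Psi> J = 0" by (simp add: avg_def)
  then show ?thesis using \<Psi> by simp
qed

text \<open>By the preceding lemma the coefficient of the mean at a basis list \<open>J0\<close> that begins with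
\<open>e0\<close> is proportional to \<open>\<Omega> J0\<close>, say with the constant \<open>c\<close>.  Every orthonormal list that begins with
\<open>e\<close> is an image of \<open>J0\<close>, so by invariance the same \<open>c\<close> serves for all \<open>e\<close>, and multilinearity extends
the relation to all lists with head \<open>e\<close>.  For \<open>\<Omega> = e \<and> \<gamma>\<close> nothing else is to be computed, since both
sides vanish at the lists without \<open>e\<close> from an orthonormal basis that contains \<open>e\<close>.\<close>

lemma avg_eigenvalue:
  assumes w: "weight w" and q: "q < CARD('n)"
  shows "\<exists>c. (\<forall>e \<Omega> vs. norm e = 1 \<longrightarrow> \<Omega> \<in> alt (Suc q) \<longrightarrow> avg \<mu> w e \<Omega> (e # vs) = c * \<Omega> (e # vs)) \<and>
    (\<forall>e \<gamma> vs. norm e = 1 \<longrightarrow> \<gamma> \<in> alt q \<longrightarrow> avg \<mu> w e (wedge e \<gamma>) vs = c * wedge e \<gamma> vs)"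
proof -
  have wm: "w \<in> borel_measurable borel" using w by (simp add: weight_def)
  have "Suc q \<le> card (Basis :: (real^'n) set)" using q by simp
  then obtain S where S: "S \<subseteq> (Basis :: (real^'n) set)" "card S = Suc q"
    by (meson obtain_subset_with_card_n)
  have "finite S" using S by (metis card.infinite nat.distinct(1))
  then obtain J0 where J0: "set J0 = S" "distinct J0" using finite_distinct_list by blast
  then have lJ0: "length J0 = Suc q" using S distinct_card by metis
  then obtain e0 js where J0e: "J0 = e0 # js" by (cases J0) auto
  have e0: "e0 \<in> Basis" "norm e0 = 1" using J0 J0e S by auto
  have oJ0: "orthonormal J0" using Basis_orthonormal J0 S by auto
  have J0B: "J0 \<in> basis_lists Basis (Suc q)" using J0 S lJ0 by (auto simp: basis_lists_def)
  \<comment> \<open>a form that takes the value 1 at \<open>J0\<close>, subtracted from \<open>\<Omega>\<close> to create a zero there\<close>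
  define D where "D = monomial_form J0"
  have D: "D \<in> alt (Suc q)" "D J0 = 1" using monomial_form_alt[of J0] monomial_form_orthonormal[OF oJ0] lJ0 by (auto simp: D_def)
  define c where "c = avg \<mu> w e0 D J0"
  have base: "avg \<mu> w e0 \<Omega> J0 = c * \<Omega> J0" if \<Omega>: "\<Omega> \<in> alt (Suc q)" for \<Omega>
  proof -
    have "avg \<mu> w e0 (\<lambda>vs. 1 * \<Omega> vs + (- \<Omega> J0) * D vs) J0 = 0"
      by (rule avg_basis_list_zero[OF w e0(1) alt_lincomb[OF \<Omega> D(1)] J0B J0(2)]) (simp add: D)
    then show ?thesis unfolding avg_lincomb[OF \<Omega> D(1) w e0(2)] by (simp add: c_def)
  qed
  have ortho: "avg \<mu> w e \<Omega> (e # us) = c * \<Omega> (e # us)"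
    if \<Omega>: "\<Omega> \<in> alt (Suc q)" and us: "orthonormal (e # us)" "length us = q" for \<Omega> e us
  proof -
    obtain g where g: "orthogonal_transformation g" "map g J0 = e # us"
      using orthogonal_transformation_between[OF oJ0 us(1)] us lJ0 by auto
    have "avg \<mu> w (g e0) \<Omega> (map g J0) = avg \<mu> w e0 (\<lambda>vs. \<Omega> (map g vs)) J0"
      by (rule avg_invariant[OF g(1) \<Omega> wm])
    also have "\<dots> = c * \<Omega> (map g J0)"
      by (rule base[OF alt_map[OF \<Omega> orthogonal_transformation_linear[OF g(1)]]])
    finally show ?thesis using g J0e by simp
  qed
  \<comment> \<open>an orthonormal basis that contains \<open>e\<close>, in the form of an image of the standard one\<close>
  have basis: "\<exists>g. orthogonal_transformation g \<and> g e0 = e \<and> (\<forall>v. v = (\<Sum>b\<in>g ` Basis. (v \<bullet> b) *\<^sub>R b))"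
    if e: "norm e = 1" for e :: "real^'n"
  proof -
    have "orthonormal [e0]" "orthonormal [e]" using e e0 by (auto simp: orthonormal_def norm_eq_1)
    from orthogonal_transformation_between[OF this]
    obtain g where g: "orthogonal_transformation g" "g e0 = e" by auto
    interpret linear g by (rule orthogonal_transformation_linear[OF g(1)])
    have gi: "g x \<bullet> g y = x \<bullet> y" for x y using g(1) by (simp add: orthogonal_transformation_def)
    have inj: "inj g" by (rule orthogonal_transformation_inj[OF g(1)])
    have "v = (\<Sum>b\<in>g ` Basis. (v \<bullet> b) *\<^sub>R b)" for v
    proof -
      obtain x where x: "v = g x" using orthogonal_transformation_surj[OF g(1)] by (metis surjD)
      have "(\<Sum>b\<in>g ` Basis. (v \<bullet> b) *\<^sub>R b) = (\<Sum>b\<in>Basis. (x \<bullet> b) *\<^sub>R g b)"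
        by (subst sum.reindex) (auto intro: inj_on_subset[OF inj] simp: x gi)
      also have "\<dots> = g (\<Sum>b\<in>Basis. (x \<bullet> b) *\<^sub>R b)" by (simp only: sum scaleR)
      finally show ?thesis by (simp add: x euclidean_representation)
    qed
    then show ?thesis using g by blast
  qed
  have orthoB: "orthonormal us" if og: "orthogonal_transformation g" "set us \<subseteq> g ` Basis" "distinct us" for g and us :: "(real^'n) list"
    unfolding orthonormal_def
  proof (intro allI impI)
    fix i j assume ij: "i < length us" "j < length us"
    then obtain a b where ab: "us ! i = g a" "us ! j = g b" "a \<in> Basis" "b \<in> Basis"
      using og(2) by (meson imageE nth_mem subsetD)
    have "us ! i \<bullet> us ! j = a \<bullet> b" using ab og(1) by (simp add: orthogonal_transformation_def)
    moreover have "a = b \<longleftrightarrow> i = j"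
      using ab ij og(3) orthogonal_transformation_inj[OF og(1)] by (metis injD nth_eq_iff_index_eq)
    ultimately show "us ! i \<bullet> us ! j = (if i = j then 1 else 0)" using ab by (simp add: inner_Basis)
  qed
  have I: "avg \<mu> w e \<Omega> (e # vs) = c * \<Omega> (e # vs)" if e: "norm e = 1" and \<Omega>: "\<Omega> \<in> alt (Suc q)" for e \<Omega> vs
  proof -
    obtain g where g: "orthogonal_transformation g" "g e0 = e" and B: "\<And>v. v = (\<Sum>b\<in>g ` Basis. (v \<bullet> b) *\<^sub>R b)"
      using basis[OF e] by blast
    have A: "avg \<mu> w e \<Omega> \<in> alt (Suc q)" by (rule avg_alt[OF \<Omega> w e])
    have "contract e (avg \<mu> w e \<Omega>) vs = c * contract e \<Omega> vs"
    proof (rule alt_eqI[OF contract_alt[OF A] alt_cmult[OF contract_alt[OF \<Omega>]] B])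
      fix bs assume bs: "bs \<in> basis_lists (g ` Basis) q" "distinct bs"
      show "contract e (avg \<mu> w e \<Omega>) bs = c * contract e \<Omega> bs"
      proof (cases "e \<in> set bs")
        case True
        then have "\<not> distinct (e # bs)" by simp
        then show ?thesis using alt_not_distinct[OF \<Omega>] alt_not_distinct[OF A] by (simp add: contract_def)
      next
        case False
        have "orthonormal (e # bs)"
          by (rule orthoB[OF g(1)]) (use bs False g e0 in \<open>auto simp: basis_lists_def\<close>)
        then show ?thesis using ortho[OF \<Omega>] bs by (simp add: contract_def basis_lists_def)
      qed
    qed
    then show ?thesis by (simp add: contract_def)
  qed
  have II: "avg \<mu> w e (wedge e \<gamma>) vs = c * wedge e \<gamma> vs" if e: "norm e = 1" and \<gamma>: "\<gamma> \<in> alt q" for e \<gamma> vs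
  proof -
    obtain g where g: "orthogonal_transformation g" "g e0 = e" and B: "\<And>v. v = (\<Sum>b\<in>g ` Basis. (v \<bullet> b) *\<^sub>R b)"
      using basis[OF e] by blast
    have gi: "g x \<bullet> g y = x \<bullet> y" for x y using g(1) by (simp add: orthogonal_transformation_def)
    have \<Omega>: "wedge e \<gamma> \<in> alt (Suc q)" by (rule wedge_alt[OF \<gamma>])
    have A: "avg \<mu> w e (wedge e \<gamma>) \<in> alt (Suc q)" by (rule avg_alt[OF \<Omega> w e])
    show ?thesis
    proof (rule alt_eqI[OF A alt_cmult[OF \<Omega>] B])
      fix bs assume bs: "bs \<in> basis_lists (g ` Basis) (Suc q)" "distinct bs"
      show "avg \<mu> w e (wedge e \<gamma>) bs = c * wedge e \<gamma> bs"
      proof (cases "e \<in> set bs")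
        case True
        \<comment> \<open>reorder \<open>bs\<close> so that \<open>e\<close> comes first; there the relation is the case \<open>I\<close>\<close>
        let ?\<Phi> = "\<lambda>vs. 1 * avg \<mu> w e (wedge e \<gamma>) vs + (- c) * wedge e \<gamma> vs"
        have "?\<Phi> bs = 0"
        proof (rule alt_perm_zero[OF alt_lincomb[OF A \<Omega>], of "e # remove1 e bs"])
          show "?\<Phi> (e # remove1 e bs) = 0" using I[OF e \<Omega>] by simp
        qed (use bs True in \<open>auto simp: basis_lists_def length_remove1\<close>)
        then show ?thesis by simp
      next
        case False
        have perp: "e \<bullet> b = 0" if b: "b \<in> set bs" for b
        proof -
          obtain a where a: "b = g a" "a \<in> Basis" using b bs by (auto simp: basis_lists_def)
          then have "a \<noteq> e0" using False b g by auto
          then show ?thesis using a e0 gi[of e0 a] g by (simp add: inner_Basis)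
        qed
        have z: "wedge e \<gamma> bs = 0"
          using perp by (cases bs) (auto simp: wedge_def)
        obtain bs' where bs': "bs = map g bs'" "set bs' \<subseteq> Basis"
        proof -
          have "bs \<in> lists (g ` Basis)" using bs by (simp add: basis_lists_def lists_eq_set)
          then have "bs \<in> map g ` lists Basis" by (simp only: lists_image)
          then show ?thesis using that by (auto simp: lists_eq_set)
        qed
        have "avg \<mu> w (g e0) (wedge e \<gamma>) (map g bs') = avg \<mu> w e0 (\<lambda>vs. wedge e \<gamma> (map g vs)) bs'"
          by (rule avg_invariant[OF g(1) \<Omega> wm])
        also have "\<dots> = 0"
          by (rule avg_basis_list_zero[OF w e0(1) alt_map[OF \<Omega> orthogonal_transformation_linear[OF g(1)]]])
             (use bs bs' z in \<open>auto simp: basis_lists_def distinct_map\<close>)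
        finally show ?thesis using z bs' g by simp
      qed
    qed
  qed
  from I II show ?thesis by blast
qed

end

text \<open>The pullback by a symmetric matrix is a symmetric operator on forms for the inner product
that has the basis monomials as orthogonal vectors.\<close>

lemma sum_basis_lists_symmetric:
  assumes "\<Phi> \<in> alt m" "\<Psi> \<in> alt m" and X: "transpose X = (X::real^'n^'n)"
  shows "(\<Sum>J\<in>basis_lists Basis m. \<Phi> J * \<Psi> (map ((*v) X) J)) = (\<Sum>J\<in>basis_lists Basis m. \<Phi> (map ((*v) X) J) * \<Psi> J)"
  using assms(1,2)
proof (induction m arbitrary: \<Phi> \<Psi>)
  case 0
  then show ?case by (simp add: basis_lists_0)
next
  case (Suc m)
  have one: "(\<Sum>b\<in>Basis. f b * h (X *v b)) = (\<Sum>b\<in>Basis. f (X *v b) * h b)"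
    if "linear f" "linear h" for f h :: "real^'n \<Rightarrow> real"
  proof -
    have ex: "f (X *v b) = (\<Sum>a\<in>Basis. ((X *v b) \<bullet> a) * f a)" if "linear f" for f :: "real^'n \<Rightarrow> real" and b
    proof -
      interpret linear f by fact
      have "f (X *v b) = f (\<Sum>a\<in>Basis. ((X *v b) \<bullet> a) *\<^sub>R a)" by (simp add: euclidean_representation)
      then show ?thesis by (simp only: sum scaleR real_scaleR_def)
    qed
    have "(\<Sum>b\<in>Basis. f b * h (X *v b)) = (\<Sum>b\<in>Basis. \<Sum>a\<in>Basis. ((X *v b) \<bullet> a) * (f b * h a))"
      by (simp add: ex[OF that(2)] sum_distrib_left algebra_simps)
    also have "\<dots> = (\<Sum>a\<in>Basis. \<Sum>b\<in>Basis. ((X *v b) \<bullet> a) * (f b * h a))" by (rule sum.swap)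
    also have "\<dots> = (\<Sum>a\<in>Basis. \<Sum>b\<in>Basis. ((X *v a) \<bullet> b) * (f b * h a))"
      by (intro sum.cong refl) (metis symmetric_inner[OF X] inner_commute)
    also have "\<dots> = (\<Sum>a\<in>Basis. f (X *v a) * h a)"
      by (simp add: ex[OF that(1)] sum_distrib_left sum_distrib_right mult_ac)
    finally show ?thesis .
  qed
  have "(\<Sum>J\<in>basis_lists Basis (Suc m). \<Phi> J * \<Psi> (map ((*v) X) J)) =
     (\<Sum>b\<in>Basis. \<Sum>bs\<in>basis_lists Basis m. contract b \<Phi> bs * contract (X *v b) \<Psi> (map ((*v) X) bs))"
    by (simp add: sum_basis_lists_Suc contract_def)
  also have "\<dots> = (\<Sum>b\<in>Basis. \<Sum>bs\<in>basis_lists Basis m. contract b \<Phi> (map ((*v) X) bs) * contract (X *v b) \<Psi> bs)"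
    by (intro sum.cong refl Suc.IH contract_alt Suc.prems)
  also have "\<dots> = (\<Sum>bs\<in>basis_lists Basis m. \<Sum>b\<in>Basis. \<Phi> (b # map ((*v) X) bs) * \<Psi> (X *v b # bs))"
    unfolding contract_def by (rule sum.swap)
  also have "\<dots> = (\<Sum>bs\<in>basis_lists Basis m. \<Sum>b\<in>Basis. \<Phi> (X *v b # map ((*v) X) bs) * \<Psi> (b # bs))"
    by (intro sum.cong refl one alt_Cons_linear[OF Suc.prems(1)] alt_Cons_linear[OF Suc.prems(2)])
  also have "\<dots> = (\<Sum>b\<in>Basis. \<Sum>bs\<in>basis_lists Basis m. \<Phi> (X *v b # map ((*v) X) bs) * \<Psi> (b # bs))"
    by (rule sum.swap)
  finally show ?case by (simp add: sum_basis_lists_Suc)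
qed

lemma orthonormal_list_in_subspace:
  fixes S :: "'a::euclidean_space set"
  assumes "subspace S" "q \<le> dim S"
  shows "\<exists>us. orthonormal us \<and> set us \<subseteq> S \<and> length us = q"
proof -
  obtain B where B: "B \<subseteq> S" "pairwise orthogonal B" "\<And>x. x \<in> B \<Longrightarrow> norm x = 1" "card B = dim S"
    using orthonormal_basis_subspace[OF assms(1)] by metis
  have "finite B" using B(2,3) pairwise_orthogonal_imp_finite by blast
  obtain C where C: "C \<subseteq> B" "card C = q" "finite C"
    using assms(2) B(4) \<open>finite B\<close> by (metis finite_subset obtain_subset_with_card_n)
  obtain us where us: "set us = C" "distinct us" using C finite_distinct_list by blast
  have "orthonormal us"
    unfolding orthonormal_def
  proof (intro allI impI)
    fix i j assume ij: "i < length us" "j < length us"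
    then have "us ! i \<in> B" "us ! j \<in> B" using us C by auto
    then show "us ! i \<bullet> us ! j = (if i = j then 1 else 0)"
      using B(2,3) us(2) ij by (auto simp: pairwise_def orthogonal_def norm_eq_1 nth_eq_iff_index_eq)
  qed
  then show ?thesis using us C B distinct_card by (metis subset_trans)
qed

context random_projection
begin

text \<open>For a projection \<open>X\<close> the pullback is a symmetric idempotent, so pairing the mean of
\<open>w(|X e|) X^* \<Omega>\<close> with \<open>\<Omega>\<close> gives the mean of \<open>w(|X e|) |X^* \<Omega>|^2\<close>, a nonnegative number.  If \<open>c\<close>
were not positive, this would vanish for all basis monomials \<open>\<Omega>\<close>, hence almost every \<open>X\<close> would
annihilate all forms of degree \<open>q + 1\<close>; but there is a form of that degree which is not zero on the range
of \<open>X\<close>, because the dimension \<open>k\<close> of the range is at least \<open>q + 1\<close>.\<close>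

lemma avg_eigenvalue_pos:
  assumes w: "weight w" and pos: "\<And>t. 0 < t \<Longrightarrow> t \<le> 1 \<Longrightarrow> w t > 0" and w0: "w 0 \<ge> 0"
    and q: "Suc q \<le> k"
    and c: "\<And>e \<gamma> vs. norm e = 1 \<Longrightarrow> \<gamma> \<in> alt q \<Longrightarrow> avg \<mu> w e (wedge e \<gamma>) vs = c * wedge e \<gamma> vs"
  shows "c > 0"
proof (rule ccontr)
  assume "\<not> c > 0"
  then have c0: "c \<le> 0" by simp
  let ?Bl = "basis_lists (Basis :: (real^'n) set) (Suc q)"
  have fin: "finite ?Bl" by (simp add: finite_basis_lists)
  have wnn: "w (norm (X *v e)) \<ge> 0" if "transpose X = X \<and> X ** X = X \<and> dim (range ((*v) X)) = k" "norm e = 1" for X and e :: "real^'n"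
  proof -
    have "norm (X *v e) \<le> 1" using projection_norm_le[of X e] that by simp
    then show ?thesis using pos[of "norm (X *v e)"] w0 by (cases "norm (X *v e) = 0") auto
  qed
  have AE: "AE X in \<mu>. \<forall>J'\<in>?Bl. monomial_form J (map ((*v) X) J') = 0" if J: "J \<in> ?Bl" for J
  proof -
    obtain e js where Je: "J = e # js" "e \<in> Basis" "length js = q" using J by (cases J) (auto simp: basis_lists_def)
    have e: "norm e = 1" using Je by simp
    let ?\<gamma> = "monomial_form js" and ?\<Omega> = "wedge e (monomial_form js)"
    have \<gamma>: "?\<gamma> \<in> alt q" using monomial_form_alt[of js] Je by simp
    have \<Omega>: "?\<Omega> \<in> alt (Suc q)" by (rule wedge_alt[OF \<gamma>])
    let ?f = "\<lambda>X. w (norm (X *v e)) * (\<Sum>J'\<in>?Bl. (?\<Omega> (map ((*v) X) J'))\<^sup>2)"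
    let ?h = "\<lambda>X. \<Sum>J'\<in>?Bl. ?\<Omega> J' * (w (norm (X *v e)) * ?\<Omega> (map ((*v) X) J'))"
    have int: "integrable \<mu> ?h"
      by (intro Bochner_Integration.integrable_sum integrable_mult_right avg_integrable[OF \<Omega> w e])
    have eq: "AE X in \<mu>. ?h X = ?f X"
      using proj
    proof eventually_elim
      case (elim X)
      have "linear ((*v) X)" by simp
      then have \<Psi>: "(\<lambda>vs. ?\<Omega> (map ((*v) X) vs)) \<in> alt (Suc q)" by (rule alt_map[OF \<Omega>])
      have XX: "map ((*v) X) (map ((*v) X) J') = map ((*v) X) J'" for J'
        using elim by (simp add: matrix_vector_mul_assoc)
      have "(\<Sum>J'\<in>?Bl. ?\<Omega> J' * ?\<Omega> (map ((*v) X) J')) = (\<Sum>J'\<in>?Bl. ?\<Omega> J' * ?\<Omega> (map ((*v) X) (map ((*v) X) J')))"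
        by (simp only: XX)
      also have "\<dots> = (\<Sum>J'\<in>?Bl. ?\<Omega> (map ((*v) X) J') * ?\<Omega> (map ((*v) X) J'))"
        by (rule sum_basis_lists_symmetric[OF \<Omega> \<Psi>]) (use elim in simp)
      finally have "(\<Sum>J'\<in>?Bl. ?\<Omega> J' * ?\<Omega> (map ((*v) X) J')) = (\<Sum>J'\<in>?Bl. (?\<Omega> (map ((*v) X) J'))\<^sup>2)"
        by (simp add: power2_eq_square)
      moreover have "?h X = w (norm (X *v e)) * (\<Sum>J'\<in>?Bl. ?\<Omega> J' * ?\<Omega> (map ((*v) X) J'))"
        by (simp add: sum_distrib_left mult.left_commute)
      ultimately show ?case by simp
    qed
    have meas: "?f \<in> borel_measurable \<mu>"
    proof -
      have wm: "w \<in> borel_measurable borel" using w by (simp add: weight_def)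
      have "(\<lambda>X::real^'n^'n. norm (X *v e)) \<in> borel_measurable borel"
        by (intro borel_measurable_continuous_onI continuous_intros)
      moreover have "(\<lambda>X::real^'n^'n. ?\<Omega> (map ((*v) X) J')) \<in> borel_measurable borel" for J'
        by (intro borel_measurable_continuous_onI alt_map_continuous[OF \<Omega>])
      ultimately show ?thesis using wm by measurable
    qed
    have intf: "integrable \<mu> ?f"
      using integrable_cong_AE[THEN iffD1, OF _ meas eq int] int by auto
    have "(\<integral>X. ?f X \<partial>\<mu>) = (\<integral>X. ?h X \<partial>\<mu>)"
      using eq by (intro integral_cong_AE meas) (use int in auto)
    also have "\<dots> = (\<Sum>J'\<in>?Bl. ?\<Omega> J' * avg \<mu> w e ?\<Omega> J')"
      unfolding avg_def
      by (subst Bochner_Integration.integral_sum) (intro integrable_mult_right avg_integrable[OF \<Omega> w e], simp)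
    also have "\<dots> = c * (\<Sum>J'\<in>?Bl. (?\<Omega> J')\<^sup>2)"
      by (simp add: c[OF e \<gamma>] sum_distrib_left power2_eq_square mult.left_commute)
    also have "\<dots> \<le> 0" using c0 by (simp add: mult_nonpos_nonneg sum_nonneg)
    finally have le: "(\<integral>X. ?f X \<partial>\<mu>) \<le> 0" .
    have nn: "AE X in \<mu>. 0 \<le> ?f X"
      using proj by eventually_elim (auto intro!: mult_nonneg_nonneg sum_nonneg wnn e)
    have "(\<integral>X. ?f X \<partial>\<mu>) = 0" using le integral_nonneg_AE[OF nn] by simp
    then have "AE X in \<mu>. ?f X = 0" using integral_nonneg_eq_0_iff_AE[OF intf nn] by simp
    then show ?thesis using proj
    proof eventually_elim
      case (elim X)
      show ?case
      proof (cases "X *v e = 0")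
        case True
        \<comment> \<open>here the weight carries no information, but the form itself is zero on the range of \<open>X\<close>\<close>
        have "e \<bullet> (X *v v) = 0" for v
          using symmetric_inner[of X e v] elim True by simp
        then have "wedge e (monomial_form js) (map ((*v) X) J') = 0" for J'
          by (cases J') (auto simp: wedge_def)
        then show ?thesis using Je by simp
      next
        case False
        have "norm (X *v e) \<le> 1" using projection_norm_le[of X e] elim e by simp
        then have "w (norm (X *v e)) > 0" using False by (intro pos) auto
        then have "(\<Sum>J'\<in>?Bl. (?\<Omega> (map ((*v) X) J'))\<^sup>2) = 0" using elim by simp
        then show ?thesis using fin Je by (subst (asm) sum_nonneg_eq_0_iff) auto
      qed
    qed
  qed
  have "AE X in \<mu>. \<forall>J\<in>?Bl. \<forall>J'\<in>?Bl. monomial_form J (map ((*v) X) J') = 0"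
    by (rule AE_finite_allI[OF fin AE])
  with proj have "AE X in \<mu>. False"
  proof eventually_elim
    case (elim X)
    have lX: "linear ((*v) X)" by simp
    have "subspace (range ((*v) X))" by (simp add: linear_subspace_image)
    then obtain us where us: "orthonormal us" "set us \<subseteq> range ((*v) X)" "length us = Suc q"
      using orthonormal_list_in_subspace[of "range ((*v) X)" "Suc q"] q elim by auto
    have "X *v u = u" if "u \<in> set us" for u
      using us(2) that elim by (auto simp: matrix_vector_mul_assoc dest!: subsetD)
    then have Xus: "map ((*v) X) us = us" by (intro map_idI) auto
    have "monomial_form J us = 0" if J: "J \<in> ?Bl" for J
    proof -
      have "monomial_form J \<in> alt (Suc q)" using J monomial_form_alt[of J] by (simp add: basis_lists_def)
      then have "(\<lambda>vs. monomial_form J (map ((*v) X) vs)) \<in> alt (Suc q)" by (rule alt_map[OF _ lX])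
      from alt_expand[OF this us(3), of Basis] have "monomial_form J (map ((*v) X) us) = 0"
        using elim J by (simp add: euclidean_representation)
      then show ?thesis by (simp add: Xus)
    qed
    then have "monomial_form us us = 0" by (subst monomial_form_expand) (simp add: us)
    then show False using monomial_form_orthonormal[OF us(1)] by simp
  qed
  then show False by (simp add: AE_False)
qed

end

section \<open>Integrable majorants and derivatives of integrals\<close>

text \<open>A function that dominates \<open>|y|^(1 - n)\<close> near the origin up to a constant and is still
integrable at infinity; it serves as the common majorant for dominated convergence.\<close>

definition decay :: "'a::euclidean_space \<Rightarrow> real" where
  "decay y = norm y powr (1 - real DIM('a)) / (1 + norm y)\<^sup>2"

lemma decay_nonneg: "decay y \<ge> 0" by (simp add: decay_def)

lemma decay_measurable [measurable]: "decay \<in> borel_measurable borel"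
  unfolding decay_def by measurable

text \<open>A layer-cake bound in place of polar coordinates: the integral over \<open>r \<ge> |y|\<close> is at
least the part over \<open>[|y|, 2 |y|]\<close>, where the integrand is comparable to its value at \<open>|y|\<close>.\<close>

lemma decay_layer:
  fixes y :: "'a::euclidean_space"
  assumes "y \<noteq> 0"
  shows "ennreal (decay y) \<le> (\<integral>\<^sup>+r. ennreal (4 * 2 ^ DIM('a)) *
    (ennreal (r powr - real DIM('a) / (1 + r)\<^sup>2) * indicator {norm y..} r) \<partial>lborel)"
proof -
  let ?n = "real DIM('a)" and ?a = "norm y"
  have a: "?a > 0" using assms by simp
  let ?c = "(2 * ?a) powr (- ?n) / (1 + 2 * ?a)\<^sup>2"
  have "decay y \<le> 4 * 2 ^ DIM('a) * (?c * ?a)"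
  proof -
    have "(1 + 2 * ?a)\<^sup>2 \<le> (2 * (1 + ?a))\<^sup>2" using a by (intro power_mono) auto
    then have "(1 + 2 * ?a)\<^sup>2 \<le> 4 * (1 + ?a)\<^sup>2" unfolding power_mult_distrib by simp
    then have le: "1 / (1 + ?a)\<^sup>2 \<le> 4 * (1 / (1 + 2 * ?a)\<^sup>2)"
    proof -
      have "1 / A \<le> 4 * (1 / B)" if "A > 0" "B > 0" "B \<le> 4 * A" for A B :: real
        using that by (simp add: field_simps)
      moreover have "1 + ?a > 0" "1 + 2 * ?a > 0" using a by linarith+
      ultimately show ?thesis using \<open>(1 + 2 * ?a)\<^sup>2 \<le> 4 * (1 + ?a)\<^sup>2\<close> by (meson zero_less_power)
    qed
    have p: "(2 * ?a) powr (- ?n) = 2 powr (- ?n) * ?a powr (- ?n)" using a by (simp add: powr_mult)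
    have q: "2 ^ DIM('a) * (2::real) powr (- ?n) = 1" by (simp add: powr_minus powr_realpow)
    have r: "?a powr (1 - ?n) = ?a powr (- ?n) * ?a" using a by (simp add: powr_diff powr_minus divide_inverse)
    have "decay y = ?a powr (- ?n) * ?a * (1 / (1 + ?a)\<^sup>2)" by (simp add: decay_def r)
    also have "\<dots> \<le> ?a powr (- ?n) * ?a * (4 * (1 / (1 + 2 * ?a)\<^sup>2))"
      using a by (intro mult_left_mono[OF le]) auto
    also have "\<dots> = (2 ^ DIM('a) * 2 powr (- ?n)) * (?a powr (- ?n) * ?a * (4 * (1 / (1 + 2 * ?a)\<^sup>2)))"
      by (simp only: q mult_1)
    also have "\<dots> = 4 * 2 ^ DIM('a) * (?c * ?a)" by (simp add: p)
    finally show ?thesis .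
  qed
  then have "ennreal (decay y) \<le> ennreal (4 * 2 ^ DIM('a) * (?c * ?a))" by (rule ennreal_leI)
  also have "\<dots> = ennreal (4 * 2 ^ DIM('a)) * (ennreal ?c * emeasure lborel {?a..2 * ?a})"
    using a by (simp add: ennreal_mult[symmetric])
  also have "\<dots> = ennreal (4 * 2 ^ DIM('a)) * (\<integral>\<^sup>+r. ennreal ?c * indicator {?a..2 * ?a} r \<partial>lborel)"
    by (subst nn_integral_cmult_indicator) auto
  also have "\<dots> \<le> ennreal (4 * 2 ^ DIM('a)) * (\<integral>\<^sup>+r. ennreal (r powr - ?n / (1 + r)\<^sup>2) * indicator {norm y..} r \<partial>lborel)"
  proof (intro mult_left_mono nn_integral_mono)
    fix r :: real
    show "ennreal ?c * indicator {?a..2 * ?a} r \<le> ennreal (r powr - ?n / (1 + r)\<^sup>2) * indicator {norm y..} r"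
    proof (cases "r \<in> {?a..2 * ?a}")
      case True
      have r: "r > 0" by (rule less_le_trans[OF a]) (use True in simp)
      then have "(2 * ?a) powr (- ?n) \<le> r powr (- ?n)" using True by (intro powr_mono2') auto
      moreover have "(1 + r)\<^sup>2 \<le> (1 + 2 * ?a)\<^sup>2" using True r by (intro power_mono) auto
      ultimately have "?c \<le> r powr - ?n / (1 + r)\<^sup>2" using r by (intro frac_le) auto
      then show ?thesis using True by (simp add: ennreal_leI)
    qed simp
  qed auto
  also have "\<dots> = (\<integral>\<^sup>+r. ennreal (4 * 2 ^ DIM('a)) * (ennreal (r powr - ?n / (1 + r)\<^sup>2) * indicator {norm y..} r) \<partial>lborel)"
    by (subst nn_integral_cmult) auto
  finally show ?thesis .
qed

text \<open>After exchanging the integrals in the layer-cake bound, the volume \<open>O(r^n)\<close> of the ball of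
radius \<open>r\<close> cancels \<open>r^(-n)\<close> and leaves \<open>\<integral> 1 / (1 + r)^2 dr\<close>.\<close>

lemma decay_integrable: "integrable lborel (decay :: 'a::euclidean_space \<Rightarrow> real)"
proof (rule integrableI_bounded)
  let ?n = "real DIM('a)"
  let ?K = "ennreal (4 * 2 ^ DIM('a))"
  let ?g = "\<lambda>r::real. ennreal (r powr - ?n / (1 + r)\<^sup>2)"
  have "(\<integral>\<^sup>+y. ennreal (norm (decay (y::'a))) \<partial>lborel) \<le>
    (\<integral>\<^sup>+(y::'a). \<integral>\<^sup>+r. ?K * (?g r * indicator {norm y..} r) \<partial>lborel \<partial>lborel)"
  proof (rule nn_integral_mono)
    fix y :: 'a
    show "ennreal (norm (decay y)) \<le> (\<integral>\<^sup>+r. ?K * (?g r * indicator {norm y..} r) \<partial>lborel)"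
    proof (cases "y = 0")
      case True
      then show ?thesis by (simp add: decay_def)
    next
      case False
      then show ?thesis using decay_layer[OF False] decay_nonneg[of y] by simp
    qed
  qed
  also have "\<dots> = (\<integral>\<^sup>+(y::'a). \<integral>\<^sup>+r. ?K * (?g r * indicator {(y, r). norm y \<le> r} (y, r)) \<partial>lborel \<partial>lborel)"
    by (intro nn_integral_cong) (simp add: indicator_def)
  also have "\<dots> = (\<integral>\<^sup>+r. \<integral>\<^sup>+(y::'a). ?K * (?g r * indicator {(y, r). norm y \<le> r} (y, r)) \<partial>lborel \<partial>lborel)"
  proof (rule lborel_pair.Fubini'[symmetric])
    have "{(y::'a, r::real). norm y \<le> r} \<in> sets (lborel \<Otimes>\<^sub>M lborel)"
    proof -
      have "closed {p::'a \<times> real. norm (fst p) \<le> snd p}"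
        by (intro closed_Collect_le continuous_intros)
      then have "{p::'a \<times> real. norm (fst p) \<le> snd p} \<in> sets (lborel \<Otimes>\<^sub>M lborel)"
        unfolding lborel_prod by (simp add: borel_closed)
      then show ?thesis by (simp add: case_prod_beta')
    qed
    then show "(\<lambda>(y::'a, r). ?K * (?g r * indicator {(y, r). norm y \<le> r} (y, r))) \<in> borel_measurable (lborel \<Otimes>\<^sub>M lborel)"
      by measurable
  qed
  also have "\<dots> = (\<integral>\<^sup>+r. ?K * (?g r * emeasure lborel (cball (0::'a) r)) \<partial>lborel)"
  proof (rule nn_integral_cong)
    fix r :: real
    have "(\<integral>\<^sup>+(y::'a). ?K * (?g r * indicator {(y, r). norm y \<le> r} (y, r)) \<partial>lborel) =
      (\<integral>\<^sup>+(y::'a). (?K * ?g r) * indicator (cball 0 r) y \<partial>lborel)"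
      by (intro nn_integral_cong) (auto simp: indicator_def)
    also have "\<dots> = ?K * ?g r * emeasure lborel (cball (0::'a) r)"
      by (subst nn_integral_cmult_indicator) auto
    finally show "(\<integral>\<^sup>+(y::'a). ?K * (?g r * indicator {(y, r). norm y \<le> r} (y, r)) \<partial>lborel) = ?K * (?g r * emeasure lborel (cball (0::'a) r))"
      by (simp add: mult.assoc)
  qed
  also have "\<dots> \<le> (\<integral>\<^sup>+r. (?K * ennreal (unit_ball_vol ?n)) * (ennreal (1 / (1 + r)\<^sup>2) * indicator {0..} r) \<partial>lborel)"
  proof (rule nn_integral_mono)
    fix r :: real
    show "?K * (?g r * emeasure lborel (cball (0::'a) r)) \<le> (?K * ennreal (unit_ball_vol ?n)) * (ennreal (1 / (1 + r)\<^sup>2) * indicator {0..} r)"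
    proof (cases "r > 0")
      case True
      have "r powr - ?n / (1 + r)\<^sup>2 * (unit_ball_vol ?n * r ^ DIM('a)) = unit_ball_vol ?n * (1 / (1 + r)\<^sup>2)"
        using True by (simp add: powr_minus powr_realpow field_simps)
      then have "?g r * emeasure lborel (cball (0::'a) r) = ennreal (unit_ball_vol ?n) * ennreal (1 / (1 + r)\<^sup>2)"
        using True by (simp add: emeasure_cball ennreal_mult[symmetric])
      then show ?thesis using True by (simp add: mult.assoc)
    next
      case False
      show ?thesis
      proof (cases "r = 0")
        case False
        then have "cball (0::'a) r = {}" using \<open>\<not> r > 0\<close> by auto
        then show ?thesis by simp
      qed simp
    qed
  qed
  also have "\<dots> = (?K * ennreal (unit_ball_vol ?n)) * (\<integral>\<^sup>+r. ennreal (1 / (1 + r)\<^sup>2) * indicator {0..} r \<partial>lborel)"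
    by (subst nn_integral_cmult) auto
  also have "(\<integral>\<^sup>+r. ennreal (1 / (1 + r)\<^sup>2) * indicator {0::real..} r \<partial>lborel) = ennreal (0 - (- 1 / (1 + 0)))"
  proof (rule nn_integral_FTC_atLeast)
    show "((\<lambda>r::real. - 1 / (1 + r)) has_real_derivative 1 / (1 + x)\<^sup>2) (at x)" if "0 \<le> x" for x
      using that by (auto intro!: derivative_eq_intros simp: power2_eq_square divide_simps)
    show "((\<lambda>r::real. - 1 / (1 + r)) \<longlongrightarrow> 0) at_top" by real_asymp
  qed auto
  also have "?K * ennreal (unit_ball_vol ?n) * ennreal (0 - (- 1 / (1 + 0))) < \<infinity>"
    by (simp add: ennreal_mult_less_top)
  finally show "(\<integral>\<^sup>+y. ennreal (norm (decay (y::'a))) \<partial>lborel) < \<infinity>" .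
qed auto

lemma integrable_decay_bound:
  fixes f :: "'a::euclidean_space \<Rightarrow> real"
  assumes "f \<in> borel_measurable borel" "\<And>y. y \<noteq> 0 \<Longrightarrow> \<bar>f y\<bar> \<le> C * decay y"
  shows "integrable lborel f"
proof (rule Bochner_Integration.integrable_bound)
  show "integrable lborel (\<lambda>y::'a. C * decay y)" by (intro integrable_mult_right decay_integrable)
  have "AE y in lborel. y \<noteq> (0::'a)" using AE_lborel_singleton by blast
  then show "AE y in lborel. norm (f y) \<le> norm (C * decay y)"
    by eventually_elim (use assms(2) in force)
qed (use assms(1) in simp)

text \<open>Difference quotients are dominated by \<open>g\<close> by the mean value theorem.\<close>

lemma deriv_under_integral:
  fixes f f' :: "real \<Rightarrow> 's \<Rightarrow> real"
  assumes der: "\<And>t \<omega>. \<bar>t\<bar> < 1 \<Longrightarrow> \<omega> \<in> space M \<Longrightarrow> ((\<lambda>t. f t \<omega>) has_real_derivative f' t \<omega>) (at t)"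
    and bnd: "\<And>t \<omega>. \<bar>t\<bar> < 1 \<Longrightarrow> \<omega> \<in> space M \<Longrightarrow> \<bar>f' t \<omega>\<bar> \<le> g \<omega>"
    and g: "integrable M g" and f: "\<And>t. \<bar>t\<bar> < 1 \<Longrightarrow> integrable M (f t)"
  shows "integrable M (f' 0)" "((\<lambda>t. \<integral>\<omega>. f t \<omega> \<partial>M) has_real_derivative (\<integral>\<omega>. f' 0 \<omega> \<partial>M)) (at 0)"
proof -
  let ?q = "\<lambda>h \<omega>. (f h \<omega> - f 0 \<omega>) / h"
  have qb: "\<bar>?q h \<omega>\<bar> \<le> g \<omega>" if h: "\<bar>h\<bar> < 1" "h \<noteq> 0" and \<omega>: "\<omega> \<in> space M" for h \<omega>
  proof -
    have "norm (f h \<omega> - f 0 \<omega>) \<le> g \<omega> * norm (h - 0)"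
    proof (rule field_differentiable_bound[of "{-1<..<1}"])
      fix z :: real assume "z \<in> {-1<..<1}"
      then have z: "\<bar>z\<bar> < 1" by auto
      show "((\<lambda>t. f t \<omega>) has_field_derivative f' z \<omega>) (at z within {-1<..<1})"
        using der[OF z \<omega>] by (rule has_field_derivative_at_within)
      show "norm (f' z \<omega>) \<le> g \<omega>" using bnd[OF z \<omega>] by simp
    qed (use h in auto)
    then show ?thesis using h by (simp add: divide_simps abs_mult)
  qed
  have conv: "integrable M (f' 0) \<and> (\<lambda>i. \<integral>\<omega>. ?q (X i) \<omega> \<partial>M) \<longlonglongrightarrow> (\<integral>\<omega>. f' 0 \<omega> \<partial>M)"
    if X: "\<And>i. X i \<noteq> 0" "\<And>i. \<bar>X i\<bar> < 1" "X \<longlonglongrightarrow> 0" for X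
  proof -
    have lim: "(\<lambda>i. ?q (X i) \<omega>) \<longlonglongrightarrow> f' 0 \<omega>" if "\<omega> \<in> space M" for \<omega>
    proof -
      have "((\<lambda>h. ?q h \<omega>) \<longlongrightarrow> f' 0 \<omega>) (at 0)" using der[OF _ that, of 0] by (simp add: DERIV_def)
      then show ?thesis using X by (auto simp: tendsto_at_iff_sequentially comp_def)
    qed
    have qm: "?q (X i) \<in> borel_measurable M" for i
      using f[OF X(2)[of i]] f[of 0] by (auto intro!: borel_measurable_divide borel_measurable_diff)
    have m: "f' 0 \<in> borel_measurable M"
      by (rule borel_measurable_LIMSEQ_real[OF lim qm])
    have bb: "AE \<omega> in M. norm (?q (X i) \<omega>) \<le> g \<omega>" for i using qb X by auto
    have ll: "AE \<omega> in M. (\<lambda>i. ?q (X i) \<omega>) \<longlonglongrightarrow> f' 0 \<omega>" using lim by auto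
    show ?thesis
      using integrable_dominated_convergence[OF m qm g ll bb] integral_dominated_convergence[OF m qm g ll bb] by simp
  qed
  have "(\<lambda>i. inverse (real (Suc (Suc i)))) \<longlonglongrightarrow> 0"
    using LIMSEQ_Suc[OF LIMSEQ_inverse_real_of_nat] by simp
  then show "integrable M (f' 0)" using conv[of "\<lambda>i. inverse (real (Suc (Suc i)))"] by (auto simp: field_simps)
  show "((\<lambda>t. \<integral>\<omega>. f t \<omega> \<partial>M) has_real_derivative (\<integral>\<omega>. f' 0 \<omega> \<partial>M)) (at 0)"
    unfolding DERIV_def tendsto_at_iff_sequentially comp_def
  proof (intro allI impI)
    fix X :: "nat \<Rightarrow> real" assume X: "\<forall>i. X i \<in> UNIV - {0}" "X \<longlonglongrightarrow> 0"
    obtain k where k: "\<And>i. i \<ge> k \<Longrightarrow> \<bar>X i\<bar> < 1"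
      using LIMSEQ_D[OF X(2), of 1] by auto
    have lim: "(\<lambda>i. \<integral>\<omega>. ?q (X (i + k)) \<omega> \<partial>M) \<longlonglongrightarrow> (\<integral>\<omega>. f' 0 \<omega> \<partial>M)"
      using conv[of "\<lambda>i. X (i + k)"] X k LIMSEQ_ignore_initial_segment[OF X(2), of k] by auto
    have eq: "(\<integral>\<omega>. ?q (X (i + k)) \<omega> \<partial>M) =
       ((\<integral>\<omega>. f (0 + X (i + k)) \<omega> \<partial>M) - (\<integral>\<omega>. f 0 \<omega> \<partial>M)) / X (i + k)" for i
      using f[of "X (i + k)"] f[of 0] k[of "i + k"] by simp
    show "(\<lambda>i. ((\<integral>\<omega>. f (0 + X i) \<omega> \<partial>M) - (\<integral>\<omega>. f 0 \<omega> \<partial>M)) / X i) \<longlonglongrightarrow> (\<integral>\<omega>. f' 0 \<omega> \<partial>M)"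
      by (rule LIMSEQ_offset[where k = k]) (rule lim[unfolded eq])
  qed
qed

section \<open>Directional derivatives and Schwartz functions\<close>

lemma has_dir_deriv0:
  assumes "f differentiable (at x)"
  shows "((\<lambda>t. f (x + t *\<^sub>R u)) has_real_derivative dir_deriv u f x) (at 0)"
    and "(f has_derivative (\<lambda>h. dir_deriv h f x)) (at x)"
proof -
  obtain f' where f': "(f has_derivative f') (at x)" using assms by (auto simp: differentiable_def)
  interpret bounded_linear f' by (rule has_derivative_bounded_linear[OF f'])
  have *: "((\<lambda>t. f (x + t *\<^sub>R h)) has_real_derivative f' h) (at 0)" for h
  proof -
    have "((\<lambda>t. f (x + t *\<^sub>R h)) has_derivative (\<lambda>t. f' (t *\<^sub>R h))) (at 0)"
      by (rule has_derivative_compose[of "\<lambda>t. x + t *\<^sub>R h" _ 0 UNIV f f', simplified])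
         (auto intro!: derivative_eq_intros f')
    then show ?thesis by (simp add: has_field_derivative_def scaleR mult.commute[of _ "f' h"])
  qed
  then have "dir_deriv h f x = f' h" for h by (simp add: dir_deriv_def DERIV_imp_deriv)
  then show "((\<lambda>t. f (x + t *\<^sub>R u)) has_real_derivative dir_deriv u f x) (at 0)"
    and "(f has_derivative (\<lambda>h. dir_deriv h f x)) (at x)" using * f' by auto
qed

lemma has_dir_deriv:
  assumes "f differentiable (at (x + t *\<^sub>R u))"
  shows "((\<lambda>t. f (x + t *\<^sub>R u)) has_real_derivative dir_deriv u f (x + t *\<^sub>R u)) (at t)"
proof -
  have "((\<lambda>s. f (x + (s + t) *\<^sub>R u)) has_real_derivative dir_deriv u f (x + t *\<^sub>R u)) (at 0)"
    using has_dir_deriv0(1)[OF assms, of u] by (simp add: algebra_simps)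
  then show ?thesis
    using DERIV_shift[of "\<lambda>s. f (x + s *\<^sub>R u)" "dir_deriv u f (x + t *\<^sub>R u)" 0 t] by simp
qed

lemma dir_derivI: "((\<lambda>t. f (x + t *\<^sub>R u)) has_real_derivative d) (at 0) \<Longrightarrow> dir_deriv u f x = d"
  by (simp add: dir_deriv_def DERIV_imp_deriv)

abbreviation smooth :: "('a::euclidean_space \<Rightarrow> real) \<Rightarrow> bool" where
  "smooth \<equiv> smooth_on_subspace UNIV"

lemma iter_deriv_simps [simp]:
  "iter_deriv [] f = f" "iter_deriv (u # us) f = dir_deriv u (iter_deriv us f)"
  by (simp_all add: iter_deriv_def)

lemma iter_deriv_append: "iter_deriv (us @ vs) f = iter_deriv us (iter_deriv vs f)"
  by (simp add: iter_deriv_def)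

lemma smooth_differentiable: "smooth f \<Longrightarrow> f differentiable (at x)"
  unfolding smooth_on_subspace_def differentiable_on_def by (metis UNIV_I iter_deriv_simps(1) subset_UNIV)

lemma smoothI: "(\<And>us x. iter_deriv us f differentiable (at x)) \<Longrightarrow> smooth f"
  unfolding smooth_on_subspace_def differentiable_on_def by (simp add: differentiable_at_withinI)

lemma smooth_iter: "smooth f \<Longrightarrow> smooth (iter_deriv vs f)"
  unfolding smooth_on_subspace_def by (simp flip: iter_deriv_append)

lemma smooth_dir: "smooth f \<Longrightarrow> smooth (dir_deriv u f)"
  using smooth_iter[of f "[u]"] by simp

lemma smooth_continuous: "smooth f \<Longrightarrow> continuous_on S f"
  by (meson continuous_at_imp_continuous_on differentiable_imp_continuous_within smooth_differentiable)

lemma smooth_measurable: "smooth f \<Longrightarrow> f \<in> borel_measurable borel"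
  by (rule borel_measurable_continuous_onI[OF smooth_continuous])

lemma dir_deriv_lincomb:
  assumes "f differentiable (at x)" "g differentiable (at x)"
  shows "dir_deriv u (\<lambda>x. a * f x + b * g x) x = a * dir_deriv u f x + b * dir_deriv u g x"
  by (rule dir_derivI) (intro DERIV_add DERIV_cmult has_dir_deriv0(1) assms)

lemma iter_deriv_lincomb:
  assumes "smooth f" "smooth g"
  shows "iter_deriv us (\<lambda>x. a * f x + b * g x) = (\<lambda>x. a * iter_deriv us f x + b * iter_deriv us g x)"
proof (induction us)
  case (Cons u us)
  show ?case
    by (simp add: Cons dir_deriv_lincomb smooth_differentiable smooth_iter assms fun_eq_iff)
qed simp

lemma smooth_lincomb:
  assumes "smooth f" "smooth g"
  shows "smooth (\<lambda>x. a * f x + b * g x)"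
proof (rule smoothI)
  fix us x
  have fg: "iter_deriv us f differentiable (at x)" "iter_deriv us g differentiable (at x)"
    by (rule smooth_differentiable[OF smooth_iter[OF assms(1)]], rule smooth_differentiable[OF smooth_iter[OF assms(2)]])
  have "(\<lambda>x. a * iter_deriv us f x + b * iter_deriv us g x) differentiable (at x)"
    by (rule differentiable_add[OF differentiable_mult[OF differentiable_const fg(1)]
          differentiable_mult[OF differentiable_const fg(2)]])
  then show "iter_deriv us (\<lambda>x. a * f x + b * g x) differentiable (at x)"
    by (simp only: iter_deriv_lincomb[OF assms])
qed

lemma dir_deriv_zero: "dir_deriv u (\<lambda>x. 0) = (\<lambda>x. 0)"
  by (auto simp: dir_deriv_def)

lemma iter_deriv_zero: "iter_deriv us (\<lambda>x. 0) = (\<lambda>x. 0)"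
  by (induction us) (auto simp: dir_deriv_zero)

lemma smooth_zero: "smooth (\<lambda>x. 0)"
  unfolding smooth_on_subspace_def iter_deriv_zero by simp

lemma smooth_sum: "(\<And>i. i \<in> I \<Longrightarrow> smooth (f i)) \<Longrightarrow> smooth (\<lambda>x. \<Sum>i\<in>I. a i * f i x)"
proof (induction I rule: infinite_finite_induct)
  case (insert i I)
  then show ?case using smooth_lincomb[of "f i" "\<lambda>x. \<Sum>i\<in>I. a i * f i x" "a i" 1] by simp
qed (auto simp: smooth_zero)

lemma iter_deriv_sum: "(\<And>i. i \<in> I \<Longrightarrow> smooth (f i)) \<Longrightarrow>
   iter_deriv us (\<lambda>x. \<Sum>i\<in>I. a i * f i x) = (\<lambda>x. \<Sum>i\<in>I. a i * iter_deriv us (f i) x)"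
proof (induction I rule: infinite_finite_induct)
  case (insert i I)
  then show ?case
    using iter_deriv_lincomb[of "f i" "\<lambda>x. \<Sum>i\<in>I. a i * f i x" us "a i" 1] by (simp add: smooth_sum)
qed (auto simp: iter_deriv_zero)

lemma dir_deriv_sum_Basis:
  assumes "smooth f"
  shows "dir_deriv u f = (\<lambda>x. \<Sum>b\<in>Basis. (u \<bullet> b) * dir_deriv b f x)"
proof
  fix x
  have "(f has_derivative (\<lambda>h. dir_deriv h f x)) (at x)"
    by (rule has_dir_deriv0(2)[OF smooth_differentiable[OF assms]])
  then interpret bounded_linear "\<lambda>h. dir_deriv h f x" by (rule has_derivative_bounded_linear)
  have "dir_deriv u f x = dir_deriv (\<Sum>b\<in>Basis. (u \<bullet> b) *\<^sub>R b) f x" by (simp add: euclidean_representation)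
  then show "dir_deriv u f x = (\<Sum>b\<in>Basis. (u \<bullet> b) * dir_deriv b f x)"
    by (simp only: sum scaleR real_scaleR_def)
qed

lemma iter_deriv_shift: "iter_deriv us (\<lambda>y. f (x + y)) = (\<lambda>y. iter_deriv us f (x + y))"
  by (induction us) (auto simp: dir_deriv_def add.assoc)

lemma smooth_shift: "smooth f \<Longrightarrow> smooth (\<lambda>y. f (x + y))"
proof (rule smoothI)
  fix us y
  assume "smooth f"
  then have "iter_deriv us f differentiable (at (x + y))" by (intro smooth_differentiable smooth_iter)
  then have "(iter_deriv us f \<circ> (\<lambda>y. x + y)) differentiable (at y)"
    by (intro differentiable_chain_at) auto
  then show "iter_deriv us (\<lambda>y. f (x + y)) differentiable (at y)" by (simp add: comp_def iter_deriv_shift)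
qed

definition rapid :: "('a::euclidean_space \<Rightarrow> real) \<Rightarrow> bool" where
  "rapid f \<longleftrightarrow> (\<forall>N. \<exists>C. \<forall>x. \<bar>f x\<bar> * (1 + norm x) ^ N \<le> C)"

text \<open>Decay is asked of derivatives along all vectors, so that the class is visibly closed under
\<open>dir_deriv\<close>; the coordinate directions suffice, as shown in \<open>schwartzI_Basis\<close>.\<close>

definition schwartz :: "('a::euclidean_space \<Rightarrow> real) \<Rightarrow> bool" where
  "schwartz f \<longleftrightarrow> smooth f \<and> (\<forall>us. rapid (iter_deriv us f))"

lemma rapid_lincomb:
  assumes "rapid f" "rapid g"
  shows "rapid (\<lambda>x. a * f x + b * g x)"
  unfolding rapid_def
proof
  fix N
  obtain C D where C: "\<And>x. \<bar>f x\<bar> * (1 + norm x) ^ N \<le> C" and D: "\<And>x. \<bar>g x\<bar> * (1 + norm x) ^ N \<le> D"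
    using assms unfolding rapid_def by meson
  have "\<bar>a * f x + b * g x\<bar> * (1 + norm x) ^ N \<le> \<bar>a\<bar> * C + \<bar>b\<bar> * D" for x
  proof -
    have "\<bar>a * f x + b * g x\<bar> * (1 + norm x) ^ N \<le> (\<bar>a\<bar> * \<bar>f x\<bar> + \<bar>b\<bar> * \<bar>g x\<bar>) * (1 + norm x) ^ N"
      by (intro mult_right_mono) (auto simp: abs_mult[symmetric] intro!: abs_triangle_ineq)
    also have "\<dots> = \<bar>a\<bar> * (\<bar>f x\<bar> * (1 + norm x) ^ N) + \<bar>b\<bar> * (\<bar>g x\<bar> * (1 + norm x) ^ N)"
      by (simp add: algebra_simps)
    also have "\<dots> \<le> \<bar>a\<bar> * C + \<bar>b\<bar> * D" by (intro add_mono mult_left_mono C D) auto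
    finally show ?thesis .
  qed
  then show "\<exists>C. \<forall>x. \<bar>a * f x + b * g x\<bar> * (1 + norm x) ^ N \<le> C" by blast
qed

lemma rapid_zero: "rapid (\<lambda>x. 0)" by (auto simp: rapid_def)

lemma rapid_sum: "(\<And>i. i \<in> I \<Longrightarrow> rapid (f i)) \<Longrightarrow> rapid (\<lambda>x. \<Sum>i\<in>I. a i * f i x)"
proof (induction I rule: infinite_finite_induct)
  case (insert i I)
  then show ?case using rapid_lincomb[of "f i" "\<lambda>x. \<Sum>i\<in>I. a i * f i x" "a i" 1] by simp
qed (auto simp: rapid_zero)

lemma schwartz_iter: "schwartz f \<Longrightarrow> schwartz (iter_deriv vs f)"
  by (auto simp: schwartz_def smooth_iter simp flip: iter_deriv_append)

lemma schwartz_dir: "schwartz f \<Longrightarrow> schwartz (dir_deriv u f)"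
  using schwartz_iter[of f "[u]"] by simp

lemma schwartz_smooth: "schwartz f \<Longrightarrow> smooth f" by (simp add: schwartz_def)

lemma schwartz_rapid: "schwartz f \<Longrightarrow> rapid f" unfolding schwartz_def by (metis iter_deriv_simps(1))

lemma schwartz_lincomb: "schwartz f \<Longrightarrow> schwartz g \<Longrightarrow> schwartz (\<lambda>x. a * f x + b * g x)"
  by (simp add: schwartz_def smooth_lincomb iter_deriv_lincomb rapid_lincomb)

lemma schwartz_sum: "(\<And>i. i \<in> I \<Longrightarrow> schwartz (f i)) \<Longrightarrow> schwartz (\<lambda>x. \<Sum>i\<in>I. a i * f i x)"
  by (simp add: schwartz_def smooth_sum iter_deriv_sum rapid_sum)

lemma schwartz_zero: "schwartz (\<lambda>x. 0)"
  by (simp add: schwartz_def smooth_zero iter_deriv_zero rapid_zero)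

lemma schwartz_shift:
  assumes "schwartz f"
  shows "schwartz (\<lambda>y. f (x + y))"
  unfolding schwartz_def iter_deriv_shift
proof (intro conjI allI)
  show "smooth (\<lambda>y. f (x + y))" using assms by (simp add: schwartz_def smooth_shift)
  fix us
  show "rapid (\<lambda>y. iter_deriv us f (x + y))"
    unfolding rapid_def
  proof
    fix N
    obtain C where C: "\<And>y. \<bar>iter_deriv us f y\<bar> * (1 + norm y) ^ N \<le> C"
      using assms unfolding schwartz_def rapid_def by meson
    have "\<bar>iter_deriv us f (x + y)\<bar> * (1 + norm y) ^ N \<le> (1 + norm x) ^ N * C" for y
    proof -
      have "norm y \<le> norm (x + y) + norm x" using norm_triangle_ineq4[of "x + y" x] by simp
      also have "1 + (norm (x + y) + norm x) \<le> (1 + norm x) * (1 + norm (x + y))"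
        by (simp add: algebra_simps)
      finally have "(1 + norm y) ^ N \<le> ((1 + norm x) * (1 + norm (x + y))) ^ N"
        by (intro power_mono) auto
      then have "\<bar>iter_deriv us f (x + y)\<bar> * (1 + norm y) ^ N \<le>
        \<bar>iter_deriv us f (x + y)\<bar> * ((1 + norm x) * (1 + norm (x + y))) ^ N"
        by (intro mult_left_mono) auto
      also have "\<dots> = (1 + norm x) ^ N * (\<bar>iter_deriv us f (x + y)\<bar> * (1 + norm (x + y)) ^ N)"
        by (simp add: power_mult_distrib)
      also have "\<dots> \<le> (1 + norm x) ^ N * C" by (intro mult_left_mono C) auto
      finally show ?thesis .
    qed
    then show "\<exists>C. \<forall>y. \<bar>iter_deriv us f (x + y)\<bar> * (1 + norm y) ^ N \<le> C" by blast
  qed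
qed

text \<open>A directional derivative is a linear combination of coordinate derivatives; expand one
direction at a time.\<close>

lemma schwartzI_Basis:
  assumes "smooth f" "\<And>us. set us \<subseteq> Basis \<Longrightarrow> rapid (iter_deriv us f)"
  shows "schwartz f"
proof -
  define good where "good f \<longleftrightarrow> smooth f \<and> (\<forall>us. set us \<subseteq> Basis \<longrightarrow> rapid (iter_deriv us f))" for f :: "'a \<Rightarrow> real"
  have sum: "good (\<lambda>x. \<Sum>b\<in>Basis. a b * g b x)" if "\<And>b. b \<in> Basis \<Longrightarrow> good (g b)" for a and g :: "'a \<Rightarrow> 'a \<Rightarrow> real"
    using that by (simp add: good_def smooth_sum iter_deriv_sum rapid_sum)
  have dirB: "good (dir_deriv b g)" if "good g" "b \<in> Basis" for g and b :: 'a
    unfolding good_def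
  proof (intro conjI allI impI)
    show "smooth (dir_deriv b g)" using that by (simp add: good_def smooth_dir)
    fix us :: "'a list" assume "set us \<subseteq> Basis"
    then have "rapid (iter_deriv (us @ [b]) g)" using that by (simp add: good_def)
    then show "rapid (iter_deriv us (dir_deriv b g))" by (simp add: iter_deriv_append)
  qed
  have dir: "good (dir_deriv u g)" if "good g" for g u
    unfolding dir_deriv_sum_Basis[OF that[unfolded good_def, THEN conjunct1], of u]
    by (rule sum) (rule dirB[OF that])
  have "good (iter_deriv us f)" for us
  proof (induction us)
    case Nil
    show ?case using assms by (simp add: good_def)
  qed (simp add: dir)
  then have "rapid (iter_deriv us f)" for us
    unfolding good_def by (metis empty_subsetI iter_deriv_simps(1) list.set(1))
  then show ?thesis using assms by (simp add: schwartz_def)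
qed

definition lap :: "('a::euclidean_space \<Rightarrow> real) \<Rightarrow> 'a \<Rightarrow> real" where
  "lap f = (\<lambda>x. \<Sum>b\<in>Basis. dir_deriv b (dir_deriv b f) x)"

lemma schwartz_lap: "schwartz f \<Longrightarrow> schwartz (lap f)"
  using schwartz_sum[of Basis "\<lambda>b. dir_deriv b (dir_deriv b f)" "\<lambda>_. 1"]
  by (simp add: lap_def schwartz_dir)

lemma schwartz_lapN: "schwartz f \<Longrightarrow> schwartz ((lap ^^ N) f)"
  by (induction N) (auto simp: schwartz_lap)

lemma lapN_shift: "(lap ^^ N) (\<lambda>y. f (x + y)) = (\<lambda>y. (lap ^^ N) f (x + y))"
proof (induction N)
  case (Suc N)
  have "dir_deriv b (\<lambda>y. g (x + y)) = (\<lambda>y. dir_deriv b g (x + y))" for b and g :: "'a \<Rightarrow> real"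
    using iter_deriv_shift[of "[b]" g x] by simp
  then show ?case using Suc by (simp add: lap_def)
qed simp

lemma schwartz_bound:
  assumes "schwartz f"
  shows "\<exists>C\<ge>0. \<forall>x. \<bar>f x\<bar> \<le> C / (1 + norm x) ^ N"
proof -
  obtain C where C: "\<And>x. \<bar>f x\<bar> * (1 + norm x) ^ N \<le> C"
    using schwartz_rapid[OF assms] unfolding rapid_def by meson
  have "1 + norm x > 0" for x :: 'a by (metis add_pos_nonneg norm_ge_zero zero_less_one)
  then have "\<bar>f x\<bar> \<le> C / (1 + norm x) ^ N" for x using C[of x] by (simp add: field_simps)
  moreover have "0 \<le> C" using C[of 0] by (meson abs_ge_zero mult_nonneg_nonneg norm_ge_zero order_trans zero_le_power add_nonneg_nonneg zero_le_one)
  ultimately show ?thesis by blast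
qed

section \<open>Singular kernels and integration by parts\<close>

definition kernel_bd :: "real \<Rightarrow> nat \<Rightarrow> 'a::euclidean_space \<Rightarrow> real" where
  "kernel_bd A b y = A * (norm y powr (1 - real DIM('a)) * (1 + norm y) ^ b)"

text \<open>The singularity of \<open>y / |y|^n\<close> is the strongest one that occurs.\<close>

definition kernel :: "('a::euclidean_space \<Rightarrow> real) \<Rightarrow> bool" where
  "kernel g \<longleftrightarrow> g \<in> borel_measurable borel \<and> (\<exists>A b. \<forall>y. y \<noteq> 0 \<longrightarrow> \<bar>g y\<bar> \<le> kernel_bd A b y)"

definition poly_growth :: "('a::euclidean_space \<Rightarrow> real) \<Rightarrow> bool" where
  "poly_growth g \<longleftrightarrow> g \<in> borel_measurable borel \<and> (\<exists>A b. \<forall>y. \<bar>g y\<bar> \<le> A * (1 + norm y) ^ b)"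

lemma kernel_bd_schwartz:
  assumes "schwartz \<phi>"
  shows "\<exists>C. \<forall>g. \<forall>y. \<bar>g y\<bar> \<le> kernel_bd A b y \<longrightarrow> \<bar>g y * \<phi> y\<bar> \<le> C * decay y"
proof -
  obtain C where C: "C \<ge> 0" "\<And>x. \<bar>\<phi> x\<bar> \<le> C / (1 + norm x) ^ (b + 2)" using schwartz_bound[OF assms] by blast
  have "\<bar>g y * \<phi> y\<bar> \<le> (A * C) * decay y" if "\<bar>g y\<bar> \<le> kernel_bd A b y" for g :: "'a \<Rightarrow> real" and y
  proof -
    have p: "1 + norm y > 0" by (metis add_pos_nonneg norm_ge_zero zero_less_one)
    have "\<bar>g y * \<phi> y\<bar> \<le> kernel_bd A b y * (C / (1 + norm y) ^ (b + 2))"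
      unfolding abs_mult using that by (intro mult_mono C) auto
    also have "\<dots> = (A * C) * decay y"
    proof -
      have "A * (w * P ^ b) * (C / P ^ (b + 2)) = (A * C) * (w / P\<^sup>2)" if "P > 0" for P w :: real
        using that by (simp add: power_add power2_eq_square field_simps)
      from this[OF p] show ?thesis by (simp only: kernel_bd_def decay_def)
    qed
    finally show ?thesis .
  qed
  then show ?thesis by blast
qed

lemma kernel_integrable:
  assumes "kernel g" "schwartz \<phi>"
  shows "integrable lborel (\<lambda>y. g y * \<phi> y)"
proof -
  obtain A b where g: "g \<in> borel_measurable borel" "\<And>y. y \<noteq> 0 \<Longrightarrow> \<bar>g y\<bar> \<le> kernel_bd A b y"
    using assms(1) unfolding kernel_def by blast
  obtain C where "\<And>g y. \<bar>g y\<bar> \<le> kernel_bd A b y \<Longrightarrow> \<bar>g y * \<phi> y\<bar> \<le> C * decay y"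
    using kernel_bd_schwartz[OF assms(2), of A b] by blast
  then show ?thesis
    using g smooth_measurable[OF schwartz_smooth[OF assms(2)]]
    by (intro integrable_decay_bound[where C = C]) auto
qed

text \<open>A bound uniform in \<open>k\<close> makes \<open>decay\<close> a common majorant.\<close>

lemma kernel_limit:
  assumes \<phi>: "schwartz \<phi>" and gm: "\<And>k. g k \<in> borel_measurable borel"
    and gb: "\<And>k y. y \<noteq> 0 \<Longrightarrow> \<bar>g k y\<bar> \<le> kernel_bd A b y"
    and hm: "h \<in> borel_measurable borel"
    and lim: "\<And>y. y \<noteq> 0 \<Longrightarrow> (\<lambda>k. g k y) \<longlonglongrightarrow> h y"
  shows "(\<lambda>k. \<integral>y. g k y * \<phi> y \<partial>lborel) \<longlonglongrightarrow> (\<integral>y. h y * \<phi> y \<partial>lborel)"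
proof -
  obtain C where C: "\<And>g y. \<bar>g y\<bar> \<le> kernel_bd A b y \<Longrightarrow> \<bar>g y * \<phi> y\<bar> \<le> C * decay y"
    using kernel_bd_schwartz[OF \<phi>, of A b] by blast
  have \<phi>m [measurable]: "\<phi> \<in> borel_measurable borel" using smooth_measurable[OF schwartz_smooth[OF \<phi>]] .
  have ne: "AE y in lborel. y \<noteq> (0::'a)" using AE_lborel_singleton by blast
  show ?thesis
  proof (rule integral_dominated_convergence)
    show "integrable lborel (\<lambda>y::'a. C * decay y)" by (intro integrable_mult_right decay_integrable)
    show "AE y in lborel. (\<lambda>k. g k y * \<phi> y) \<longlonglongrightarrow> h y * \<phi> y"
      using ne by eventually_elim (intro tendsto_intros lim)
    show "AE y in lborel. norm (g k y * \<phi> y) \<le> C * decay y" for k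
      using ne by eventually_elim (use C gb in auto)
  qed (use gm hm in auto)
qed

lemma one_plus_norm_pos: "0 < 1 + norm y"
  by (simp add: add_pos_nonneg)

lemma norm_powr_dim:
  fixes y :: "'a::euclidean_space"
  assumes "y \<noteq> 0"
  shows "norm y powr (1 - real DIM('a)) = 1 / norm y ^ (DIM('a) - 1)"
proof -
  have "1 - real DIM('a) = - real (DIM('a) - 1)" by (simp add: of_nat_diff Suc_leI)
  then have "norm y powr (1 - real DIM('a)) = norm y powr (- real (DIM('a) - 1))" by (simp only:)
  also have "\<dots> = inverse (norm y powr real (DIM('a) - 1))" by (rule powr_minus)
  also have "norm y powr real (DIM('a) - 1) = norm y ^ (DIM('a) - 1)"
    by (rule powr_realpow) (use assms in simp)
  also have "inverse (norm y ^ (DIM('a) - 1)) = 1 / norm y ^ (DIM('a) - 1)" by (rule inverse_eq_divide)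
  finally show ?thesis .
qed

text \<open>Near the origin \<open>|y|^(1 - n)\<close> is bounded below, and far away its smallness is
compensated by a higher power of \<open>1 + |y|\<close>.\<close>

lemma poly_growth_kernel: 
  assumes "poly_growth g" shows "kernel g"
proof -
  obtain A b where g: "g \<in> borel_measurable borel" "\<And>y. \<bar>g y\<bar> \<le> A * (1 + norm y) ^ b"
    using assms unfolding poly_growth_def by blast
  have "\<bar>g y\<bar> \<le> kernel_bd A (b + (DIM('a) - 1)) y" if "y \<noteq> 0" for y
  proof -
    have A: "A \<ge> 0" using order_trans[OF abs_ge_zero g(2)[of 0]] by simp
    have y: "norm y > 0" using that by simp
    have "norm y powr (1 - real DIM('a)) = 1 / norm y ^ (DIM('a) - 1)"
      by (rule norm_powr_dim[OF that])
    moreover have "norm y ^ (DIM('a) - 1) \<le> (1 + norm y) ^ (DIM('a) - 1)" by (intro power_mono) auto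
    moreover have "1 \<le> 1 / X * Y" if "X > 0" "X \<le> Y" for X Y :: real using that by (simp add: field_simps)
    ultimately have "1 \<le> norm y powr (1 - real DIM('a)) * (1 + norm y) ^ (DIM('a) - 1)"
      using zero_less_power[OF y] by metis
    then have "A * (1 + norm y) ^ b * 1 \<le> A * (1 + norm y) ^ b * (norm y powr (1 - real DIM('a)) * (1 + norm y) ^ (DIM('a) - 1))"
      using A by (intro mult_left_mono) auto
    also have "\<dots> = kernel_bd A (b + (DIM('a) - 1)) y"
      unfolding kernel_bd_def power_add by (simp only: mult_ac)
    finally show ?thesis using g(2)[of y] by simp
  qed
  then show ?thesis using g(1) unfolding kernel_def by blast
qed

lemma poly_growth_schwartz_bound:
  assumes "poly_growth g" "schwartz \<phi>"
  shows "\<exists>K\<ge>0. \<forall>y. \<bar>g y * \<phi> y\<bar> \<le> K / (1 + norm y) ^ N"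
proof -
  obtain A b where g: "\<And>y. \<bar>g y\<bar> \<le> A * (1 + norm y) ^ b"
    using assms unfolding poly_growth_def by blast
  obtain C where C: "C \<ge> 0" "\<And>x. \<bar>\<phi> x\<bar> \<le> C / (1 + norm x) ^ (b + N)" using schwartz_bound[OF assms(2)] by blast
  have A: "A \<ge> 0" using order_trans[OF abs_ge_zero g[of 0]] by simp
  have "\<bar>g y * \<phi> y\<bar> \<le> (A * C) / (1 + norm y) ^ N" for y
  proof -
    have p: "1 + norm y > 0" by (metis add_pos_nonneg norm_ge_zero zero_less_one)
    have "\<bar>g y * \<phi> y\<bar> \<le> (A * (1 + norm y) ^ b) * (C / (1 + norm y) ^ (b + N))"
      unfolding abs_mult using g A by (intro mult_mono C) auto
    also have "\<dots> = (A * C) / (1 + norm y) ^ N"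
    proof -
      have "(A * P ^ b) * (C / P ^ (b + N)) = (A * C) / P ^ N" if "P > 0" for P :: real
        using that by (simp add: power_add field_simps)
      from this[OF p] show ?thesis .
    qed
    finally show ?thesis .
  qed
  then show ?thesis using A C by (intro exI[of _ "A * C"]) auto
qed

lemma lborel_translate:
  fixes f :: "'a::euclidean_space \<Rightarrow> real"
  assumes "f \<in> borel_measurable borel"
  shows "(\<integral>y. f (c + y) \<partial>lborel) = (\<integral>y. f y \<partial>lborel)"
  using integral_distr[of "(+) c" lborel borel f] assms by (simp add: lborel_distr_plus)

lemma integrable_inverse_power: "integrable lborel (\<lambda>y::'a::euclidean_space. K / (1 + norm y) ^ (DIM('a) + 1))"
proof (rule integrable_decay_bound)
  fix y :: 'a assume "y \<noteq> 0"
  then have y: "norm y > 0" by simp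
  have eq: "norm y powr (1 - real DIM('a)) = 1 / norm y ^ (DIM('a) - 1)"
    by (rule norm_powr_dim) (use y in simp)
  have "norm y ^ (DIM('a) - 1) * (1 + norm y)\<^sup>2 \<le> (1 + norm y) ^ (DIM('a) - 1) * (1 + norm y)\<^sup>2"
    by (intro mult_right_mono power_mono) auto
  also have "\<dots> = (1 + norm y) ^ (DIM('a) + 1)"
    unfolding power_add[symmetric] by (simp add: Suc_leI numeral_2_eq_2)
  finally have "1 / (1 + norm y) ^ (DIM('a) + 1) \<le> 1 / (norm y ^ (DIM('a) - 1) * (1 + norm y)\<^sup>2)"
    using y one_plus_norm_pos[of y] by (intro divide_left_mono mult_pos_pos zero_less_power) auto
  also have "\<dots> = decay y" by (simp add: decay_def eq)
  finally have "\<bar>K\<bar> * (1 / (1 + norm y) ^ (DIM('a) + 1)) \<le> \<bar>K\<bar> * decay y" by (intro mult_left_mono) auto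
  then show "\<bar>K / (1 + norm y) ^ (DIM('a) + 1)\<bar> \<le> \<bar>K\<bar> * decay y" by simp
qed auto

text \<open>No boundary is needed on the whole space: the integral of \<open>a \<phi>\<close> over the translates by
\<open>t u\<close> is constant in \<open>t\<close>, and its derivative at 0 is the integral of the derivative of \<open>a \<phi>\<close>.\<close>

lemma integration_by_parts:
  fixes a :: "'a::euclidean_space \<Rightarrow> real"
  assumes a: "poly_growth a" and a': "poly_growth a'"
    and der: "\<And>y. ((\<lambda>t. a (y + t *\<^sub>R u)) has_real_derivative a' y) (at 0)"
    and \<phi>: "schwartz \<phi>"
  shows "(\<integral>y. a y * dir_deriv u \<phi> y \<partial>lborel) = - (\<integral>y. a' y * \<phi> y \<partial>lborel)"
proof -
  let ?N = "DIM('a) + 1"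
  define F where "F y = a y * \<phi> y" for y
  define F' where "F' y = a' y * \<phi> y + a y * dir_deriv u \<phi> y" for y
  have du: "schwartz (dir_deriv u \<phi>)" by (rule schwartz_dir[OF \<phi>])
  have ia: "integrable lborel (\<lambda>y. a y * dir_deriv u \<phi> y)" "integrable lborel (\<lambda>y. a' y * \<phi> y)"
      "integrable lborel F"
    unfolding F_def by (intro kernel_integrable poly_growth_kernel a a' du \<phi>)+
  obtain K1 K2 where K: "\<And>y. \<bar>a' y * \<phi> y\<bar> \<le> K1 / (1 + norm y) ^ ?N" "\<And>y. \<bar>a y * dir_deriv u \<phi> y\<bar> \<le> K2 / (1 + norm y) ^ ?N"
    "K1 \<ge> 0" "K2 \<ge> 0"
    using poly_growth_schwartz_bound[OF a' \<phi>, of ?N] poly_growth_schwartz_bound[OF a du, of ?N] by blast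
  define K where "K = (K1 + K2) * (1 + norm u) ^ ?N"
  have bnd: "\<bar>F' (y + t *\<^sub>R u)\<bar> \<le> K / (1 + norm y) ^ ?N" if t: "\<bar>t\<bar> < 1" for y t
  proof -
    let ?z = "y + t *\<^sub>R u"
    have "norm y \<le> norm ?z + norm (t *\<^sub>R u)" using norm_triangle_ineq4[of ?z "t *\<^sub>R u"] by simp
    also have "norm (t *\<^sub>R u) \<le> norm u" using t by (simp add: mult_left_le_one_le)
    finally have "1 + norm y \<le> (1 + norm u) * (1 + norm ?z)"
      by (simp add: algebra_simps) (smt (verit) mult_nonneg_nonneg norm_ge_zero)
    then have pw: "(1 + norm y) ^ ?N \<le> (1 + norm u) ^ ?N * (1 + norm ?z) ^ ?N"
      unfolding power_mult_distrib[symmetric] by (intro power_mono) auto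
    have pos: "(1 + norm y) ^ ?N > 0" "(1 + norm ?z) ^ ?N > 0" by (intro zero_less_power; smt (verit) norm_ge_zero)+
    have "\<bar>F' ?z\<bar> \<le> K1 / (1 + norm ?z) ^ ?N + K2 / (1 + norm ?z) ^ ?N"
      unfolding F'_def by (intro order_trans[OF abs_triangle_ineq] add_mono K)
    also have "\<dots> = (K1 + K2) * (1 / (1 + norm ?z) ^ ?N)" by (simp add: add_divide_distrib)
    also have "\<dots> \<le> (K1 + K2) * ((1 + norm u) ^ ?N / (1 + norm y) ^ ?N)"
    proof (intro mult_left_mono)
      have "1 / B \<le> C / A" if "A > 0" "B > 0" "A \<le> C * B" for A B C :: real
        using that by (simp add: field_simps)
      from this[OF pos pw] show "1 / (1 + norm ?z) ^ ?N \<le> (1 + norm u) ^ ?N / (1 + norm y) ^ ?N" .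
    qed (use K in simp)
    finally show ?thesis by (simp add: K_def)
  qed
  have dF: "((\<lambda>t. F (y + t *\<^sub>R u)) has_real_derivative F' y) (at 0)" for y
    unfolding F_def F'_def
    by (rule DERIV_cong[OF DERIV_mult[OF der[of y] has_dir_deriv0(1)[OF smooth_differentiable[OF schwartz_smooth[OF \<phi>]], of y u]]])
       simp
  have dFt: "((\<lambda>t. F (y + t *\<^sub>R u)) has_real_derivative F' (y + t *\<^sub>R u)) (at t)" for y t
  proof -
    have "((\<lambda>s. F (y + (s + t) *\<^sub>R u)) has_real_derivative F' (y + t *\<^sub>R u)) (at 0)"
      using dF[of "y + t *\<^sub>R u"] by (simp add: algebra_simps)
    then show ?thesis using DERIV_shift[of "\<lambda>s. F (y + s *\<^sub>R u)" "F' (y + t *\<^sub>R u)" 0 t] by simp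
  qed
  have Fm: "F \<in> borel_measurable borel" using ia(3) by (simp add: borel_measurable_integrable)
  have tr: "(\<integral>y. F (y + t *\<^sub>R u) \<partial>lborel) = (\<integral>y. F y \<partial>lborel)" for t
    using lborel_translate[OF Fm, of "t *\<^sub>R u"] by (simp add: add.commute)
  have Fi: "integrable lborel (\<lambda>y. F (y + t *\<^sub>R u))" for t
  proof -
    have "integrable (distr lborel borel ((+) (t *\<^sub>R u))) F" using ia(3) by (simp add: lborel_distr_plus)
    then show ?thesis by (subst (asm) integrable_distr_eq) (use Fm in \<open>auto simp: add.commute\<close>)
  qed
  have "((\<lambda>t. \<integral>y. F (y + t *\<^sub>R u) \<partial>lborel) has_real_derivative (\<integral>y. F' (y + 0 *\<^sub>R u) \<partial>lborel)) (at 0)"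
    by (rule deriv_under_integral(2)[where g = "\<lambda>y. K / (1 + norm y) ^ ?N"])
       (use dFt bnd Fi integrable_inverse_power[of K] in auto)
  then have "((\<lambda>t. \<integral>y. F y \<partial>lborel) has_real_derivative (\<integral>y. F' y \<partial>lborel)) (at (0::real))"
    by (simp add: tr)
  then have "(\<integral>y. F' y \<partial>lborel) = 0" using DERIV_unique DERIV_const by blast
  then show ?thesis unfolding F'_def using ia by simp
qed

lemma poly_growthI: "g \<in> borel_measurable borel \<Longrightarrow> (\<And>y. \<bar>g y\<bar> \<le> A * (1 + norm y) ^ b) \<Longrightarrow> poly_growth g"
  unfolding poly_growth_def by blast

lemma poly_growth_mult:
  assumes "poly_growth f" "poly_growth g"
  shows "poly_growth (\<lambda>y. f y * g y)"
proof -
  obtain A b where f: "f \<in> borel_measurable borel" "\<And>y. \<bar>f y\<bar> \<le> A * (1 + norm y) ^ b" using assms(1) unfolding poly_growth_def by blast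
  obtain A' b' where g: "g \<in> borel_measurable borel" "\<And>y. \<bar>g y\<bar> \<le> A' * (1 + norm y) ^ b'" using assms(2) unfolding poly_growth_def by blast
  show ?thesis
  proof (rule poly_growthI)
    show "(\<lambda>y. f y * g y) \<in> borel_measurable borel" using f g by simp
    fix y
    have "\<bar>f y * g y\<bar> \<le> (A * (1 + norm y) ^ b) * (A' * (1 + norm y) ^ b')"
      unfolding abs_mult by (intro mult_mono f g order_trans[OF abs_ge_zero f(2)]) auto
    then show "\<bar>f y * g y\<bar> \<le> (A * A') * (1 + norm y) ^ (b + b')" by (simp add: power_add mult_ac)
  qed
qed

lemma poly_growth_add:
  assumes "poly_growth f" "poly_growth g"
  shows "poly_growth (\<lambda>y. f y + g y)"
proof -
  obtain A b where f: "f \<in> borel_measurable borel" "\<And>y. \<bar>f y\<bar> \<le> A * (1 + norm y) ^ b" using assms(1) unfolding poly_growth_def by blast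
  obtain A' b' where g: "g \<in> borel_measurable borel" "\<And>y. \<bar>g y\<bar> \<le> A' * (1 + norm y) ^ b'" using assms(2) unfolding poly_growth_def by blast
  have A: "A \<ge> 0" "A' \<ge> 0" using order_trans[OF abs_ge_zero f(2)[of 0]] order_trans[OF abs_ge_zero g(2)[of 0]] by auto
  show ?thesis
  proof (rule poly_growthI)
    show "(\<lambda>y. f y + g y) \<in> borel_measurable borel" using f g by simp
    fix y :: 'a
    have m: "(1 + norm y) ^ b \<le> (1 + norm y) ^ (b + b')" "(1 + norm y) ^ b' \<le> (1 + norm y) ^ (b + b')"
      by (intro power_increasing; simp)+
    have "\<bar>f y + g y\<bar> \<le> A * (1 + norm y) ^ b + A' * (1 + norm y) ^ b'"
      by (rule order_trans[OF abs_triangle_ineq add_mono[OF f(2) g(2)]])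
    also have "\<dots> \<le> A * (1 + norm y) ^ (b + b') + A' * (1 + norm y) ^ (b + b')"
      by (intro add_mono mult_left_mono m A)
    finally show "\<bar>f y + g y\<bar> \<le> (A + A') * (1 + norm y) ^ (b + b')" by (simp add: algebra_simps)
  qed
qed

lemma poly_growth_const: "poly_growth (\<lambda>y. c)"
  by (rule poly_growthI[where A = "\<bar>c\<bar>" and b = 0]) auto

lemma poly_growth_inner: "poly_growth (\<lambda>y. y \<bullet> u)"
proof (rule poly_growthI[where A = "norm u" and b = 1])
  fix y :: 'a
  have "\<bar>y \<bullet> u\<bar> \<le> norm y * norm u" by (rule Cauchy_Schwarz_ineq2)
  also have "\<dots> \<le> norm u * (1 + norm y) ^ 1" by (simp add: algebra_simps)
  finally show "\<bar>y \<bullet> u\<bar> \<le> norm u * (1 + norm y) ^ 1" .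
qed auto

section \<open>Green's formula for radial kernels\<close>

text \<open>With \<open>t = |y|^2\<close> this is \<open>|y|^(-n) + |y|^(2 b)\<close>, one power of \<open>|y|\<close> more singular than
\<open>kernel_bd\<close>; the missing power comes from the factor \<open>y \<bullet> u\<close>.\<close>

definition tame_bound :: "nat \<Rightarrow> nat \<Rightarrow> real \<Rightarrow> real" where
  "tame_bound n b t = t powr (- (real n / 2)) + t ^ b"

text \<open>Radial profiles \<open>Q\<close>, as functions of \<open>|y|^2\<close>, with their first two derivatives.  The bound
on \<open>Q2\<close> carries a factor \<open>t\<close> because in the Laplacian the second derivative comes with \<open>|y|^2\<close>.\<close>

definition tame :: "nat \<Rightarrow> (real \<Rightarrow> real) \<Rightarrow> (real \<Rightarrow> real) \<Rightarrow> (real \<Rightarrow> real) \<Rightarrow> bool" where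
  "tame n Q Q1 Q2 \<longleftrightarrow>
     Q \<in> borel_measurable borel \<and> Q1 \<in> borel_measurable borel \<and> Q2 \<in> borel_measurable borel \<and>
     continuous_on {0<..} Q2 \<and>
     (\<forall>t>0. (Q has_real_derivative Q1 t) (at t) \<and> (Q1 has_real_derivative Q2 t) (at t)) \<and>
     (\<exists>A b. \<forall>t>0. \<bar>Q t\<bar> \<le> A * tame_bound n b t \<and> \<bar>Q1 t\<bar> \<le> A * tame_bound n b t \<and> t * \<bar>Q2 t\<bar> \<le> A * tame_bound n b t)"

lemma radial_deriv:
  fixes y :: "'a::real_inner"
  assumes "(Q has_real_derivative Q') (at (e + (norm y)\<^sup>2))"
  shows "((\<lambda>s. Q (e + (norm (y + s *\<^sub>R u))\<^sup>2)) has_real_derivative 2 * (y \<bullet> u) * Q') (at 0)"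
proof -
  have "((\<lambda>s. e + (norm (y + s *\<^sub>R u))\<^sup>2) has_real_derivative 2 * (y \<bullet> u)) (at 0)"
    unfolding power2_norm_eq_inner
    by (auto intro!: derivative_eq_intros simp: inner_add_left inner_add_right inner_commute algebra_simps
        power2_eq_square)
  moreover have "(Q has_real_derivative Q') (at (e + (norm (y + 0 *\<^sub>R u))\<^sup>2))" using assms by simp
  ultimately have "((\<lambda>s. Q (e + (norm (y + s *\<^sub>R u))\<^sup>2)) has_real_derivative Q' * (2 * (y \<bullet> u))) (at 0)"
    by (rule DERIV_chain2[rotated])
  then show ?thesis by (simp only: mult.commute)
qed

lemma norm2_le: "0 \<le> e \<Longrightarrow> e \<le> 1 \<Longrightarrow> e + (norm y)\<^sup>2 \<le> (1 + norm y)\<^sup>2"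
  using norm_ge_zero[of y] by (simp add: power2_sum del: norm_ge_zero)

lemma tame_bound_poly_growth:
  fixes g :: "real \<Rightarrow> real"
  assumes e: "0 < e" "e \<le> 1" and g: "g \<in> borel_measurable borel" and b: "\<And>t. t > 0 \<Longrightarrow> \<bar>g t\<bar> \<le> A * tame_bound n b t"
  shows "poly_growth (\<lambda>y::'a::euclidean_space. g (e + (norm y)\<^sup>2))"
proof (rule poly_growthI)
  show "(\<lambda>y::'a. g (e + (norm y)\<^sup>2)) \<in> borel_measurable borel"
    by (rule measurable_compose[OF _ g]) simp
  fix y :: 'a
  let ?t = "e + (norm y)\<^sup>2"
  have t: "?t > 0" "?t \<ge> e" using e by (auto intro: add_pos_nonneg)
  have A: "A \<ge> 0"
  proof -
    have "0 \<le> A * tame_bound n b 1" using order_trans[OF abs_ge_zero b[of 1]] by simp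
    then show ?thesis by (simp add: tame_bound_def)
  qed
  have "?t powr (- (real n / 2)) \<le> e powr (- (real n / 2))" using t e by (intro powr_mono2') auto
  moreover have "?t ^ b \<le> ((1 + norm y)\<^sup>2) ^ b" using t norm2_le[of e y] e by (intro power_mono) auto
  then have "?t ^ b \<le> (1 + norm y) ^ (2 * b)" by (simp only: power_mult)
  moreover have "1 \<le> (1 + norm y) ^ (2 * b)" by (rule one_le_power) simp
  then have "e powr (- (real n / 2)) * 1 \<le> e powr (- (real n / 2)) * (1 + norm y) ^ (2 * b)" by (intro mult_left_mono) auto
  ultimately have "tame_bound n b ?t \<le> (e powr (- (real n / 2)) + 1) * (1 + norm y) ^ (2 * b)"
    by (simp add: tame_bound_def distrib_right)
  then have "A * tame_bound n b ?t \<le> A * ((e powr (- (real n / 2)) + 1) * (1 + norm y) ^ (2 * b))" using A by (intro mult_left_mono)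
  then show "\<bar>g ?t\<bar> \<le> (A * (e powr (- (real n / 2)) + 1)) * (1 + norm y) ^ (2 * b)"
    using b[OF t(1)] by (simp add: mult.assoc)
qed

lemma tame_bound_kernel_bd:
  fixes y :: "'a::euclidean_space"
  assumes y: "y \<noteq> 0" and e: "0 \<le> e" "e \<le> 1" and x: "\<bar>x\<bar> \<le> A * tame_bound DIM('a) b (e + (norm y)\<^sup>2)"
  shows "\<bar>x * (y \<bullet> u)\<bar> \<le> kernel_bd (2 * A * norm u) (2 * b + 1 + DIM('a)) y"
proof -
  let ?n = "real DIM('a)" and ?t = "e + (norm y)\<^sup>2" and ?r = "norm y"
  have r: "?r > 0" using y by simp
  have t: "?t > 0" "?t \<ge> ?r\<^sup>2" using e r by (auto intro!: add_nonneg_pos)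
  have blp: "tame_bound DIM('a) b ?t > 0" using t unfolding tame_bound_def by (intro add_pos_pos) auto
  have A: "A \<ge> 0" using order_trans[OF abs_ge_zero x] blp by (simp add: zero_le_mult_iff)
  have B: "1 \<le> (1 + ?r) ^ c" for c by (rule one_le_power) simp
  have "?t powr (- (?n / 2)) \<le> (?r\<^sup>2) powr (- (?n / 2))" using t r by (intro powr_mono2') auto
  also have "(?r\<^sup>2) powr (- (?n / 2)) = ?r powr (- ?n)"
    using r by (simp add: powr_powr flip: powr_numeral)
  finally have "?t powr (- (?n / 2)) * ?r \<le> ?r powr (- ?n) * ?r"
    by (intro mult_right_mono) auto
  also have "?r powr (- ?n) * ?r = ?r powr (1 - ?n)"
    using powr_add[of ?r "- ?n" 1] r by simp
  finally have 1: "?t powr (- (?n / 2)) * ?r \<le> ?r powr (1 - ?n)" .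
  have 1: "?t powr (- (?n / 2)) * ?r \<le> ?r powr (1 - ?n) * (1 + ?r) ^ (2 * b + 1 + DIM('a))"
    using order_trans[OF 1, of "?r powr (1 - ?n) * (1 + ?r) ^ (2 * b + 1 + DIM('a))"]
      mult_left_mono[OF B[of "2 * b + 1 + DIM('a)"], of "?r powr (1 - ?n)"] by simp
  have "?t ^ b \<le> ((1 + ?r)\<^sup>2) ^ b" using t norm2_le[of e y] e by (intro power_mono) auto
  then have "?t ^ b * ?r \<le> (1 + ?r) ^ (2 * b) * (1 + ?r)"
    using r by (intro mult_mono) (auto simp: power_mult)
  also have "\<dots> = (1 + ?r) ^ (2 * b + 1)" by simp
  also have "\<dots> = 1 * (1 + ?r) ^ (2 * b + 1)" by simp
  also have "\<dots> \<le> (?r powr (1 - ?n) * (1 + ?r) ^ DIM('a)) * (1 + ?r) ^ (2 * b + 1)"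
  proof (intro mult_right_mono)
    have "?r ^ (DIM('a) - 1) \<le> (1 + ?r) ^ (DIM('a) - 1)" by (intro power_mono) auto
    also have "\<dots> \<le> (1 + ?r) ^ DIM('a)" by (intro power_increasing) auto
    finally have "?r ^ (DIM('a) - 1) \<le> (1 + ?r) ^ DIM('a)" .
    moreover have "1 \<le> 1 / X * Y" if "X > 0" "X \<le> Y" for X Y :: real using that by (simp add: field_simps)
    ultimately show "1 \<le> ?r powr (1 - ?n) * (1 + ?r) ^ DIM('a)"
      unfolding norm_powr_dim[OF y] using zero_less_power[OF r] by metis
  qed auto
  also have "\<dots> = ?r powr (1 - ?n) * (1 + ?r) ^ (2 * b + 1 + DIM('a))" unfolding power_add by (simp only: mult_ac)
  finally have 2: "?t ^ b * ?r \<le> ?r powr (1 - ?n) * (1 + ?r) ^ (2 * b + 1 + DIM('a))" .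
  have "\<bar>x * (y \<bullet> u)\<bar> \<le> (A * tame_bound DIM('a) b ?t) * (?r * norm u)"
    unfolding abs_mult using A blp by (intro mult_mono x Cauchy_Schwarz_ineq2) auto
  also have "\<dots> = (A * norm u) * (?t powr (- (?n / 2)) * ?r + ?t ^ b * ?r)" by (simp add: tame_bound_def algebra_simps)
  also have "\<dots> \<le> (A * norm u) * (?r powr (1 - ?n) * (1 + ?r) ^ (2 * b + 1 + DIM('a)) + ?r powr (1 - ?n) * (1 + ?r) ^ (2 * b + 1 + DIM('a)))"
    by (intro mult_left_mono add_mono 1 2) (use A in auto)
  also have "\<dots> = kernel_bd (2 * A * norm u) (2 * b + 1 + DIM('a)) y" by (simp add: kernel_bd_def)
  finally show ?thesis .
qed

lemma sum_Basis_inner: "(\<Sum>j\<in>Basis. (y \<bullet> j) * (j \<bullet> i)) = y \<bullet> (i::'a::euclidean_space)"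
  using euclidean_inner[of y i] by (simp add: inner_commute)

lemma sum_Basis_sq: "(\<Sum>j\<in>Basis. (y \<bullet> j)\<^sup>2) = (norm (y::'a::euclidean_space))\<^sup>2"
  unfolding power2_norm_eq_inner euclidean_inner[of y y] by (simp add: power2_eq_square)

text \<open>The Laplacian of \<open>Q(e + |y|^2) (y \<bullet> i)\<close> computed by the chain rule; for \<open>e > 0\<close>
the function is smooth, so two integrations by parts in each coordinate are legitimate.\<close>

lemma green_radial_reg:
  fixes \<phi> :: "'a::euclidean_space \<Rightarrow> real"
  assumes Q: "tame DIM('a) Q Q1 Q2" and e: "0 < e" "e \<le> 1" and \<phi>: "schwartz \<phi>"
  shows "(\<integral>y. Q (e + (norm y)\<^sup>2) * (y \<bullet> i) * lap \<phi> y \<partial>lborel) =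
    (\<integral>y. ((2 * real DIM('a) + 4) * Q1 (e + (norm y)\<^sup>2) + 4 * (norm y)\<^sup>2 * Q2 (e + (norm y)\<^sup>2)) * (y \<bullet> i) * \<phi> y \<partial>lborel)"
proof -
  let ?t = "\<lambda>y::'a. e + (norm y)\<^sup>2"
  have t: "?t y > 0" "?t y \<ge> e" for y using e by (auto intro: add_pos_nonneg)
  have Qd: "\<And>t. t > 0 \<Longrightarrow> (Q has_real_derivative Q1 t) (at t)" "\<And>t. t > 0 \<Longrightarrow> (Q1 has_real_derivative Q2 t) (at t)"
    and Qm: "Q \<in> borel_measurable borel" "Q1 \<in> borel_measurable borel" "Q2 \<in> borel_measurable borel"
    using Q unfolding tame_def by auto
  obtain A b where Qb: "\<And>t. t > 0 \<Longrightarrow> \<bar>Q t\<bar> \<le> A * tame_bound DIM('a) b t" "\<And>t. t > 0 \<Longrightarrow> \<bar>Q1 t\<bar> \<le> A * tame_bound DIM('a) b t"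
      "\<And>t. t > 0 \<Longrightarrow> t * \<bar>Q2 t\<bar> \<le> A * tame_bound DIM('a) b t"
    using Q unfolding tame_def by blast
  have pQ: "poly_growth (\<lambda>y::'a. Q (?t y))" and pQ1: "poly_growth (\<lambda>y::'a. Q1 (?t y))"
    by (rule tame_bound_poly_growth[OF e Qm(1) Qb(1)] tame_bound_poly_growth[OF e Qm(2) Qb(2)]; assumption)+
  have pQ2: "poly_growth (\<lambda>y::'a. Q2 (?t y))"
  proof -
    have "poly_growth (\<lambda>y::'a. (\<lambda>t. t * Q2 t) (?t y))"
      by (rule tame_bound_poly_growth[OF e, where A = A and b = b and n = "DIM('a)"]) (use Qb(3) Qm in \<open>auto simp: abs_mult\<close>)
    then obtain A' b' where b': "\<And>y::'a. \<bar>?t y * Q2 (?t y)\<bar> \<le> A' * (1 + norm y) ^ b'"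
      unfolding poly_growth_def by auto
    show ?thesis
    proof (rule poly_growthI)
      show "(\<lambda>y::'a. Q2 (?t y)) \<in> borel_measurable borel" by (rule measurable_compose[OF _ Qm(3)]) simp
      fix y :: 'a
      have "e * \<bar>Q2 (?t y)\<bar> \<le> ?t y * \<bar>Q2 (?t y)\<bar>" using t by (intro mult_right_mono) auto
      also have "\<dots> \<le> A' * (1 + norm y) ^ b'" using b'[of y] t(1)[of y] by (simp add: abs_mult)
      finally show "\<bar>Q2 (?t y)\<bar> \<le> (A' / e) * (1 + norm y) ^ b'" using e by (simp add: field_simps)
    qed
  qed
  note pg = poly_growth_mult poly_growth_add poly_growth_const poly_growth_inner pQ pQ1 pQ2
  \<comment> \<open>\<open>a1 j\<close> and \<open>a2 j\<close> are the first and second derivatives of \<open>a\<close> in the direction \<open>j\<close>\<close>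
  define a where "a y = Q (?t y) * (y \<bullet> i)" for y
  define a1 where "a1 j y = 2 * (y \<bullet> j) * Q1 (?t y) * (y \<bullet> i) + (j \<bullet> i) * Q (?t y)" for j y
  define a2 where "a2 j y = 2 * (j \<bullet> j) * (Q1 (?t y) * (y \<bullet> i)) + 4 * (y \<bullet> j) * ((y \<bullet> j) * (Q2 (?t y) * (y \<bullet> i)))
      + 4 * ((y \<bullet> j) * (j \<bullet> i)) * Q1 (?t y)" for j y
  have inn: "((\<lambda>s. (y + s *\<^sub>R u) \<bullet> v) has_real_derivative u \<bullet> v) (at 0)" for y u v :: 'a
    by (auto intro!: derivative_eq_intros simp: inner_add_left)
  have d1: "((\<lambda>s. a (y + s *\<^sub>R j)) has_real_derivative a1 j y) (at 0)" for y j
    unfolding a_def a1_def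
    by (rule DERIV_cong[OF DERIV_mult[OF radial_deriv[OF Qd(1)[OF t(1)]] inn]]) simp
  have d2: "((\<lambda>s. a1 j (y + s *\<^sub>R j)) has_real_derivative a2 j y) (at 0)" for y j
    unfolding a1_def a2_def
    by (rule DERIV_cong[OF DERIV_add[OF DERIV_mult[OF DERIV_mult[OF DERIV_cmult[OF inn, where c = 2] radial_deriv[OF Qd(2)[OF t(1)]]] inn]
          DERIV_cmult[OF radial_deriv[OF Qd(1)[OF t(1)]]]]]) (simp add: algebra_simps)
  have pa: "poly_growth a" and pa1: "poly_growth (a1 j)" and pa2: "poly_growth (a2 j)" for j
    unfolding a_def a1_def a2_def by (intro pg)+
  have "(\<integral>y. a y * lap \<phi> y \<partial>lborel) = (\<integral>y. (\<Sum>j\<in>Basis. a y * dir_deriv j (dir_deriv j \<phi>) y) \<partial>lborel)"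
    by (simp add: lap_def sum_distrib_left)
  also have "\<dots> = (\<Sum>j\<in>Basis. \<integral>y. a y * dir_deriv j (dir_deriv j \<phi>) y \<partial>lborel)"
    by (intro Bochner_Integration.integral_sum kernel_integrable poly_growth_kernel pa schwartz_dir \<phi>)
  also have "\<dots> = (\<Sum>j\<in>Basis. \<integral>y. a2 j y * \<phi> y \<partial>lborel)"
  proof (rule sum.cong[OF refl])
    fix j :: 'a
    show "(\<integral>y. a y * dir_deriv j (dir_deriv j \<phi>) y \<partial>lborel) = (\<integral>y. a2 j y * \<phi> y \<partial>lborel)"
      using integration_by_parts[OF pa pa1 d1 schwartz_dir[OF \<phi>]] integration_by_parts[OF pa1 pa2 d2 \<phi>] by simp
  qed
  also have "\<dots> = (\<integral>y. (\<Sum>j\<in>Basis. a2 j y * \<phi> y) \<partial>lborel)"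
    by (intro Bochner_Integration.integral_sum[symmetric] kernel_integrable poly_growth_kernel pa2 \<phi>)
  also have "\<dots> = (\<integral>y. ((2 * real DIM('a) + 4) * Q1 (?t y) + 4 * (norm y)\<^sup>2 * Q2 (?t y)) * (y \<bullet> i) * \<phi> y \<partial>lborel)"
  proof (rule Bochner_Integration.integral_cong[OF refl])
    fix y :: 'a
    have s1: "(\<Sum>j\<in>(Basis :: 'a set). 2 * (j \<bullet> j) * (Q1 (?t y) * (y \<bullet> i))) = 2 * real DIM('a) * (Q1 (?t y) * (y \<bullet> i))" by simp
    have s2: "(\<Sum>j\<in>Basis. 4 * (y \<bullet> j) * ((y \<bullet> j) * (Q2 (?t y) * (y \<bullet> i)))) = 4 * (norm y)\<^sup>2 * (Q2 (?t y) * (y \<bullet> i))"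
      unfolding sum_Basis_sq[symmetric] sum_distrib_left sum_distrib_right
      by (intro sum.cong refl) (simp add: power2_eq_square)
    have s3: "(\<Sum>j\<in>Basis. 4 * ((y \<bullet> j) * (j \<bullet> i)) * Q1 (?t y)) = 4 * (y \<bullet> i) * Q1 (?t y)"
    proof -
      have "(\<Sum>j\<in>Basis. 4 * ((y \<bullet> j) * (j \<bullet> i)) * Q1 (?t y)) = 4 * (\<Sum>j\<in>Basis. (y \<bullet> j) * (j \<bullet> i)) * Q1 (?t y)"
        by (simp add: sum_distrib_left sum_distrib_right)
      then show ?thesis by (simp only: sum_Basis_inner)
    qed
    have "(\<Sum>j\<in>Basis. a2 j y) = 2 * real DIM('a) * (Q1 (?t y) * (y \<bullet> i)) + 4 * (norm y)\<^sup>2 * (Q2 (?t y) * (y \<bullet> i)) + 4 * (y \<bullet> i) * Q1 (?t y)"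
      unfolding a2_def sum.distrib s1 s2 s3 ..
    moreover have "(\<Sum>j\<in>Basis. a2 j y * \<phi> y) = (\<Sum>j\<in>Basis. a2 j y) * \<phi> y"
      by (rule sum_distrib_right[symmetric])
    ultimately show "(\<Sum>j\<in>Basis. a2 j y * \<phi> y) = ((2 * real DIM('a) + 4) * Q1 (?t y) + 4 * (norm y)\<^sup>2 * Q2 (?t y)) * (y \<bullet> i) * \<phi> y"
      by (simp add: algebra_simps)
  qed
  finally show ?thesis by (simp add: a_def)
qed

definition eps :: "nat \<Rightarrow> real" where "eps k = inverse (real (Suc k))"

lemma eps: "0 < eps k" "eps k \<le> 1" "eps \<longlonglongrightarrow> 0"
  unfolding eps_def using LIMSEQ_inverse_real_of_nat by (auto simp: field_simps)

lemma eps_lim: "(\<lambda>k. eps k + c) \<longlonglongrightarrow> c"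
  using tendsto_add[OF eps(3) tendsto_const[of c]] by simp

text \<open>Let the regularisation tend to 0.  The bounds in \<open>tame\<close> are exactly what dominates both
sides, so the singularity at the origin contributes no extra term.\<close>

lemma green_radial:
  fixes \<phi> :: "'a::euclidean_space \<Rightarrow> real"
  assumes Q: "tame DIM('a) Q Q1 Q2" and \<phi>: "schwartz \<phi>"
  shows "(\<integral>y. Q ((norm y)\<^sup>2) * (y \<bullet> i) * lap \<phi> y \<partial>lborel) =
    (\<integral>y. ((2 * real DIM('a) + 4) * Q1 ((norm y)\<^sup>2) + 4 * (norm y)\<^sup>2 * Q2 ((norm y)\<^sup>2)) * (y \<bullet> i) * \<phi> y \<partial>lborel)"
proof -
  have Qd: "\<And>t. t > 0 \<Longrightarrow> (Q has_real_derivative Q1 t) (at t)" "\<And>t. t > 0 \<Longrightarrow> (Q1 has_real_derivative Q2 t) (at t)"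
    and Qm [measurable]: "Q \<in> borel_measurable borel" "Q1 \<in> borel_measurable borel" "Q2 \<in> borel_measurable borel"
    and Qc: "continuous_on {0<..} Q2"
    using Q unfolding tame_def by auto
  obtain A b where Qb: "\<And>t. t > 0 \<Longrightarrow> \<bar>Q t\<bar> \<le> A * tame_bound DIM('a) b t" "\<And>t. t > 0 \<Longrightarrow> \<bar>Q1 t\<bar> \<le> A * tame_bound DIM('a) b t"
      "\<And>t. t > 0 \<Longrightarrow> t * \<bar>Q2 t\<bar> \<le> A * tame_bound DIM('a) b t"
    using Q unfolding tame_def by blast
  have cont: "(\<lambda>k. f (eps k + (norm y)\<^sup>2)) \<longlonglongrightarrow> f ((norm y)\<^sup>2)" if "y \<noteq> 0" "isCont f ((norm y)\<^sup>2)" for f :: "real \<Rightarrow> real" and y :: 'a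
    by (rule isCont_tendsto_compose[OF that(2) eps_lim])
  have c0: "isCont Q t" and c1: "isCont Q1 t" and c2: "isCont Q2 t" if "t > 0" for t
    using Qd[OF that] Qc that by (auto intro: DERIV_isCont simp: continuous_on_eq_continuous_at)
  let ?R = "\<lambda>e y. (2 * real DIM('a) + 4) * Q1 (e + (norm y)\<^sup>2) + 4 * (norm y)\<^sup>2 * Q2 (e + (norm y)\<^sup>2)"
  have L1: "(\<lambda>k. \<integral>y. (Q (eps k + (norm y)\<^sup>2) * (y \<bullet> i)) * lap \<phi> y \<partial>lborel) \<longlonglongrightarrow> (\<integral>y. (Q ((norm y)\<^sup>2) * (y \<bullet> i)) * lap \<phi> y \<partial>lborel)"
  proof (rule kernel_limit[OF schwartz_lap[OF \<phi>]])
    fix k and y :: 'a assume y: "y \<noteq> 0"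
    show "\<bar>Q (eps k + (norm y)\<^sup>2) * (y \<bullet> i)\<bar> \<le> kernel_bd (2 * A * norm i) (2 * b + 1 + DIM('a)) y"
      using eps(1)[of k] eps(2)[of k] by (intro tame_bound_kernel_bd[OF y, where e = "eps k"] Qb) (auto intro: add_pos_nonneg)
  next
    fix y :: 'a assume y: "y \<noteq> 0"
    then show "(\<lambda>k. Q (eps k + (norm y)\<^sup>2) * (y \<bullet> i)) \<longlonglongrightarrow> Q ((norm y)\<^sup>2) * (y \<bullet> i)"
      by (intro tendsto_intros cont c0) auto
  qed auto
  have L2: "(\<lambda>k. \<integral>y. (?R (eps k) y * (y \<bullet> i)) * \<phi> y \<partial>lborel) \<longlonglongrightarrow> (\<integral>y. (?R 0 y * (y \<bullet> i)) * \<phi> y \<partial>lborel)"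
  proof (rule kernel_limit[OF \<phi>])
    fix k and y :: 'a assume y: "y \<noteq> 0"
    let ?t = "eps k + (norm y)\<^sup>2"
    have t: "?t > 0" using eps(1)[of k] eps(2)[of k] by (intro add_pos_nonneg) auto
    have "\<bar>?R (eps k) y\<bar> \<le> (2 * real DIM('a) + 4) * \<bar>Q1 ?t\<bar> + 4 * (norm y)\<^sup>2 * \<bar>Q2 ?t\<bar>"
      by (rule order_trans[OF abs_triangle_ineq]) (simp add: abs_mult)
    also have "\<dots> \<le> (2 * real DIM('a) + 4) * \<bar>Q1 ?t\<bar> + 4 * (?t * \<bar>Q2 ?t\<bar>)"
      using eps(1)[of k] by (intro add_left_mono) (simp add: mult_right_mono)
    also have "\<dots> \<le> (2 * real DIM('a) + 4) * (A * tame_bound DIM('a) b ?t) + 4 * (A * tame_bound DIM('a) b ?t)"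
      by (intro add_mono mult_left_mono Qb t) auto
    also have "\<dots> = ((2 * real DIM('a) + 8) * A) * tame_bound DIM('a) b ?t" by (simp add: algebra_simps)
    finally show "\<bar>?R (eps k) y * (y \<bullet> i)\<bar> \<le> kernel_bd (2 * ((2 * real DIM('a) + 8) * A) * norm i) (2 * b + 1 + DIM('a)) y"
      using eps(1)[of k] eps(2)[of k] by (intro tame_bound_kernel_bd[OF y, where e = "eps k"]) auto
  next
    fix y :: 'a assume y: "y \<noteq> 0"
    then show "(\<lambda>k. ?R (eps k) y * (y \<bullet> i)) \<longlonglongrightarrow> ?R 0 y * (y \<bullet> i)"
      unfolding add_0 by (intro tendsto_intros cont c1 c2) auto
  qed auto
  have eq: "(\<integral>y. (Q (eps k + (norm y)\<^sup>2) * (y \<bullet> i)) * lap \<phi> y \<partial>lborel) = (\<integral>y. (?R (eps k) y * (y \<bullet> i)) * \<phi> y \<partial>lborel)" for k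
    by (rule green_radial_reg[OF Q eps(1) eps(2) \<phi>])
  from LIMSEQ_unique[OF L1 L2[folded eq]] show ?thesis by simp
qed

section \<open>The Newton kernel reproduces the value at the origin\<close>

lemma lborel_scale:
  fixes f :: "'a::euclidean_space \<Rightarrow> real"
  assumes "c > 0" and [measurable]: "f \<in> borel_measurable borel"
  shows "(\<integral>y. f y \<partial>lborel) = c ^ DIM('a) * (\<integral>z. f (c *\<^sub>R z) \<partial>lborel)"
proof -
  have "(\<integral>y. f y \<partial>lborel) = (\<integral>y. f y \<partial>density (distr lborel borel (\<lambda>x. 0 + c *\<^sub>R x)) (\<lambda>_. \<bar>c\<bar> ^ DIM('a)))"
    by (subst lborel_affine[of c "0::'a"]) (use assms in simp_all)
  also have "\<dots> = c ^ DIM('a) * (\<integral>z. f (c *\<^sub>R z) \<partial>lborel)"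
    using assms by (subst integral_density) (auto simp: integral_distr)
  finally show ?thesis .
qed

text \<open>Pairing with the component \<open>j\<close> of \<open>y / |y|^n\<close>, the gradient of the Newton potential up
to a constant.\<close>

definition newton_int :: "'a::euclidean_space \<Rightarrow> ('a \<Rightarrow> real) \<Rightarrow> real" where
  "newton_int j \<phi> = (\<integral>y. norm y powr (- real DIM('a)) * (y \<bullet> j) * \<phi> y \<partial>lborel)"

lemma norm_sq_powr: "y \<noteq> 0 \<Longrightarrow> ((norm y)\<^sup>2) powr p = norm y powr (2 * p)"
  by (simp add: powr_powr flip: powr_numeral)

lemma newton_int_limit:
  fixes \<psi> :: "'a::euclidean_space \<Rightarrow> real"
  assumes "schwartz \<psi>"
  shows "(\<lambda>k. \<integral>y. (eps k + (norm y)\<^sup>2) powr (- (real DIM('a) / 2)) * (y \<bullet> j) * \<psi> y \<partial>lborel) \<longlonglongrightarrow> newton_int j \<psi>"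
  unfolding newton_int_def
proof (rule kernel_limit[OF assms])
  fix k and y :: 'a assume y: "y \<noteq> 0"
  show "\<bar>(eps k + (norm y)\<^sup>2) powr (- (real DIM('a) / 2)) * (y \<bullet> j)\<bar> \<le> kernel_bd (2 * 1 * norm j) (2 * 0 + 1 + DIM('a)) y"
    using eps(1)[of k] eps(2)[of k] by (intro tame_bound_kernel_bd[OF y, where e = "eps k"]) (auto simp: tame_bound_def)
next
  fix y :: 'a assume y: "y \<noteq> 0"
  have "(\<lambda>k. (eps k + (norm y)\<^sup>2) powr (- (real DIM('a) / 2)) * (y \<bullet> j)) \<longlonglongrightarrow> ((norm y)\<^sup>2) powr (- (real DIM('a) / 2)) * (y \<bullet> j)"
    using y by (intro tendsto_intros eps_lim) auto
  then show "(\<lambda>k. (eps k + (norm y)\<^sup>2) powr (- (real DIM('a) / 2)) * (y \<bullet> j)) \<longlonglongrightarrow> norm y powr (- real DIM('a)) * (y \<bullet> j)"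
    by (simp add: norm_sq_powr[OF y])
qed auto

lemma newton_by_parts_reg:
  fixes \<phi> :: "'a::euclidean_space \<Rightarrow> real"
  assumes e: "0 < e" "e \<le> 1" and \<phi>: "schwartz \<phi>"
  defines "t \<equiv> \<lambda>y::'a. e + (norm y)\<^sup>2" and "p \<equiv> - (real DIM('a) / 2)"
  shows "(\<integral>y. t y powr p * (y \<bullet> j) * dir_deriv i \<phi> y \<partial>lborel) =
      - (\<integral>y. (2 * (y \<bullet> i) * (p * t y powr (p - 1)) * (y \<bullet> j) + (i \<bullet> j) * t y powr p) * \<phi> y \<partial>lborel)"
    and "integrable lborel (\<lambda>y. (2 * (y \<bullet> i) * (p * t y powr (p - 1)) * (y \<bullet> j) + (i \<bullet> j) * t y powr p) * \<phi> y)"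
proof -
  have t: "t y > 0" for y unfolding t_def using e by (auto intro: add_pos_nonneg)
  have p1: "poly_growth (\<lambda>y::'a. t y powr p)" unfolding t_def
    by (rule tame_bound_poly_growth[OF e, where A = 1 and n = "DIM('a)" and b = 0]) (auto simp: tame_bound_def p_def)
  have "- (real (DIM('a) + 2) / 2) = p - 1" by (simp add: p_def add_divide_distrib)
  then have p2: "poly_growth (\<lambda>y::'a. t y powr (p - 1))" unfolding t_def
    by (intro tame_bound_poly_growth[OF e, where A = 1 and n = "DIM('a) + 2" and b = 0]) (auto simp: tame_bound_def simp del: of_nat_add)
  note pg = poly_growth_mult poly_growth_add poly_growth_const poly_growth_inner p1 p2
  have inn: "((\<lambda>s. (y + s *\<^sub>R u) \<bullet> v) has_real_derivative u \<bullet> v) (at 0)" for y u v :: 'a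
    by (auto intro!: derivative_eq_intros simp: inner_add_left)
  have Qd: "((\<lambda>t. t powr p) has_real_derivative p * x powr (p - 1)) (at x)" if "x > 0" for x :: real
    using that by (auto intro!: derivative_eq_intros)
  have d1: "((\<lambda>s. t (y + s *\<^sub>R i) powr p * ((y + s *\<^sub>R i) \<bullet> j)) has_real_derivative
      2 * (y \<bullet> i) * (p * t y powr (p - 1)) * (y \<bullet> j) + (i \<bullet> j) * t y powr p) (at 0)" for y
    using t[of y] unfolding t_def
    by (intro DERIV_cong[OF DERIV_mult[OF radial_deriv[OF Qd] inn]]) auto
  have a: "poly_growth (\<lambda>y. t y powr p * (y \<bullet> j))" by (intro pg)
  have a': "poly_growth (\<lambda>y. 2 * (y \<bullet> i) * (p * t y powr (p - 1)) * (y \<bullet> j) + (i \<bullet> j) * t y powr p)" by (intro pg)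
  show "(\<integral>y. t y powr p * (y \<bullet> j) * dir_deriv i \<phi> y \<partial>lborel) =
      - (\<integral>y. (2 * (y \<bullet> i) * (p * t y powr (p - 1)) * (y \<bullet> j) + (i \<bullet> j) * t y powr p) * \<phi> y \<partial>lborel)"
    by (rule integration_by_parts[OF a a' d1 \<phi>])
  show "integrable lborel (\<lambda>y. (2 * (y \<bullet> i) * (p * t y powr (p - 1)) * (y \<bullet> j) + (i \<bullet> j) * t y powr p) * \<phi> y)"
    by (intro kernel_integrable poly_growth_kernel a' \<phi>)
qed

text \<open>After regularisation the kernel is a gradient, and \<open>\<partial>_i\<close> of its component \<open>j\<close> is
symmetric in \<open>i\<close> and \<open>j\<close>.\<close>

lemma newton_int_sym:
  fixes \<phi> :: "'a::euclidean_space \<Rightarrow> real"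
  assumes "schwartz \<phi>"
  shows "newton_int j (dir_deriv i \<phi>) = newton_int i (dir_deriv j \<phi>)"
proof -
  have "(\<integral>y. (eps k + (norm y)\<^sup>2) powr (- (real DIM('a) / 2)) * (y \<bullet> j) * dir_deriv i \<phi> y \<partial>lborel) =
     (\<integral>y. (eps k + (norm y)\<^sup>2) powr (- (real DIM('a) / 2)) * (y \<bullet> i) * dir_deriv j \<phi> y \<partial>lborel)" for k
    unfolding newton_by_parts_reg(1)[OF eps(1) eps(2) assms]
    by (intro arg_cong[where f = uminus] Bochner_Integration.integral_cong refl) (simp add: inner_commute mult_ac)
  then show ?thesis
    using LIMSEQ_unique[OF newton_int_limit[OF schwartz_dir[OF assms], of j i] ] newton_int_limit[OF schwartz_dir[OF assms], of i j]
    by simp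
qed

text \<open>The divergence of \<open>y (e + |y|^2)^(-n/2)\<close> is \<open>n e (e + |y|^2)^(-n/2 - 1)\<close>, which is this
function rescaled to width \<open>sqrt e\<close>.\<close>

definition bump :: "'a::euclidean_space \<Rightarrow> real" where
  "bump z = real DIM('a) * (1 + (norm z)\<^sup>2) powr (- (real DIM('a) / 2) - 1)"

lemma bump_pos: "bump (z::'a::euclidean_space) > 0"
proof -
  have "1 + (norm z)\<^sup>2 > 0" by (intro add_pos_nonneg) auto
  then show ?thesis by (simp add: bump_def)
qed

lemma bump_integrable: "integrable lborel (bump :: 'a::euclidean_space \<Rightarrow> real)"
proof (rule integrable_decay_bound)
  show "(bump :: 'a \<Rightarrow> real) \<in> borel_measurable borel" unfolding bump_def by measurable
  fix y :: 'a assume y: "y \<noteq> 0"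
  let ?n = "real DIM('a)" and ?r = "norm y"
  have r: "?r > 0" using y by simp
  let ?t = "1 + ?r\<^sup>2"
  have t: "?t \<ge> 1" "?t > 0" by (auto intro: add_pos_nonneg)
  have "?t powr (- (?n / 2)) \<le> ?t powr ((1 - ?n) / 2)" using t by (intro powr_mono) auto
  also have "\<dots> \<le> (?r\<^sup>2) powr ((1 - ?n) / 2)" using r by (intro powr_mono2') auto
  also have "\<dots> = ?r powr (2 * ((1 - ?n) / 2))" by (rule norm_sq_powr[OF y])
  also have "2 * ((1 - ?n) / 2) = 1 - ?n" by simp
  finally have 1: "?t powr (- (?n / 2)) \<le> ?r powr (1 - ?n)" .
  have sq: "(1 + ?r)\<^sup>2 \<le> 2 * ?t"
    using zero_le_power2[of "?r - 1"] by (simp add: power2_eq_square algebra_simps)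
  have 2: "1 / ?t \<le> 2 / (1 + ?r)\<^sup>2"
  proof -
    have "1 / t \<le> 2 / A" if "A > 0" "t > 0" "A \<le> 2 * t" for A t :: real using that by (simp add: field_simps)
    from this[OF _ t(2) sq] show ?thesis using one_plus_norm_pos[of y] by (meson zero_less_power)
  qed
  have "?t powr (- (?n / 2) - 1) = ?t powr (- (?n / 2)) * (1 / ?t)" using t by (simp add: powr_diff)
  also have "\<dots> \<le> ?r powr (1 - ?n) * (2 / (1 + ?r)\<^sup>2)" using t by (intro mult_mono 1 2) auto
  finally have "?t powr (- (?n / 2) - 1) \<le> 2 * decay y" by (simp add: decay_def mult.commute)
  then show "\<bar>bump y\<bar> \<le> (?n * 2) * decay y" using bump_pos[of y] by (simp add: bump_def mult_left_mono)
qed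

lemma bump_integral_pos: "(\<integral>z. bump (z::'a::euclidean_space) \<partial>lborel) > 0"
proof -
  have nn: "AE z::'a in lborel. 0 \<le> bump z" using bump_pos by (auto intro: less_imp_le)
  have "(\<integral>z. bump (z::'a) \<partial>lborel) \<noteq> 0"
  proof
    assume "(\<integral>z. bump (z::'a) \<partial>lborel) = 0"
    then have "AE z::'a in lborel. bump z = 0"
      using integral_nonneg_eq_0_iff_AE[OF bump_integrable nn] by simp
    then have "AE z::'a in lborel. False" by eventually_elim (use bump_pos in \<open>metis less_irrefl\<close>)
    then have "emeasure lborel (UNIV :: 'a set) = 0" by (simp add: AE_iff_null null_sets_def)
    then show False by simp
  qed
  moreover have "(\<integral>z. bump (z::'a) \<partial>lborel) \<ge> 0" using nn by (rule integral_nonneg_AE)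
  ultimately show ?thesis by simp
qed

lemma schwartz_bounded: "schwartz \<phi> \<Longrightarrow> \<exists>B. \<forall>y. \<bar>\<phi> y\<bar> \<le> B"
  using schwartz_bound[of \<phi> 0] by auto

text \<open>The divergence of the regularised kernel is an approximate identity: it is the density
\<open>bump\<close> rescaled to width \<open>sqrt (eps k)\<close>, so in the limit only \<open>\<phi> 0\<close> remains.\<close>

lemma newton_int_div:
  fixes \<phi> :: "'a::euclidean_space \<Rightarrow> real"
  assumes \<phi>: "schwartz \<phi>"
  shows "(\<Sum>i\<in>Basis. newton_int i (dir_deriv i \<phi>)) = - (\<integral>z. bump (z::'a) \<partial>lborel) * \<phi> 0"
proof -
  let ?p = "- (real DIM('a) / 2)"
  have \<phi>m [measurable]: "\<phi> \<in> borel_measurable borel" by (rule smooth_measurable[OF schwartz_smooth[OF \<phi>]])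
  have eq: "(\<Sum>i\<in>Basis. \<integral>y. (eps k + (norm y)\<^sup>2) powr ?p * (y \<bullet> i) * dir_deriv i \<phi> y \<partial>lborel) =
     - (\<integral>z. bump z * \<phi> (sqrt (eps k) *\<^sub>R z) \<partial>lborel)" for k
  proof -
    let ?e = "eps k" and ?s = "sqrt (eps k)"
    let ?t = "\<lambda>y::'a. ?e + (norm y)\<^sup>2"
    have e: "?e > 0" "?s > 0" "?s * ?s = ?e" using eps(1)[of k] by auto
    have t: "?t y > 0" for y using e by (auto intro: add_pos_nonneg)
    have "(\<Sum>i\<in>Basis. \<integral>y. ?t y powr ?p * (y \<bullet> i) * dir_deriv i \<phi> y \<partial>lborel) =
      - (\<integral>y. (\<Sum>i\<in>Basis. (2 * (y \<bullet> i) * (?p * ?t y powr (?p - 1)) * (y \<bullet> i) + (i \<bullet> i) * ?t y powr ?p) * \<phi> y) \<partial>lborel)"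
      unfolding newton_by_parts_reg(1)[OF eps(1) eps(2) \<phi>]
      by (subst Bochner_Integration.integral_sum[OF newton_by_parts_reg(2)[OF eps(1) eps(2) \<phi>]]) (simp only: sum_negf)
    also have "(\<integral>y. (\<Sum>i\<in>Basis. (2 * (y \<bullet> i) * (?p * ?t y powr (?p - 1)) * (y \<bullet> i) + (i \<bullet> i) * ?t y powr ?p) * \<phi> y) \<partial>lborel) =
      (\<integral>y. real DIM('a) * ?e * ?t y powr (?p - 1) * \<phi> y \<partial>lborel)"
    proof (rule Bochner_Integration.integral_cong[OF refl])
      fix y :: 'a
      have "(\<Sum>i\<in>Basis. 2 * (y \<bullet> i) * (?p * ?t y powr (?p - 1)) * (y \<bullet> i) + (i \<bullet> i) * ?t y powr ?p) =
         (\<Sum>i\<in>Basis. (y \<bullet> i)\<^sup>2) * (2 * ?p * ?t y powr (?p - 1)) + (\<Sum>i\<in>(Basis::'a set). ?t y powr ?p)"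
        unfolding sum_distrib_right sum.distrib[symmetric]
        by (intro sum.cong refl) (simp add: power2_eq_square)
      also have "\<dots> = (norm y)\<^sup>2 * (2 * ?p * ?t y powr (?p - 1)) + real DIM('a) * ?t y powr ?p"
        by (simp add: sum_Basis_sq)
      also have "\<dots> = real DIM('a) * ?e * ?t y powr (?p - 1)"
      proof -
        have "?t y powr ?p = ?t y * ?t y powr (?p - 1)"
          using t[of y] by (simp add: powr_diff)
        then show ?thesis by (simp only:) (simp add: algebra_simps)
      qed
      finally have "(\<Sum>i\<in>Basis. 2 * (y \<bullet> i) * (?p * ?t y powr (?p - 1)) * (y \<bullet> i) + (i \<bullet> i) * ?t y powr ?p) = real DIM('a) * ?e * ?t y powr (?p - 1)" .
      moreover have "(\<Sum>i\<in>Basis. (2 * (y \<bullet> i) * (?p * ?t y powr (?p - 1)) * (y \<bullet> i) + (i \<bullet> i) * ?t y powr ?p) * \<phi> y) =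
        (\<Sum>i\<in>Basis. 2 * (y \<bullet> i) * (?p * ?t y powr (?p - 1)) * (y \<bullet> i) + (i \<bullet> i) * ?t y powr ?p) * \<phi> y"
        by (rule sum_distrib_right[symmetric])
      ultimately show "(\<Sum>i\<in>Basis. (2 * (y \<bullet> i) * (?p * ?t y powr (?p - 1)) * (y \<bullet> i) + (i \<bullet> i) * ?t y powr ?p) * \<phi> y) =
         real DIM('a) * ?e * ?t y powr (?p - 1) * \<phi> y" by simp
    qed
    also have "\<dots> = ?s ^ DIM('a) * (\<integral>z. real DIM('a) * ?e * ?t (?s *\<^sub>R z) powr (?p - 1) * \<phi> (?s *\<^sub>R z) \<partial>lborel)"
      by (rule lborel_scale[OF e(2)]) simp
    also have "\<dots> = (\<integral>z. ?s ^ DIM('a) * (real DIM('a) * ?e * ?t (?s *\<^sub>R z) powr (?p - 1) * \<phi> (?s *\<^sub>R z)) \<partial>lborel)"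
      by simp
    also have "\<dots> = (\<integral>z. bump z * \<phi> (?s *\<^sub>R z) \<partial>lborel)"
    proof (rule Bochner_Integration.integral_cong[OF refl])
      fix z :: 'a
      have "?t (?s *\<^sub>R z) = ?s\<^sup>2 * (1 + (norm z)\<^sup>2)"
        using e by (simp add: power_mult_distrib algebra_simps power2_eq_square)
      then have "?t (?s *\<^sub>R z) powr (?p - 1) = (?s\<^sup>2) powr (?p - 1) * (1 + (norm z)\<^sup>2) powr (?p - 1)"
        by (simp add: powr_mult)
      also have "(?s\<^sup>2) powr (?p - 1) = ?s powr (2 * (?p - 1))"
        using e by (simp only: powr_powr flip: powr_numeral)
      also have "?s powr (2 * (?p - 1)) = inverse (?s ^ (DIM('a) + 2))"
      proof -
        have "2 * (?p - 1) = - real (DIM('a) + 2)" by simp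
        then have "?s powr (2 * (?p - 1)) = inverse (?s powr real (DIM('a) + 2))" by (simp only: powr_minus)
        then show ?thesis using e by (simp only: powr_realpow)
      qed
      finally have T: "?t (?s *\<^sub>R z) powr (?p - 1) = inverse (?s ^ (DIM('a) + 2)) * (1 + (norm z)\<^sup>2) powr (?p - 1)" .
      have "?s ^ DIM('a) * ?e * inverse (?s ^ (DIM('a) + 2)) = 1"
        using e by (simp add: power_add power2_eq_square field_simps)
      then have "?s ^ DIM('a) * (real DIM('a) * ?e * (inverse (?s ^ (DIM('a) + 2)) * w) * v) = real DIM('a) * w * v" for w v
        by (metis (no_types, lifting) mult.assoc mult.commute mult.left_commute mult_1)
      then show "?s ^ DIM('a) * (real DIM('a) * ?e * ?t (?s *\<^sub>R z) powr (?p - 1) * \<phi> (?s *\<^sub>R z)) = bump z * \<phi> (?s *\<^sub>R z)"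
        unfolding T bump_def by blast
    qed
    finally show ?thesis .
  qed
  have L1: "(\<lambda>k. \<Sum>i\<in>Basis. \<integral>y. (eps k + (norm y)\<^sup>2) powr ?p * (y \<bullet> i) * dir_deriv i \<phi> y \<partial>lborel) \<longlonglongrightarrow> (\<Sum>i\<in>Basis. newton_int i (dir_deriv i \<phi>))"
    by (intro tendsto_sum newton_int_limit schwartz_dir \<phi>)
  obtain B where B: "\<And>y. \<bar>\<phi> y\<bar> \<le> B" using schwartz_bounded[OF \<phi>] by blast
  have "(\<lambda>k. \<integral>z. bump z * \<phi> (sqrt (eps k) *\<^sub>R z) \<partial>lborel) \<longlonglongrightarrow> (\<integral>z. bump (z::'a) * \<phi> 0 \<partial>lborel)"
  proof (rule integral_dominated_convergence)
    show "integrable lborel (\<lambda>z::'a. bump z * B)" by (intro integrable_mult_left bump_integrable)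
    show "AE z in lborel. norm (bump z * \<phi> (sqrt (eps k) *\<^sub>R z)) \<le> bump z * B" for k
    proof (rule AE_I2)
      fix z :: 'a
      show "norm (bump z * \<phi> (sqrt (eps k) *\<^sub>R z)) \<le> bump z * B"
        using bump_pos[of z] B[of "sqrt (eps k) *\<^sub>R z"] by (simp add: abs_mult mult_left_mono)
    qed
    show "AE z in lborel. (\<lambda>k. bump z * \<phi> (sqrt (eps k) *\<^sub>R z)) \<longlonglongrightarrow> bump z * \<phi> 0"
    proof (rule AE_I2)
      fix z :: 'a
      have "(\<lambda>k. sqrt (eps k) *\<^sub>R z) \<longlonglongrightarrow> sqrt 0 *\<^sub>R z" by (intro tendsto_intros eps(3))
      moreover have "isCont \<phi> 0"
        using smooth_continuous[OF schwartz_smooth[OF \<phi>], of UNIV] by (simp add: continuous_on_eq_continuous_at)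
      ultimately have "(\<lambda>k. \<phi> (sqrt (eps k) *\<^sub>R z)) \<longlonglongrightarrow> \<phi> 0"
        by (intro isCont_tendsto_compose[of 0 \<phi>]) auto
      then show "(\<lambda>k. bump z * \<phi> (sqrt (eps k) *\<^sub>R z)) \<longlonglongrightarrow> bump z * \<phi> 0" by (rule tendsto_mult_left)
    qed
  qed (use bump_integrable in \<open>auto intro!: borel_measurable_times\<close>)
  then have "(\<lambda>k. - (\<integral>z. bump z * \<phi> (sqrt (eps k) *\<^sub>R z) \<partial>lborel)) \<longlonglongrightarrow> - (\<integral>z. bump (z::'a) * \<phi> 0 \<partial>lborel)"
    by (rule tendsto_minus)
  from LIMSEQ_unique[OF L1[unfolded eq] this] show ?thesis by simp
qed

section \<open>Raising the exponent of the kernel\<close>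

definition radial_power_int :: "real \<Rightarrow> 'a::euclidean_space \<Rightarrow> ('a \<Rightarrow> real) \<Rightarrow> real" where
  "radial_power_int q i \<phi> = (\<integral>y. norm y powr q * (y \<bullet> i) * \<phi> y \<partial>lborel)"

lemma powr_tame_bound:
  assumes "p \<ge> - (real n / 2)" "t > 0"
  shows "t powr p \<le> tame_bound n (nat \<lceil>p\<rceil>) t"
proof (cases "t \<le> 1")
  case True
  have "t powr p \<le> t powr (- (real n / 2))" using True assms by (intro powr_mono') auto
  then show ?thesis using assms by (simp add: tame_bound_def add_increasing2)
next
  case False
  have "t powr p \<le> t powr real (nat \<lceil>p\<rceil>)" using False by (intro powr_mono) linarith+
  also have "\<dots> = t ^ nat \<lceil>p\<rceil>" using assms by (simp add: powr_realpow)
  finally show ?thesis by (simp add: tame_bound_def add_increasing)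
qed

lemma tame_powr:
  assumes "p \<ge> 1 - real n / 2"
  shows "tame n (\<lambda>t. t powr p) (\<lambda>t. p * t powr (p - 1)) (\<lambda>t. p * (p - 1) * t powr (p - 2))"
proof -
  have le: "t powr p \<le> 1 * tame_bound n (nat \<lceil>p\<rceil>) t" if "t > 0" for t using powr_tame_bound[of n p t] that assms by simp
  have le1: "t powr (p - 1) \<le> 2 * tame_bound n (nat \<lceil>p\<rceil>) t" if t: "t > 0" for t
  proof (cases "t \<le> 1")
    case True
    have "t powr (p - 1) \<le> t powr (- (real n / 2))" using True assms t by (intro powr_mono') auto
    also have "\<dots> \<le> 2 * tame_bound n (nat \<lceil>p\<rceil>) t" using t by (simp add: tame_bound_def)
    finally show ?thesis .
  next
    case False
    have "t powr (p - 1) \<le> t powr p" using False by (intro powr_mono) auto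
    also have "\<dots> \<le> 1 * tame_bound n (nat \<lceil>p\<rceil>) t" by (rule le[OF t])
    also have "\<dots> \<le> 2 * tame_bound n (nat \<lceil>p\<rceil>) t" using t by (simp add: tame_bound_def)
    finally show ?thesis .
  qed
  have blp: "tame_bound n (nat \<lceil>p\<rceil>) t > 0" if "t > 0" for t using that by (auto simp: tame_bound_def intro: add_pos_pos)
  show ?thesis
    unfolding tame_def
  proof (intro conjI allI impI exI[of _ "1 + 2 * \<bar>p\<bar> + 2 * \<bar>p * (p - 1)\<bar>"] exI[of _ "nat \<lceil>p\<rceil>"])
    show "continuous_on {0<..} (\<lambda>t. p * (p - 1) * t powr (p - 2))" by (intro continuous_intros) auto
  next
    fix t :: real assume t: "t > 0"
    show "((\<lambda>t. t powr p) has_real_derivative p * t powr (p - 1)) (at t)"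
      using t by (auto intro!: derivative_eq_intros)
    show "((\<lambda>t. p * t powr (p - 1)) has_real_derivative p * (p - 1) * t powr (p - 2)) (at t)"
      using t by (auto intro!: derivative_eq_intros simp: diff_diff_add)
    show "\<bar>t powr p\<bar> \<le> (1 + 2 * \<bar>p\<bar> + 2 * \<bar>p * (p - 1)\<bar>) * tame_bound n (nat \<lceil>p\<rceil>) t"
      using order_trans[OF le[OF t], of "(1 + 2 * \<bar>p\<bar> + 2 * \<bar>p * (p - 1)\<bar>) * tame_bound n (nat \<lceil>p\<rceil>) t"] blp[OF t]
      by (simp add: mult_right_mono)
    have "\<bar>p * t powr (p - 1)\<bar> \<le> \<bar>p\<bar> * (2 * tame_bound n (nat \<lceil>p\<rceil>) t)"
      unfolding abs_mult using le1[OF t] by (intro mult_mono) auto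
    also have "\<dots> \<le> (1 + 2 * \<bar>p\<bar> + 2 * \<bar>p * (p - 1)\<bar>) * tame_bound n (nat \<lceil>p\<rceil>) t"
      using blp[OF t] by (simp add: algebra_simps)
    finally show "\<bar>p * t powr (p - 1)\<bar> \<le> (1 + 2 * \<bar>p\<bar> + 2 * \<bar>p * (p - 1)\<bar>) * tame_bound n (nat \<lceil>p\<rceil>) t" .
    have "t * \<bar>p * (p - 1) * t powr (p - 2)\<bar> = \<bar>p * (p - 1)\<bar> * (t * t powr (p - 2))" using t by (simp add: abs_mult)
    also have "t * t powr (p - 2) = t powr (p - 1)" using t powr_add[of t 1 "p - 2"] by simp
    also have "\<bar>p * (p - 1)\<bar> * t powr (p - 1) \<le> \<bar>p * (p - 1)\<bar> * (2 * tame_bound n (nat \<lceil>p\<rceil>) t)"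
      by (intro mult_left_mono le1[OF t]) auto
    also have "\<dots> \<le> (1 + 2 * \<bar>p\<bar> + 2 * \<bar>p * (p - 1)\<bar>) * tame_bound n (nat \<lceil>p\<rceil>) t"
      using blp[OF t] by (simp add: distrib_right)
    finally show "t * \<bar>p * (p - 1) * t powr (p - 2)\<bar> \<le> (1 + 2 * \<bar>p\<bar> + 2 * \<bar>p * (p - 1)\<bar>) * tame_bound n (nat \<lceil>p\<rceil>) t" .
  qed auto
qed

text \<open>The Laplacian of \<open>|y|^(q + 2) y_i\<close> is \<open>(q + 2) (q + n + 2) |y|^q y_i\<close>.\<close>

lemma radial_power_int_step:
  fixes \<phi> :: "'a::euclidean_space \<Rightarrow> real"
  assumes q: "q \<ge> - real DIM('a)" and \<phi>: "schwartz \<phi>"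
  shows "radial_power_int (q + 2) i (lap \<phi>) = (q + 2) * (q + real DIM('a) + 2) * radial_power_int q i \<phi>"
proof -
  let ?p = "q / 2 + 1" and ?n = "real DIM('a)"
  have "radial_power_int (q + 2) i (lap \<phi>) = (\<integral>y. ((norm y)\<^sup>2) powr ?p * (y \<bullet> i) * lap \<phi> y \<partial>lborel)"
    unfolding radial_power_int_def
  proof (intro Bochner_Integration.integral_cong refl)
    fix y :: 'a
    have "((norm y)\<^sup>2) powr ?p = norm y powr (q + 2)" if "y \<noteq> 0"
    proof -
      have "2 * ?p = q + 2" by simp
      then show ?thesis using norm_sq_powr[OF that, of ?p] by (simp only:)
    qed
    then show "norm y powr (q + 2) * (y \<bullet> i) * lap \<phi> y = ((norm y)\<^sup>2) powr ?p * (y \<bullet> i) * lap \<phi> y"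
      by (cases "y = 0") auto
  qed
  also have "\<dots> = (\<integral>y. ((2 * ?n + 4) * (?p * ((norm y)\<^sup>2) powr (?p - 1)) + 4 * (norm y)\<^sup>2 * (?p * (?p - 1) * ((norm y)\<^sup>2) powr (?p - 2))) * (y \<bullet> i) * \<phi> y \<partial>lborel)"
    by (rule green_radial[OF tame_powr \<phi>]) (use q in simp)
  also have "\<dots> = (\<integral>y. ((q + 2) * (q + ?n + 2)) * (norm y powr q * (y \<bullet> i) * \<phi> y) \<partial>lborel)"
  proof (rule Bochner_Integration.integral_cong[OF refl])
    fix y :: 'a
    show "((2 * ?n + 4) * (?p * ((norm y)\<^sup>2) powr (?p - 1)) + 4 * (norm y)\<^sup>2 * (?p * (?p - 1) * ((norm y)\<^sup>2) powr (?p - 2))) * (y \<bullet> i) * \<phi> y =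
        ((q + 2) * (q + ?n + 2)) * (norm y powr q * (y \<bullet> i) * \<phi> y)"
    proof (cases "y = 0")
      case False
      let ?t = "(norm y)\<^sup>2"
      have "2 * (?p - 1) = q" by simp
      then have a: "?t powr (?p - 1) = norm y powr q" using norm_sq_powr[OF False, of "?p - 1"] by (simp only:)
      have "?t * ?t powr (?p - 2) = ?t powr (1 + (?p - 2))" using False by (simp only: powr_add) simp
      also have "1 + (?p - 2) = ?p - 1" by simp
      finally have b: "?t * ?t powr (?p - 2) = norm y powr q" using a by simp
      have "(2 * ?n + 4) * (?p * ?t powr (?p - 1)) + 4 * ?t * (?p * (?p - 1) * ?t powr (?p - 2)) =
         (2 * ?n + 4) * (?p * ?t powr (?p - 1)) + 4 * (?p * (?p - 1)) * (?t * ?t powr (?p - 2))" by (simp only: mult_ac)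
      also have "\<dots> = ((2 * ?n + 4) * ?p + 4 * (?p * (?p - 1))) * norm y powr q" unfolding a b by (simp add: distrib_right)
      also have "(2 * ?n + 4) * ?p + 4 * (?p * (?p - 1)) = (q + 2) * (q + ?n + 2)" by (simp add: field_simps)
      finally show ?thesis by (simp only: mult.assoc)
    qed simp
  qed
  also have "\<dots> = (q + 2) * (q + ?n + 2) * radial_power_int q i \<phi>" by (simp add: radial_power_int_def)
  finally show ?thesis .
qed

text \<open>The factors of the steps from \<open>|y|^(-n)\<close> upwards vanish only when the exponent 0 is
reached, that is, when \<open>2 i = n\<close>; there a power has to be replaced by a logarithm.\<close>

lemma radial_power_int_chain:
  assumes "\<And>i. 1 \<le> i \<Longrightarrow> i \<le> N \<Longrightarrow> 2 * i \<noteq> DIM('a::euclidean_space)"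
  shows "\<exists>c. c \<noteq> 0 \<and> (\<forall>\<phi> (i::'a). schwartz \<phi> \<longrightarrow> radial_power_int (2 * real N - real DIM('a)) i ((lap ^^ N) \<phi>) = c * newton_int i \<phi>)"
  using assms
proof (induction N)
  case 0
  show ?case by (intro exI[of _ 1]) (simp add: radial_power_int_def newton_int_def)
next
  case (Suc N)
  then obtain c where c: "c \<noteq> 0" "\<And>\<phi> i::'a. schwartz \<phi> \<Longrightarrow> radial_power_int (2 * real N - real DIM('a)) i ((lap ^^ N) \<phi>) = c * newton_int i \<phi>"
    by (metis le_SucI)
  let ?q = "2 * real N - real DIM('a)"
  have "?q + 2 \<noteq> 0" using Suc.prems[of "Suc N"] by auto
  moreover have "?q + real DIM('a) + 2 \<noteq> 0" by simp
  moreover have "radial_power_int (2 * real (Suc N) - real DIM('a)) i ((lap ^^ Suc N) \<phi>) = ((?q + 2) * (?q + real DIM('a) + 2) * c) * newton_int i \<phi>"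
    if "schwartz \<phi>" for \<phi> and i :: 'a
    using radial_power_int_step[of ?q "(lap ^^ N) \<phi>" i] schwartz_lapN[OF that] c(2)[OF that] by (simp add: algebra_simps)
  ultimately show ?case using c(1) by (intro exI[of _ "(?q + 2) * (?q + real DIM('a) + 2) * c"]) auto
qed

lemma tame_kernel:
  fixes i :: "'a::euclidean_space"
  assumes "tame DIM('a) Q Q1 Q2"
  shows "kernel (\<lambda>y. Q ((norm y)\<^sup>2) * (y \<bullet> i))"
proof -
  have Qm [measurable]: "Q \<in> borel_measurable borel" using assms unfolding tame_def by auto
  obtain A b where Qb: "\<And>t. t > 0 \<Longrightarrow> \<bar>Q t\<bar> \<le> A * tame_bound DIM('a) b t"
    using assms unfolding tame_def by blast
  have "\<bar>Q ((norm y)\<^sup>2) * (y \<bullet> i)\<bar> \<le> kernel_bd (2 * A * norm i) (2 * b + 1 + DIM('a)) y" if "y \<noteq> 0" for y :: 'a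
    using tame_bound_kernel_bd[OF that, where e = 0 and x = "Q ((norm y)\<^sup>2)" and A = A and b = b and u = i] Qb[of "(norm y)\<^sup>2"] that by simp
  then show ?thesis unfolding kernel_def by (intro conjI exI allI impI) auto
qed

lemma inverse_le_tame_bound:
  assumes "n \<ge> 2" and t: "t > 0"
  shows "1 / t \<le> tame_bound n 1 t"
proof (cases "t \<le> 1")
  case True
  have "1 / t = t powr (- 1)" using t by (simp add: powr_minus divide_inverse)
  also have "\<dots> \<le> t powr (- (real n / 2))" using True t assms by (intro powr_mono') auto
  finally show ?thesis using t by (simp add: tame_bound_def)
next
  case False
  then have "1 / t \<le> 1" "1 \<le> t" by auto
  then have "1 / t \<le> t" by linarith
  then show ?thesis using t by (simp add: tame_bound_def add_increasing)
qed

lemma ln_le_tame_bound: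
  assumes "n \<ge> 2" and t: "t > 0"
  shows "\<bar>ln t\<bar> \<le> tame_bound n 1 t"
proof (cases "t \<le> 1")
  case True
  have "ln (1 / t) \<le> 1 / t - 1" using t by (intro ln_le_minus_one) auto
  then have "- ln t \<le> 1 / t" using t by (simp add: ln_div)
  moreover have "ln t \<le> 0" using True t by simp
  ultimately show ?thesis using inverse_le_tame_bound[OF assms] by linarith
next
  case False
  have "ln t \<le> t" using ln_le_minus_one[OF t] by simp
  also have "t \<le> tame_bound n 1 t" by (simp add: tame_bound_def)
  finally show ?thesis using False by simp
qed

lemma tame_ln:
  assumes "n \<ge> 2"
  shows "tame n ln (\<lambda>t. 1 / t) (\<lambda>t. - 1 / t\<^sup>2)"
  unfolding tame_def
proof (intro conjI allI impI exI[of _ "1::real"] exI[of _ "1::nat"])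
  show "continuous_on {0<..} (\<lambda>t::real. - 1 / t\<^sup>2)" by (intro continuous_intros) auto
next
  fix t :: real assume t: "t > 0"
  show "(ln has_real_derivative 1 / t) (at t)" using t by (auto intro!: derivative_eq_intros)
  show "((\<lambda>t. 1 / t) has_real_derivative - 1 / t\<^sup>2) (at t)"
    using t by (auto intro!: derivative_eq_intros simp: power2_eq_square)
  show "\<bar>ln t\<bar> \<le> 1 * tame_bound n 1 t" using ln_le_tame_bound[OF assms t] by simp
  show "\<bar>1 / t\<bar> \<le> 1 * tame_bound n 1 t" "t * \<bar>- 1 / t\<^sup>2\<bar> \<le> 1 * tame_bound n 1 t"
    using inverse_le_tame_bound[OF assms t] t by (auto simp: power2_eq_square)
qed auto

text \<open>The two profiles \<open>ln t\<close> and \<open>t ln t\<close> are needed in even dimension to pass the exponent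
0, at which the step for powers breaks down.\<close>

lemma tame_t_ln:
  assumes "n \<ge> 2"
  shows "tame n (\<lambda>t. t * ln t) (\<lambda>t. ln t + 1) (\<lambda>t. 1 / t)"
proof -
  have one: "1 \<le> tame_bound n 2 t" and tt: "t \<le> tame_bound n 2 t" if t: "t > 0" for t :: real
  proof -
    have "1 \<le> t powr (- (real n / 2))" if "t \<le> 1"
      using powr_mono'[of "- (real n / 2)" 0 t] that t by simp
    moreover have "1 \<le> t\<^sup>2" "t \<le> t\<^sup>2" if "\<not> t \<le> 1" using that one_le_power[of t 2] by (simp_all add: power2_eq_square)
    moreover have "0 \<le> t powr (- (real n / 2))" "0 \<le> t\<^sup>2" by auto
    ultimately show "1 \<le> tame_bound n 2 t" "t \<le> tame_bound n 2 t" unfolding tame_bound_def by (cases "t \<le> 1"; linarith)+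
  qed
  have b12: "tame_bound n 1 t \<le> 2 * tame_bound n 2 t" if t: "t > 0" for t
  proof -
    have "t powr (- (real n / 2)) \<le> tame_bound n 2 t" by (simp add: tame_bound_def)
    then show ?thesis using tt[OF t] zero_le_power2[of t] unfolding tame_bound_def power_one_right distrib_left by linarith
  qed
  show ?thesis
    unfolding tame_def
  proof (intro conjI allI impI exI[of _ "3::real"] exI[of _ "2::nat"])
    show "continuous_on {0<..} (\<lambda>t::real. 1 / t)" by (intro continuous_intros) auto
  next
    fix t :: real assume t: "t > 0"
    show "((\<lambda>t. t * ln t) has_real_derivative ln t + 1) (at t)" using t by (auto intro!: derivative_eq_intros)
    show "((\<lambda>t. ln t + 1) has_real_derivative 1 / t) (at t)" using t by (auto intro!: derivative_eq_intros)
    show "\<bar>t * ln t\<bar> \<le> 3 * tame_bound n 2 t"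
    proof (cases "t \<le> 1")
      case True
      have "ln (1 / t) \<le> 1 / t - 1" using t by (intro ln_le_minus_one) auto
      then have "\<bar>ln t\<bar> \<le> 1 / t" using t True by (simp add: ln_div)
      then have "t * \<bar>ln t\<bar> \<le> t * (1 / t)" using t by (intro mult_left_mono) auto
      then show ?thesis using t one[OF t] by (simp add: abs_mult)
    next
      case False
      have "\<bar>ln t\<bar> \<le> t" using ln_le_minus_one[OF t] False by simp
      then have "t * \<bar>ln t\<bar> \<le> t * t" using t by (intro mult_left_mono) auto
      also have "\<dots> \<le> tame_bound n 2 t" by (simp add: tame_bound_def power2_eq_square)
      finally show ?thesis using t one[OF t] by (simp add: abs_mult)
    qed
    show "\<bar>ln t + 1\<bar> \<le> 3 * tame_bound n 2 t" using ln_le_tame_bound[OF assms t] b12[OF t] one[OF t] by linarith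
    show "t * \<bar>1 / t\<bar> \<le> 3 * tame_bound n 2 t" using t one[OF t] by simp
  qed auto
qed

lemma tame_const: "tame n (\<lambda>t. 1) (\<lambda>t. 0) (\<lambda>t. 0)"
  unfolding tame_def
proof (intro conjI allI impI exI[of _ "1::real"] exI[of _ "0::nat"])
  fix t :: real
  show "\<bar>1\<bar> \<le> 1 * tame_bound n 0 t" by (simp add: tame_bound_def)
qed (auto simp: tame_bound_def)

lemma integral_inner_lap:
  fixes \<phi> :: "'a::euclidean_space \<Rightarrow> real"
  assumes "schwartz \<phi>"
  shows "(\<integral>y. (y \<bullet> i) * lap \<phi> y \<partial>lborel) = 0"
  using green_radial[OF tame_const assms, of i] by simp

text \<open>\<open>|y|^2 y_i\<close> is biharmonic.\<close>

lemma integral_norm2_inner_lap2: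
  fixes \<phi> :: "'a::euclidean_space \<Rightarrow> real"
  assumes "schwartz \<phi>"
  shows "(\<integral>y. (norm y)\<^sup>2 * (y \<bullet> i) * lap (lap \<phi>) y \<partial>lborel) = 0"
proof -
  have "tame DIM('a) (\<lambda>t. t powr 1) (\<lambda>t. 1 * t powr (1 - 1)) (\<lambda>t. 1 * (1 - 1) * t powr (1 - 2))"
    by (rule tame_powr) simp
  from green_radial[OF this schwartz_lap[OF assms], of i]
  have "(\<integral>y. (norm y)\<^sup>2 * (y \<bullet> i) * lap (lap \<phi>) y \<partial>lborel) =
    (\<integral>y. ((2 * real DIM('a) + 4) * ((norm y)\<^sup>2) powr 0) * (y \<bullet> i) * lap \<phi> y \<partial>lborel)" by simp
  also have "\<dots> = (\<integral>y. (2 * real DIM('a) + 4) * ((y \<bullet> i) * lap \<phi> y) \<partial>lborel)"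
  proof (intro Bochner_Integration.integral_cong refl)
    fix y :: 'a
    show "((2 * real DIM('a) + 4) * ((norm y)\<^sup>2) powr 0) * (y \<bullet> i) * lap \<phi> y = (2 * real DIM('a) + 4) * ((y \<bullet> i) * lap \<phi> y)"
      by (cases "y = 0") auto
  qed
  also have "\<dots> = 0" using integral_inner_lap[OF assms, of i] by simp
  finally show ?thesis .
qed

lemma lapN_Suc: "(lap ^^ Suc N) f = lap ((lap ^^ N) f)" by simp

lemma kappa_log_continuous: "continuous_on UNIV (\<lambda>r::real. r\<^sup>2 * ln \<bar>r\<bar>)"
proof -
  have "isCont (\<lambda>r::real. r\<^sup>2 * ln \<bar>r\<bar>) r" for r
  proof (cases "r = 0")
    case True
    have "((\<lambda>r::real. r\<^sup>2 * ln \<bar>r\<bar>) \<longlongrightarrow> 0) (at_right 0)" "((\<lambda>r::real. r\<^sup>2 * ln \<bar>r\<bar>) \<longlongrightarrow> 0) (at_left 0)"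
      by real_asymp+
    then have "((\<lambda>r::real. r\<^sup>2 * ln \<bar>r\<bar>) \<longlongrightarrow> 0) (at 0)" by (simp add: filterlim_split_at)
    then show ?thesis using True by (simp add: isCont_def)
  qed (auto intro!: continuous_intros)
  then show ?thesis by (simp add: continuous_on_eq_continuous_at)
qed

text \<open>For odd \<open>n\<close> the exponents \<open>-n, -n + 2, \<dots>\<close> never meet 0 and the chain ends at 1.  For
even \<open>n\<close> it is stopped at \<open>-2\<close> and continued with \<open>ln |y|^2\<close> and \<open>|y|^2 ln |y|^2\<close>; the harmonic
remainder \<open>y_i\<close> that arises on the way pairs to 0 with a Laplacian.  Homogeneity fails for the logarithm
only by the term \<open>r^2 d(t)\<close>, which the last clause of the conclusion makes harmless.\<close>

theorem radial_kernel_exists: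
  assumes n: "DIM('a::euclidean_space) \<ge> 2"
  shows "\<exists>\<kappa> w d :: real \<Rightarrow> real. \<exists>N c. c \<noteq> 0 \<and>
    continuous_on UNIV \<kappa> \<and> continuous_on UNIV w \<and> continuous_on UNIV d \<and>
    (\<forall>r\<ge>0. \<bar>\<kappa> r\<bar> \<le> (1 + r) ^ 3) \<and> (\<forall>t>0. w t > 0) \<and> w 0 = 0 \<and>
    (\<forall>r>0. \<forall>t\<ge>0. \<kappa> (r * t) = \<kappa> r * w t + r\<^sup>2 * d t) \<and>
    (\<forall>f::'a \<Rightarrow> real. schwartz f \<longrightarrow>
      (\<Sum>i\<in>Basis. \<integral>y. \<kappa> (norm y) * (y \<bullet> i) * (lap ^^ N) (dir_deriv i f) y \<partial>lborel) = c * f 0) \<and>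
    (\<forall>(f::'a \<Rightarrow> real) i j. schwartz f \<longrightarrow>
      (\<integral>y. \<kappa> (norm y) * (y \<bullet> j) * (lap ^^ N) (dir_deriv i f) y \<partial>lborel) =
      (\<integral>y. \<kappa> (norm y) * (y \<bullet> i) * (lap ^^ N) (dir_deriv j f) y \<partial>lborel)) \<and>
    (\<forall>(f::'a \<Rightarrow> real) i. schwartz f \<longrightarrow> (\<integral>y. (norm y)\<^sup>2 * (y \<bullet> i) * (lap ^^ N) f y \<partial>lborel) = 0)"
proof -
  define C0 where "C0 = (\<integral>z. bump (z::'a) \<partial>lborel)"
  have C0: "C0 > 0" unfolding C0_def by (rule bump_integral_pos)
  have main: "(\<Sum>i\<in>Basis. \<integral>y. \<kappa> (norm y) * (y \<bullet> i) * (lap ^^ N) (dir_deriv i f) y \<partial>lborel) = (- c * C0) * f 0 \<and>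
      (\<integral>y. \<kappa> (norm y) * (y \<bullet> j) * (lap ^^ N) (dir_deriv i f) y \<partial>lborel) =
      (\<integral>y. \<kappa> (norm y) * (y \<bullet> i) * (lap ^^ N) (dir_deriv j f) y \<partial>lborel)"
    if \<kappa>: "\<And>\<phi> (i::'a). schwartz \<phi> \<Longrightarrow> (\<integral>y. \<kappa> (norm y) * (y \<bullet> i) * (lap ^^ N) \<phi> y \<partial>lborel) = c * newton_int i \<phi>"
      and f: "schwartz f" for \<kappa> :: "real \<Rightarrow> real" and N c and f :: "'a \<Rightarrow> real" and i j
    using newton_int_div[OF f] newton_int_sym[OF f, of j i]
    by (simp add: \<kappa>[OF schwartz_dir[OF f]] C0_def flip: sum_distrib_left)
  have moment: "(\<integral>y. (norm y)\<^sup>2 * (y \<bullet> i) * (lap ^^ N) f y \<partial>lborel) = 0" if N: "N \<ge> 2" and f: "schwartz f" for N i and f :: "'a \<Rightarrow> real"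
  proof -
    obtain M where M: "N = Suc (Suc M)" using N by (metis Suc_le_D numeral_2_eq_2 Suc_le_mono)
    show ?thesis unfolding M lapN_Suc by (rule integral_norm2_inner_lap2[OF schwartz_lapN[OF f]])
  qed
  show ?thesis
  proof (cases "odd DIM('a)")
    case True
    then obtain p where p: "DIM('a) = 2 * p + 1" by (elim oddE)
    obtain c where c: "c \<noteq> 0" "\<And>\<phi> i::'a. schwartz \<phi> \<Longrightarrow> radial_power_int (2 * real (Suc p) - real DIM('a)) i ((lap ^^ Suc p) \<phi>) = c * newton_int i \<phi>"
      using radial_power_int_chain[where 'a = 'a, of "Suc p"] p by (metis even_mult_iff even_numeral odd_even_add odd_one True)
    have K: "(\<integral>y. \<bar>norm y\<bar> * (y \<bullet> i) * (lap ^^ Suc p) \<phi> y \<partial>lborel) = c * newton_int i \<phi>" if "schwartz \<phi>" for \<phi> and i :: 'a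
    proof -
      have e: "2 * real (Suc p) - real DIM('a) = 1" by (simp add: p)
      have "radial_power_int 1 i ((lap ^^ Suc p) \<phi>) = c * newton_int i \<phi>" using c(2)[OF that, of i] unfolding e .
      then show ?thesis by (simp add: radial_power_int_def del: funpow.simps)
    qed
    show ?thesis
    proof (rule exI[of _ "\<lambda>r. \<bar>r\<bar>"], rule exI[of _ "\<lambda>t. \<bar>t\<bar>"], rule exI[of _ "\<lambda>t. 0"],
        rule exI[of _ "Suc p"], rule exI[of _ "- c * C0"], intro conjI allI impI)
      fix r :: real assume "r \<ge> 0"
      then have "\<bar>r\<bar> \<le> (1 + r) ^ 1" by simp
      also have "\<dots> \<le> (1 + r) ^ 3" using \<open>r \<ge> 0\<close> by (intro power_increasing) auto
      finally show "\<bar>\<bar>r\<bar>\<bar> \<le> (1 + r) ^ 3" by simp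
    qed (use c C0 main[where \<kappa> = "\<lambda>r. \<bar>r\<bar>", OF K] moment[of "Suc p"] n p in \<open>auto intro!: continuous_intros simp: abs_mult simp del: funpow.simps\<close>)
  next
    case False
    then obtain p where p: "DIM('a) = 2 * p" by (auto elim: evenE)
    then have p1: "p \<ge> 1" using n by simp
    obtain c where c: "c \<noteq> 0" "\<And>\<phi> i::'a. schwartz \<phi> \<Longrightarrow> radial_power_int (2 * real (p - 1) - real DIM('a)) i ((lap ^^ (p - 1)) \<phi>) = c * newton_int i \<phi>"
    proof -
      have "2 * i \<noteq> DIM('a)" if "1 \<le> i" "i \<le> p - 1" for i using p p1 that by auto
      from radial_power_int_chain[where 'a = 'a, of "p - 1", OF this] show ?thesis using that by blast
    qed
    let ?n = "real DIM('a)"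
    have L1: "(\<integral>y. ln ((norm y)\<^sup>2) * (y \<bullet> i) * lap \<psi> y \<partial>lborel) = 2 * ?n * radial_power_int (- 2) i \<psi>" if "schwartz \<psi>" for \<psi> and i :: 'a
    proof -
      have "(\<integral>y. ln ((norm y)\<^sup>2) * (y \<bullet> i) * lap \<psi> y \<partial>lborel) =
        (\<integral>y. ((2 * ?n + 4) * (1 / (norm y)\<^sup>2) + 4 * (norm y)\<^sup>2 * (- 1 / ((norm y)\<^sup>2)\<^sup>2)) * (y \<bullet> i) * \<psi> y \<partial>lborel)"
        by (rule green_radial[OF tame_ln[OF n] that])
      also have "\<dots> = (\<integral>y. 2 * ?n * (norm y powr (- 2) * (y \<bullet> i) * \<psi> y) \<partial>lborel)"
      proof (intro Bochner_Integration.integral_cong refl)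
        fix y :: 'a
        show "((2 * ?n + 4) * (1 / (norm y)\<^sup>2) + 4 * (norm y)\<^sup>2 * (- 1 / ((norm y)\<^sup>2)\<^sup>2)) * (y \<bullet> i) * \<psi> y =
          2 * ?n * (norm y powr (- 2) * (y \<bullet> i) * \<psi> y)"
        proof (cases "y = 0")
          case False
          define t where "t = (norm y)\<^sup>2"
          have t: "t \<noteq> 0" using False by (simp add: t_def)
          have a: "norm y powr (- 2) = 1 / t" using False by (simp add: powr_minus divide_inverse t_def)
          have "(2 * ?n + 4) * (1 / t) + 4 * t * (- 1 / t\<^sup>2) = 2 * ?n * (1 / t)"
            using t by (simp add: power2_eq_square field_simps)
          then show ?thesis unfolding t_def[symmetric] a by simp
        qed simp
      qed
      finally show ?thesis by (simp add: radial_power_int_def)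
    qed
    have L2: "(\<integral>y. (norm y)\<^sup>2 * ln ((norm y)\<^sup>2) * (y \<bullet> i) * lap (lap \<psi>) y \<partial>lborel) = (2 * ?n + 4) * (2 * ?n) * radial_power_int (- 2) i \<psi>" if \<psi>: "schwartz \<psi>" for \<psi> and i :: 'a
    proof -
      note l = schwartz_lap[OF \<psi>]
      have i1: "integrable lborel (\<lambda>y. ln ((norm y)\<^sup>2) * (y \<bullet> i) * lap \<psi> y)" by (rule kernel_integrable[OF tame_kernel[OF tame_ln[OF n]] l])
      have i2: "integrable lborel (\<lambda>y. (y \<bullet> i) * lap \<psi> y)" by (rule kernel_integrable[OF poly_growth_kernel[OF poly_growth_inner] l])
      have "(\<integral>y. (norm y)\<^sup>2 * ln ((norm y)\<^sup>2) * (y \<bullet> i) * lap (lap \<psi>) y \<partial>lborel) =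
        (\<integral>y. ((2 * ?n + 4) * (ln ((norm y)\<^sup>2) + 1) + 4 * (norm y)\<^sup>2 * (1 / (norm y)\<^sup>2)) * (y \<bullet> i) * lap \<psi> y \<partial>lborel)"
        by (rule green_radial[OF tame_t_ln[OF n] l])
      also have "\<dots> = (\<integral>y. (2 * ?n + 4) * (ln ((norm y)\<^sup>2) * (y \<bullet> i) * lap \<psi> y) + (2 * ?n + 8) * ((y \<bullet> i) * lap \<psi> y) \<partial>lborel)"
      proof (intro Bochner_Integration.integral_cong refl)
        fix y :: 'a
        show "((2 * ?n + 4) * (ln ((norm y)\<^sup>2) + 1) + 4 * (norm y)\<^sup>2 * (1 / (norm y)\<^sup>2)) * (y \<bullet> i) * lap \<psi> y =
          (2 * ?n + 4) * (ln ((norm y)\<^sup>2) * (y \<bullet> i) * lap \<psi> y) + (2 * ?n + 8) * ((y \<bullet> i) * lap \<psi> y)"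
          by (cases "y = 0") (simp_all add: algebra_simps)
      qed
      also have "\<dots> = (2 * ?n + 4) * (\<integral>y. ln ((norm y)\<^sup>2) * (y \<bullet> i) * lap \<psi> y \<partial>lborel) + (2 * ?n + 8) * (\<integral>y. (y \<bullet> i) * lap \<psi> y \<partial>lborel)"
        using i1 i2 by simp
      finally show ?thesis unfolding L1[OF \<psi>] integral_inner_lap[OF \<psi>] by simp
    qed
    let ?\<kappa> = "\<lambda>r::real. r\<^sup>2 * ln \<bar>r\<bar>"
    \<comment> \<open>the factor 1/2 from \<open>ln |r|\<close> instead of \<open>ln (r^2)\<close> is included\<close>
    let ?c = "(2 * ?n + 4) * ?n * c"
    have K: "(\<integral>y. ?\<kappa> (norm y) * (y \<bullet> i) * (lap ^^ Suc p) \<phi> y \<partial>lborel) = ?c * newton_int i \<phi>" if \<phi>: "schwartz \<phi>" for \<phi> and i :: 'a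
    proof -
      have Np: "(lap ^^ Suc p) \<phi> = lap (lap ((lap ^^ (p - 1)) \<phi>))" using p1 by (cases p) auto
      have "(\<integral>y. ?\<kappa> (norm y) * (y \<bullet> i) * (lap ^^ Suc p) \<phi> y \<partial>lborel) =
        (\<integral>y. (1/2) * ((norm y)\<^sup>2 * ln ((norm y)\<^sup>2) * (y \<bullet> i) * lap (lap ((lap ^^ (p - 1)) \<phi>)) y) \<partial>lborel)"
        unfolding Np
      proof (intro Bochner_Integration.integral_cong refl)
        fix y :: 'a
        show "?\<kappa> (norm y) * (y \<bullet> i) * lap (lap ((lap ^^ (p - 1)) \<phi>)) y =
          (1/2) * ((norm y)\<^sup>2 * ln ((norm y)\<^sup>2) * (y \<bullet> i) * lap (lap ((lap ^^ (p - 1)) \<phi>)) y)"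
          by (cases "y = 0") (simp_all add: ln_realpow)
      qed
      also have "\<dots> = (1/2) * ((2 * ?n + 4) * (2 * ?n) * radial_power_int (- 2) i ((lap ^^ (p - 1)) \<phi>))"
        by (simp only: L2[OF schwartz_lapN[OF \<phi>]] integral_mult_right_zero)
      also have "radial_power_int (- 2) i ((lap ^^ (p - 1)) \<phi>) = c * newton_int i \<phi>"
      proof -
        have "2 * real (p - 1) - real DIM('a) = - 2" using p1 by (simp add: p of_nat_diff)
        then show ?thesis using c(2)[OF \<phi>, of i] by simp
      qed
      finally show ?thesis by simp
    qed
    show ?thesis
    proof (rule exI[of _ ?\<kappa>], rule exI[of _ "\<lambda>t. t\<^sup>2"], rule exI[of _ ?\<kappa>],
        rule exI[of _ "Suc p"], rule exI[of _ "- ?c * C0"], intro conjI allI impI)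
      show "- ?c * C0 \<noteq> 0" using c C0 n by simp
      show "continuous_on UNIV ?\<kappa>" by (rule kappa_log_continuous)
      show "continuous_on UNIV ?\<kappa>" by (rule kappa_log_continuous)
      show "continuous_on UNIV (\<lambda>t::real. t\<^sup>2)" by (intro continuous_intros)
    next
      fix r :: real assume r: "r \<ge> 0"
      show "\<bar>?\<kappa> r\<bar> \<le> (1 + r) ^ 3"
      proof (cases "r = 0")
        case False
        then have r0: "r > 0" using r by simp
        have "r * \<bar>ln r\<bar> \<le> 1 + r\<^sup>2"
        proof (cases "r \<le> 1")
          case True
          have "ln (1 / r) \<le> 1 / r - 1" using r0 by (intro ln_le_minus_one) auto
          then have "\<bar>ln r\<bar> \<le> 1 / r" using r0 True by (simp add: ln_div)
          then have "r * \<bar>ln r\<bar> \<le> r * (1 / r)" using r0 by (intro mult_left_mono) auto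
          then show ?thesis using r0 by (simp add: add_increasing2)
        next
          case False
          have "\<bar>ln r\<bar> \<le> r" using ln_le_minus_one[OF r0] False by simp
          then have "r * \<bar>ln r\<bar> \<le> r * r" using r0 by (intro mult_left_mono) auto
          then show ?thesis by (simp add: power2_eq_square)
        qed
        then have "r * (r * \<bar>ln r\<bar>) \<le> r * (1 + r\<^sup>2)" using r0 by (intro mult_left_mono) auto
        moreover have "\<bar>?\<kappa> r\<bar> = r * (r * \<bar>ln r\<bar>)" using r0 by (simp add: abs_mult power2_eq_square)
        moreover have "r * (1 + r\<^sup>2) \<le> (1 + r) ^ 3" using r0 by (simp add: power2_eq_square power3_eq_cube algebra_simps)
        ultimately show ?thesis by linarith
      qed simp
    next
      fix r t :: real assume r: "r > 0" and t: "t \<ge> 0"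
      show "?\<kappa> (r * t) = ?\<kappa> r * t\<^sup>2 + r\<^sup>2 * ?\<kappa> t"
        using r t by (cases "t = 0") (auto simp: abs_mult ln_mult power_mult_distrib algebra_simps)
    next
      fix f :: "'a \<Rightarrow> real" assume f: "schwartz f"
      show "(\<Sum>i\<in>Basis. \<integral>y. ?\<kappa> (norm y) * (y \<bullet> i) * (lap ^^ Suc p) (dir_deriv i f) y \<partial>lborel) = - ?c * C0 * f 0"
        using main[where \<kappa> = ?\<kappa>, OF K f] by blast
    next
      fix f :: "'a \<Rightarrow> real" and i j :: 'a assume f: "schwartz f"
      show "(\<integral>y. ?\<kappa> (norm y) * (y \<bullet> j) * (lap ^^ Suc p) (dir_deriv i f) y \<partial>lborel) =
        (\<integral>y. ?\<kappa> (norm y) * (y \<bullet> i) * (lap ^^ Suc p) (dir_deriv j f) y \<partial>lborel)"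
        using main[where \<kappa> = ?\<kappa>, OF K f] by blast
    next
      fix f :: "'a \<Rightarrow> real" and i :: 'a assume f: "schwartz f"
      show "(\<integral>y. (norm y)\<^sup>2 * (y \<bullet> i) * (lap ^^ Suc p) f y \<partial>lborel) = 0"
        by (rule moment[OF _ f]) (use p1 in simp)
    qed auto
  qed
qed

section \<open>Convolution with a projected kernel\<close>

text \<open>The exponent 3 accommodates \<open>r^2 ln r\<close>.\<close>

definition admissible :: "(real \<Rightarrow> real) \<Rightarrow> bool" where
  "admissible \<kappa> \<longleftrightarrow> continuous_on UNIV \<kappa> \<and> (\<forall>r\<ge>0. \<bar>\<kappa> r\<bar> \<le> (1 + r) ^ 3)"

text \<open>The matrix \<open>X\<close> is arbitrary here, not only a projection: this makes continuity in \<open>X\<close>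
meaningful on the whole space of matrices.\<close>

definition kernel_conv :: "(real \<Rightarrow> real) \<Rightarrow> real^'n \<Rightarrow> (real^'n \<Rightarrow> real) \<Rightarrow> real^'n^'n \<Rightarrow> real^'n \<Rightarrow> real" where
  "kernel_conv \<kappa> j \<psi> X x = (\<integral>y. \<kappa> (norm (X *v y)) * ((X *v y) \<bullet> j) * \<psi> (x + y) \<partial>lborel)"

lemma bounded_bilinear_mult_vec: "bounded_bilinear ((*v) :: real^'n^'m \<Rightarrow> real^'n \<Rightarrow> real^'m)"
  unfolding bilinear_conv_bounded_bilinear[symmetric] bilinear_def
proof (intro conjI allI)
  fix X :: "real^'n^'m" show "linear ((*v) X)" by simp
next
  fix v :: "real^'n" show "linear (\<lambda>X::real^'n^'m. X *v v)" using bounded_linear_mult_vec by (rule bounded_linear.linear)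
qed

lemma mult_vec_bound: "\<exists>B>0. \<forall>(X::real^'n^'m) v. norm (X *v v) \<le> norm X * norm v * B"
  using bounded_bilinear.pos_bounded[OF bounded_bilinear_mult_vec] by blast

lemma kernel_conv_integrand_measurable:
  fixes X :: "real^'n^'n"
  assumes "admissible \<kappa>" "schwartz \<psi>"
  shows "(\<lambda>y. \<kappa> (norm (X *v y)) * ((X *v y) \<bullet> j) * \<psi> (x + y)) \<in> borel_measurable borel"
proof (rule borel_measurable_continuous_onI)
  have k: "continuous_on UNIV \<kappa>" using assms(1) by (simp add: admissible_def)
  have mv: "continuous_on UNIV ((*v) X)" by (rule linear_continuous_on[OF linear_conv_bounded_linear[THEN iffD1, OF matrix_vector_mul_linear]])
  have s: "continuous_on UNIV (\<lambda>y. \<psi> (x + y))"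
    by (rule smooth_continuous[OF schwartz_smooth[OF schwartz_shift[OF assms(2)]]])
  show "continuous_on UNIV (\<lambda>y. \<kappa> (norm (X *v y)) * ((X *v y) \<bullet> j) * \<psi> (x + y))"
    by (intro continuous_intros s mv continuous_on_compose2[OF k]) auto
qed

text \<open>The kernel grows polynomially and \<open>\<psi>\<close> decays rapidly, uniformly for \<open>X\<close> and \<open>x\<close>
in a bounded set.\<close>

lemma kernel_conv_integrand_bound:
  fixes j :: "real^'n"
  assumes \<kappa>: "admissible \<kappa>" and \<psi>: "schwartz \<psi>"
  shows "\<exists>C. \<forall>(X::real^'n^'n) x y. norm X \<le> K \<and> norm x \<le> K \<longrightarrow>
    \<bar>\<kappa> (norm (X *v y)) * ((X *v y) \<bullet> j) * \<psi> (x + y)\<bar> \<le> C / (1 + norm y) ^ (DIM(real^'n) + 1)"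
proof (cases "K \<ge> 0")
  case False
  then show ?thesis using norm_ge_zero by (metis order_trans)
next
  case K: True
  obtain B where B: "B > 0" "\<And>(X::real^'n^'n) v. norm (X *v v) \<le> norm X * norm v * B" using mult_vec_bound by blast
  let ?N = "DIM(real^'n) + 1"
  obtain D where D: "D \<ge> 0" "\<And>x. \<bar>\<psi> x\<bar> \<le> D / (1 + norm x) ^ (4 + ?N)" using schwartz_bound[OF \<psi>] by blast
  let ?L = "1 + K * B"
  let ?C = "?L ^ 4 * norm j * (D * (1 + K) ^ (4 + ?N))"
  have "\<bar>\<kappa> (norm (X *v y)) * ((X *v y) \<bullet> j) * \<psi> (x + y)\<bar> \<le> ?C / (1 + norm y) ^ ?N"
    if X: "norm X \<le> K" and x: "norm x \<le> K" for X :: "real^'n^'n" and x y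
  proof -
    have L: "?L \<ge> 1" using K B by simp
    have "norm (X *v y) \<le> K * norm y * B"
      by (rule order_trans[OF B(2)]) (use X B K in \<open>intro mult_right_mono, auto\<close>)
    moreover have "K * norm y * B = K * B * norm y" "0 \<le> K * B" "0 \<le> norm y" using K B by auto
    ultimately have le: "1 + norm (X *v y) \<le> ?L * (1 + norm y)"
      unfolding distrib_left distrib_right mult_1 mult_1_right by linarith
    have k: "\<bar>\<kappa> (norm (X *v y))\<bar> \<le> (1 + norm (X *v y)) ^ 3" using \<kappa> by (simp add: admissible_def)
    have "\<bar>\<kappa> (norm (X *v y)) * ((X *v y) \<bullet> j)\<bar> \<le> (1 + norm (X *v y)) ^ 3 * (norm (X *v y) * norm j)"
      unfolding abs_mult by (intro mult_mono k Cauchy_Schwarz_ineq2) auto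
    also have "\<dots> \<le> (1 + norm (X *v y)) ^ 3 * ((1 + norm (X *v y)) * norm j)"
      by (intro mult_left_mono mult_right_mono) auto
    also have "\<dots> = (1 + norm (X *v y)) ^ 4 * norm j" by (simp add: power_Suc numeral_eq_Suc mult_ac)
    also have "\<dots> \<le> (?L * (1 + norm y)) ^ 4 * norm j" using le by (intro mult_right_mono power_mono) auto
    finally have 1: "\<bar>\<kappa> (norm (X *v y)) * ((X *v y) \<bullet> j)\<bar> \<le> ?L ^ 4 * norm j * (1 + norm y) ^ 4"
      by (simp only: power_mult_distrib mult_ac)
    have "norm y \<le> norm (x + y) + norm x" using norm_triangle_ineq4[of "x + y" x] by simp
    then have "norm y \<le> norm (x + y) + K" using x by simp
    moreover have "0 \<le> K * norm (x + y)" using K by simp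
    ultimately have le2: "1 + norm y \<le> (1 + K) * (1 + norm (x + y))"
      unfolding distrib_left distrib_right by linarith
    have p: "1 + norm y > 0" "1 + norm (x + y) > 0" by (rule one_plus_norm_pos)+
    have "\<bar>\<psi> (x + y)\<bar> \<le> D / (1 + norm (x + y)) ^ (4 + ?N)" by (rule D)
    also have "\<dots> \<le> D * (1 + K) ^ (4 + ?N) / (1 + norm y) ^ (4 + ?N)"
    proof -
      have "D / B ^ m \<le> D * L ^ m / A ^ m" if "A > 0" "B > 0" "L \<ge> 0" "A \<le> L * B" for A B L :: real and m
      proof -
        have "A ^ m \<le> L ^ m * B ^ m" using that unfolding power_mult_distrib[symmetric] by (intro power_mono) auto
        then have "D * A ^ m \<le> D * (L ^ m * B ^ m)" using D by (intro mult_left_mono) auto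
        then show ?thesis using that by (simp add: field_simps)
      qed
      from this[OF p _ le2] K show ?thesis by simp
    qed
    finally have 2: "\<bar>\<psi> (x + y)\<bar> \<le> D * (1 + K) ^ (4 + ?N) / (1 + norm y) ^ (4 + ?N)" .
    have "\<bar>\<kappa> (norm (X *v y)) * ((X *v y) \<bullet> j) * \<psi> (x + y)\<bar> \<le>
      (?L ^ 4 * norm j * (1 + norm y) ^ 4) * (D * (1 + K) ^ (4 + ?N) / (1 + norm y) ^ (4 + ?N))"
      unfolding abs_mult[of _ "\<psi> (x + y)"] by (intro mult_mono 1 2) auto
    also have "\<dots> = ?C / (1 + norm y) ^ ?N"
    proof -
      have "(a * A ^ 4) * (b / A ^ (4 + m)) = a * b / A ^ m" if "A > 0" for a b A :: real and m
        using that by (simp add: power_add)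
      from this[OF p(1)] show ?thesis .
    qed
    finally show ?thesis .
  qed
  then show ?thesis by blast
qed

lemma kernel_conv_integrable:
  fixes X :: "real^'n^'n"
  assumes "admissible \<kappa>" "schwartz \<psi>"
  shows "integrable lborel (\<lambda>y. \<kappa> (norm (X *v y)) * ((X *v y) \<bullet> j) * \<psi> (x + y))"
proof -
  obtain C where C: "\<And>X' x' y. norm X' \<le> max (norm X) (norm x) \<and> norm x' \<le> max (norm X) (norm x) \<Longrightarrow>
    \<bar>\<kappa> (norm (X' *v y)) * ((X' *v y) \<bullet> j) * \<psi> (x' + y)\<bar> \<le> C / (1 + norm y) ^ (DIM(real^'n) + 1)"
    using kernel_conv_integrand_bound[OF assms, of "max (norm X) (norm x)" j] by blast
  show ?thesis
  proof (rule Bochner_Integration.integrable_bound[OF integrable_inverse_power[of C]])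
    show "AE y in lborel. norm (\<kappa> (norm (X *v y)) * ((X *v y) \<bullet> j) * \<psi> (x + y)) \<le> norm (C / (1 + norm y) ^ (DIM(real^'n) + 1))"
    proof (rule AE_I2)
      fix y
      show "norm (\<kappa> (norm (X *v y)) * ((X *v y) \<bullet> j) * \<psi> (x + y)) \<le> norm (C / (1 + norm y) ^ (DIM(real^'n) + 1))"
        unfolding real_norm_def by (rule order_trans[OF C abs_ge_self]) auto
    qed
  qed (use kernel_conv_integrand_measurable[OF assms] in simp)
qed

text \<open>Dominated convergence, with a majorant that is uniform on bounded sets of pairs.\<close>

lemma kernel_conv_continuous:
  fixes j :: "real^'n"
  assumes \<kappa>: "admissible \<kappa>" and \<psi>: "schwartz \<psi>"
  shows "continuous_on UNIV (\<lambda>p. kernel_conv \<kappa> j \<psi> (fst p) (snd p))"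
proof -
  have k: "isCont \<kappa> r" for r using \<kappa> by (simp add: admissible_def continuous_on_eq_continuous_at)
  have p: "isCont \<psi> z" for z
    using smooth_continuous[OF schwartz_smooth[OF \<psi>], of UNIV] by (simp add: continuous_on_eq_continuous_at)
  have "isCont (\<lambda>p. kernel_conv \<kappa> j \<psi> (fst p) (snd p)) q" for q
    unfolding continuous_at_sequentially comp_def
  proof (intro allI impI)
    fix s :: "nat \<Rightarrow> (real^'n^'n) \<times> (real^'n)" assume s: "s \<longlonglongrightarrow> q"
    then obtain K where K: "\<And>k. norm (s k) \<le> K" using convergentI convergent_imp_Bseq BseqE by metis
    have K1: "norm (fst (s k)) \<le> K" "norm (snd (s k)) \<le> K" for k
      using K[of k] norm_fst_le[of "fst (s k)" "snd (s k)"] norm_snd_le[of "snd (s k)" "fst (s k)"] by auto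
    obtain C where C: "\<And>X' x' y. norm X' \<le> K \<and> norm x' \<le> K \<Longrightarrow>
      \<bar>\<kappa> (norm (X' *v y)) * ((X' *v y) \<bullet> j) * \<psi> (x' + y)\<bar> \<le> C / (1 + norm y) ^ (DIM(real^'n) + 1)"
      using kernel_conv_integrand_bound[OF assms, of K j] by blast
    show "(\<lambda>k. kernel_conv \<kappa> j \<psi> (fst (s k)) (snd (s k))) \<longlonglongrightarrow> kernel_conv \<kappa> j \<psi> (fst q) (snd q)"
      unfolding kernel_conv_def
    proof (rule integral_dominated_convergence)
      show "integrable lborel (\<lambda>y::real^'n. C / (1 + norm y) ^ (DIM(real^'n) + 1))" by (rule integrable_inverse_power)
      show "AE y in lborel. norm (\<kappa> (norm (fst (s k) *v y)) * ((fst (s k) *v y) \<bullet> j) * \<psi> (snd (s k) + y)) \<le> C / (1 + norm y) ^ (DIM(real^'n) + 1)" for k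
        using C K1 by (intro AE_I2) simp
      show "AE y in lborel. (\<lambda>k. \<kappa> (norm (fst (s k) *v y)) * ((fst (s k) *v y) \<bullet> j) * \<psi> (snd (s k) + y)) \<longlonglongrightarrow>
         \<kappa> (norm (fst q *v y)) * ((fst q *v y) \<bullet> j) * \<psi> (snd q + y)"
      proof (rule AE_I2)
        fix y
        have f: "(\<lambda>k. fst (s k)) \<longlonglongrightarrow> fst q" "(\<lambda>k. snd (s k)) \<longlonglongrightarrow> snd q" using s by (auto intro: tendsto_fst tendsto_snd)
        have mv: "(\<lambda>k. fst (s k) *v y) \<longlonglongrightarrow> fst q *v y"
          by (rule bounded_linear.tendsto[OF bounded_linear_mult_vec f(1)])
        show "(\<lambda>k. \<kappa> (norm (fst (s k) *v y)) * ((fst (s k) *v y) \<bullet> j) * \<psi> (snd (s k) + y)) \<longlonglongrightarrow>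
          \<kappa> (norm (fst q *v y)) * ((fst q *v y) \<bullet> j) * \<psi> (snd q + y)"
          by (intro tendsto_intros mv f isCont_tendsto_compose[OF k] isCont_tendsto_compose[OF p])
      qed
    qed (use kernel_conv_integrand_measurable[OF assms] in simp_all)
  qed
  then show ?thesis by (simp add: continuous_on_eq_continuous_at)
qed

lemma kernel_conv_continuous_point:
  assumes \<kappa>: "admissible \<kappa>" and \<psi>: "schwartz \<psi>"
  shows "continuous_on UNIV (kernel_conv \<kappa> j \<psi> X)"
  using continuous_on_compose2[OF kernel_conv_continuous[OF assms], of UNIV "\<lambda>x. (X, x)" j]
  by (simp add: continuous_on_Pair)

lemma kernel_conv_lincomb:
  assumes "admissible \<kappa>" "\<And>i. i \<in> I \<Longrightarrow> schwartz (\<psi> i)"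
  shows "kernel_conv \<kappa> j (\<lambda>x. \<Sum>i\<in>I. a i * \<psi> i x) X x = (\<Sum>i\<in>I. a i * kernel_conv \<kappa> j (\<psi> i) X x)"
proof -
  have "kernel_conv \<kappa> j (\<lambda>x. \<Sum>i\<in>I. a i * \<psi> i x) X x =
    (\<integral>y. (\<Sum>i\<in>I. a i * (\<kappa> (norm (X *v y)) * ((X *v y) \<bullet> j) * \<psi> i (x + y))) \<partial>lborel)"
    unfolding kernel_conv_def by (intro Bochner_Integration.integral_cong refl) (simp add: sum_distrib_left mult.left_commute)
  also have "\<dots> = (\<Sum>i\<in>I. a i * kernel_conv \<kappa> j (\<psi> i) X x)"
    unfolding kernel_conv_def by (subst Bochner_Integration.integral_sum) (auto intro!: integrable_mult_right kernel_conv_integrable assms)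
  finally show ?thesis .
qed

lemma kernel_conv_dir_deriv:
  assumes \<kappa>: "admissible \<kappa>" and \<psi>: "schwartz \<psi>"
  shows "((\<lambda>t. kernel_conv \<kappa> j \<psi> X (x + t *\<^sub>R u)) has_real_derivative kernel_conv \<kappa> j (dir_deriv u \<psi>) X x) (at 0)"
proof -
  let ?K = "max (norm X) (norm x + norm u)"
  obtain C where C: "\<And>X' x' y. norm X' \<le> ?K \<and> norm x' \<le> ?K \<Longrightarrow>
    \<bar>\<kappa> (norm (X' *v y)) * ((X' *v y) \<bullet> j) * dir_deriv u \<psi> (x' + y)\<bar> \<le> C / (1 + norm y) ^ (DIM(real^'a) + 1)"
    using kernel_conv_integrand_bound[OF \<kappa> schwartz_dir[OF \<psi>], of ?K j] by blast
  have "((\<lambda>t. \<integral>y. \<kappa> (norm (X *v y)) * ((X *v y) \<bullet> j) * \<psi> (x + t *\<^sub>R u + y) \<partial>lborel) has_real_derivative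
    (\<integral>y. \<kappa> (norm (X *v y)) * ((X *v y) \<bullet> j) * dir_deriv u \<psi> (x + 0 *\<^sub>R u + y) \<partial>lborel)) (at 0)"
  proof (rule deriv_under_integral(2)[where g = "\<lambda>y. C / (1 + norm y) ^ (DIM(real^'a) + 1)"
        and f' = "\<lambda>t y. \<kappa> (norm (X *v y)) * ((X *v y) \<bullet> j) * dir_deriv u \<psi> (x + t *\<^sub>R u + y)"])
    fix t :: real and y assume t: "\<bar>t\<bar> < 1"
    have "((\<lambda>t. \<psi> (x + y + t *\<^sub>R u)) has_real_derivative dir_deriv u \<psi> (x + y + t *\<^sub>R u)) (at t)"
      by (rule has_dir_deriv[OF smooth_differentiable[OF schwartz_smooth[OF \<psi>]]])
    from DERIV_cmult[OF this, of "\<kappa> (norm (X *v y)) * ((X *v y) \<bullet> j)"]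
    show "((\<lambda>t. \<kappa> (norm (X *v y)) * ((X *v y) \<bullet> j) * \<psi> (x + t *\<^sub>R u + y)) has_real_derivative
       \<kappa> (norm (X *v y)) * ((X *v y) \<bullet> j) * dir_deriv u \<psi> (x + t *\<^sub>R u + y)) (at t)"
      by (simp only: add_ac)
    have "norm (t *\<^sub>R u) \<le> norm u" using t by (simp add: mult_left_le_one_le)
    then have "norm (x + t *\<^sub>R u) \<le> norm x + norm u" using norm_triangle_ineq[of x "t *\<^sub>R u"] by simp
    then show "\<bar>\<kappa> (norm (X *v y)) * ((X *v y) \<bullet> j) * dir_deriv u \<psi> (x + t *\<^sub>R u + y)\<bar> \<le> C / (1 + norm y) ^ (DIM(real^'a) + 1)"
      by (intro C) auto
  next
    show "integrable lborel (\<lambda>y::real^'a. C / (1 + norm y) ^ (DIM(real^'a) + 1))" by (rule integrable_inverse_power)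
    show "integrable lborel (\<lambda>y. \<kappa> (norm (X *v y)) * ((X *v y) \<bullet> j) * \<psi> (x + t *\<^sub>R u + y))" for t
      by (rule kernel_conv_integrable[OF assms])
  qed
  then show ?thesis by (simp add: kernel_conv_def)
qed

text \<open>The classical criterion, with directional derivatives that are already known to be
linear in the direction: the mean value theorem on the segment from \<open>x\<close> to \<open>y\<close> gives the estimate.\<close>

lemma has_derivative_continuous_partials:
  fixes f :: "'a::euclidean_space \<Rightarrow> real"
  assumes d: "\<And>x u. ((\<lambda>t. f (x + t *\<^sub>R u)) has_real_derivative D u x) (at 0)"
    and lin: "\<And>u x. D u x = (\<Sum>b\<in>Basis. (u \<bullet> b) * D b x)"
    and cont: "\<And>b. b \<in> Basis \<Longrightarrow> continuous_on UNIV (D b)"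
  shows "(f has_derivative (\<lambda>h. D h x)) (at x)"
  unfolding has_derivative_at_alt
proof (intro conjI allI impI)
  have "bounded_linear (\<lambda>u. \<Sum>b\<in>Basis. (u \<bullet> b) * D b x)"
    by (intro bounded_linear_sum bounded_linear_mult_const bounded_linear_inner_left)
  then show "bounded_linear (\<lambda>h. D h x)" by (simp only: lin[symmetric])
  fix e :: real assume e: "e > 0"
  let ?S = "\<lambda>z. \<Sum>b\<in>Basis. \<bar>D b z - D b x\<bar>"
  have "continuous_on UNIV ?S" using cont by (intro continuous_intros) auto
  then have "isCont ?S x" by (simp add: continuous_on_eq_continuous_at)
  then obtain r where r: "r > 0" "\<And>z. dist z x < r \<Longrightarrow> dist (?S z) (?S x) < e"
    using e unfolding continuous_at_eps_delta by metis
  have small: "?S z < e" if "norm (z - x) < r" for z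
    using r(2)[of z] that by (simp add: dist_norm)
  show "\<exists>d>0. \<forall>y. norm (y - x) < d \<longrightarrow> norm (f y - f x - D (y - x) x) \<le> e * norm (y - x)"
  proof (intro exI[of _ r] conjI allI impI r(1))
    fix y assume y: "norm (y - x) < r"
    let ?h = "y - x"
    have dt: "((\<lambda>t. f (x + t *\<^sub>R ?h)) has_real_derivative D ?h (x + t *\<^sub>R ?h)) (at t)" for t
    proof -
      have "((\<lambda>s. f (x + (s + t) *\<^sub>R ?h)) has_real_derivative D ?h (x + t *\<^sub>R ?h)) (at 0)"
        using d[of "x + t *\<^sub>R ?h" ?h] by (simp add: algebra_simps)
      then show ?thesis using DERIV_shift[of "\<lambda>s. f (x + s *\<^sub>R ?h)" "D ?h (x + t *\<^sub>R ?h)" 0 t] by simp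
    qed
    obtain t where t: "0 < t" "t < 1" "f (x + 1 *\<^sub>R ?h) - f (x + 0 *\<^sub>R ?h) = (1 - 0) * D ?h (x + t *\<^sub>R ?h)"
      using MVT2[of 0 1 "\<lambda>t. f (x + t *\<^sub>R ?h)" "\<lambda>t. D ?h (x + t *\<^sub>R ?h)"] dt by auto
    let ?z = "x + t *\<^sub>R ?h"
    have "t * norm ?h \<le> norm ?h" using t by (simp add: mult_left_le_one_le)
    then have z: "norm (?z - x) < r" using y t by simp
    have "f y - f x - D ?h x = D ?h ?z - D ?h x" using t by simp
    also have "\<dots> = (\<Sum>b\<in>Basis. (?h \<bullet> b) * (D b ?z - D b x))"
      unfolding lin[of ?h] by (simp add: right_diff_distrib sum_subtractf)
    finally have "norm (f y - f x - D ?h x) \<le> (\<Sum>b\<in>Basis. \<bar>?h \<bullet> b\<bar> * \<bar>D b ?z - D b x\<bar>)"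
      by (simp add: sum_abs[THEN order_trans] abs_mult[symmetric])
    also have "\<dots> \<le> (\<Sum>b\<in>Basis. norm ?h * \<bar>D b ?z - D b x\<bar>)"
      by (intro sum_mono mult_right_mono Basis_le_norm) auto
    also have "\<dots> = norm ?h * ?S ?z" by (simp add: sum_distrib_left)
    also have "\<dots> \<le> norm ?h * e" using small[OF z] by (intro mult_left_mono) auto
    finally show "norm (f y - f x - D ?h x) \<le> e * norm ?h" by (simp add: mult.commute)
  qed
qed

text \<open>All differentiation falls on the Schwartz factor; the kernel need only be continuous.\<close>

lemma kernel_conv_has_derivative:
  assumes \<kappa>: "admissible \<kappa>" and \<psi>: "schwartz \<psi>"
  shows "kernel_conv \<kappa> j \<psi> X differentiable (at x)" "dir_deriv u (kernel_conv \<kappa> j \<psi> X) = kernel_conv \<kappa> j (dir_deriv u \<psi>) X"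
proof -
  have lin: "kernel_conv \<kappa> j (dir_deriv u \<psi>) X x = (\<Sum>b\<in>Basis. (u \<bullet> b) * kernel_conv \<kappa> j (dir_deriv b \<psi>) X x)" for u x
    unfolding dir_deriv_sum_Basis[OF schwartz_smooth[OF \<psi>], of u]
    by (rule kernel_conv_lincomb[OF \<kappa> schwartz_dir[OF \<psi>]])
  have "(kernel_conv \<kappa> j \<psi> X has_derivative (\<lambda>h. kernel_conv \<kappa> j (dir_deriv h \<psi>) X x)) (at x)"
    by (rule has_derivative_continuous_partials[OF kernel_conv_dir_deriv[OF assms] lin
          kernel_conv_continuous_point[OF \<kappa> schwartz_dir[OF \<psi>]]])
  then show "kernel_conv \<kappa> j \<psi> X differentiable (at x)" by (auto simp: differentiable_def)
  show "dir_deriv u (kernel_conv \<kappa> j \<psi> X) = kernel_conv \<kappa> j (dir_deriv u \<psi>) X"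
    by (rule ext, rule dir_derivI, rule kernel_conv_dir_deriv[OF assms])
qed

lemma iter_deriv_kernel_conv:
  assumes "admissible \<kappa>" "schwartz \<psi>"
  shows "iter_deriv us (kernel_conv \<kappa> j \<psi> X) = kernel_conv \<kappa> j (iter_deriv us \<psi>) X"
  by (induction us) (simp_all add: kernel_conv_has_derivative(2)[OF assms(1) schwartz_iter[OF assms(2)]])

lemma smooth_kernel_conv:
  assumes "admissible \<kappa>" "schwartz \<psi>"
  shows "smooth (kernel_conv \<kappa> j \<psi> X)"
  by (rule smoothI) (simp add: iter_deriv_kernel_conv[OF assms] kernel_conv_has_derivative(1)[OF assms(1) schwartz_iter[OF assms(2)]])

text \<open>The decay of forms is stated with \<open>sqrt (1 + |x|^2)\<close>, which is comparable to \<open>1 + |x|\<close>.\<close>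

lemma schwartz_form_coeff:
  fixes \<alpha> :: "'a::euclidean_space form"
  assumes "\<alpha> \<in> schwartz_forms m"
  shows "schwartz (\<lambda>x. \<alpha> x vs)"
proof (rule schwartzI_Basis)
  show "smooth (\<lambda>x. \<alpha> x vs)" using assms by (simp add: schwartz_forms_def smooth_forms_def)
  fix us :: "'a list" assume us: "set us \<subseteq> Basis"
  show "rapid (iter_deriv us (\<lambda>x. \<alpha> x vs))"
    unfolding rapid_def
  proof
    fix N
    obtain C where C: "\<And>x. \<bar>iter_deriv us (\<lambda>y. \<alpha> y vs) x\<bar> \<le> C / sqrt (1 + (norm x)\<^sup>2) ^ N"
      using assms us by (fastforce simp: schwartz_forms_def)
    have "\<bar>iter_deriv us (\<lambda>x. \<alpha> x vs) x\<bar> * (1 + norm x) ^ N \<le> C * 2 ^ N" for x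
    proof -
      let ?s = "sqrt (1 + (norm x)\<^sup>2)"
      have s: "?s > 0" by (simp add: add_pos_nonneg)
      have "1 \<le> ?s" "norm x \<le> ?s" by (auto intro: real_le_rsqrt)
      then have "1 + norm x \<le> 2 * ?s" by linarith
      then have "(1 + norm x) ^ N \<le> (2 * ?s) ^ N" by (intro power_mono) auto
      then have "\<bar>iter_deriv us (\<lambda>x. \<alpha> x vs) x\<bar> * (1 + norm x) ^ N \<le> (C / ?s ^ N) * (2 * ?s) ^ N"
        by (intro mult_mono C order_trans[OF abs_ge_zero C]) auto
      also have "\<dots> = C * 2 ^ N" using s by (simp add: power_mult_distrib)
      finally show ?thesis .
    qed
    then show "\<exists>C. \<forall>x. \<bar>iter_deriv us (\<lambda>x. \<alpha> x vs) x\<bar> * (1 + norm x) ^ N \<le> C" by blast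
  qed
qed

section \<open>The family of pulled-back forms\<close>

definition lap_deriv :: "nat \<Rightarrow> 'a::euclidean_space \<Rightarrow> ('a \<Rightarrow> real) \<Rightarrow> 'a \<Rightarrow> real" where
  "lap_deriv N i f = (lap ^^ N) (dir_deriv i f)"

lemma lap_lincomb:
  assumes "smooth f" "smooth g"
  shows "lap (\<lambda>x. a * f x + b * g x) = (\<lambda>x. a * lap f x + b * lap g x)"
proof -
  have "lap h = (\<lambda>x. \<Sum>b\<in>Basis. iter_deriv [b, b] h x)" for h :: "'a \<Rightarrow> real" by (simp add: lap_def)
  then show ?thesis
    by (simp only: iter_deriv_lincomb[OF assms]) (simp add: sum.distrib sum_distrib_left)
qed

lemma lapN_lincomb:
  assumes "schwartz f" "schwartz g"
  shows "(lap ^^ N) (\<lambda>x. a * f x + b * g x) = (\<lambda>x. a * (lap ^^ N) f x + b * (lap ^^ N) g x)"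
  by (induction N) (simp_all add: lap_lincomb schwartz_smooth schwartz_lapN assms)

lemma lap_deriv_lincomb:
  assumes "schwartz f" "schwartz g"
  shows "lap_deriv N i (\<lambda>x. a * f x + b * g x) x = a * lap_deriv N i f x + b * lap_deriv N i g x"
proof -
  have "dir_deriv i (\<lambda>x. a * f x + b * g x) = (\<lambda>x. a * dir_deriv i f x + b * dir_deriv i g x)"
    using iter_deriv_lincomb[OF schwartz_smooth[OF assms(1)] schwartz_smooth[OF assms(2)], of "[i]" a b] by simp
  then show ?thesis by (simp add: lap_deriv_def lapN_lincomb schwartz_dir assms)
qed

lemma lap_deriv_zero: "lap_deriv N i (\<lambda>x. 0) x = 0"
  using lap_deriv_lincomb[OF schwartz_zero schwartz_zero, of N i 0 0] by simp

lemma schwartz_lap_deriv: "schwartz f \<Longrightarrow> schwartz (lap_deriv N i f)"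
  by (simp add: lap_deriv_def schwartz_lapN schwartz_dir)

lemma lap_deriv_shift: "lap_deriv N i (\<lambda>y. f (x + y)) y = lap_deriv N i f (x + y)"
  using iter_deriv_shift[of "[i]" f x] lapN_shift[of N "dir_deriv i f" x] by (simp add: lap_deriv_def)

lemma kernel_conv_lincomb2:
  assumes "admissible \<kappa>" "schwartz f" "schwartz g"
  shows "kernel_conv \<kappa> j (\<lambda>x. a * f x + b * g x) X x = a * kernel_conv \<kappa> j f X x + b * kernel_conv \<kappa> j g X x"
  using kernel_conv_lincomb[OF assms(1), of "UNIV :: bool set" "\<lambda>i. if i then f else g" j "\<lambda>i. if i then a else b" X x] assms(2,3)
  by (simp add: UNIV_bool add.commute)

lemma kernel_conv_zero: "kernel_conv \<kappa> j (\<lambda>x. 0) X x = 0" by (simp add: kernel_conv_def)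

lemma wedge_contract_alt: "\<gamma> \<in> alt m \<Longrightarrow> wedge j (contract i \<gamma>) \<in> alt m"
proof (cases m)
  case 0
  assume "\<gamma> \<in> alt m"
  then have "contract i \<gamma> = (\<lambda>vs. 0)" using 0 contract_not_alt_0 by blast
  then have "wedge j (contract i \<gamma>) = (\<lambda>vs. 0)" by (auto simp: wedge_def split: list.splits)
  then show ?thesis by (simp add: alt_zero)
qed (auto intro: wedge_alt contract_alt)

text \<open>The constants \<open>p1\<close> and \<open>p2\<close> are chosen at the very end, to normalise the two means.\<close>

locale form_data =
  fixes m N :: nat and \<kappa> :: "real \<Rightarrow> real" and p1 p2 :: real and \<alpha> :: "(real^'n) form"
  assumes \<kappa>: "admissible \<kappa>" and \<alpha>: "\<alpha> \<in> schwartz_forms m"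
begin

lemma coeff: "schwartz (\<lambda>x. \<alpha> x vs)"
  by (rule schwartz_form_coeff[OF \<alpha>])

lemma \<alpha>_alt: "\<alpha> x \<in> alt m"
  using \<alpha> by (simp add: schwartz_forms_def smooth_forms_def)

definition deriv_form :: "real^'n \<Rightarrow> real^'n \<Rightarrow> (real^'n) list \<Rightarrow> real" where
  "deriv_form i x = (\<lambda>l. lap_deriv N i (\<lambda>z. \<alpha> z l) x)"

text \<open>Linear functionals \<open>a\<close> of the coefficients through which differentiation passes.  They
include evaluation after any contraction and exterior multiplication by constant vectors.\<close>

definition compat :: "(((real^'n) list \<Rightarrow> real) \<Rightarrow> real) \<Rightarrow> bool" where
  "compat a \<longleftrightarrow> schwartz (\<lambda>z. a (\<alpha> z)) \<and> (\<forall>i x. a (deriv_form i x) = lap_deriv N i (\<lambda>z. a (\<alpha> z)) x)"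

lemma compat_eval: "compat (\<lambda>\<theta>. \<theta> l)"
  by (simp add: compat_def coeff deriv_form_def)

lemma compat_zero: "compat (\<lambda>\<theta>. 0)"
  by (simp add: compat_def schwartz_zero lap_deriv_zero)

lemma compat_lincomb: "compat a \<Longrightarrow> compat b \<Longrightarrow> compat (\<lambda>\<theta>. s * a \<theta> + t * b \<theta>)"
  by (simp add: compat_def schwartz_lincomb lap_deriv_lincomb)

lemma compat_cmult: "compat a \<Longrightarrow> compat (\<lambda>\<theta>. s * a \<theta>)"
  using compat_lincomb[of a a s 0] by simp

lemma compat_diff: "compat a \<Longrightarrow> compat b \<Longrightarrow> compat (\<lambda>\<theta>. a \<theta> - b \<theta>)"
  using compat_lincomb[of a b 1 "-1"] by simp

lemma compat_sum: "finite I \<Longrightarrow> (\<And>i. i \<in> I \<Longrightarrow> compat (a i)) \<Longrightarrow> compat (\<lambda>\<theta>. \<Sum>i\<in>I. a i \<theta>)"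
proof (induction I rule: finite_induct)
  case (insert i I)
  then show ?case using compat_lincomb[of "a i" "\<lambda>\<theta>. \<Sum>i\<in>I. a i \<theta>" 1 1] by simp
qed (simp add: compat_zero)

lemma compat_contract_wedge: "compat (\<lambda>\<theta>. contract j (wedge i \<theta>) vs)"
  unfolding contract_def wedge_def list.case
  by (intro compat_diff compat_cmult compat_eval compat_sum) simp

lemma compat_wedge_contract: "compat (\<lambda>\<theta>. wedge j (contract i \<theta>) vs)"
proof (cases vs)
  case Nil
  then show ?thesis by (simp add: wedge_def compat_zero)
next
  case (Cons v us)
  show ?thesis
    unfolding Cons contract_def wedge_def list.case
    by (intro compat_diff compat_cmult compat_eval compat_sum) simp
qed

lemma deriv_form_alt: "deriv_form i x \<in> alt m"
proof (rule altI)
  fix vs :: "(real^'n) list" assume "length vs \<noteq> m"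
  then have "(\<lambda>z. \<alpha> z vs) = (\<lambda>z. 0)" using alt_length[OF \<alpha>_alt] by auto
  then show "deriv_form i x vs = 0" by (simp add: deriv_form_def lap_deriv_zero)
next
  fix vs :: "(real^'n) list" and l u v a b
  assume "length vs = m" "l < m"
  then have "(\<lambda>z. \<alpha> z (vs[l := a *\<^sub>R u + b *\<^sub>R v])) = (\<lambda>z. a * \<alpha> z (vs[l := u]) + b * \<alpha> z (vs[l := v]))"
    using alt_linear[OF \<alpha>_alt] by auto
  then show "deriv_form i x (vs[l := a *\<^sub>R u + b *\<^sub>R v]) = a * deriv_form i x (vs[l := u]) + b * deriv_form i x (vs[l := v])"
    by (simp add: deriv_form_def lap_deriv_lincomb coeff)
next
  fix vs :: "(real^'n) list" and l l'
  assume "length vs = m" "l < l'" "l' < m" "vs ! l = vs ! l'"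
  then have "(\<lambda>z. \<alpha> z vs) = (\<lambda>z. 0)" using alt_repeat[OF \<alpha>_alt, of vs l l'] by auto
  then show "deriv_form i x vs = 0" by (simp add: deriv_form_def lap_deriv_zero)
qed

text \<open>The part of the integrand of \<open>F\<close> that multiplies the component \<open>j\<close> of the kernel.\<close>

definition U :: "real^'n \<Rightarrow> (real^'n) form" where
  "U j x = (\<lambda>vs. \<Sum>i\<in>Basis. p1 * contract j (wedge i (deriv_form i x)) vs + p2 * wedge j (contract i (deriv_form i x)) vs)"

lemma U_alt: "U j x \<in> alt m"
  unfolding U_def
  by (intro alt_sum alt_lincomb contract_alt wedge_alt wedge_contract_alt deriv_form_alt)

lemma U_schwartz: "schwartz (\<lambda>x. U j x vs)"
proof -
  have 1: "schwartz (\<lambda>x. contract j (wedge i (deriv_form i x)) vs)" for i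
    using compat_contract_wedge[of j i vs] by (simp add: compat_def schwartz_lap_deriv)
  have 2: "schwartz (\<lambda>x. wedge j (contract i (deriv_form i x)) vs)" for i
    using compat_wedge_contract[of j i vs] by (simp add: compat_def schwartz_lap_deriv)
  show ?thesis
    unfolding U_def
    using schwartz_sum[of Basis "\<lambda>i x. p1 * contract j (wedge i (deriv_form i x)) vs + p2 * wedge j (contract i (deriv_form i x)) vs" "\<lambda>_. 1"]
    by (simp add: schwartz_lincomb 1 2)
qed

text \<open>Only the arguments of \<open>U\<close> and the kernel are projected, not the base point: the convolution
itself makes the result constant along the null space of \<open>X\<close>.\<close>

definition F :: "real^'n^'n \<Rightarrow> (real^'n) form" where
  "F X x vs = (\<Sum>j\<in>Basis. kernel_conv \<kappa> j (\<lambda>z. U j z (map ((*v) X) vs)) X x)"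

lemma F_alt: "F X x \<in> alt m"
proof (rule altI)
  fix vs :: "(real^'n) list" assume "length vs \<noteq> m"
  then show "F X x vs = 0" by (simp add: F_def alt_length[OF U_alt] kernel_conv_zero)
next
  fix vs :: "(real^'n) list" and l u v a b
  assume "length vs = m" "l < m"
  then show "F X x (vs[l := a *\<^sub>R u + b *\<^sub>R v]) = a * F X x (vs[l := u]) + b * F X x (vs[l := v])"
    by (simp add: F_def map_update matrix_vector_right_distrib matrix_vector_mult_scaleR alt_linear[OF U_alt]
        kernel_conv_lincomb2[OF \<kappa> U_schwartz U_schwartz] sum.distrib sum_distrib_left)
next
  fix vs :: "(real^'n) list" and l l'
  assume vs: "length vs = m" "l < l'" "l' < m" "vs ! l = vs ! l'"
  have "U j z (map ((*v) X) vs) = 0" for j z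
    by (rule alt_repeat[OF U_alt, of _ l l']) (use vs in auto)
  then show "F X x vs = 0" by (simp add: F_def kernel_conv_zero)
qed

lemma iter_deriv_F:
  "iter_deriv us (\<lambda>x. F X x vs) = (\<lambda>x. \<Sum>j\<in>Basis. kernel_conv \<kappa> j (iter_deriv us (\<lambda>z. U j z (map ((*v) X) vs))) X x)"
  using iter_deriv_sum[of Basis "\<lambda>j. kernel_conv \<kappa> j (\<lambda>z. U j z (map ((*v) X) vs)) X" us "\<lambda>_. 1"]
  by (simp add: F_def smooth_kernel_conv[OF \<kappa> U_schwartz] iter_deriv_kernel_conv[OF \<kappa> U_schwartz])

lemma F_smooth: "smooth (\<lambda>x. F X x vs)"
  using smooth_sum[of Basis "\<lambda>j. kernel_conv \<kappa> j (\<lambda>z. U j z (map ((*v) X) vs)) X" "\<lambda>_. 1"]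
  by (simp add: F_def smooth_kernel_conv[OF \<kappa> U_schwartz])

lemma F_smooth_form: "F X \<in> smooth_forms UNIV m"
  by (simp add: smooth_forms_def F_alt F_smooth)

text \<open>The derivatives of \<open>F\<close> as polynomials in the matrix \<open>X\<close> times convolutions of fixed
Schwartz functions, from which joint continuity in \<open>X\<close> and \<open>x\<close> is read off.\<close>

lemma iter_deriv_F_expand:
  assumes "length vs = m"
  shows "iter_deriv us (\<lambda>x. F X x vs) x =
    (\<Sum>j\<in>Basis. \<Sum>bs\<in>basis_lists Basis m. coord (map ((*v) X) vs) bs * kernel_conv \<kappa> j (iter_deriv us (\<lambda>z. U j z bs)) X x)"
  unfolding iter_deriv_F
proof (rule sum.cong[OF refl])
  fix j :: "real^'n"
  have "(\<lambda>z. U j z (map ((*v) X) vs)) = (\<lambda>z. \<Sum>bs\<in>basis_lists Basis m. coord (map ((*v) X) vs) bs * U j z bs)"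
    by (rule ext, rule alt_expand[OF U_alt]) (simp_all add: assms euclidean_representation)
  then have "iter_deriv us (\<lambda>z. U j z (map ((*v) X) vs)) =
     (\<lambda>z. \<Sum>bs\<in>basis_lists Basis m. coord (map ((*v) X) vs) bs * iter_deriv us (\<lambda>z. U j z bs) z)"
    by (simp only: iter_deriv_sum[OF schwartz_smooth[OF U_schwartz]])
  then show "kernel_conv \<kappa> j (iter_deriv us (\<lambda>z. U j z (map ((*v) X) vs))) X x =
     (\<Sum>bs\<in>basis_lists Basis m. coord (map ((*v) X) vs) bs * kernel_conv \<kappa> j (iter_deriv us (\<lambda>z. U j z bs)) X x)"
    by (simp only: kernel_conv_lincomb[OF \<kappa> schwartz_iter[OF U_schwartz]])
qed

lemma iter_deriv_F_continuous:
  "continuous_on UNIV (\<lambda>p. iter_deriv us (\<lambda>x. F (fst p) x vs) (snd p))"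
proof (cases "length vs = m")
  case True
  show ?thesis
    unfolding iter_deriv_F_expand[OF True]
    by (intro continuous_intros kernel_conv_continuous[OF \<kappa> schwartz_iter[OF U_schwartz]]
        continuous_on_compose2[OF coord_map_continuous[where S = UNIV]]) auto
next
  case False
  then show ?thesis by (simp add: alt_length[OF F_alt] iter_deriv_zero)
qed

text \<open>The vector \<open>x - X x\<close> lies in the null space of \<open>X\<close>; translating the integration variable
\<open>y\<close> by it does not change \<open>X y\<close> and moves the base point from \<open>X x\<close> to \<open>x\<close>.\<close>

lemma F_projection:
  assumes X: "X ** X = X"
  shows "F X (X *v x) (map ((*v) X) vs) = F X x vs"
  unfolding F_def
proof (rule sum.cong[OF refl])
  fix j :: "real^'n"
  let ?\<psi> = "\<lambda>z. U j z (map ((*v) X) vs)"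
  have XX: "X *v (X *v v) = X *v v" for v using X by (simp add: matrix_vector_mul_assoc)
  then have m: "map ((*v) X) (map ((*v) X) vs) = map ((*v) X) vs" by simp
  have "kernel_conv \<kappa> j ?\<psi> X (X *v x) =
     (\<integral>y. \<kappa> (norm (X *v ((x - X *v x) + y))) * ((X *v ((x - X *v x) + y)) \<bullet> j) * ?\<psi> (X *v x + ((x - X *v x) + y)) \<partial>lborel)"
    unfolding kernel_conv_def
    by (rule lborel_translate[symmetric, OF kernel_conv_integrand_measurable[OF \<kappa> U_schwartz]])
  also have "\<dots> = kernel_conv \<kappa> j ?\<psi> X x"
    unfolding kernel_conv_def
  proof (intro Bochner_Integration.integral_cong refl)
    fix y
    have "X *v ((x - X *v x) + y) = X *v y"
      by (simp add: matrix_vector_right_distrib matrix_vector_mult_diff_distrib XX)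
    moreover have "X *v x + ((x - X *v x) + y) = x + y" by simp
    ultimately show "\<kappa> (norm (X *v ((x - X *v x) + y))) * ((X *v ((x - X *v x) + y)) \<bullet> j) * ?\<psi> (X *v x + ((x - X *v x) + y)) =
       \<kappa> (norm (X *v y)) * ((X *v y) \<bullet> j) * ?\<psi> (x + y)" by simp
  qed
  finally show "kernel_conv \<kappa> j (\<lambda>z. U j z (map ((*v) X) (map ((*v) X) vs))) X (X *v x) = kernel_conv \<kappa> j ?\<psi> X x"
    unfolding m .
qed

end

section \<open>Averaging the family recovers the form\<close>

definition is_proj :: "nat \<Rightarrow> real^'n^'n \<Rightarrow> bool" where
  "is_proj k X \<longleftrightarrow> transpose X = X \<and> X ** X = X \<and> dim (range ((*v) X)) = k"

text \<open>A crude bound on the entries is enough: it confines the projections to a fixed ball.\<close>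

lemma contraction_norm_bound:
  fixes X :: "real^'n^'n"
  assumes X: "\<And>v. norm (X *v v) \<le> norm v"
  shows "norm X \<le> real CARD('n) * real CARD('n)"
proof -
  have "\<bar>X $ i $ j\<bar> \<le> 1" for i j
  proof -
    have "X $ i $ j = (X *v axis j 1) $ i" by (subst matrix_vector_mul_component) (rule cart_eq_inner_axis)
    also have "\<bar>\<dots>\<bar> \<le> norm (X *v axis j 1)" by (rule component_le_norm_cart)
    also have "\<dots> \<le> norm (axis j (1::real) :: real^'n)" by (rule X)
    finally show ?thesis by simp
  qed
  then have "norm (X $ i) \<le> real CARD('n)" for i
    by (intro order_trans[OF norm_le_l1_cart]) (metis (no_types, lifting) sum_bounded_above of_nat_mult mult.right_neutral real_norm_def)
  then have "(\<Sum>i\<in>UNIV. norm (X $ i)) \<le> real CARD('n) * real CARD('n)"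
    by (metis (no_types, lifting) sum_bounded_above)
  moreover have "norm X \<le> (\<Sum>i\<in>UNIV. norm (X $ i))" unfolding norm_vec_def by (rule L2_set_le_sum) simp
  ultimately show ?thesis by linarith
qed

lemma projection_norm_bound:
  fixes X :: "real^'n^'n"
  assumes "is_proj k X"
  shows "norm X \<le> real CARD('n) * real CARD('n)"
  by (rule contraction_norm_bound, rule projection_norm_le) (use assms in \<open>auto simp: is_proj_def\<close>)

lemma coord_map_bound:
  assumes "\<And>v. norm (f v) \<le> norm v" "bs \<in> basis_lists Basis (length vs)"
  shows "\<bar>coord (map f vs) bs\<bar> \<le> prod_list (map norm vs)"
  using coord_bound[of bs "map f vs"] prod_list_norm_mono[of f vs] assms by (auto simp: basis_lists_def)

lemma continuous_weight: "continuous_on UNIV w \<Longrightarrow> weight w"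
  unfolding weight_def
proof (intro conjI)
  assume w: "continuous_on UNIV w"
  then show "w \<in> borel_measurable borel" by (rule borel_measurable_continuous_onI)
  have "compact (w ` {0..1})" by (intro compact_continuous_image continuous_on_subset[OF w]) auto
  then have "bounded (w ` {0..1})" by (rule compact_imp_bounded)
  then show "\<exists>W. \<forall>t\<in>{0..1}. \<bar>w t\<bar> \<le> W" unfolding bounded_iff by auto
qed

context random_projection
begin

lemma AE_is_proj: "AE X in \<mu>. is_proj k X"
  using proj by (simp add: is_proj_def)

text \<open>Projections have bounded norm, so one integrable majorant in \<open>y\<close> serves for almost all
\<open>X\<close>.\<close>

lemma kernel_conv_Fubini:
  fixes p :: "real^'n^'n \<Rightarrow> real"
  assumes \<kappa>: "admissible \<kappa>" and \<psi>: "schwartz \<psi>" and pc: "continuous_on UNIV p"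
    and pb: "\<And>X. is_proj k X \<Longrightarrow> \<bar>p X\<bar> \<le> B"
  shows "integrable (\<mu> \<Otimes>\<^sub>M lborel) (\<lambda>(X, y). p X * (\<kappa> (norm (X *v y)) * ((X *v y) \<bullet> j) * \<psi> (x + y)))"
proof -
  let ?f = "\<lambda>X y. p X * (\<kappa> (norm (X *v y)) * ((X *v y) \<bullet> j) * \<psi> (x + y))"
  interpret pair_sigma_finite \<mu> "lborel :: (real^'n) measure"
    by (intro pair_sigma_finite.intro lborel.sigma_finite_measure_axioms sigma_finite_measure_axioms)
  have k: "continuous_on UNIV \<kappa>" using \<kappa> by (simp add: admissible_def)
  have mv: "continuous_on UNIV (\<lambda>z::(real^'n^'n) \<times> (real^'n). fst z *v snd z)"
    by (intro bounded_bilinear.continuous_on[OF bounded_bilinear_mult_vec] continuous_intros)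
  have "continuous_on UNIV (\<lambda>z::(real^'n^'n) \<times> (real^'n). ?f (fst z) (snd z))"
    by (intro continuous_intros continuous_on_compose2[OF pc] continuous_on_compose2[OF k] mv
        continuous_on_compose2[OF smooth_continuous[OF schwartz_smooth[OF \<psi>], of UNIV]]) auto
  then have "(\<lambda>z::(real^'n^'n) \<times> (real^'n). ?f (fst z) (snd z)) \<in> borel_measurable borel"
    by (rule borel_measurable_continuous_onI)
  then have meas: "(\<lambda>z. ?f (fst z) (snd z)) \<in> borel_measurable (\<mu> \<Otimes>\<^sub>M lborel)"
    by (subst measurable_cong_sets[of _ borel _ borel]) (auto simp: borel_prod[symmetric] intro!: sets_pair_measure_cong)
  let ?K = "max (real CARD('n) * real CARD('n)) (norm x)"
  obtain C where C: "\<And>X x' y. norm X \<le> ?K \<and> norm x' \<le> ?K \<Longrightarrow>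
    \<bar>\<kappa> (norm (X *v y)) * ((X *v y) \<bullet> j) * \<psi> (x' + y)\<bar> \<le> C / (1 + norm y) ^ (DIM(real^'n) + 1)"
    using kernel_conv_integrand_bound[OF \<kappa> \<psi>, of ?K j] by blast
  let ?h = "\<lambda>y::real^'n. B * (C / (1 + norm y) ^ (DIM(real^'n) + 1))"
  have hi: "integrable lborel ?h" by (intro integrable_mult_right integrable_inverse_power)
  have fb: "\<bar>?f X y\<bar> \<le> ?h y" if X: "is_proj k X" for X y
  proof -
    have "norm X \<le> ?K" using projection_norm_bound[OF X] by simp
    then have "\<bar>\<kappa> (norm (X *v y)) * ((X *v y) \<bullet> j) * \<psi> (x + y)\<bar> \<le> C / (1 + norm y) ^ (DIM(real^'n) + 1)" by (intro C) auto
    then show ?thesis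
      using pb[OF X] unfolding abs_mult[of "p X"] by (intro mult_mono) auto
  qed
  have fi: "integrable lborel (?f X)" for X by (intro integrable_mult_right kernel_conv_integrable \<kappa> \<psi>)
  have "integrable (\<mu> \<Otimes>\<^sub>M lborel) (\<lambda>z. ?f (fst z) (snd z))"
  proof (rule Fubini_integrable[OF meas])
    show "integrable \<mu> (\<lambda>X. \<integral>y. norm (?f (fst (X, y)) (snd (X, y))) \<partial>lborel)"
    proof (rule integrable_const_bound)
      show "(\<lambda>X. \<integral>y. norm (?f (fst (X, y)) (snd (X, y))) \<partial>lborel) \<in> borel_measurable \<mu>"
        using meas by (intro lborel.borel_measurable_lebesgue_integral) (simp add: case_prod_beta')
      show "AE X in \<mu>. norm (\<integral>y. norm (?f (fst (X, y)) (snd (X, y))) \<partial>lborel) \<le> (\<integral>y. ?h y \<partial>lborel)"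
        using AE_is_proj
      proof eventually_elim
        case (elim X)
        have "norm (\<integral>y. norm (?f X y) \<partial>lborel) = (\<integral>y. norm (?f X y) \<partial>lborel)" by simp
        also have "\<dots> \<le> (\<integral>y. ?h y \<partial>lborel)"
          by (intro integral_mono integrable_norm fi hi) (use fb[OF elim] in auto)
        finally show ?case by simp
      qed
    qed
    show "AE X in \<mu>. integrable lborel (\<lambda>y. ?f (fst (X, y)) (snd (X, y)))" using fi by simp
  qed
  then show ?thesis by (simp add: case_prod_beta')
qed

end

locale averaging = random_projection \<mu> k + form_data m N \<kappa> p1 p2 \<alpha>
  for \<mu> :: "(real^'n^'n) measure" and k m N \<kappa> p1 p2 and \<alpha> :: "(real^'n) form"
begin

definition integrand :: "real^'n \<Rightarrow> (real^'n) list \<Rightarrow> real^'n^'n \<Rightarrow> real^'n \<Rightarrow> real" where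
  "integrand x vs X y = \<kappa> (norm (X *v y)) * (\<Sum>i\<in>Basis.
      p1 * contract (X *v y) (wedge i (deriv_form i (x + y))) (map ((*v) X) vs) +
      p2 * wedge (X *v y) (contract i (deriv_form i (x + y))) (map ((*v) X) vs))"

lemma integrand_expand:
  assumes "length vs = m"
  shows "integrand x vs X y = (\<Sum>j\<in>Basis. \<Sum>bs\<in>basis_lists Basis m. coord (map ((*v) X) vs) bs *
     (\<kappa> (norm (X *v y)) * ((X *v y) \<bullet> j) * U j (x + y) bs))"
    and "integrand x vs X y = (\<Sum>j\<in>Basis. \<kappa> (norm (X *v y)) * ((X *v y) \<bullet> j) * U j (x + y) (map ((*v) X) vs))"
proof -
  let ?l = "map ((*v) X) vs" and ?u = "X *v y"
  have c: "contract ?u (wedge i (deriv_form i z)) ?l = (\<Sum>j\<in>Basis. (?u \<bullet> j) * contract j (wedge i (deriv_form i z)) ?l)" for i z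
    by (rule contract_sum_Basis[OF wedge_alt[OF deriv_form_alt]])
  have w: "wedge ?u (contract i (deriv_form i z)) ?l = (\<Sum>j\<in>Basis. (?u \<bullet> j) * wedge j (contract i (deriv_form i z)) ?l)" for i z
    by (rule wedge_sum_Basis)
  have "(\<Sum>i\<in>Basis. p1 * contract ?u (wedge i (deriv_form i (x + y))) ?l + p2 * wedge ?u (contract i (deriv_form i (x + y))) ?l) =
     (\<Sum>i\<in>Basis. \<Sum>j\<in>Basis. (?u \<bullet> j) * (p1 * contract j (wedge i (deriv_form i (x + y))) ?l + p2 * wedge j (contract i (deriv_form i (x + y))) ?l))"
    unfolding c w sum_distrib_left sum.distrib[symmetric] by (intro sum.cong refl) (simp add: algebra_simps)
  also have "\<dots> = (\<Sum>j\<in>Basis. (?u \<bullet> j) * U j (x + y) ?l)"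
    unfolding U_def sum_distrib_left by (rule sum.swap)
  finally show 2: "integrand x vs X y = (\<Sum>j\<in>Basis. \<kappa> (norm ?u) * (?u \<bullet> j) * U j (x + y) ?l)"
    by (simp add: integrand_def sum_distrib_left mult.assoc)
  show "integrand x vs X y = (\<Sum>j\<in>Basis. \<Sum>bs\<in>basis_lists Basis m. coord ?l bs * (\<kappa> (norm ?u) * (?u \<bullet> j) * U j (x + y) bs))"
    unfolding 2
  proof (rule sum.cong[OF refl])
    fix j :: "real^'n"
    have "U j (x + y) ?l = (\<Sum>bs\<in>basis_lists Basis m. coord ?l bs * U j (x + y) bs)"
      by (rule alt_expand[OF U_alt]) (simp_all add: assms euclidean_representation)
    then show "\<kappa> (norm ?u) * (?u \<bullet> j) * U j (x + y) ?l = (\<Sum>bs\<in>basis_lists Basis m. coord ?l bs * (\<kappa> (norm ?u) * (?u \<bullet> j) * U j (x + y) bs))"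
      by (simp add: sum_distrib_left mult_ac)
  qed
qed

lemma F_integrand:
  assumes "length vs = m"
  shows "F X x vs = (\<integral>y. integrand x vs X y \<partial>lborel)"
  unfolding F_def kernel_conv_def integrand_expand(2)[OF assms]
  by (rule Bochner_Integration.integral_sum[symmetric]) (rule kernel_conv_integrable[OF \<kappa> U_schwartz])

lemma integrand_Fubini:
  assumes "length vs = m"
  shows "integrable \<mu> (\<lambda>X. F X x vs)"
    and "(\<integral>X. F X x vs \<partial>\<mu>) = (\<integral>y. (\<integral>X. integrand x vs X y \<partial>\<mu>) \<partial>lborel)"
proof -
  interpret pair_sigma_finite \<mu> "lborel :: (real^'n) measure"
    by (intro pair_sigma_finite.intro lborel.sigma_finite_measure_axioms sigma_finite_measure_axioms)
  have "integrable (\<mu> \<Otimes>\<^sub>M lborel) (\<lambda>(X, y). coord (map ((*v) X) vs) bs * (\<kappa> (norm (X *v y)) * ((X *v y) \<bullet> j) * U j (x + y) bs))"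
    if "bs \<in> basis_lists Basis m" for j bs
  proof (rule kernel_conv_Fubini[OF \<kappa> U_schwartz coord_map_continuous])
    fix X :: "real^'n^'n" assume X: "is_proj k X"
    show "\<bar>coord (map ((*v) X) vs) bs\<bar> \<le> prod_list (map norm vs)"
      using X that assms by (intro coord_map_bound projection_norm_le) (auto simp: is_proj_def)
  qed
  then have "integrable (\<mu> \<Otimes>\<^sub>M lborel) (\<lambda>z. \<Sum>j\<in>Basis. \<Sum>bs\<in>basis_lists Basis m. (\<lambda>(X, y). coord (map ((*v) X) vs) bs * (\<kappa> (norm (X *v y)) * ((X *v y) \<bullet> j) * U j (x + y) bs)) z)"
    by (intro Bochner_Integration.integrable_sum)
  then have I: "integrable (\<mu> \<Otimes>\<^sub>M lborel) (\<lambda>(X, y). integrand x vs X y)"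
    by (simp add: integrand_expand(1)[OF assms] case_prod_beta')
  from integrable_fst'[OF I] show "integrable \<mu> (\<lambda>X. F X x vs)"
    by (simp add: F_integrand[OF assms])
  show "(\<integral>X. F X x vs \<partial>\<mu>) = (\<integral>y. (\<integral>X. integrand x vs X y \<partial>\<mu>) \<partial>lborel)"
    using Fubini_integral[OF I] by (simp add: F_integrand[OF assms])
qed

text \<open>Write \<open>y = r e\<close> and split \<open>\<kappa>(|X y|) = \<kappa>(r) w(|X e|) + r^2 d(|X e|)\<close>.  Contraction
by \<open>X y\<close> followed by the pullback is the pullback followed by contraction by \<open>y\<close>, so both means are known.\<close>

lemma average_contract:
  assumes w: "continuous_on UNIV w" "continuous_on UNIV d"
    and scal: "\<And>r t. r > 0 \<Longrightarrow> t \<ge> 0 \<Longrightarrow> \<kappa> (r * t) = \<kappa> r * w t + r\<^sup>2 * d t"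
    and c: "\<And>e \<Omega> vs. norm e = 1 \<Longrightarrow> \<Omega> \<in> alt (Suc q) \<Longrightarrow> avg \<mu> w e \<Omega> (e # vs) = c * \<Omega> (e # vs)"
    and c': "\<And>e \<Omega> vs. norm e = 1 \<Longrightarrow> \<Omega> \<in> alt (Suc q) \<Longrightarrow> avg \<mu> d e \<Omega> (e # vs) = c' * \<Omega> (e # vs)"
    and \<Omega>: "\<Omega> \<in> alt (Suc q)"
  shows "has_bochner_integral \<mu> (\<lambda>X. \<kappa> (norm (X *v y)) * contract (X *v y) \<Omega> (map ((*v) X) vs))
     ((c * \<kappa> (norm y) + c' * (norm y)\<^sup>2) * contract y \<Omega> vs)"
proof (cases "y = 0")
  case True
  have "\<Omega> (0 # l) = 0" for l using linear_0[OF alt_Cons_linear[OF \<Omega>]] .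
  then show ?thesis using True by (simp add: contract_def has_bochner_integral_zero)
next
  case False
  let ?r = "norm y" and ?e = "y /\<^sub>R norm y"
  have r: "?r > 0" and e: "norm ?e = 1" and y: "y = ?r *\<^sub>R ?e" using False by auto
  have lin: "\<Omega> ((?r *\<^sub>R u) # l) = ?r * \<Omega> (u # l)" for u l
    using linear_cmul[OF alt_Cons_linear[OF \<Omega>]] by simp
  have eq: "\<kappa> (norm (X *v y)) * contract (X *v y) \<Omega> (map ((*v) X) vs) =
     ?r * \<kappa> ?r * (w (norm (X *v ?e)) * \<Omega> (map ((*v) X) (?e # vs))) + ?r * ?r\<^sup>2 * (d (norm (X *v ?e)) * \<Omega> (map ((*v) X) (?e # vs)))" for X
  proof -
    have Xy: "X *v y = ?r *\<^sub>R (X *v ?e)" by (subst y) (simp add: matrix_vector_mult_scaleR)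
    have "\<kappa> (norm (X *v y)) = \<kappa> ?r * w (norm (X *v ?e)) + ?r\<^sup>2 * d (norm (X *v ?e))"
      unfolding Xy using scal[OF r, of "norm (X *v ?e)"] by simp
    moreover have "contract (X *v y) \<Omega> (map ((*v) X) vs) = ?r * \<Omega> (map ((*v) X) (?e # vs))"
      unfolding Xy contract_def lin by simp
    ultimately show ?thesis by (simp add: algebra_simps)
  qed
  have int: "integrable \<mu> (\<lambda>X. w (norm (X *v ?e)) * \<Omega> (map ((*v) X) (?e # vs)))" "integrable \<mu> (\<lambda>X. d (norm (X *v ?e)) * \<Omega> (map ((*v) X) (?e # vs)))"
    by (rule avg_integrable[OF \<Omega> continuous_weight[OF w(1)] e], rule avg_integrable[OF \<Omega> continuous_weight[OF w(2)] e])
  have val: "?r * \<kappa> ?r * (c * \<Omega> (?e # vs)) + ?r * ?r\<^sup>2 * (c' * \<Omega> (?e # vs)) = (c * \<kappa> ?r + c' * ?r\<^sup>2) * contract y \<Omega> vs"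
  proof -
    have "contract y \<Omega> vs = ?r * \<Omega> (?e # vs)" unfolding contract_def by (subst y) (rule lin)
    then show ?thesis by (simp add: algebra_simps)
  qed
  have "has_bochner_integral \<mu> (\<lambda>X. ?r * \<kappa> ?r * (w (norm (X *v ?e)) * \<Omega> (map ((*v) X) (?e # vs))) + ?r * ?r\<^sup>2 * (d (norm (X *v ?e)) * \<Omega> (map ((*v) X) (?e # vs))))
     (?r * \<kappa> ?r * avg \<mu> w ?e \<Omega> (?e # vs) + ?r * ?r\<^sup>2 * avg \<mu> d ?e \<Omega> (?e # vs))"
    unfolding avg_def by (intro has_bochner_integral_add has_bochner_integral_mult_right has_bochner_integral_integrable int)
  then show ?thesis unfolding eq c[OF e \<Omega>] c'[OF e \<Omega>] val .
qed

text \<open>As for contraction, except that here \<open>X\<close> has to be a projection: on arguments in the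
range of \<open>X\<close> the covectors \<open>X e\<close> and \<open>e\<close> agree.\<close>

lemma average_wedge:
  assumes w: "continuous_on UNIV w" "continuous_on UNIV d"
    and scal: "\<And>r t. r > 0 \<Longrightarrow> t \<ge> 0 \<Longrightarrow> \<kappa> (r * t) = \<kappa> r * w t + r\<^sup>2 * d t"
    and c: "\<And>e \<eta> vs. norm e = 1 \<Longrightarrow> \<eta> \<in> alt q \<Longrightarrow> avg \<mu> w e (wedge e \<eta>) vs = c * wedge e \<eta> vs"
    and c': "\<And>e \<eta> vs. norm e = 1 \<Longrightarrow> \<eta> \<in> alt q \<Longrightarrow> avg \<mu> d e (wedge e \<eta>) vs = c' * wedge e \<eta> vs"
    and \<eta>: "\<eta> \<in> alt q"
  shows "has_bochner_integral \<mu> (\<lambda>X. \<kappa> (norm (X *v y)) * wedge (X *v y) \<eta> (map ((*v) X) vs))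
     ((c * \<kappa> (norm y) + c' * (norm y)\<^sup>2) * wedge y \<eta> vs)"
proof (cases "y = 0")
  case True
  have "wedge 0 \<eta> l = 0" for l using linear_0[OF wedge_linear] .
  then show ?thesis using True by (simp add: has_bochner_integral_zero)
next
  case False
  let ?r = "norm y" and ?e = "y /\<^sub>R norm y"
  have r: "?r > 0" and e: "norm ?e = 1" and y: "y = ?r *\<^sub>R ?e" using False by auto
  have lin: "wedge (?r *\<^sub>R u) \<eta> l = ?r * wedge u \<eta> l" for u l
    using linear_cmul[OF wedge_linear] by simp
  have \<Omega>: "wedge ?e \<eta> \<in> alt (Suc q)" by (rule wedge_alt[OF \<eta>])
  let ?g = "\<lambda>X. ?r * \<kappa> ?r * (w (norm (X *v ?e)) * wedge ?e \<eta> (map ((*v) X) vs)) + ?r * ?r\<^sup>2 * (d (norm (X *v ?e)) * wedge ?e \<eta> (map ((*v) X) vs))"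
  have eq: "\<kappa> (norm (X *v y)) * wedge (X *v y) \<eta> (map ((*v) X) vs) = ?g X" if X: "is_proj k X" for X
  proof -
    have Xy: "X *v y = ?r *\<^sub>R (X *v ?e)" by (subst y) (simp add: matrix_vector_mult_scaleR)
    have "\<kappa> (norm (X *v y)) = \<kappa> ?r * w (norm (X *v ?e)) + ?r\<^sup>2 * d (norm (X *v ?e))"
      unfolding Xy using scal[OF r, of "norm (X *v ?e)"] by simp
    moreover have "(X *v ?e) \<bullet> (X *v v) = ?e \<bullet> (X *v v)" for v
      using X symmetric_inner[of X ?e "X *v v"] by (simp add: is_proj_def matrix_vector_mul_assoc)
    then have "wedge (X *v ?e) \<eta> (map ((*v) X) vs) = wedge ?e \<eta> (map ((*v) X) vs)"
      by (cases vs) (simp_all add: wedge_def)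
    then have "wedge (X *v y) \<eta> (map ((*v) X) vs) = ?r * wedge ?e \<eta> (map ((*v) X) vs)"
      unfolding Xy lin by simp
    ultimately show ?thesis by (simp add: algebra_simps)
  qed
  have int: "integrable \<mu> (\<lambda>X. w (norm (X *v ?e)) * wedge ?e \<eta> (map ((*v) X) vs))" "integrable \<mu> (\<lambda>X. d (norm (X *v ?e)) * wedge ?e \<eta> (map ((*v) X) vs))"
    by (rule avg_integrable[OF \<Omega> continuous_weight[OF w(1)] e], rule avg_integrable[OF \<Omega> continuous_weight[OF w(2)] e])
  have val: "?r * \<kappa> ?r * (c * wedge ?e \<eta> vs) + ?r * ?r\<^sup>2 * (c' * wedge ?e \<eta> vs) = (c * \<kappa> ?r + c' * ?r\<^sup>2) * wedge y \<eta> vs"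
  proof -
    have "wedge y \<eta> vs = ?r * wedge ?e \<eta> vs" by (subst (1) y) (rule lin)
    then show ?thesis by (simp add: algebra_simps)
  qed
  have "has_bochner_integral \<mu> ?g (?r * \<kappa> ?r * avg \<mu> w ?e (wedge ?e \<eta>) vs + ?r * ?r\<^sup>2 * avg \<mu> d ?e (wedge ?e \<eta>) vs)"
    unfolding avg_def by (intro has_bochner_integral_add has_bochner_integral_mult_right has_bochner_integral_integrable int)
  then have g: "has_bochner_integral \<mu> ?g ((c * \<kappa> ?r + c' * ?r\<^sup>2) * wedge y \<eta> vs)"
    unfolding c[OF e \<eta>] c'[OF e \<eta>] val .
  have "(\<lambda>X. \<kappa> (norm (X *v y)) * wedge (X *v y) \<eta> (map ((*v) X) vs)) \<in> borel_measurable borel"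
  proof (rule borel_measurable_continuous_onI)
    have k: "continuous_on UNIV \<kappa>" using \<kappa> by (simp add: admissible_def)
    have "wedge (X *v y) \<eta> (map ((*v) X) vs) = (\<Sum>b\<in>Basis. ((X *v y) \<bullet> b) * wedge b \<eta> (map ((*v) X) vs))" for X
      by (rule wedge_sum_Basis)
    then show "continuous_on UNIV (\<lambda>X. \<kappa> (norm (X *v y)) * wedge (X *v y) \<eta> (map ((*v) X) vs))"
      by (simp only:) (intro continuous_intros continuous_on_compose2[OF k] alt_map_continuous[OF wedge_alt[OF \<eta>]]; simp)
  qed
  then have m: "(\<lambda>X. \<kappa> (norm (X *v y)) * wedge (X *v y) \<eta> (map ((*v) X) vs)) \<in> borel_measurable \<mu>"
    by (simp add: measurable_cong_sets[OF sets_eq refl])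
  have "AE X in \<mu>. ?g X = \<kappa> (norm (X *v y)) * wedge (X *v y) \<eta> (map ((*v) X) vs)"
    using AE_is_proj by eventually_elim (simp only: eq)
  from has_bochner_integralI_AE[OF g m this] show ?thesis .
qed

lemma kappa_poly_growth: "poly_growth (\<lambda>y::real^'n. \<kappa> (norm y) * (y \<bullet> j))"
proof (intro poly_growth_mult poly_growth_inner poly_growthI)
  have k: "continuous_on UNIV \<kappa>" using \<kappa> by (simp add: admissible_def)
  show "(\<lambda>y::real^'n. \<kappa> (norm y)) \<in> borel_measurable borel"
    by (intro borel_measurable_continuous_onI continuous_on_compose2[OF k] continuous_intros) auto
  show "\<bar>\<kappa> (norm y)\<bar> \<le> 1 * (1 + norm y) ^ 3" for y :: "real^'n" using \<kappa> by (simp add: admissible_def)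
qed

lemma norm2_poly_growth: "poly_growth (\<lambda>y::real^'n. (norm y)\<^sup>2 * (y \<bullet> j))"
proof (intro poly_growth_mult poly_growth_inner poly_growthI)
  show "\<bar>(norm y)\<^sup>2\<bar> \<le> 1 * (1 + norm y) ^ 2" for y :: "real^'n" by (simp add: power_mono)
qed auto

text \<open>The computation sketched in the introduction.  After Fubini's theorem and the two averages,
the mean of the integrand is \<open>1 / C\<close> times \<open>\<kappa>(|y|) \<Sum>i. \<iota>_y (e_i \<and> \<gamma>_i) + y \<and> \<iota>_(e_i) \<gamma>_i\<close> plus
multiples of \<open>|y|^2\<close> that integrate to 0.  The symmetry of the kernel exchanges \<open>i\<close> and \<open>j\<close> in the
second sum, and Cartan's identity reduces the double sum to its diagonal.\<close>

lemma representation: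
  assumes w: "continuous_on UNIV w" "continuous_on UNIV d"
    and scal: "\<And>r t. r > 0 \<Longrightarrow> t \<ge> 0 \<Longrightarrow> \<kappa> (r * t) = \<kappa> r * w t + r\<^sup>2 * d t"
    and avg1: "\<And>e \<Omega> vs. norm e = 1 \<Longrightarrow> \<Omega> \<in> alt (Suc m) \<Longrightarrow> avg \<mu> w e \<Omega> (e # vs) = c1 * \<Omega> (e # vs)"
      "\<And>e \<Omega> vs. norm e = 1 \<Longrightarrow> \<Omega> \<in> alt (Suc m) \<Longrightarrow> avg \<mu> d e \<Omega> (e # vs) = d1 * \<Omega> (e # vs)"
    and avg2: "\<And>q e \<eta> vs. m = Suc q \<Longrightarrow> norm e = 1 \<Longrightarrow> \<eta> \<in> alt q \<Longrightarrow> avg \<mu> w e (wedge e \<eta>) vs = c2 * wedge e \<eta> vs"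
      "\<And>q e \<eta> vs. m = Suc q \<Longrightarrow> norm e = 1 \<Longrightarrow> \<eta> \<in> alt q \<Longrightarrow> avg \<mu> d e (wedge e \<eta>) vs = d2 * wedge e \<eta> vs"
    and C: "C \<noteq> 0" and p1: "p1 * c1 = 1 / C" and p2: "p2 * c2 = 1 / C"
    and rep: "\<And>f::real^'n \<Rightarrow> real. schwartz f \<Longrightarrow> (\<Sum>i\<in>Basis. \<integral>y. \<kappa> (norm y) * (y \<bullet> i) * lap_deriv N i f y \<partial>lborel) = C * f 0"
    and sym: "\<And>(f::real^'n \<Rightarrow> real) i j. schwartz f \<Longrightarrow>
       (\<integral>y. \<kappa> (norm y) * (y \<bullet> j) * lap_deriv N i f y \<partial>lborel) = (\<integral>y. \<kappa> (norm y) * (y \<bullet> i) * lap_deriv N j f y \<partial>lborel)"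
    and moment: "\<And>(f::real^'n \<Rightarrow> real) i j. schwartz f \<Longrightarrow> (\<integral>y. (norm y)\<^sup>2 * (y \<bullet> j) * lap_deriv N i f y \<partial>lborel) = 0"
    and vs: "length vs = m"
  shows "has_bochner_integral \<mu> (\<lambda>X. F X x vs) (\<alpha> x vs)"
proof -
  define a where "a i j \<theta> = contract j (wedge i \<theta>) vs" for i j and \<theta> :: "(real^'n) list \<Rightarrow> real"
  define b where "b i j \<theta> = wedge j (contract i \<theta>) vs" for i j and \<theta> :: "(real^'n) list \<Rightarrow> real"
  have ca: "compat (a i j)" and cb: "compat (b i j)" for i j
    unfolding a_def b_def by (rule compat_contract_wedge, rule compat_wedge_contract)
  \<comment> \<open>the coefficients of \<open>\<iota>_j (i \<and> \<alpha>)\<close> and \<open>j \<and> \<iota>_i \<alpha>\<close>, centred at \<open>x\<close>\<close>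
  define fa where "fa i j y = a i j (\<alpha> (x + y))" for i j y
  define fb where "fb i j y = b i j (\<alpha> (x + y))" for i j y
  have sfa: "schwartz (fa i j)" and sfb: "schwartz (fb i j)" for i j
    using schwartz_shift[of "\<lambda>z. a i j (\<alpha> z)" x] schwartz_shift[of "\<lambda>z. b i j (\<alpha> z)" x] ca[of i j] cb[of i j]
    by (simp_all add: fa_def[abs_def] fb_def[abs_def] compat_def)
  have ga: "a i j (deriv_form l (x + y)) = lap_deriv N l (fa i j) y" and gb: "b i j (deriv_form l (x + y)) = lap_deriv N l (fb i j) y" for i j l y
    using ca[of i j] cb[of i j] lap_deriv_shift[of N l "\<lambda>z. a i j (\<alpha> z)" x y] lap_deriv_shift[of N l "\<lambda>z. b i j (\<alpha> z)" x y]
    by (simp_all add: fa_def[abs_def] fb_def[abs_def] compat_def)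
  have S1: "has_bochner_integral \<mu> (\<lambda>X. \<kappa> (norm (X *v y)) * contract (X *v y) (wedge i (deriv_form i (x + y))) (map ((*v) X) vs))
      ((c1 * \<kappa> (norm y) + d1 * (norm y)\<^sup>2) * contract y (wedge i (deriv_form i (x + y))) vs)" for i y
    by (rule average_contract[OF w scal avg1 wedge_alt[OF deriv_form_alt]])
  have S2: "has_bochner_integral \<mu> (\<lambda>X. \<kappa> (norm (X *v y)) * wedge (X *v y) (contract i (deriv_form i (x + y))) (map ((*v) X) vs))
      ((c2 * \<kappa> (norm y) + d2 * (norm y)\<^sup>2) * wedge y (contract i (deriv_form i (x + y))) vs)" for i y
  proof (cases m)
    \<comment> \<open>a form of degree 0 has no contraction, so the second term is absent\<close>
    case 0
    then show ?thesis using vs by (simp add: wedge_def has_bochner_integral_zero)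
  next
    case (Suc q)
    show ?thesis
      by (rule average_wedge[OF w scal avg2(1)[OF Suc] avg2(2)[OF Suc] contract_alt]) (use deriv_form_alt Suc in auto)
  qed
  have inner: "(\<integral>X. integrand x vs X y \<partial>\<mu>) =
      (\<Sum>i\<in>Basis. \<Sum>j\<in>Basis. (1 / C) * (\<kappa> (norm y) * (y \<bullet> j) * lap_deriv N i (fa i j) y) + (1 / C) * (\<kappa> (norm y) * (y \<bullet> j) * lap_deriv N i (fb i j) y)
        + p1 * d1 * ((norm y)\<^sup>2 * (y \<bullet> j) * lap_deriv N i (fa i j) y) + p2 * d2 * ((norm y)\<^sup>2 * (y \<bullet> j) * lap_deriv N i (fb i j) y))" for y
  proof -
    have "has_bochner_integral \<mu> (\<lambda>X. \<Sum>i\<in>Basis.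
        p1 * (\<kappa> (norm (X *v y)) * contract (X *v y) (wedge i (deriv_form i (x + y))) (map ((*v) X) vs)) +
        p2 * (\<kappa> (norm (X *v y)) * wedge (X *v y) (contract i (deriv_form i (x + y))) (map ((*v) X) vs)))
      (\<Sum>i\<in>Basis. p1 * ((c1 * \<kappa> (norm y) + d1 * (norm y)\<^sup>2) * contract y (wedge i (deriv_form i (x + y))) vs) +
        p2 * ((c2 * \<kappa> (norm y) + d2 * (norm y)\<^sup>2) * wedge y (contract i (deriv_form i (x + y))) vs))"
      by (intro has_bochner_integral_sum has_bochner_integral_add has_bochner_integral_mult_right S1 S2)
    moreover have "integrand x vs X y = (\<Sum>i\<in>Basis.
        p1 * (\<kappa> (norm (X *v y)) * contract (X *v y) (wedge i (deriv_form i (x + y))) (map ((*v) X) vs)) +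
        p2 * (\<kappa> (norm (X *v y)) * wedge (X *v y) (contract i (deriv_form i (x + y))) (map ((*v) X) vs)))" for X
      unfolding integrand_def sum_distrib_left by (intro sum.cong refl) (simp add: algebra_simps)
    ultimately have "(\<integral>X. integrand x vs X y \<partial>\<mu>) =
      (\<Sum>i\<in>Basis. p1 * ((c1 * \<kappa> (norm y) + d1 * (norm y)\<^sup>2) * contract y (wedge i (deriv_form i (x + y))) vs) +
        p2 * ((c2 * \<kappa> (norm y) + d2 * (norm y)\<^sup>2) * wedge y (contract i (deriv_form i (x + y))) vs))"
      by (simp add: has_bochner_integral_integral_eq)
    also have "\<dots> = (\<Sum>i\<in>Basis. \<Sum>j\<in>Basis. (1 / C) * (\<kappa> (norm y) * (y \<bullet> j) * lap_deriv N i (fa i j) y) + (1 / C) * (\<kappa> (norm y) * (y \<bullet> j) * lap_deriv N i (fb i j) y)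
        + p1 * d1 * ((norm y)\<^sup>2 * (y \<bullet> j) * lap_deriv N i (fa i j) y) + p2 * d2 * ((norm y)\<^sup>2 * (y \<bullet> j) * lap_deriv N i (fb i j) y))"
    proof (rule sum.cong[OF refl])
      fix i :: "real^'n"
      have A: "contract y (wedge i (deriv_form i (x + y))) vs = (\<Sum>j\<in>Basis. (y \<bullet> j) * lap_deriv N i (fa i j) y)"
        unfolding contract_sum_Basis[OF wedge_alt[OF deriv_form_alt], of y] ga[symmetric] a_def ..
      have B: "wedge y (contract i (deriv_form i (x + y))) vs = (\<Sum>j\<in>Basis. (y \<bullet> j) * lap_deriv N i (fb i j) y)"
        unfolding wedge_sum_Basis[of y] gb[symmetric] b_def ..
      have gen: "p1 * ((c1 * K + d1 * Q) * s) + p2 * ((c2 * K + d2 * Q) * t) =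
         (1 / C) * (K * s) + (1 / C) * (K * t) + p1 * d1 * (Q * s) + p2 * d2 * (Q * t)" for K Q s t
      proof -
        have "(1 / C) * (K * s) = p1 * c1 * (K * s)" "(1 / C) * (K * t) = p2 * c2 * (K * t)"
          by (simp_all only: p1 p2)
        then show ?thesis by (simp only: distrib_left distrib_right mult_ac add_ac)
      qed
      show "p1 * ((c1 * \<kappa> (norm y) + d1 * (norm y)\<^sup>2) * contract y (wedge i (deriv_form i (x + y))) vs) +
          p2 * ((c2 * \<kappa> (norm y) + d2 * (norm y)\<^sup>2) * wedge y (contract i (deriv_form i (x + y))) vs) =
         (\<Sum>j\<in>Basis. (1 / C) * (\<kappa> (norm y) * (y \<bullet> j) * lap_deriv N i (fa i j) y) + (1 / C) * (\<kappa> (norm y) * (y \<bullet> j) * lap_deriv N i (fb i j) y)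
          + p1 * d1 * ((norm y)\<^sup>2 * (y \<bullet> j) * lap_deriv N i (fa i j) y) + p2 * d2 * ((norm y)\<^sup>2 * (y \<bullet> j) * lap_deriv N i (fb i j) y))"
        unfolding A B gen sum_distrib_left sum.distrib[symmetric] by (intro sum.cong refl) (simp only: mult.assoc)
    qed
    finally show ?thesis .
  qed
  have ik: "integrable lborel (\<lambda>y. \<kappa> (norm y) * (y \<bullet> j) * lap_deriv N i f y)" if "schwartz f" for i j and f :: "real^'n \<Rightarrow> real"
    by (rule kernel_integrable[OF poly_growth_kernel[OF kappa_poly_growth] schwartz_lap_deriv[OF that]])
  have i2: "integrable lborel (\<lambda>y. (norm y)\<^sup>2 * (y \<bullet> j) * lap_deriv N i f y)" if "schwartz f" for i j and f :: "real^'n \<Rightarrow> real"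
    by (rule kernel_integrable[OF poly_growth_kernel[OF norm2_poly_growth] schwartz_lap_deriv[OF that]])
  define K where "K j i f = (\<integral>y. \<kappa> (norm y) * (y \<bullet> j) * lap_deriv N i f y \<partial>lborel)" for j i and f :: "real^'n \<Rightarrow> real"
  have "has_bochner_integral lborel (\<lambda>y. \<Sum>i\<in>Basis. \<Sum>j\<in>Basis. (1 / C) * (\<kappa> (norm y) * (y \<bullet> j) * lap_deriv N i (fa i j) y) + (1 / C) * (\<kappa> (norm y) * (y \<bullet> j) * lap_deriv N i (fb i j) y)
        + p1 * d1 * ((norm y)\<^sup>2 * (y \<bullet> j) * lap_deriv N i (fa i j) y) + p2 * d2 * ((norm y)\<^sup>2 * (y \<bullet> j) * lap_deriv N i (fb i j) y))
     (\<Sum>i\<in>Basis. \<Sum>j\<in>Basis. (1 / C) * K j i (fa i j) + (1 / C) * K j i (fb i j) + p1 * d1 * 0 + p2 * d2 * 0)"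
  proof -
    have z: "has_bochner_integral lborel (\<lambda>y. (norm y)\<^sup>2 * (y \<bullet> j) * lap_deriv N i f y) 0" if "schwartz f" for i j and f :: "real^'n \<Rightarrow> real"
      using has_bochner_integral_integrable[OF i2[OF that]] moment[OF that] by simp
    show ?thesis
      unfolding K_def
      by (intro has_bochner_integral_sum has_bochner_integral_add has_bochner_integral_mult_right has_bochner_integral_integrable
          ik[OF sfa] ik[OF sfb] z[OF sfa] z[OF sfb])
  qed
  then have "(\<integral>y. (\<integral>X. integrand x vs X y \<partial>\<mu>) \<partial>lborel) = (\<Sum>i\<in>Basis. \<Sum>j\<in>Basis. (1 / C) * K j i (fa i j) + (1 / C) * K j i (fb i j))"
    unfolding inner by (simp add: has_bochner_integral_integral_eq)
  also have "\<dots> = (1 / C) * ((\<Sum>i\<in>Basis. \<Sum>j\<in>Basis. K j i (fa i j)) + (\<Sum>i\<in>Basis. \<Sum>j\<in>Basis. K j i (fb i j)))"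
    by (simp add: sum_distrib_left sum.distrib distrib_left)
  also have "(\<Sum>i\<in>Basis. \<Sum>j\<in>Basis. K j i (fb i j)) = (\<Sum>i\<in>Basis. \<Sum>j\<in>Basis. K i j (fb i j))"
    unfolding K_def using sym[OF sfb] by simp
  also have "\<dots> = (\<Sum>i\<in>Basis. \<Sum>j\<in>Basis. K j i (fb j i))" by (rule sum.swap)
  also have "(\<Sum>i\<in>Basis. \<Sum>j\<in>Basis. K j i (fa i j)) + (\<Sum>i\<in>Basis. \<Sum>j\<in>Basis. K j i (fb j i)) =
     (\<Sum>i\<in>Basis. \<Sum>j\<in>Basis. (i \<bullet> j) * K j i (\<lambda>y. \<alpha> (x + y) vs))"
    unfolding sum.distrib[symmetric]
  proof (intro sum.cong refl)
    fix i j :: "real^'n"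
    \<comment> \<open>Cartan's identity, with the indices of the second term already exchanged\<close>
    have "(\<lambda>y. 1 * fa i j y + 1 * fb j i y) = (\<lambda>y. (i \<bullet> j) * \<alpha> (x + y) vs)"
      unfolding fa_def fb_def a_def b_def mult_1 by (rule ext) (rule contract_wedge[OF \<alpha>_alt])
    then have "lap_deriv N i (\<lambda>y. (i \<bullet> j) * \<alpha> (x + y) vs + 0 * \<alpha> (x + y) vs) y = 1 * lap_deriv N i (fa i j) y + 1 * lap_deriv N i (fb j i) y" for y
      using lap_deriv_lincomb[OF sfa sfb, of N i 1 i j 1 j i y] by simp
    then have "(i \<bullet> j) * lap_deriv N i (\<lambda>y. \<alpha> (x + y) vs) y = lap_deriv N i (fa i j) y + lap_deriv N i (fb j i) y" for y
      using lap_deriv_lincomb[OF schwartz_shift[OF coeff] schwartz_shift[OF coeff], of N i "i \<bullet> j" x vs 0 x vs y] by simp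
    then have "(\<integral>y. (i \<bullet> j) * (\<kappa> (norm y) * (y \<bullet> j) * lap_deriv N i (\<lambda>y. \<alpha> (x + y) vs) y) \<partial>lborel) =
      (\<integral>y. \<kappa> (norm y) * (y \<bullet> j) * lap_deriv N i (fa i j) y + \<kappa> (norm y) * (y \<bullet> j) * lap_deriv N i (fb j i) y \<partial>lborel)"
      by (intro Bochner_Integration.integral_cong refl) (simp add: distrib_left[symmetric] mult.left_commute)
    then show "K j i (fa i j) + K j i (fb j i) = (i \<bullet> j) * K j i (\<lambda>y. \<alpha> (x + y) vs)"
      unfolding K_def by (simp add: ik sfa sfb)
  qed
  also have "\<dots> = (\<Sum>i\<in>Basis. K i i (\<lambda>y. \<alpha> (x + y) vs))"
  proof (rule sum.cong[OF refl])
    fix i :: "real^'n" assume i: "i \<in> Basis"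
    have "(\<Sum>j\<in>Basis. (i \<bullet> j) * K j i (\<lambda>y. \<alpha> (x + y) vs)) = (\<Sum>j\<in>Basis. if j = i then K j i (\<lambda>y. \<alpha> (x + y) vs) else 0)"
      using i by (intro sum.cong refl) (auto simp: inner_Basis)
    then show "(\<Sum>j\<in>Basis. (i \<bullet> j) * K j i (\<lambda>y. \<alpha> (x + y) vs)) = K i i (\<lambda>y. \<alpha> (x + y) vs)" using i by simp
  qed
  also have "\<dots> = C * \<alpha> x vs"
    unfolding K_def using rep[OF schwartz_shift[OF coeff], of x vs] by simp
  also have "(1 / C) * (C * \<alpha> x vs) = \<alpha> x vs" using C by simp
  finally have "(\<integral>X. F X x vs \<partial>\<mu>) = \<alpha> x vs" unfolding integrand_Fubini(2)[OF vs] .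
  then show ?thesis using integrand_Fubini(1)[OF vs] by (metis has_bochner_integral_integrable)
qed

end

section \<open>From subspaces to projection matrices\<close>

lemma orth_proj_eqI:
  assumes P: "subspace P" and y: "y \<in> P" "\<And>z. z \<in> P \<Longrightarrow> (x - y) \<bullet> z = 0"
  shows "orth_proj P x = y"
proof -
  let ?d = "orth_proj P x - y"
  have d: "?d \<in> P" using P y(1) orth_proj_in[OF P] by (simp add: subspace_diff)
  have "(x - orth_proj P x) \<bullet> ?d = 0" using orth_proj_orthogonal[OF P d] by (simp add: orthogonal_def)
  moreover have "(x - y) \<bullet> ?d = 0" by (rule y(2)[OF d])
  ultimately have "?d \<bullet> ?d = 0" by (simp add: inner_diff_left)
  then show ?thesis by simp
qed

lemma orth_proj_fixed: "subspace P \<Longrightarrow> x \<in> P \<Longrightarrow> orth_proj P x = x"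
  by (rule orth_proj_eqI) auto

lemma orth_proj_inner:
  assumes P: "subspace P" shows "orth_proj P x \<bullet> y = orth_proj P x \<bullet> orth_proj P y"
proof -
  have "y \<bullet> orth_proj P x = orth_proj P y \<bullet> orth_proj P x"
    using orth_proj_orthogonal[OF P orth_proj_in[OF P], of y x] by (simp add: orthogonal_def inner_diff_left)
  then show ?thesis by (metis inner_commute)
qed

lemma linear_orth_proj:
  assumes P: "subspace P" shows "linear (orth_proj P)"
proof (rule linearI)
  have o: "(x - orth_proj P x) \<bullet> z = 0" if "z \<in> P" for x z
    using orth_proj_orthogonal[OF P that] by (simp add: orthogonal_def)
  show "orth_proj P (x + y) = orth_proj P x + orth_proj P y" for x y
  proof (rule orth_proj_eqI[OF P])
    fix z assume "z \<in> P"
    then show "(x + y - (orth_proj P x + orth_proj P y)) \<bullet> z = 0"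
      using o[of z x] o[of z y] by (simp add: inner_diff_left inner_add_left)
  qed (simp add: P subspace_add orth_proj_in)
  show "orth_proj P (c *\<^sub>R x) = c *\<^sub>R orth_proj P x" for c x
  proof (rule orth_proj_eqI[OF P])
    fix z assume "z \<in> P"
    then show "(c *\<^sub>R x - c *\<^sub>R orth_proj P x) \<bullet> z = 0"
      using o[of z x] by (simp add: inner_diff_left)
  qed (simp add: P subspace_scale orth_proj_in)
qed

definition pmat :: "(real^'n) set \<Rightarrow> real^'n^'n" where
  "pmat P = matrix (orth_proj P)"

lemma pmat_mult: "subspace P \<Longrightarrow> pmat P *v x = orth_proj P x"
  unfolding pmat_def using matrix_vector_mul(2)[OF linear_orth_proj] by metis

lemma pmat_is_proj:
  assumes "P \<in> grassmannian k" shows "is_proj k (pmat P)"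
  unfolding is_proj_def
proof (intro conjI)
  have P: "subspace P" "dim P = k" using assms by (auto simp: grassmannian_def)
  have "(transpose (pmat P) *v x) \<bullet> y = (pmat P *v x) \<bullet> y" for x y
  proof -
    have "(transpose (pmat P) *v x) \<bullet> y = x \<bullet> (pmat P *v y)"
      by (metis dot_lmul_matrix transpose_matrix_vector)
    also have "\<dots> = (pmat P *v x) \<bullet> y"
      using orth_proj_inner[OF P(1), of x y] orth_proj_inner[OF P(1), of y x] by (simp add: pmat_mult[OF P(1)] inner_commute)
    finally show ?thesis .
  qed
  then show "transpose (pmat P) = pmat P" unfolding matrix_eq using vector_eq_rdot by blast
  show "pmat P ** pmat P = pmat P"
    by (simp add: matrix_eq matrix_vector_mul_assoc[symmetric] pmat_mult[OF P(1)] orth_proj_fixed[OF P(1)] orth_proj_in[OF P(1)])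
  have "range ((*v) (pmat P)) = P"
    using orth_proj_in[OF P(1)] orth_proj_fixed[OF P(1)] by (auto simp: pmat_mult[OF P(1)]) (metis rangeI)
  then show "dim (range ((*v) (pmat P))) = k" using P by simp
qed

text \<open>The orthogonal projection onto \<open>g ` P\<close> is the conjugate by \<open>g\<close> of the one onto \<open>P\<close>.\<close>

lemma pmat_image:
  fixes g :: "real^'n \<Rightarrow> real^'n"
  assumes g: "orthogonal_transformation g" and P: "subspace P"
  shows "pmat (g ` P) = matrix g ** pmat P ** transpose (matrix g)"
proof -
  have lg: "linear g" by (rule orthogonal_transformation_linear[OF g])
  have gm: "matrix g *v x = g x" for x using matrix_vector_mul(2)[OF lg] by metis
  have gi: "g x \<bullet> g y = x \<bullet> y" for x y using g by (simp add: orthogonal_transformation_def)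
  have "orthogonal_matrix (matrix g)" using g by (simp add: orthogonal_transformation_matrix)
  then have tg: "transpose (matrix g) *v g x = x" for x
    by (metis gm matrix_vector_mul_assoc matrix_vector_mul_lid orthogonal_matrix_def)
  have gP: "subspace (g ` P)" by (rule linear_subspace_image[OF lg P])
  have "pmat (g ` P) *v v = (matrix g ** pmat P ** transpose (matrix g)) *v v" for v
  proof -
    obtain x where x: "v = g x" using orthogonal_transformation_surj[OF g] by (metis surjD)
    have "orth_proj (g ` P) (g x) = g (orth_proj P x)"
    proof (rule orth_proj_eqI[OF gP])
      show "g (orth_proj P x) \<in> g ` P" using orth_proj_in[OF P] by blast
      fix z assume "z \<in> g ` P"
      then obtain u where u: "z = g u" "u \<in> P" by blast
      have "(g x - g (orth_proj P x)) \<bullet> g u = (x - orth_proj P x) \<bullet> u"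
        by (simp add: inner_diff_left gi)
      then show "(g x - g (orth_proj P x)) \<bullet> z = 0"
        using orth_proj_orthogonal[OF P u(2), of x] u by (simp add: orthogonal_def)
    qed
    moreover have "(matrix g ** pmat P ** transpose (matrix g)) *v g x = g (orth_proj P x)"
      by (simp only: matrix_vector_mul_assoc[symmetric] tg gm pmat_mult[OF P])
    ultimately show ?thesis by (simp only: x pmat_mult[OF gP])
  qed
  then show ?thesis by (simp add: matrix_eq)
qed

lemma image_grassmannian:
  assumes g: "orthogonal_transformation g" and P: "P \<in> grassmannian k"
  shows "g ` P \<in> grassmannian k"
  using P linear_subspace_image[OF orthogonal_transformation_linear[OF g]]
    dim_image_eq[OF orthogonal_transformation_linear[OF g], of P] orthogonal_transformation_inj[OF g]
  by (auto simp: grassmannian_def inj_on_subset)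

lemma bounded_bilinear_matrix_mult: "bounded_bilinear ((**) :: real^'n^'n \<Rightarrow> real^'n^'n \<Rightarrow> real^'n^'n)"
  unfolding bilinear_conv_bounded_bilinear[symmetric] bilinear_def
  by (auto intro!: linearI simp: matrix_eq matrix_vector_mul_assoc[symmetric] matrix_vector_mult_add_rdistrib
      matrix_vector_right_distrib scaleR_matrix_vector_assoc[symmetric] matrix_vector_mult_scaleR)

text \<open>The projections of rank \<open>k\<close> are the orbit of one of them under conjugation by the compact
orthogonal group.  The set is what makes the statement "almost every matrix is a projection" measurable under
the image measure.\<close>

lemma compact_projections:
  "\<exists>C :: (real^'n^'n) set. compact C \<and> pmat ` grassmannian k \<subseteq> C \<and> (\<forall>X\<in>C. is_proj k X)"
proof (cases "grassmannian k = ({} :: (real^'n) set set)")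
  case True
  then show ?thesis by (intro exI[of _ "{}"]) auto
next
  case False
  then obtain P0 :: "(real^'n) set" where P0: "P0 \<in> grassmannian k" by blast
  then have sP0: "subspace P0" "dim P0 = k" by (auto simp: grassmannian_def)
  let ?O = "{G :: real^'n^'n. \<forall>v. norm (G *v v) = norm v}"
  let ?f = "\<lambda>G. G ** pmat P0 ** transpose G"
  have orth: "orthogonal_transformation ((*v) G)" if "G \<in> ?O" for G
    using that by (simp add: orthogonal_transformation)
  have "closed ?O"
    by (intro closed_Collect_all closed_Collect_eq continuous_intros)
  moreover have "bounded ?O"
    using contraction_norm_bound[where 'n = 'n] unfolding bounded_iff by (metis (mono_tags, lifting) mem_Collect_eq order_refl)
  ultimately have "compact ?O" by (simp add: compact_eq_bounded_closed)
  moreover have "continuous_on ?O ?f"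
  proof -
    have "linear (transpose :: real^'n^'n \<Rightarrow> real^'n^'n)"
      by (rule linearI) (simp_all add: transpose_def vec_eq_iff)
    then have "continuous_on ?O (transpose :: real^'n^'n \<Rightarrow> real^'n^'n)"
      by (intro linear_continuous_on) (simp add: linear_conv_bounded_linear)
    then show ?thesis
      by (intro bounded_bilinear.continuous_on[OF bounded_bilinear_matrix_mult] continuous_on_id continuous_on_const)
  qed
  ultimately have "compact (?f ` ?O)" by (intro compact_continuous_image)
  moreover have "pmat P \<in> ?f ` ?O" if "P \<in> grassmannian k" for P
  proof -
    have P: "subspace P" "dim P = k" using that by (auto simp: grassmannian_def)
    obtain us where us: "orthonormal us" "set us \<subseteq> P" "length us = k" using orthonormal_list_in_subspace[OF P(1)] P(2) by blast
    obtain ws where ws: "orthonormal ws" "set ws \<subseteq> P0" "length ws = k" using orthonormal_list_in_subspace[OF sP0(1)] sP0(2) by blast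
    obtain g where g: "orthogonal_transformation g" "map g ws = us"
      using orthogonal_transformation_between[OF ws(1) us(1)] ws us by auto
    have lg: "linear g" by (rule orthogonal_transformation_linear[OF g(1)])
    have span: "span (set vs) = Q" if "orthonormal vs" "set vs \<subseteq> Q" "length vs = k" "subspace Q" "dim Q = k" for vs and Q :: "(real^'n) set"
    proof -
      have "pairwise orthogonal (set vs)"
        using that(1) by (auto simp: pairwise_def orthogonal_def orthonormal_def in_set_conv_nth)
      moreover have "0 \<notin> set vs"
        using that(1) by (auto simp: orthonormal_def in_set_conv_nth) (metis inner_zero_left zero_neq_one)
      ultimately have "independent (set vs)" by (rule pairwise_orthogonal_independent)
      moreover have "card (set vs) = k" using that(3) orthonormal_distinct[OF that(1)] by (simp add: distinct_card)
      ultimately have "Q \<subseteq> span (set vs)" using that by (intro card_ge_dim_independent) auto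
      then show ?thesis using that(2,4) by (simp add: span_minimal subset_antisym)
    qed
    have "g ` P0 = P"
    proof -
      have "g ` P0 = g ` span (set ws)" using span[OF ws sP0] by simp
      also have "\<dots> = span (g ` set ws)" by (rule linear_span_image[OF lg, symmetric])
      also have "g ` set ws = set us" using g(2) by auto
      finally show ?thesis using span[OF us P] by simp
    qed
    then have "pmat P = ?f (matrix g)" using pmat_image[OF g(1) sP0(1)] by simp
    moreover have "matrix g \<in> ?O"
    proof (intro CollectI allI)
      fix v
      have "matrix g *v v = g v" by (rule fun_cong[OF matrix_vector_mul(2)[OF lg]])
      then show "norm (matrix g *v v) = norm v" by (simp add: orthogonal_transformation_norm[OF g(1)])
    qed
    ultimately show ?thesis by (rule image_eqI)
  qed
  moreover have "is_proj k X" if X: "X \<in> ?f ` ?O" for X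
  proof -
    obtain G where G: "G \<in> ?O" "X = ?f G" using X by blast
    have "X = pmat ((*v) G ` P0)" using pmat_image[OF orth[OF G(1)] sP0(1)] G(2) by simp
    then show ?thesis using pmat_is_proj[OF image_grassmannian[OF orth[OF G(1)] P0]] by simp
  qed
  ultimately show ?thesis by (intro exI[of _ "?f ` ?O"]) auto
qed

context
  fixes k :: nat and M :: "(real^'n) set measure"
  assumes M: "invariant_grassmannian_measure k M"
begin

lemma grass_prob: "prob_space M" and grass_space: "space M = grassmannian k"
  using M by (simp_all add: invariant_grassmannian_measure_def)

lemma pmat_measurable: "pmat \<in> measurable M borel"
proof (rule borel_measurableI)
  fix S :: "(real^'n^'n) set" assume "open S"
  then have "openin (grassmannian_topology k) (pmat -` S \<inter> grassmannian k)"
    unfolding grassmannian_topology_def openin_pullback_topology pmat_def[abs_def] by auto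
  then have "pmat -` S \<inter> grassmannian k \<in> sigma_sets (grassmannian k) {U. openin (grassmannian_topology k) U}"
    by (intro sigma_sets.Basic) simp
  then show "pmat -` S \<inter> space M \<in> sets M"
    using M by (simp add: invariant_grassmannian_measure_def)
qed

text \<open>The action of \<open>g\<close> on subspaces becomes conjugation of matrices; the preimage under it of
a set of matrices is the image of a set of subspaces under the inverse of \<open>g\<close>.\<close>

lemma random_projection_grassmannian: "random_projection (distr M borel pmat) k"
proof -
  interpret prob_space M by (rule grass_prob)
  interpret d: prob_space "distr M borel pmat" by (rule prob_space_distr[OF pmat_measurable])
  show ?thesis
  proof
    show "sets (distr M borel pmat) = sets borel" by simp
    obtain C :: "(real^'n^'n) set" where C': "compact C \<and> pmat ` grassmannian k \<subseteq> C \<and> (\<forall>X\<in>C. is_proj k X)"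
      using compact_projections[of k] by (rule exE)
    then have C: "compact C" "pmat ` grassmannian k \<subseteq> C" "\<And>X. X \<in> C \<Longrightarrow> is_proj k X"
      by simp_all
    have "AE P in M. pmat P \<in> C"
    proof (rule AE_I2)
      fix P assume "P \<in> space M"
      then show "pmat P \<in> C" using C(2) grass_space by blast
    qed
    moreover have "{X \<in> space borel. X \<in> C} \<in> sets borel" using borel_compact[OF C(1)] by simp
    ultimately have "AE X in distr M borel pmat. X \<in> C"
      by (simp only: AE_distr_iff[OF pmat_measurable])
    then show "AE X in distr M borel pmat. transpose X = X \<and> X ** X = X \<and> dim (range ((*v) X)) = k"
    proof eventually_elim
      case (elim X)
      then show ?case using C(3)[of X] by (simp only: is_proj_def)
    qed
    fix g :: "real^'n \<Rightarrow> real^'n" assume g: "orthogonal_transformation g"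
    let ?c = "\<lambda>X. matrix g ** X ** transpose (matrix g)"
    have cm: "?c \<in> borel_measurable borel"
      by (intro borel_measurable_continuous_onI linear_continuous_on linear_conv_bounded_linear[THEN iffD1] linearI)
         (simp_all add: matrix_eq matrix_vector_mul_assoc[symmetric] matrix_vector_mult_add_rdistrib
            matrix_vector_right_distrib scaleR_matrix_vector_assoc[symmetric] matrix_vector_mult_scaleR)
    let ?h = "inv g"
    have h: "orthogonal_transformation ?h" by (rule orthogonal_transformation_inv[OF g])
    have gh: "g ` ?h ` P = P" "?h ` g ` P = P" for P
      using orthogonal_transformation_bij[OF g]
      by (simp_all add: image_image bij_is_surj bij_is_inj surj_f_inv_f)
    show "distr (distr M borel pmat) borel ?c = distr M borel pmat"
    proof (rule measure_eqI)
      fix B assume "B \<in> sets (distr (distr M borel pmat) borel ?c)"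
      then have B: "B \<in> sets borel" by simp
      let ?A = "pmat -` B \<inter> space M"
      have A: "?A \<in> sets M" by (rule measurable_sets[OF pmat_measurable B])
      have "emeasure (distr (distr M borel pmat) borel ?c) B = emeasure M (pmat -` (?c -` B) \<inter> space M)"
        using B cm pmat_measurable measurable_sets[OF cm B] by (simp add: emeasure_distr)
      also have "pmat -` (?c -` B) \<inter> space M = (\<lambda>P. ?h ` P) ` ?A"
      proof (intro set_eqI iffI)
        fix P assume P: "P \<in> pmat -` (?c -` B) \<inter> space M"
        then have "P \<in> grassmannian k" by (simp add: grass_space)
        then have "g ` P \<in> grassmannian k" "subspace P" using image_grassmannian[OF g] by (auto simp: grassmannian_def)
        then have "g ` P \<in> ?A" using P by (simp add: grass_space pmat_image[OF g])
        then show "P \<in> (\<lambda>P. ?h ` P) ` ?A" using gh(2)[of P] by (metis (no_types, lifting) image_eqI)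
      next
        fix P assume "P \<in> (\<lambda>P. ?h ` P) ` ?A"
        then obtain Q where Q: "P = ?h ` Q" "Q \<in> ?A" by blast
        then have P: "P \<in> grassmannian k" using image_grassmannian[OF h] by (simp add: grass_space)
        then have "subspace P" by (simp add: grassmannian_def)
        then have "pmat Q = ?c (pmat P)" using pmat_image[OF g, of P] gh(1)[of Q] Q(1) by simp
        then show "P \<in> pmat -` (?c -` B) \<inter> space M" using Q P by (simp add: grass_space)
      qed
      also have "emeasure M \<dots> = emeasure M ?A"
        using M h A by (simp add: invariant_grassmannian_measure_def)
      also have "\<dots> = emeasure (distr M borel pmat) B" using B pmat_measurable by (simp add: emeasure_distr)
      finally show "emeasure (distr (distr M borel pmat) borel ?c) B = emeasure (distr M borel pmat) B" .
    qed simp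
  qed
qed

end

section \<open>Restricted forms and continuity of currents\<close>

text \<open>Lines through a point of \<open>P\<close> in a direction of \<open>P\<close> stay in \<open>P\<close>.\<close>

lemma iter_deriv_restrict:
  assumes P: "subspace P" and us: "set us \<subseteq> P" and x: "x \<in> P"
  shows "iter_deriv us (\<lambda>x. if x \<in> P then f x else 0) x = iter_deriv us f x"
  using us x
proof (induction us arbitrary: x)
  case (Cons u us)
  have "x + t *\<^sub>R u \<in> P" for t using Cons.prems P by (simp add: subspace_add subspace_scale)
  then have "iter_deriv us (\<lambda>x. if x \<in> P then f x else 0) (x + t *\<^sub>R u) = iter_deriv us f (x + t *\<^sub>R u)" for t
    using Cons by simp
  then show ?case by (simp add: dir_deriv_def)
qed simp

text \<open>A smooth form on the whole space restricts to a smooth form on \<open>P\<close>, since derivatives along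
\<open>P\<close> only see the values on \<open>P\<close>.\<close>

lemma restrict_smooth_form:
  fixes G :: "(real^'n) form"
  assumes P: "subspace P" and alt: "\<And>x. G x \<in> alt m" and sm: "\<And>vs. smooth (\<lambda>x. G x vs)"
  shows "(\<lambda>x vs. if x \<in> P \<and> set vs \<subseteq> P then G x vs else 0) \<in> smooth_forms P m"
  unfolding smooth_forms_def
proof (intro CollectI conjI ballI allI impI)
  fix x assume x: "x \<in> P"
  show "(\<lambda>vs. if x \<in> P \<and> set vs \<subseteq> P then G x vs else 0) \<in> alternating_forms P m"
    unfolding alternating_forms_def
  proof (intro CollectI conjI allI impI)
    fix vs assume "\<not> (length vs = m \<and> set vs \<subseteq> P)"
    then show "(if x \<in> P \<and> set vs \<subseteq> P then G x vs else 0) = 0" using alt_length[OF alt] by auto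
  next
    fix vs :: "(real^'n) list" and i u w a b assume A: "length vs = m \<and> set vs \<subseteq> P \<and> i < m \<and> u \<in> P \<and> w \<in> P"
    have "a *\<^sub>R u + b *\<^sub>R w \<in> P" using A P by (simp add: subspace_add subspace_scale)
    then have "set (vs[i := a *\<^sub>R u + b *\<^sub>R w]) \<subseteq> P" "set (vs[i := u]) \<subseteq> P" "set (vs[i := w]) \<subseteq> P"
      using A set_update_subset_insert[of vs i] by blast+
    then show "(if x \<in> P \<and> set (vs[i := a *\<^sub>R u + b *\<^sub>R w]) \<subseteq> P then G x (vs[i := a *\<^sub>R u + b *\<^sub>R w]) else 0) =
      a * (if x \<in> P \<and> set (vs[i := u]) \<subseteq> P then G x (vs[i := u]) else 0) + b * (if x \<in> P \<and> set (vs[i := w]) \<subseteq> P then G x (vs[i := w]) else 0)"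
      using x A alt_linear[OF alt] by simp
  next
    fix vs :: "(real^'n) list" and i j assume "length vs = m \<and> set vs \<subseteq> P \<and> i < j \<and> j < m \<and> vs ! i = vs ! j"
    then show "(if x \<in> P \<and> set vs \<subseteq> P then G x vs else 0) = 0" using alt_repeat[OF alt, of vs i j] by simp
  qed
next
  fix x assume "x \<notin> P"
  then show "(\<lambda>vs. if x \<in> P \<and> set vs \<subseteq> P then G x vs else 0) = (\<lambda>vs. 0)" by auto
next
  fix vs :: "(real^'n) list"
  show "smooth_on_subspace P (\<lambda>x. if x \<in> P \<and> set vs \<subseteq> P then G x vs else 0)"
  proof (cases "set vs \<subseteq> P")
    case False
    then show ?thesis by (simp add: smooth_on_subspace_def iter_deriv_zero)
  next
    case True
    show ?thesis
      unfolding smooth_on_subspace_def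
    proof (intro allI impI)
      fix us assume us: "set us \<subseteq> P"
      have eq: "(\<lambda>x. if x \<in> P \<and> set vs \<subseteq> P then G x vs else 0) = (\<lambda>x. if x \<in> P then G x vs else 0)"
        using True by auto
      show "iter_deriv us (\<lambda>x. if x \<in> P \<and> set vs \<subseteq> P then G x vs else 0) differentiable_on P"
        unfolding differentiable_on_def eq
      proof (rule ballI)
        fix x assume x: "x \<in> P"
        have d: "iter_deriv us (\<lambda>x. G x vs) differentiable (at x within P)"
          by (rule differentiable_at_withinI[OF smooth_differentiable[OF smooth_iter[OF sm]]])
        show "iter_deriv us (\<lambda>x. if x \<in> P then G x vs else 0) differentiable (at x within P)"
          by (rule differentiable_transform_within[OF d zero_less_one x]) (rule iter_deriv_restrict[OF P us, symmetric])
      qed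
    qed
  qed
qed

lemma zero_smooth_form: "(\<lambda>x vs. 0) \<in> smooth_forms UNIV m"
  by (simp add: smooth_forms_def alt_zero smooth_zero)

lemma smooth_forms_lincomb:
  assumes "\<alpha> \<in> smooth_forms UNIV m" "\<beta> \<in> smooth_forms UNIV m"
  shows "(\<lambda>x vs. a * \<alpha> x vs + b * \<beta> x vs) \<in> smooth_forms UNIV m"
  using assms by (simp add: smooth_forms_def alt_lincomb smooth_lincomb)

lemma compact_current_lincomb:
  assumes T: "T \<in> compact_currents UNIV m" and "\<alpha> \<in> smooth_forms UNIV m" "\<beta> \<in> smooth_forms UNIV m"
  shows "T (\<lambda>x vs. a * \<alpha> x vs + b * \<beta> x vs) = a * T \<alpha> + b * T \<beta>"
proof -
  have s: "(\<lambda>x vs. c * \<gamma> x vs) \<in> smooth_forms UNIV m" if "\<gamma> \<in> smooth_forms UNIV m" for c \<gamma>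
    using smooth_forms_lincomb[OF that that, of c 0] by simp
  have add: "T (\<lambda>x vs. \<gamma> x vs + \<delta> x vs) = T \<gamma> + T \<delta>"
    if "\<gamma> \<in> smooth_forms UNIV m" "\<delta> \<in> smooth_forms UNIV m" for \<gamma> \<delta>
    using T that by (simp add: compact_currents_def)
  have mult: "T (\<lambda>x vs. c * \<gamma> x vs) = c * T \<gamma>" if "\<gamma> \<in> smooth_forms UNIV m" for c \<gamma>
    using T that by (simp add: compact_currents_def)
  show ?thesis unfolding add[OF s[OF assms(2)] s[OF assms(3)]] mult[OF assms(2)] mult[OF assms(3)] ..
qed

lemma compact_current_sum:
  assumes T: "T \<in> compact_currents UNIV m" and "finite I" "\<And>i. i \<in> I \<Longrightarrow> \<beta> i \<in> smooth_forms UNIV m"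
  shows "(\<lambda>x vs. \<Sum>i\<in>I. a i * \<beta> i x vs) \<in> smooth_forms UNIV m \<and>
    T (\<lambda>x vs. \<Sum>i\<in>I. a i * \<beta> i x vs) = (\<Sum>i\<in>I. a i * T (\<beta> i))"
  using assms(2,3)
proof (induction I rule: finite_induct)
  case empty
  show ?case using compact_current_lincomb[OF T zero_smooth_form zero_smooth_form, of 0 0] zero_smooth_form by simp
next
  case (insert i I)
  then show ?case
    using compact_current_lincomb[OF T, of "\<beta> i" "\<lambda>x vs. \<Sum>i\<in>I. a i * \<beta> i x vs" "a i" 1]
      smooth_forms_lincomb[of "\<beta> i" m "\<lambda>x vs. \<Sum>i\<in>I. a i * \<beta> i x vs" "a i" 1] by simp
qed

text \<open>A tuple \<open>(K, us, vs, \<delta>)\<close> bounds by \<open>\<delta>\<close>, on the set \<open>K\<close>, the derivative along \<open>us\<close>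
of the coefficient at \<open>vs\<close>.\<close>

definition seminorm_small :: "('a::euclidean_space set \<times> 'a list \<times> 'a list \<times> real) set \<Rightarrow> 'a form \<Rightarrow> bool" where
  "seminorm_small D \<beta> \<longleftrightarrow> (\<forall>(K, us, vs, \<delta>)\<in>D. \<forall>x\<in>K. \<bar>iter_deriv us (\<lambda>y. \<beta> y vs) x\<bar> < \<delta>)"

definition seminorm_data :: "('a::euclidean_space set \<times> 'a list \<times> 'a list \<times> real) set \<Rightarrow> bool" where
  "seminorm_data D \<longleftrightarrow> finite D \<and> (\<forall>(K, us, vs, \<delta>)\<in>D. compact K \<and> \<delta> > 0)"

text \<open>The generating sets are balls around arbitrary forms, so a neighbourhood of 0 must be shown
to contain one around 0: on a compact set the continuous derivative of the centre stays away from the radius by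
a fixed amount.\<close>

lemma open_nhd_zero:
  fixes W :: "'a::euclidean_space form set"
  assumes "openin (smooth_forms_topology UNIV m) W" "(\<lambda>x vs. 0) \<in> W"
  shows "\<exists>D. seminorm_data D \<and> (\<forall>\<beta>\<in>smooth_forms UNIV m. seminorm_small D \<beta> \<longrightarrow> \<beta> \<in> W)"
  using assms unfolding smooth_forms_topology_def openin_topology_generated_by_iff
proof (induction rule: generate_topology_on.induct)
  case Empty
  then show ?case by simp
next
  case (Int A B)
  then obtain D E where "seminorm_data D" "\<forall>\<beta>\<in>smooth_forms UNIV m. seminorm_small D \<beta> \<longrightarrow> \<beta> \<in> A"
    "seminorm_data E" "\<forall>\<beta>\<in>smooth_forms UNIV m. seminorm_small E \<beta> \<longrightarrow> \<beta> \<in> B" by auto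
  then show ?case
    by (intro exI[of _ "D \<union> E"]) (auto simp: seminorm_data_def seminorm_small_def)
next
  case (UN K)
  then obtain A where "A \<in> K" "(\<lambda>x vs. 0) \<in> A" by auto
  then show ?case using UN.IH[of A] by blast
next
  case (Basis S)
  then obtain \<alpha> K us vs e where S: "S = {\<beta> \<in> smooth_forms UNIV m. \<forall>x\<in>K. \<bar>iter_deriv us (\<lambda>y. \<beta> y vs - \<alpha> y vs) x\<bar> < e}"
    and \<alpha>: "\<alpha> \<in> smooth_forms UNIV m" and K: "compact K" and e: "e > 0" by auto
  have sm: "smooth (\<lambda>y. \<gamma> y vs)" if "\<gamma> \<in> smooth_forms UNIV m" for \<gamma> :: "'a form"
    using that by (simp add: smooth_forms_def)
  have diff: "iter_deriv us (\<lambda>y. \<beta> y vs - \<alpha> y vs) x = iter_deriv us (\<lambda>y. \<beta> y vs) x - iter_deriv us (\<lambda>y. \<alpha> y vs) x"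
    if "\<beta> \<in> smooth_forms UNIV m" for \<beta> x
    using iter_deriv_lincomb[OF sm[OF that] sm[OF \<alpha>], of us 1 "-1"] by simp
  show ?case
  proof (cases "K = {}")
    case True
    then show ?thesis using S by (intro exI[of _ "{}"]) (auto simp: seminorm_data_def)
  next
    case False
    let ?g = "\<lambda>x. \<bar>iter_deriv us (\<lambda>y. \<alpha> y vs) x\<bar>"
    have "continuous_on K ?g" by (intro continuous_intros smooth_continuous smooth_iter sm[OF \<alpha>])
    from continuous_attains_sup[OF K False this]
    obtain x0 where x0: "x0 \<in> K" "\<And>x. x \<in> K \<Longrightarrow> ?g x \<le> ?g x0" by blast
    have "?g x0 < e" using Basis(2) x0(1) diff[OF zero_smooth_form] by (auto simp: S iter_deriv_zero)
    then have "seminorm_data {(K, us, vs, e - ?g x0)}" using K by (simp add: seminorm_data_def)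
    moreover have "\<beta> \<in> S" if \<beta>: "\<beta> \<in> smooth_forms UNIV m" and small: "seminorm_small {(K, us, vs, e - ?g x0)} \<beta>" for \<beta>
    proof -
      have "\<bar>iter_deriv us (\<lambda>y. \<beta> y vs - \<alpha> y vs) x\<bar> < e" if "x \<in> K" for x
        using small x0(2)[OF that] that unfolding diff[OF \<beta>] seminorm_small_def by fastforce
      then show ?thesis using \<beta> by (simp add: S)
    qed
    ultimately show ?thesis by blast
  qed
qed

text \<open>A current is continuous at 0, so it is controlled by finitely many seminorms.\<close>

lemma compact_current_bound:
  fixes T :: "'a::euclidean_space form \<Rightarrow> real"
  assumes T: "T \<in> compact_currents UNIV m" and e: "e > 0"
  shows "\<exists>D. seminorm_data D \<and> (\<forall>\<beta>\<in>smooth_forms UNIV m. seminorm_small D \<beta> \<longrightarrow> \<bar>T \<beta>\<bar> < e)"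
proof -
  have "continuous_map (smooth_forms_topology UNIV m) euclideanreal T" using T by (simp add: compact_currents_def)
  then have "openin (smooth_forms_topology UNIV m) {\<beta> \<in> topspace (smooth_forms_topology UNIV m). T \<beta> \<in> {-e<..<e}}"
    by (rule openin_continuous_map_preimage) simp
  moreover have "T (\<lambda>x vs. 0) = 0"
    using compact_current_lincomb[OF T zero_smooth_form zero_smooth_form, of 0 0] by simp
  ultimately obtain D where "seminorm_data D" "\<forall>\<beta>\<in>smooth_forms UNIV m. seminorm_small D \<beta> \<longrightarrow> \<beta> \<in> {\<beta> \<in> smooth_forms UNIV m. T \<beta> \<in> {-e<..<e}}"
    using open_nhd_zero[of m "{\<beta> \<in> smooth_forms UNIV m. T \<beta> \<in> {-e<..<e}}"] zero_smooth_form e by auto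
  then show ?thesis by (intro exI[of _ D]) auto
qed

section \<open>Integrating a current over the family\<close>

text \<open>The first ball of the finite cover that contains \<open>X\<close>; the point \<open>c0\<close> is a default value
off the cover.\<close>

lemma measurable_selection:
  fixes C :: "'a::metric_space set"
  assumes "finite C"
  shows "\<exists>\<rho>. (\<forall>X. \<rho> X \<in> insert c0 C) \<and> (\<forall>c. {X. \<rho> X = c} \<in> sets borel) \<and>
    (\<forall>X\<in>(\<Union>c\<in>C. ball c r). dist X (\<rho> X) < r)"
  using assms
proof (induction C rule: finite_induct)
  case empty
  have "{X :: 'a. c0 = c} \<in> sets borel" for c by (cases "c0 = c") auto
  then show ?case by (intro exI[of _ "\<lambda>X. c0"]) auto
next
  case (insert c C)
  then obtain \<rho> where \<rho>: "\<And>X. \<rho> X \<in> insert c0 C" "\<And>c. {X. \<rho> X = c} \<in> sets borel"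
    "\<And>X. X \<in> (\<Union>c\<in>C. ball c r) \<Longrightarrow> dist X (\<rho> X) < r" by blast
  let ?\<rho> = "\<lambda>X. if X \<in> ball c r then c else \<rho> X"
  have "{X. ?\<rho> X = a} \<in> sets borel" for a
  proof -
    have "{X. ?\<rho> X = a} = (if a = c then ball c r else {}) \<union> ({X. \<rho> X = a} - ball c r)" by auto
    then show ?thesis using \<rho>(2)[of a] by auto
  qed
  moreover have "?\<rho> X \<in> insert c0 (insert c C)" for X using \<rho>(1)[of X] by auto
  moreover have "dist X (?\<rho> X) < r" if "X \<in> (\<Union>c\<in>insert c C. ball c r)" for X
    using that \<rho>(3)[of X] by (cases "X \<in> ball c r") (auto simp: dist_commute)
  ultimately show ?case by (intro exI[of _ ?\<rho>]) blast
qed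

context averaging
begin

lemma AE_ball: "AE X in \<mu>. X \<in> cball 0 (real CARD('n) * real CARD('n))"
  using AE_is_proj by eventually_elim (simp add: projection_norm_bound)

lemma iter_deriv_F_continuous_X: "continuous_on UNIV (\<lambda>X. iter_deriv us (\<lambda>x. F X x vs) x)"
  using continuous_on_compose2[OF iter_deriv_F_continuous[of us vs], of UNIV "\<lambda>X. (X, x)"]
  by (simp add: continuous_on_Pair)

lemma iter_deriv_F_measurable: "(\<lambda>X. iter_deriv us (\<lambda>x. F X x vs) x) \<in> borel_measurable \<mu>"
  unfolding measurable_cong_sets[OF sets_eq refl]
  by (rule borel_measurable_continuous_onI[OF iter_deriv_F_continuous_X])

text \<open>Differentiate the representation of \<open>\<alpha>\<close> under the integral sign, one direction at a
time.  Derivatives of \<open>F\<close> are bounded on compact sets, which covers almost all \<open>X\<close>; the integrand is cut off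
outside, since no bound is available there.\<close>

lemma iter_deriv_representation:
  assumes rep: "\<And>x vs. length vs = m \<Longrightarrow> has_bochner_integral \<mu> (\<lambda>X. F X x vs) (\<alpha> x vs)"
  shows "integrable \<mu> (\<lambda>X. iter_deriv us (\<lambda>x. F X x vs) x) \<and>
    (\<integral>X. iter_deriv us (\<lambda>x. F X x vs) x \<partial>\<mu>) = iter_deriv us (\<lambda>x. \<alpha> x vs) x"
proof (cases "length vs = m")
  case False
  then show ?thesis by (simp add: alt_length[OF F_alt] alt_length[OF \<alpha>_alt] iter_deriv_zero)
next
  case True
  show ?thesis
  proof (induction us arbitrary: x)
    case Nil
    then show ?case using rep[OF True, of x] by (simp add: has_bochner_integral_iff)
  next
    case (Cons u us)
    let ?B = "cball 0 (real CARD('n) * real CARD('n)) :: (real^'n^'n) set"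
    define D where "D us X x = iter_deriv us (\<lambda>x. F X x vs) x" for us X x
    define f where "f t X = indicator ?B X * D us X (x + t *\<^sub>R u)" for t X
    define f' where "f' t X = indicator ?B X * D (u # us) X (x + t *\<^sub>R u)" for t X
    have Dm: "(\<lambda>X. D us X x) \<in> borel_measurable \<mu>" for us x
      unfolding D_def by (rule iter_deriv_F_measurable)
    have ind: "AE X in \<mu>. indicator ?B X * g X = g X" for g :: "_ \<Rightarrow> real"
      using AE_ball by eventually_elim simp
    let ?S = "(\<lambda>t. x + t *\<^sub>R u) ` {-1..1}"
    have "compact ?S" by (intro compact_continuous_image continuous_intros) auto
    then have "compact (?B \<times> ?S)" by (intro compact_Times compact_cball)
    moreover have "continuous_on (?B \<times> ?S) (\<lambda>p. D (u # us) (fst p) (snd p))"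
      unfolding D_def by (rule continuous_on_subset[OF iter_deriv_F_continuous]) simp
    ultimately have "bounded ((\<lambda>p. D (u # us) (fst p) (snd p)) ` (?B \<times> ?S))"
      by (intro compact_imp_bounded compact_continuous_image)
    then obtain C where C: "\<And>X t. X \<in> ?B \<Longrightarrow> t \<in> {-1..1} \<Longrightarrow> \<bar>D (u # us) X (x + t *\<^sub>R u)\<bar> \<le> C"
      unfolding bounded_iff by force
    have fm: "f t \<in> borel_measurable \<mu>" "f' t \<in> borel_measurable \<mu>" for t
      unfolding f_def f'_def by (intro borel_measurable_times borel_measurable_indicator Dm; simp)+
    have fi: "integrable \<mu> (f t)" for t
    proof (rule integrable_cong_AE_imp[OF _ fm(1)])
      show "integrable \<mu> (\<lambda>X. D us X (x + t *\<^sub>R u))" using Cons.IH by (simp add: D_def)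
      show "AE X in \<mu>. D us X (x + t *\<^sub>R u) = f t X" using ind[of "\<lambda>X. D us X (x + t *\<^sub>R u)"] by eventually_elim (simp add: f_def)
    qed
    have der: "((\<lambda>t. f t X) has_real_derivative f' t X) (at t)" for t X
    proof -
      have "iter_deriv us (\<lambda>x. F X x vs) differentiable (at z)" for z
        by (rule smooth_differentiable[OF smooth_iter[OF F_smooth]])
      from DERIV_cmult[OF has_dir_deriv[OF this], of "indicator ?B X"]
      show ?thesis unfolding f_def f'_def D_def by simp
    qed
    have bnd: "\<bar>f' t X\<bar> \<le> \<bar>C\<bar>" if "\<bar>t\<bar> < 1" for t X
    proof (cases "X \<in> ?B")
      case True
      have "t \<in> {-1..1}" using that by auto
      from C[OF True this] True show ?thesis unfolding f'_def by simp
    qed (simp add: f'_def)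
    have gi: "integrable \<mu> (\<lambda>X. \<bar>C\<bar>)" by simp
    note dui = deriv_under_integral[of \<mu> f f' "\<lambda>X. \<bar>C\<bar>", OF der bnd gi fi]
    have "(\<integral>X. f t X \<partial>\<mu>) = iter_deriv us (\<lambda>x. \<alpha> x vs) (x + t *\<^sub>R u)" for t
    proof -
      have "(\<integral>X. f t X \<partial>\<mu>) = (\<integral>X. D us X (x + t *\<^sub>R u) \<partial>\<mu>)"
        by (intro integral_cong_AE fm Dm) (use ind in \<open>simp add: f_def\<close>)
      then show ?thesis using Cons.IH by (simp add: D_def)
    qed
    then have "((\<lambda>t. iter_deriv us (\<lambda>x. \<alpha> x vs) (x + t *\<^sub>R u)) has_real_derivative (\<integral>X. f' 0 X \<partial>\<mu>)) (at 0)"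
      using dui(2) by simp
    then have "dir_deriv u (iter_deriv us (\<lambda>x. \<alpha> x vs)) x = (\<integral>X. f' 0 X \<partial>\<mu>)" by (rule dir_derivI)
    also have "\<dots> = (\<integral>X. D (u # us) X x \<partial>\<mu>)"
      by (intro integral_cong_AE fm Dm) (use ind in \<open>simp add: f'_def\<close>)
    finally have 1: "(\<integral>X. D (u # us) X x \<partial>\<mu>) = iter_deriv (u # us) (\<lambda>x. \<alpha> x vs) x" by simp
    have 2: "integrable \<mu> (\<lambda>X. D (u # us) X x)"
    proof (rule integrable_cong_AE_imp[OF dui(1) Dm])
      show "AE X in \<mu>. f' 0 X = D (u # us) X x" using ind[of "\<lambda>X. D (u # us) X x"] by eventually_elim (simp add: f'_def)
    qed auto
    show ?case using 1 2 unfolding D_def by (rule conjI[rotated])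
  qed
qed

abbreviation diff_form :: "(real^'n) form \<Rightarrow> (real^'n) form \<Rightarrow> (real^'n) form" where
  "diff_form \<beta> \<gamma> \<equiv> \<lambda>x vs. 1 * \<beta> x vs + (-1) * \<gamma> x vs"

lemma iter_deriv_diff_form:
  assumes "\<beta> \<in> smooth_forms UNIV m" "\<gamma> \<in> smooth_forms UNIV m"
  shows "iter_deriv us (\<lambda>x. diff_form \<beta> \<gamma> x vs) x = iter_deriv us (\<lambda>x. \<beta> x vs) x - iter_deriv us (\<lambda>x. \<gamma> x vs) x"
  using assms by (subst iter_deriv_lincomb) (auto simp: smooth_forms_def)

text \<open>Joint continuity is uniform on the product of a ball of matrices with a compact set of base
points, and finitely many seminorms are involved.\<close>

lemma F_uniformly_continuous:
  assumes "seminorm_data D"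
  shows "\<exists>r>0. \<forall>X\<in>cball 0 R. \<forall>X'\<in>cball 0 R. dist X X' < r \<longrightarrow> seminorm_small D (diff_form (F X) (F X'))"
proof -
  have "finite D" "\<forall>(K, us, vs, \<delta>)\<in>D. compact K \<and> \<delta> > 0" using assms by (auto simp: seminorm_data_def)
  then show ?thesis
  proof (induction D rule: finite_induct)
    case empty
    then show ?case by (intro exI[of _ 1]) (auto simp: seminorm_small_def)
  next
    case (insert d D)
    then obtain r where r: "r > 0" "\<And>X X'. X \<in> cball 0 R \<Longrightarrow> X' \<in> cball 0 R \<Longrightarrow> dist X X' < r \<Longrightarrow> seminorm_small D (diff_form (F X) (F X'))"
      by auto
    obtain K us vs \<delta> where d: "d = (K, us, vs, \<delta>)" by (cases d) auto
    have K: "compact K" "\<delta> > 0" using insert.prems d by auto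
    let ?g = "\<lambda>p. iter_deriv us (\<lambda>x. F (fst p) x vs) (snd p)"
    have "uniformly_continuous_on (cball 0 R \<times> K) ?g"
      by (intro compact_uniformly_continuous compact_Times compact_cball K continuous_on_subset[OF iter_deriv_F_continuous]) simp
    then obtain s where s: "s > 0" "\<And>p p'. p \<in> cball 0 R \<times> K \<Longrightarrow> p' \<in> cball 0 R \<times> K \<Longrightarrow> dist p' p < s \<Longrightarrow> dist (?g p') (?g p) < \<delta>"
      using K(2) unfolding uniformly_continuous_on_def by metis
    have "seminorm_small (insert d D) (diff_form (F X) (F X'))"
      if "X \<in> cball 0 R" "X' \<in> cball 0 R" "dist X X' < min r s" for X X'
    proof -
      have "\<bar>iter_deriv us (\<lambda>x. diff_form (F X) (F X') x vs) x\<bar> < \<delta>" if x: "x \<in> K" for x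
        using s(2)[of "(X', x)" "(X, x)"] x \<open>X \<in> cball 0 R\<close> \<open>X' \<in> cball 0 R\<close> \<open>dist X X' < min r s\<close>
        unfolding iter_deriv_diff_form[OF F_smooth_form F_smooth_form] by (simp add: dist_Pair_Pair dist_real_def)
      then show ?thesis using r(2)[of X X'] that unfolding seminorm_small_def d by auto
    qed
    then show ?case using r(1) s(1) by (intro exI[of _ "min r s"]) auto
  qed
qed

text \<open>\<open>F\<close> is continuous as a map into smooth forms, and a current is continuous there.\<close>

lemma current_F_continuous:
  assumes T: "T \<in> compact_currents UNIV m"
  shows "continuous_on UNIV (\<lambda>X. T (F X))"
  unfolding continuous_on_iff
proof (intro ballI allI impI)
  fix X0 :: "real^'n^'n" and e :: real assume e: "e > 0"
  obtain D where D: "seminorm_data D" "\<And>\<beta>. \<beta> \<in> smooth_forms UNIV m \<Longrightarrow> seminorm_small D \<beta> \<Longrightarrow> \<bar>T \<beta>\<bar> < e"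
    using compact_current_bound[OF T e] by blast
  obtain r where r: "r > 0" "\<And>X X'. X \<in> cball 0 (norm X0 + 1) \<Longrightarrow> X' \<in> cball 0 (norm X0 + 1) \<Longrightarrow> dist X X' < r \<Longrightarrow> seminorm_small D (diff_form (F X) (F X'))"
    using F_uniformly_continuous[OF D(1)] by blast
  show "\<exists>d>0. \<forall>X\<in>UNIV. dist X X0 < d \<longrightarrow> dist (T (F X)) (T (F X0)) < e"
  proof (intro exI[of _ "min r 1"] conjI ballI impI)
    fix X assume X: "dist X X0 < min r 1"
    have "norm X \<le> norm X0 + 1" using X norm_triangle_ineq2[of X X0] by (simp add: dist_norm)
    then have "seminorm_small D (diff_form (F X) (F X0))" using X by (intro r(2)) auto
    then have "\<bar>T (diff_form (F X) (F X0))\<bar> < e"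
      by (intro D(2) smooth_forms_lincomb F_smooth_form)
    then show "dist (T (F X)) (T (F X0)) < e"
      unfolding compact_current_lincomb[OF T F_smooth_form F_smooth_form] by (simp add: dist_real_def)
  qed (use r in auto)
qed

text \<open>Cut the ball of matrices into finitely many small Borel pieces with sample points \<open>c\<close> and
masses \<open>a c\<close>.  The sum of \<open>a c\<close> times \<open>F c\<close> approximates \<open>\<alpha>\<close> in the finitely many seminorms that
control \<open>T\<close>, by the representation of the derivatives of \<open>\<alpha>\<close>; and the sum of \<open>a c\<close> times \<open>T (F c)\<close>
approximates the integral of \<open>T (F X)\<close>.\<close>

lemma current_representation:
  assumes rep: "\<And>x vs. length vs = m \<Longrightarrow> has_bochner_integral \<mu> (\<lambda>X. F X x vs) (\<alpha> x vs)"
    and T: "T \<in> compact_currents UNIV m"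
  shows "has_bochner_integral \<mu> (\<lambda>X. T (F X)) (T \<alpha>)"
proof -
  let ?B = "cball 0 (real CARD('n) * real CARD('n)) :: (real^'n^'n) set"
  let ?h = "\<lambda>X. T (F X)"
  have \<alpha>s: "\<alpha> \<in> smooth_forms UNIV m" using \<alpha> by (simp add: schwartz_forms_def)
  have hm: "?h \<in> borel_measurable \<mu>"
    unfolding measurable_cong_sets[OF sets_eq refl]
    by (rule borel_measurable_continuous_onI[OF current_F_continuous[OF T]])
  have "compact (?h ` ?B)"
    by (intro compact_continuous_image compact_cball continuous_on_subset[OF current_F_continuous[OF T]]) simp
  then obtain H where H: "\<And>X. X \<in> ?B \<Longrightarrow> \<bar>?h X\<bar> \<le> H"
    using compact_imp_bounded[of "?h ` ?B"] unfolding bounded_iff by force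
  have hi: "integrable \<mu> ?h"
  proof (rule integrable_const_bound[OF _ hm])
    show "AE X in \<mu>. norm (?h X) \<le> H" using AE_ball by eventually_elim (simp add: H)
  qed
  have close: "\<bar>(\<integral>X. ?h X \<partial>\<mu>) - T \<alpha>\<bar> \<le> 2 * e" if e: "e > 0" for e
  proof -
    obtain D where D: "seminorm_data D" "\<And>\<beta>. \<beta> \<in> smooth_forms UNIV m \<Longrightarrow> seminorm_small D \<beta> \<Longrightarrow> \<bar>T \<beta>\<bar> < e"
      using compact_current_bound[OF T e] by blast
    \<comment> \<open>halving the radii turns the non-strict bound for the integral back into a strict one\<close>
    let ?D = "(\<lambda>(K, us, vs, \<delta>). (K, us, vs, \<delta> / 2)) ` D"
    have "seminorm_data ?D" using D(1) unfolding seminorm_data_def by fastforce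
    then obtain r where r: "r > 0" "\<And>X X'. X \<in> ?B \<Longrightarrow> X' \<in> ?B \<Longrightarrow> dist X X' < r \<Longrightarrow> seminorm_small ?D (diff_form (F X) (F X'))"
      using F_uniformly_continuous by blast
    have half: "\<bar>iter_deriv us (\<lambda>x. F X x vs) x - iter_deriv us (\<lambda>x. F X' x vs) x\<bar> < \<delta> / 2"
      if "X \<in> ?B" "X' \<in> ?B" "dist X X' < r" "(K, us, vs, \<delta>) \<in> D" "x \<in> K" for X X' K us vs \<delta> x
      using r(2)[OF that(1-3)] that(4,5) iter_deriv_diff_form[OF F_smooth_form[of X] F_smooth_form[of X'], of us vs x]
      unfolding seminorm_small_def by fastforce
    obtain C where C: "finite C" "C \<subseteq> ?B" "?B \<subseteq> (\<Union>c\<in>C. ball c r)"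
      by (rule compactE_image[OF compact_cball[of "0 :: real^'n^'n" "real CARD('n) * real CARD('n)"], of "cball 0 (real CARD('n) * real CARD('n))" "\<lambda>c. ball c r"])
        (use r(1) in auto)
    obtain \<rho> where \<rho>: "\<And>X. \<rho> X \<in> insert 0 C" "\<And>c. {X. \<rho> X = c} \<in> sets borel"
      "\<And>X. X \<in> (\<Union>c\<in>C. ball c r) \<Longrightarrow> dist X (\<rho> X) < r"
      using measurable_selection[OF C(1), of 0 r] by blast
    let ?C = "insert 0 C"
    have Cf: "finite ?C" "?C \<subseteq> ?B" using C by auto
    define a where "a c = measure \<mu> {X. \<rho> X = c}" for c
    \<comment> \<open>\<open>\<phi>\<close> will be both a derivative of a coefficient of \<open>F X\<close> and the number \<open>T (F X)\<close>\<close>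
    have approx: "\<bar>(\<integral>X. \<phi> X \<partial>\<mu>) - (\<Sum>c\<in>?C. a c * \<phi> c)\<bar> \<le> \<eta>"
      if \<phi>: "integrable \<mu> \<phi>" and b: "\<And>X X'. X \<in> ?B \<Longrightarrow> X' \<in> ?B \<Longrightarrow> dist X X' < r \<Longrightarrow> \<bar>\<phi> X - \<phi> X'\<bar> \<le> \<eta>" for \<phi> :: "_ \<Rightarrow> real" and \<eta>
    proof -
      let ?s = "\<lambda>X. \<Sum>c\<in>?C. \<phi> c * indicator {X. \<rho> X = c} X"
      have s: "?s X = \<phi> (\<rho> X)" for X
      proof -
        have "?s X = (\<Sum>c\<in>?C. if c = \<rho> X then \<phi> c else 0)" by (intro sum.cong refl) (auto simp: indicator_def)
        then show ?thesis using \<rho>(1)[of X] Cf(1) by simp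
      qed
      have si: "integrable \<mu> (\<lambda>X. indicator {X. \<rho> X = c} X :: real)" for c
        using \<rho>(2)[of c] by (intro integrable_real_indicator) (auto simp: emeasure_eq_measure)
      have "integrable \<mu> ?s" by (intro Bochner_Integration.integrable_sum integrable_mult_right si)
      moreover have "(\<integral>X. ?s X \<partial>\<mu>) = (\<Sum>c\<in>?C. a c * \<phi> c)"
        using si by (subst Bochner_Integration.integral_sum) (auto simp: a_def mult.commute intro: integrable_mult_right)
      ultimately have "(\<integral>X. \<phi> X \<partial>\<mu>) - (\<Sum>c\<in>?C. a c * \<phi> c) = (\<integral>X. \<phi> X - ?s X \<partial>\<mu>)" using \<phi> by simp
      moreover have "\<bar>\<integral>X. \<phi> X - ?s X \<partial>\<mu>\<bar> \<le> (\<integral>X. \<bar>\<phi> X - ?s X\<bar> \<partial>\<mu>)" by (rule integral_abs_bound)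
      moreover have "(\<integral>X. \<bar>\<phi> X - ?s X\<bar> \<partial>\<mu>) \<le> (\<integral>X. \<eta> \<partial>\<mu>)"
      proof (rule integral_mono_AE)
        show "integrable \<mu> (\<lambda>X. \<bar>\<phi> X - ?s X\<bar>)" using \<phi> \<open>integrable \<mu> ?s\<close> by (intro integrable_abs Bochner_Integration.integrable_diff)
        show "AE X in \<mu>. \<bar>\<phi> X - ?s X\<bar> \<le> \<eta>"
          using AE_ball
        proof eventually_elim
          case (elim X)
          have "\<rho> X \<in> ?B" using \<rho>(1)[of X] Cf(2) by blast
          moreover have "dist X (\<rho> X) < r" using \<rho>(3)[of X] C(3) elim by blast
          ultimately show ?case unfolding s using b elim by blast
        qed
      qed simp
      moreover have "(\<integral>X. \<eta> \<partial>\<mu>) = \<eta>" using prob_space by simp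
      ultimately show ?thesis by linarith
    qed
    let ?G = "\<lambda>x vs. \<Sum>c\<in>?C. a c * F c x vs"
    have G: "?G \<in> smooth_forms UNIV m" "T ?G = (\<Sum>c\<in>?C. a c * T (F c))"
      using compact_current_sum[OF T Cf(1), of F a] F_smooth_form by auto
    have "seminorm_small D (diff_form ?G \<alpha>)"
      unfolding seminorm_small_def
    proof (clarify)
      fix K us vs \<delta> x assume d: "(K, us, vs, \<delta>) \<in> D" and x: "x \<in> K"
      have \<delta>: "\<delta> > 0" using D(1) d by (auto simp: seminorm_data_def)
      let ?\<phi> = "\<lambda>X. iter_deriv us (\<lambda>x. F X x vs) x"
      note ir = iter_deriv_representation[OF rep, of us vs x]
      have "\<bar>(\<integral>X. ?\<phi> X \<partial>\<mu>) - (\<Sum>c\<in>?C. a c * ?\<phi> c)\<bar> \<le> \<delta> / 2"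
        using half[OF _ _ _ d x] by (intro approx ir[THEN conjunct1]) (auto intro: less_imp_le)
      moreover have "iter_deriv us (\<lambda>x. diff_form ?G \<alpha> x vs) x = (\<Sum>c\<in>?C. a c * ?\<phi> c) - iter_deriv us (\<lambda>x. \<alpha> x vs) x"
        unfolding iter_deriv_diff_form[OF G(1) \<alpha>s] by (simp only: iter_deriv_sum[OF F_smooth])
      ultimately show "\<bar>iter_deriv us (\<lambda>x. diff_form ?G \<alpha> x vs) x\<bar> < \<delta>"
        using ir[THEN conjunct2] \<delta> by linarith
    qed
    then have "\<bar>T (diff_form ?G \<alpha>)\<bar> < e" by (intro D(2) smooth_forms_lincomb G(1) \<alpha>s)
    then have 1: "\<bar>T ?G - T \<alpha>\<bar> < e" unfolding compact_current_lincomb[OF T G(1) \<alpha>s] by simp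
    have "\<bar>?h X - ?h X'\<bar> \<le> e" if X: "X \<in> ?B" "X' \<in> ?B" "dist X X' < r" for X X'
    proof -
      have "seminorm_small D (diff_form (F X) (F X'))"
        unfolding seminorm_small_def
      proof (clarify)
        fix K us vs \<delta> x assume d: "(K, us, vs, \<delta>) \<in> D" and x: "x \<in> K"
        have \<delta>: "\<delta> > 0" using D(1) d by (auto simp: seminorm_data_def)
        show "\<bar>iter_deriv us (\<lambda>x. diff_form (F X) (F X') x vs) x\<bar> < \<delta>"
          unfolding iter_deriv_diff_form[OF F_smooth_form F_smooth_form] using half[OF X d x] \<delta> by linarith
      qed
      then have "\<bar>T (diff_form (F X) (F X'))\<bar> < e" by (intro D(2) smooth_forms_lincomb F_smooth_form)
      then show ?thesis unfolding compact_current_lincomb[OF T F_smooth_form F_smooth_form] by simp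
    qed
    then have "\<bar>(\<integral>X. ?h X \<partial>\<mu>) - (\<Sum>c\<in>?C. a c * ?h c)\<bar> \<le> e" by (rule approx[OF hi])
    then show ?thesis using 1 G(2) by linarith
  qed
  have "\<bar>(\<integral>X. ?h X \<partial>\<mu>) - T \<alpha>\<bar> \<le> 0"
  proof (rule field_le_epsilon)
    fix e :: real assume "e > 0"
    then show "\<bar>(\<integral>X. ?h X \<partial>\<mu>) - T \<alpha>\<bar> \<le> 0 + e" using close[of "e / 2"] by simp
  qed
  then have "(\<integral>X. ?h X \<partial>\<mu>) = T \<alpha>" by simp
  then show ?thesis using hi by (simp add: has_bochner_integral_iff)
qed

end

section \<open>Representation of forms and currents\<close>

theorem theorem1:
  fixes m k :: nat
    and M :: "(real^'n) set measure"
    and \<alpha> :: "(real^'n) form"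
  assumes "m < k" and "k < CARD('n)"
    and "invariant_grassmannian_measure k M"
    and "\<alpha> \<in> schwartz_forms m"
  shows "\<exists>\<alpha>P :: (real^'n) set \<Rightarrow> (real^'n) form.
    (\<forall>P\<in>grassmannian k. \<alpha>P P \<in> smooth_forms P m) \<and>
    (\<forall>x vs. length vs = m \<longrightarrow>
       has_bochner_integral M (\<lambda>P. pullback_form P (\<alpha>P P) x vs) (\<alpha> x vs)) \<and>
    (\<forall>T\<in>compact_currents UNIV m.
       has_bochner_integral M (\<lambda>P. pushforward_current P T (\<alpha>P P)) (T \<alpha>))"
proof -
  note M = assms(3)
  define \<mu> where "\<mu> = distr M borel (pmat :: (real^'n) set \<Rightarrow> real^'n^'n)"
  interpret rp: random_projection \<mu> k
    unfolding \<mu>_def by (rule random_projection_grassmannian[OF M])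
  have n: "DIM(real^'n) \<ge> 2" using assms(1,2) by simp
  obtain \<kappa> w d :: "real \<Rightarrow> real" and N C where kernel: "C \<noteq> 0"
      "continuous_on UNIV \<kappa>" "continuous_on UNIV w" "continuous_on UNIV d"
      "\<forall>r\<ge>0. \<bar>\<kappa> r\<bar> \<le> (1 + r) ^ 3" "\<forall>t>0. w t > 0" "w 0 = 0"
      "\<forall>r>0. \<forall>t\<ge>0. \<kappa> (r * t) = \<kappa> r * w t + r\<^sup>2 * d t"
      "\<forall>f::real^'n \<Rightarrow> real. schwartz f \<longrightarrow>
        (\<Sum>i\<in>Basis. \<integral>y. \<kappa> (norm y) * (y \<bullet> i) * (lap ^^ N) (dir_deriv i f) y \<partial>lborel) = C * f 0"
      "\<forall>(f::real^'n \<Rightarrow> real) i j. schwartz f \<longrightarrow>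
        (\<integral>y. \<kappa> (norm y) * (y \<bullet> j) * (lap ^^ N) (dir_deriv i f) y \<partial>lborel) =
        (\<integral>y. \<kappa> (norm y) * (y \<bullet> i) * (lap ^^ N) (dir_deriv j f) y \<partial>lborel)"
      "\<forall>(f::real^'n \<Rightarrow> real) i. schwartz f \<longrightarrow> (\<integral>y. (norm y)\<^sup>2 * (y \<bullet> i) * (lap ^^ N) f y \<partial>lborel) = 0"
    using radial_kernel_exists[OF n] by (elim exE conjE) (rule that)
  note C = kernel(1) and cont = kernel(2-4) and \<kappa>b = kernel(5)[rule_format]
    and w = kernel(6)[rule_format] kernel(7) and scal = kernel(8)[rule_format]
    and rep = kernel(9)[rule_format] and sym = kernel(10)[rule_format] and moment = kernel(11)[rule_format]
  have adm: "admissible \<kappa>" using cont \<kappa>b by (simp add: admissible_def)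
  have ww: "weight w" and wd: "weight d" using cont by (auto intro: continuous_weight)
  have mn: "m < CARD('n)" using assms(1,2) by simp
  obtain c1 where c1: "\<And>e \<Omega> vs. norm e = 1 \<Longrightarrow> \<Omega> \<in> alt (Suc m) \<Longrightarrow> avg \<mu> w e \<Omega> (e # vs) = c1 * \<Omega> (e # vs)"
      "\<And>e \<gamma> vs. norm e = 1 \<Longrightarrow> \<gamma> \<in> alt m \<Longrightarrow> avg \<mu> w e (wedge e \<gamma>) vs = c1 * wedge e \<gamma> vs"
    using rp.avg_eigenvalue[OF ww mn] by blast
  obtain d1 where d1: "\<And>e \<Omega> vs. norm e = 1 \<Longrightarrow> \<Omega> \<in> alt (Suc m) \<Longrightarrow> avg \<mu> d e \<Omega> (e # vs) = d1 * \<Omega> (e # vs)"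
    using rp.avg_eigenvalue[OF wd mn] by blast
  have c1p: "c1 > 0"
    by (rule rp.avg_eigenvalue_pos[OF ww _ _ _ c1(2)]) (use w assms(1) in auto)
  have "\<exists>c2 d2. c2 > 0 \<and> (\<forall>q e \<eta> vs. m = Suc q \<longrightarrow> norm e = 1 \<longrightarrow> \<eta> \<in> alt q \<longrightarrow> avg \<mu> w e (wedge e \<eta>) vs = c2 * wedge e \<eta> vs) \<and>
      (\<forall>q e \<eta> vs. m = Suc q \<longrightarrow> norm e = 1 \<longrightarrow> \<eta> \<in> alt q \<longrightarrow> avg \<mu> d e (wedge e \<eta>) vs = d2 * wedge e \<eta> vs)"
  proof (cases m)
    case 0
    \<comment> \<open>for functions the second term of the family vanishes, so any positive constant will do\<close>
    then show ?thesis by (intro exI[of _ 1]) auto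
  next
    case (Suc q)
    have qn: "q < CARD('n)" using Suc mn by simp
    obtain c2 where c2: "\<And>e \<gamma> vs. norm e = 1 \<Longrightarrow> \<gamma> \<in> alt q \<Longrightarrow> avg \<mu> w e (wedge e \<gamma>) vs = c2 * wedge e \<gamma> vs"
      using rp.avg_eigenvalue[OF ww qn] by blast
    obtain d2 where d2: "\<And>e \<gamma> vs. norm e = 1 \<Longrightarrow> \<gamma> \<in> alt q \<Longrightarrow> avg \<mu> d e (wedge e \<gamma>) vs = d2 * wedge e \<gamma> vs"
      using rp.avg_eigenvalue[OF wd qn] by blast
    have "c2 > 0"
      by (rule rp.avg_eigenvalue_pos[OF ww _ _ _ c2]) (use w Suc assms(1) in auto)
    then show ?thesis using c2 d2 Suc by (intro exI[of _ c2] exI[of _ d2]) auto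
  qed
  then obtain c2 d2 where c2p: "c2 > 0"
    and c2: "\<And>q e \<eta> vs. m = Suc q \<Longrightarrow> norm e = 1 \<Longrightarrow> \<eta> \<in> alt q \<Longrightarrow> avg \<mu> w e (wedge e \<eta>) vs = c2 * wedge e \<eta> vs"
    and d2: "\<And>q e \<eta> vs. m = Suc q \<Longrightarrow> norm e = 1 \<Longrightarrow> \<eta> \<in> alt q \<Longrightarrow> avg \<mu> d e (wedge e \<eta>) vs = d2 * wedge e \<eta> vs"
    by blast
  \<comment> \<open>the constants cancel the eigenvalues \<open>c1\<close>, \<open>c2\<close> and the factor \<open>C\<close> of the kernel formula\<close>
  interpret A: averaging \<mu> k m N \<kappa> "1 / (C * c1)" "1 / (C * c2)" \<alpha>
    by unfold_locales (use adm assms(4) in auto)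
  let ?F = A.F
  have main: "has_bochner_integral \<mu> (\<lambda>X. ?F X x vs) (\<alpha> x vs)" if vs: "length vs = m" for x vs
  proof (rule A.representation[OF cont(2,3) scal c1(1) d1 c2 d2 C])
    show "1 / (C * c1) * c1 = 1 / C" "1 / (C * c2) * c2 = 1 / C" using c1p c2p by auto
  qed (use rep sym moment[OF schwartz_dir] vs in \<open>auto simp: lap_deriv_def\<close>)
  \<comment> \<open>\<open>F\<close> restricted to points and vectors of \<open>P\<close>, with the value 0 elsewhere\<close>
  define G where "G P = (\<lambda>x vs. if x \<in> P \<and> set vs \<subseteq> P then ?F (pmat P) x vs else 0)" for P
  have pull: "pullback_form P (G P) = ?F (pmat P)" if P: "P \<in> space M" for P
  proof (intro ext)
    fix x vs
    have P: "P \<in> grassmannian k" using P grass_space[OF M] by simp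
    then have sP: "subspace P" by (simp add: grassmannian_def)
    have mult: "orth_proj P = (*v) (pmat P)" by (rule ext) (simp add: pmat_mult[OF sP])
    have "pullback_form P (G P) x vs = ?F (pmat P) (orth_proj P x) (map (orth_proj P) vs)"
      using orth_proj_in[OF sP] by (auto simp: pullback_form_def G_def)
    also have "\<dots> = ?F (pmat P) x vs"
      unfolding mult using pmat_is_proj[OF P] by (intro A.F_projection) (simp add: is_proj_def)
    finally show "pullback_form P (G P) x vs = ?F (pmat P) x vs" .
  qed
  have transfer: "has_bochner_integral M (\<lambda>P. h (pmat P)) v" if "has_bochner_integral \<mu> h v" for h :: "real^'n^'n \<Rightarrow> real" and v
  proof -
    have hm: "h \<in> borel_measurable borel" using that unfolding \<mu>_def by (auto dest: borel_measurable_has_bochner_integral)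
    show ?thesis
      using that integrable_distr_eq[OF pmat_measurable[OF M] hm] integral_distr[OF pmat_measurable[OF M] hm]
      unfolding \<mu>_def has_bochner_integral_iff by simp
  qed
  show ?thesis
  proof (intro exI[of _ G] conjI ballI allI impI)
    fix P :: "(real^'n) set" assume "P \<in> grassmannian k"
    then show "G P \<in> smooth_forms P m"
      unfolding G_def by (intro restrict_smooth_form A.F_alt A.F_smooth) (simp add: grassmannian_def)
  next
    fix x and vs :: "(real^'n) list" assume vs: "length vs = m"
    show "has_bochner_integral M (\<lambda>P. pullback_form P (G P) x vs) (\<alpha> x vs)"
      using transfer[OF main[OF vs, of x]] has_bochner_integral_cong[OF refl _ refl, of M "\<lambda>P. pullback_form P (G P) x vs" "\<lambda>P. ?F (pmat P) x vs"]
      by (simp add: pull)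
  next
    fix T :: "(real^'n) form \<Rightarrow> real" assume T: "T \<in> compact_currents UNIV m"
    show "has_bochner_integral M (\<lambda>P. pushforward_current P T (G P)) (T \<alpha>)"
      using transfer[OF A.current_representation[OF main T]]
        has_bochner_integral_cong[OF refl _ refl, of M "\<lambda>P. pushforward_current P T (G P)" "\<lambda>P. T (?F (pmat P))"]
      by (simp add: pull pushforward_current_def)
  qed
qed

end
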